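(* Let $d\ge 2$, let $\psi:\mathbb{R}^{d-1}\to\mathbb{R}$ be a positive, measurable and locally bounded function of $x'=(x_2,\dots,x_d)$, and let $w$ be a confined weight on $\mathbb{R}^d$. Fix a measurable function $\alpha:\mathbb{R}^{d-1}\to\mathbb{C}$ with $|\alpha|\equiv1$. For $x'\in\mathbb{R}^{d-1}$ let $$H_w^{x'}=-i\frac{\psi(x')}{w(\cdot,x')}\frac{d}{dx}:D^{\alpha(x')}\subset L^2_{w(\cdot,x')}(\mathbb{R})\to L^2_{w(\cdot,x')}(\mathbb{R}),$$ where $$D^{\alpha(x')}=\left\{g\in L^2_{w(\cdot,x')}(\mathbb{R})\ \Big|\ H_w^{x'}g\in L^2_{w(\cdot,x')}(\mathbb{R}),\ \lim_{x\to\infty}g(x)=\alpha(x')\lim_{x\to-\infty}g(x)\right\};$$ these operators are essentially self-adjoint, and the same notation $H_w^{x'}$ is kept for their unique self-adjoint extensions. Then the shear flow operator $H_w=-i\frac{\psi}{w}\frac{\partial}{\partial x_1}:L^2_w(\mathbb{R}^d)\to L^2_w(\mathbb{R}^d)$ may be represented as the direct integral $$H_w=\int_{\mathbb{R}^{d-1}}^\oplus H_w^{x'}\,dx'$$ and is self-adjoint with domain $$D_w=\left\{f\in L^2_w(\mathbb{R}^d)\ \Big|\ f(\cdot,x')\in D^{\alpha(x')}\text{ for a.e. }x'\in\mathbb{R}^{d-1},\ \int_{\mathbb{R}^{d-1}}\|H_w^{x'}f(\cdot,x')\|^2_{L^2_{w(\cdot,x')}(\mathbb{R})}\,dx'<\infty\right\}.$$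 Moreover, the spectrum $\Sigma(H_w)$ is characterized by $$\lambda\in\Sigma(H_w)\quad\Leftrightarrow\quad\forall\epsilon>0,\ \mathcal{L}^{d-1}\left\{x'\ \big|\ \Sigma(H_w^{x'})\cap(\lambda-\epsilon,\lambda+\epsilon)\neq\emptyset\right\}>0,$$ where $\mathcal{L}^{d-1}$ denotes $(d-1)$-dimensional Lebesgue measure.
   Context: Points of $\mathbb{R}^d$ are written $x=(x_1,x')$ with $x_1\in\mathbb{R}$, $x'=(x_2,\dots,x_d)\in\mathbb{R}^{d-1}$. A positive bounded weight $0<w\in L^\infty(\mathbb{R}^d)$ is called confined if there exists a set $S\subset\mathbb{R}^{d-1}$ (the confinement region) such that (1) $w(x_1,x')=1$ for all $x'\in\mathbb{R}^{d-1}\setminus S$ (and all $x_1$), and (2) $\|w(\cdot,x')\|_{L^1(\mathbb{R})}<+\infty$ for all $x'\in S$. $L^2_w(\mathbb{R}^d)$ is the Hilbert space of functions $f:\mathbb{R}^d\to\mathbb{C}$ with $\int_{\mathbb{R}^d}|f|^2w\,dx<\infty$ and inner product $(f,g)_{L^2_w}=\int_{\mathbb{R}^d} f\overline g\,w\,dx$; $L^2_{w(\cdot,x')}(\mathbb{R})$ is the space of $g:\mathbb{R}\to\mathbb{C}$ with $\int_{\mathbb{R}}|g(s)|^2w(s,x')\,ds<\infty$, with the analogous inner product. There is the direct integral decomposition $L^2_w(\mathbb{R}^d)=\int^\oplus_{\mathbb{R}^{d-1}}L^2_{w(\cdot,x')}(\mathbb{R})\,dx'$, and $H_w=\int^\oplus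 H_w^{x'}\,dx'$ means that $(H_wf)(\cdot,x')=H_w^{x'}f(\cdot,x')$ for a.e. $x'$ and every $f\in D_w$. Derivatives are in the sense of distributions, and functions in $D^{\alpha(x')}$ are identified with their continuous representatives. $\Sigma(\cdot)$ denotes the spectrum. *)

theory Defs
  imports "HOL-Analysis.Analysis"
begin

section \<open>Unbounded operators in the Hilbert space $L^2(M)$\<close>

text \<open>
  Elements of $L^2(M)$ are represented by functions, equality in $L^2(M)$ being equality almost
  everywhere. An operator is given by its graph, a set of pairs of functions; operator graphs are
  closed under almost everywhere modification of either component, so that equality of graphs
  is equality of operators.
\<close>

type_synonym 'a operator = "(('a \<Rightarrow> complex) \<times> ('a \<Rightarrow> complex)) set"

definition L2 :: "'a measure \<Rightarrow> ('a \<Rightarrow> complex) set" where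
  "L2 M = {f \<in> borel_measurable M. integrable M (\<lambda>x. (cmod (f x))\<^sup>2)}"

definition L2_inner :: "'a measure \<Rightarrow> ('a \<Rightarrow> complex) \<Rightarrow> ('a \<Rightarrow> complex) \<Rightarrow> complex" where
  "L2_inner M f g = (LINT x|M. f x * cnj (g x))"

definition L2_norm :: "'a measure \<Rightarrow> ('a \<Rightarrow> complex) \<Rightarrow> real" where
  "L2_norm M f = sqrt (LINT x|M. (cmod (f x))\<^sup>2)"

definition linear_operator :: "'a measure \<Rightarrow> 'a operator \<Rightarrow> bool" where
  "linear_operator M T \<longleftrightarrow>
     T \<subseteq> L2 M \<times> L2 M \<and>
     (\<forall>f h f' h'. (f, h) \<in> T \<longrightarrow> f' \<in> L2 M \<longrightarrow> h' \<in> L2 M \<longrightarrow>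
        (AE x in M. f' x = f x) \<longrightarrow> (AE x in M. h' x = h x) \<longrightarrow> (f', h') \<in> T) \<and>
     (\<forall>f h g k. (f, h) \<in> T \<longrightarrow> (g, k) \<in> T \<longrightarrow> (\<lambda>x. f x + g x, \<lambda>x. h x + k x) \<in> T) \<and>
     (\<forall>c f h. (f, h) \<in> T \<longrightarrow> (\<lambda>x. c * f x, \<lambda>x. c * h x) \<in> T) \<and>
     (\<forall>f h h'. (f, h) \<in> T \<longrightarrow> (f, h') \<in> T \<longrightarrow> (AE x in M. h x = h' x))"

definition densely_defined :: "'a measure \<Rightarrow> 'a operator \<Rightarrow> bool" where
  "densely_defined M T \<longleftrightarrow>
     (\<forall>f \<in> L2 M. \<forall>\<epsilon>>0. \<exists>g \<in> Domain T. L2_norm M (\<lambda>x. f x - g x) < \<epsilon>)"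

definition op_adjoint :: "'a measure \<Rightarrow> 'a operator \<Rightarrow> 'a operator" where
  "op_adjoint M T = {(f, h). f \<in> L2 M \<and> h \<in> L2 M \<and>
     (\<forall>(g, k) \<in> T. L2_inner M k f = L2_inner M g h)}"

definition op_closure :: "'a measure \<Rightarrow> 'a operator \<Rightarrow> 'a operator" where
  "op_closure M T = {(f, h). f \<in> L2 M \<and> h \<in> L2 M \<and>
     (\<forall>\<epsilon>>0. \<exists>(g, k) \<in> T. L2_norm M (\<lambda>x. f x - g x) < \<epsilon> \<and> L2_norm M (\<lambda>x. h x - k x) < \<epsilon>)}"

definition self_adjoint :: "'a measure \<Rightarrow> 'a operator \<Rightarrow> bool" where
  "self_adjoint M T \<longleftrightarrow> linear_operator M T \<and> densely_defined M T \<and> op_adjoint M T = T"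

definition essentially_self_adjoint :: "'a measure \<Rightarrow> 'a operator \<Rightarrow> bool" where
  "essentially_self_adjoint M T \<longleftrightarrow>
     linear_operator M T \<and> densely_defined M T \<and> self_adjoint M (op_closure M T)"

text \<open>
  $z$ is in the resolvent set if $T - z$ is a bijection from the domain of $T$ onto
  $L^2(M)$ with bounded inverse; the lower bound comprises injectivity.
\<close>

definition resolvent_set :: "'a measure \<Rightarrow> 'a operator \<Rightarrow> complex set" where
  "resolvent_set M T = {z.
     (\<forall>h \<in> L2 M. \<exists>(f, k) \<in> T. AE x in M. k x - z * f x = h x) \<and>
     (\<exists>C. \<forall>(f, k) \<in> T. L2_norm M f \<le> C * L2_norm M (\<lambda>x. k x - z * f x))}"

definition spectrum :: "'a measure \<Rightarrow> 'a operator \<Rightarrow> complex set" where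
  "spectrum M T = - resolvent_set M T"


section \<open>Distributional derivatives\<close>

primrec C_k :: "nat \<Rightarrow> ('a::euclidean_space \<Rightarrow> real) \<Rightarrow> bool" where
  "C_k 0 \<phi> \<longleftrightarrow> continuous_on UNIV \<phi>"
| "C_k (Suc k) \<phi> \<longleftrightarrow> (\<forall>x. \<phi> differentiable (at x)) \<and>
     (\<forall>b \<in> Basis. C_k k (\<lambda>x. frechet_derivative \<phi> (at x) b))"

definition test_function :: "('a::euclidean_space \<Rightarrow> real) \<Rightarrow> bool" where
  "test_function \<phi> \<longleftrightarrow> (\<forall>k. C_k k \<phi>) \<and> (\<exists>K. compact K \<and> (\<forall>x. x \<notin> K \<longrightarrow> \<phi> x = 0))"

definition locally_integrable :: "('a::euclidean_space \<Rightarrow> complex) \<Rightarrow> bool" where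
  "locally_integrable f \<longleftrightarrow> (\<forall>K. compact K \<longrightarrow> set_integrable lebesgue K f)"

definition has_weak_derivative ::
    "'a::euclidean_space \<Rightarrow> ('a \<Rightarrow> complex) \<Rightarrow> ('a \<Rightarrow> complex) \<Rightarrow> bool" where
  "has_weak_derivative b f v \<longleftrightarrow> locally_integrable f \<and> locally_integrable v \<and>
     (\<forall>\<phi>. test_function \<phi> \<longrightarrow>
        (LINT x|lebesgue. frechet_derivative \<phi> (at x) b *\<^sub>R f x)
          = - (LINT x|lebesgue. \<phi> x *\<^sub>R v x))"

definition weak_deriv :: "(real \<Rightarrow> complex) \<Rightarrow> real \<Rightarrow> complex" where
  "weak_deriv g = (SOME v. has_weak_derivative 1 g v)"

text \<open>
  The distributional derivative $\partial f/\partial x_1 = v$ for $f$ on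
  $\mathbb{R}\times\mathbb{R}^{d-1}$. Neither functions $f \in L^2_w(\mathbb{R}^d)$ nor the
  derivatives of functions in the domain of the shear flow operator need be locally integrable on
  $\mathbb{R}^d$, because $w(\cdot,x')$ and $\psi(x')$ may be arbitrarily small as $x'$ varies.
  Since $\partial/\partial x_1$ commutes with multiplication by functions $\rho(x')$, the
  identity $\partial_1 f = v$ is understood as $\partial_1(\rho f) = \rho v$ in the sense of
  distributions for some positive measurable $\rho$ making both sides locally integrable.
  For $\rho = 1$ this is the usual notion.
\<close>

definition has_weak_partial1 ::
    "(real \<times> 'b::euclidean_space \<Rightarrow> complex) \<Rightarrow> (real \<times> 'b \<Rightarrow> complex) \<Rightarrow> bool" where
  "has_weak_partial1 f v \<longleftrightarrow>
     (\<exists>\<rho> \<in> borel_measurable lebesgue. (\<forall>x'. 0 < \<rho> x') \<and>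
        has_weak_derivative (1, 0) (\<lambda>(s, x'). \<rho> x' *\<^sub>R f (s, x')) (\<lambda>(s, x'). \<rho> x' *\<^sub>R v (s, x')))"


section \<open>Shear flow operators with confined weights\<close>

text \<open>
  The coordinates $x = (x_1,x')$ of $\mathbb{R}^d = \mathbb{R}\times\mathbb{R}^{d-1}$ are kept as
  a pair. A weight is a fixed representative, positive everywhere and bounded
  up to a null set. Integrability of \<open>w (\<cdot>, x')\<close> for \<open>x' \<in> S\<close> contains its measurability.
\<close>

definition confined :: "(real \<times> (real ^ 'n) \<Rightarrow> real) \<Rightarrow> bool" where
  "confined w \<longleftrightarrow> w \<in> borel_measurable lebesgue \<and> (\<forall>x. 0 < w x) \<and>
     (\<exists>C. AE x in lebesgue. w x \<le> C) \<and>
     (\<exists>S. (\<forall>x'. x' \<notin> S \<longrightarrow> (\<forall>s. w (s, x') = 1)) \<and>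
          (\<forall>x' \<in> S. integrable lebesgue (\<lambda>s. w (s, x'))))"

definition weighted :: "('a::euclidean_space \<Rightarrow> real) \<Rightarrow> 'a measure" where
  "weighted u = density lebesgue (\<lambda>x. ennreal (u x))"

context
  fixes \<psi> :: "real ^ 'n \<Rightarrow> real"
    and w :: "real \<times> (real ^ 'n) \<Rightarrow> real"
    and \<alpha> :: "real ^ 'n \<Rightarrow> complex"
begin

definition fiber_measure :: "real ^ 'n \<Rightarrow> real measure" where
  "fiber_measure x' = weighted (\<lambda>s. w (s, x'))"

definition fiber_action :: "real ^ 'n \<Rightarrow> (real \<Rightarrow> complex) \<Rightarrow> real \<Rightarrow> complex" where
  "fiber_action x' g = (\<lambda>s. - \<i> * complex_of_real (\<psi> x' / w (s, x')) * weak_deriv g s)"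

text \<open>The function \<open>g0\<close> below is the continuous representative of \<open>g\<close>.\<close>

definition fiber_domain :: "real ^ 'n \<Rightarrow> (real \<Rightarrow> complex) set" where
  "fiber_domain x' = {g \<in> L2 (fiber_measure x').
     (\<exists>v. has_weak_derivative 1 g v) \<and> fiber_action x' g \<in> L2 (fiber_measure x') \<and>
     (\<exists>g0 a b. continuous_on UNIV g0 \<and> (AE s in lebesgue. g s = g0 s) \<and>
        (g0 \<longlongrightarrow> a) at_bot \<and> (g0 \<longlongrightarrow> b) at_top \<and> b = \<alpha> x' * a)}"

definition fiber_operator :: "real ^ 'n \<Rightarrow> real operator" where
  "fiber_operator x' = {(g, h). g \<in> fiber_domain x' \<and> h \<in> L2 (fiber_measure x') \<and>
     (AE s in lebesgue. h s = fiber_action x' g s)}"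

text \<open>The unique self-adjoint extension of an essentially self-adjoint operator is its closure.\<close>

definition fiber_extension :: "real ^ 'n \<Rightarrow> real operator" where
  "fiber_extension x' = op_closure (fiber_measure x') (fiber_operator x')"

definition shear_domain :: "(real \<times> (real ^ 'n) \<Rightarrow> complex) set" where
  "shear_domain = {f \<in> L2 (weighted w).
     (AE x' in lebesgue. (\<lambda>s. f (s, x')) \<in> fiber_domain x') \<and>
     (\<integral>\<^sup>+x'. (\<integral>\<^sup>+s. ennreal ((cmod (fiber_action x' (\<lambda>s. f (s, x')) s))\<^sup>2) \<partial>fiber_measure x')
        \<partial>lebesgue) < \<infinity>}"

definition shear_operator :: "(real \<times> (real ^ 'n)) operator" where
  "shear_operator = {(f, h). f \<in> shear_domain \<and> h \<in> L2 (weighted w) \<and>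
     (\<exists>v. has_weak_partial1 f v \<and>
        (AE (s, x') in lebesgue.
           h (s, x') = - \<i> * complex_of_real (\<psi> x' / w (s, x')) * v (s, x')))}"

text \<open>
  The direct integral over $x'$ of operators in the fibres $L^2_{w(\cdot,x')}(\mathbb{R})$. The
  requirement that the image lies in $L^2_w(\mathbb{R}^d)$ contains the square integrability
  condition on the domain.
\<close>

definition direct_integral :: "(real ^ 'n \<Rightarrow> real operator) \<Rightarrow> (real \<times> (real ^ 'n)) operator" where
  "direct_integral T = {(f, h). f \<in> L2 (weighted w) \<and> h \<in> L2 (weighted w) \<and>
     (AE x' in lebesgue. (\<lambda>s. f (s, x'), \<lambda>s. h (s, x')) \<in> T x')}"

end

end

theory Submission
  imports Defs
begin

text \<open>
  On the fibre over \<open>x'\<close> the phase \<open>s \<mapsto> \<integral>\<^sub>0\<^sup>s w(\<cdot>,x')/\<psi>(x')\<close> turns \<open>-i (\<psi>/w) d/dx\<close> into \<open>-i d/dx\<close>, on an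
  interval of length \<open>L(x') = \<integral> w(\<cdot>,x')/\<psi>(x')\<close> with a quasi-periodic boundary condition if
  \<open>w(\<cdot>,x')\<close> is integrable, and on the line otherwise. The resolvent is therefore given by an explicit
  integral formula, and the spectrum is \<open>{t. exp (i t L) = \<alpha>}\<close> in the first case and \<open>\<real>\<close> in the
  second. A symmetric operator \<open>H\<close> for which \<open>H - z\<close> is onto for all nonreal \<open>z\<close> is self-adjoint; this
  applies to the fibres and, because the formula for the resolvent is measurable in \<open>x'\<close> and
  the fibre resolvents are bounded by \<open>1/|Im z|\<close>, to their direct integral.

  If the fibre spectra avoid \<open>(t - \<epsilon>, t + \<epsilon>)\<close> for almost every \<open>x'\<close>, the fibre resolvents at \<open>t\<close> are
  uniformly bounded and \<open>t\<close> is in the resolvent set. Conversely, if \<open>\<alpha> = exp (i \<theta>)\<close>, the fibre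
  eigenvalues form the countably many measurable branches \<open>(\<theta> + 2 \<pi> k)/L\<close>. Either one branch stays in
  \<open>(t - \<epsilon>, t + \<epsilon>)\<close> on a set of positive measure, or the fibres with spectrum \<open>\<real>\<close> form such a
  set; eigenfunctions, or exponentials with a slow cutoff, on these fibres are
  approximate eigenvectors of the direct integral.
\<close>

section \<open>The space of square integrable functions\<close>

text \<open>Joint measurability is the obstacle. \<open>weak_deriv\<close> is a choice made slice by
  slice, so the fibrewise image of an \<open>f\<close> in \<open>shear_domain\<close> is not known
  to be measurable on the product and cannot simply be taken as the image under the direct integral.
  It is obtained abstractly: Yosida approximations, built from the resolvent of the direct integral
  itself, are bounded by the fibre norms, and self-adjointness then supplies an image
  (\<open>self_adjoint_domainI\<close>). The same concern explains why \<open>primitive\<close>,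
  \<open>boundary_constant\<close> and \<open>resolvent\<close> are explicit integrals: Borel
  representatives of the data in a slice give the same values, and integrals with a parameter are
  measurable. Derivatives are kept in integrated form (\<open>antiderivative\<close>), so the
  calculus needs neither pointwise differentiability nor smoothness of the weight. On the product,
  exceptional null sets depend on the test function; countably many bumps with rational ends decide,
  and continuity of primitives does the rest.\<close>

lemma L2_I: "f \<in> borel_measurable M \<Longrightarrow> integrable M (\<lambda>x. (cmod (f x))\<^sup>2) \<Longrightarrow> f \<in> L2 M"
  by (simp add: L2_def)

lemma L2_measurable: "f \<in> L2 M \<Longrightarrow> f \<in> borel_measurable M"
  by (simp add: L2_def)

lemma L2_integrable: "f \<in> L2 M \<Longrightarrow> integrable M (\<lambda>x. (cmod (f x))\<^sup>2)"
  by (simp add: L2_def)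

lemma L2_iff_nn_integral:
  "f \<in> L2 M \<longleftrightarrow> f \<in> borel_measurable M \<and> (\<integral>\<^sup>+x. ennreal ((cmod (f x))\<^sup>2) \<partial>M) < \<infinity>"
proof -
  have "f \<in> borel_measurable M \<Longrightarrow> (\<lambda>x. (cmod (f x))\<^sup>2) \<in> borel_measurable M"
    by measurable
  then show ?thesis
    by (auto simp: L2_def integrable_iff_bounded)
qed

lemma L2_bound:
  assumes "f \<in> L2 M" "g \<in> borel_measurable M" "AE x in M. cmod (g x) \<le> C * cmod (f x)"
  shows "g \<in> L2 M"
proof (rule L2_I)
  have m: "(\<lambda>x. (cmod (g x))\<^sup>2) \<in> borel_measurable M" using assms(2) by measurable
  show "integrable M (\<lambda>x. (cmod (g x))\<^sup>2)"
  proof (rule Bochner_Integration.integrable_bound [OF _ m])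
    show "integrable M (\<lambda>x. C\<^sup>2 * (cmod (f x))\<^sup>2)"
      using L2_integrable[OF assms(1)] by simp
    show "AE x in M. norm ((cmod (g x))\<^sup>2) \<le> norm (C\<^sup>2 * (cmod (f x))\<^sup>2)"
      using assms(3)
    proof eventually_elim
      case (elim x)
      then have "(cmod (g x))\<^sup>2 \<le> (C * cmod (f x))\<^sup>2"
        by (intro power_mono) auto
      then show ?case by (simp add: power_mult_distrib)
    qed
  qed
qed (fact assms(2))

lemma L2_integrable_mult:
  assumes "f \<in> L2 M" "g \<in> L2 M"
  shows "integrable M (\<lambda>x. f x * g x)"
proof -
  note [measurable] = assms[THEN L2_measurable]
  have "integrable M (\<lambda>x. (cmod (f x))\<^sup>2 + (cmod (g x))\<^sup>2)"
    using assms by (simp add: L2_integrable)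
  moreover have "(\<lambda>x. f x * g x) \<in> borel_measurable M" by measurable
  moreover have "cmod (f x * g x) \<le> norm ((cmod (f x))\<^sup>2 + (cmod (g x))\<^sup>2)" for x
  proof -
    have "0 \<le> cmod (f x) * cmod (g x)" by simp
    then show ?thesis
      unfolding norm_mult
      using sum_squares_bound[of "cmod (f x)" "cmod (g x)"]
      by (simp add: abs_of_nonneg del: zero_le_mult_iff mult_nonneg_nonneg)
  qed
  ultimately show ?thesis
    by (rule Bochner_Integration.integrable_bound[OF _ _ AE_I2])
qed

lemma L2_cnj: "f \<in> L2 M \<Longrightarrow> (\<lambda>x. cnj (f x)) \<in> L2 M"
  by (simp add: L2_def borel_measurable_continuous_on[OF continuous_on_cnj[OF continuous_on_id]])

lemma L2_inner_integrable:
  "f \<in> L2 M \<Longrightarrow> g \<in> L2 M \<Longrightarrow> integrable M (\<lambda>x. f x * cnj (g x))"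
  by (rule L2_integrable_mult[OF _ L2_cnj])

lemma L2_scale: "f \<in> L2 M \<Longrightarrow> (\<lambda>x. c * f x) \<in> L2 M" for c :: complex
  by (auto simp: L2_def norm_mult power_mult_distrib)

lemma L2_add:
  assumes "f \<in> L2 M" "g \<in> L2 M"
  shows "(\<lambda>x. f x + g x) \<in> L2 M"
proof (rule L2_I)
  note [measurable] = assms[THEN L2_measurable]
  show m: "(\<lambda>x. f x + g x) \<in> borel_measurable M" by measurable
  have "integrable M (\<lambda>x. 2 * (cmod (f x))\<^sup>2 + 2 * (cmod (g x))\<^sup>2)"
    using assms by (simp add: L2_integrable)
  moreover have "(\<lambda>x. (cmod (f x + g x))\<^sup>2) \<in> borel_measurable M" by measurable
  moreover have "norm ((cmod (f x + g x))\<^sup>2) \<le> norm (2 * (cmod (f x))\<^sup>2 + 2 * (cmod (g x))\<^sup>2)" for x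
  proof -
    have "(cmod (f x + g x))\<^sup>2 \<le> (cmod (f x) + cmod (g x))\<^sup>2"
      by (intro power_mono norm_triangle_ineq) simp
    also have "\<dots> \<le> 2 * (cmod (f x))\<^sup>2 + 2 * (cmod (g x))\<^sup>2"
      using sum_squares_bound[of "cmod (f x)" "cmod (g x)"] by (simp add: power2_sum)
    finally show ?thesis by simp
  qed
  ultimately show "integrable M (\<lambda>x. (cmod (f x + g x))\<^sup>2)"
    by (rule Bochner_Integration.integrable_bound[OF _ _ AE_I2])
qed

lemma L2_diff:
  assumes "f \<in> L2 M" "g \<in> L2 M"
  shows "(\<lambda>x. f x - g x) \<in> L2 M"
  using L2_add[OF assms(1) L2_scale[OF assms(2), of "-1"]] by simp

lemma L2_zero: "(\<lambda>x. 0) \<in> L2 M"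
  by (simp add: L2_def)

lemma L2_inner_add_left:
  "f \<in> L2 M \<Longrightarrow> g \<in> L2 M \<Longrightarrow> k \<in> L2 M \<Longrightarrow>
    L2_inner M (\<lambda>x. f x + g x) k = L2_inner M f k + L2_inner M g k"
  by (simp add: L2_inner_def distrib_right Bochner_Integration.integral_add L2_inner_integrable)

lemma L2_inner_diff_left:
  "f \<in> L2 M \<Longrightarrow> g \<in> L2 M \<Longrightarrow> k \<in> L2 M \<Longrightarrow>
    L2_inner M (\<lambda>x. f x - g x) k = L2_inner M f k - L2_inner M g k"
  by (simp add: L2_inner_def left_diff_distrib Bochner_Integration.integral_diff L2_inner_integrable)

lemma L2_inner_add_right:
  "f \<in> L2 M \<Longrightarrow> g \<in> L2 M \<Longrightarrow> k \<in> L2 M \<Longrightarrow>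
    L2_inner M k (\<lambda>x. f x + g x) = L2_inner M k f + L2_inner M k g"
  by (simp add: L2_inner_def distrib_left Bochner_Integration.integral_add L2_inner_integrable)

lemma L2_inner_diff_right:
  "f \<in> L2 M \<Longrightarrow> g \<in> L2 M \<Longrightarrow> k \<in> L2 M \<Longrightarrow>
    L2_inner M k (\<lambda>x. f x - g x) = L2_inner M k f - L2_inner M k g"
  by (simp add: L2_inner_def right_diff_distrib Bochner_Integration.integral_diff L2_inner_integrable)

lemma L2_inner_scale_left: "L2_inner M (\<lambda>x. c * f x) g = c * L2_inner M f g"
  by (simp add: L2_inner_def mult.assoc)

lemma L2_inner_scale_right: "L2_inner M f (\<lambda>x. c * g x) = cnj c * L2_inner M f g"
  by (simp add: L2_inner_def mult.left_commute[of _ "cnj c"])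

lemma L2_inner_commute: "L2_inner M g f = cnj (L2_inner M f g)"
proof -
  have "(\<lambda>x. g x * cnj (f x)) = (\<lambda>x. cnj (f x * cnj (g x)))"
    by (simp add: mult.commute fun_eq_iff)
  then show ?thesis unfolding L2_inner_def by (simp only: Bochner_Integration.integral_cnj)
qed

lemma L2_inner_cong_AE:
  assumes "f \<in> borel_measurable M" "f' \<in> borel_measurable M" "AE x in M. f x = f' x"
    "g \<in> borel_measurable M" "g' \<in> borel_measurable M" "AE x in M. g x = g' x"
  shows "L2_inner M f g = L2_inner M f' g'"
proof -
  have c: "cnj \<in> borel_measurable borel"
    by (intro borel_measurable_continuous_onI continuous_intros)
  note [measurable] = assms(1,2,4,5) c
  show ?thesis unfolding L2_inner_def
    using assms(3,6) by (intro integral_cong_AE) auto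
qed

lemma L2_norm_nonneg: "0 \<le> L2_norm M f"
  by (simp add: L2_norm_def)

lemma L2_norm_power2: "(L2_norm M f)\<^sup>2 = (LINT x|M. (cmod (f x))\<^sup>2)"
  by (simp add: L2_norm_def)

lemma L2_norm_nn_integral:
  "f \<in> L2 M \<Longrightarrow> ennreal ((L2_norm M f)\<^sup>2) = (\<integral>\<^sup>+x. ennreal ((cmod (f x))\<^sup>2) \<partial>M)"
  by (simp add: L2_norm_power2 nn_integral_eq_integral L2_integrable)

lemma L2_inner_self: "L2_inner M f f = complex_of_real ((L2_norm M f)\<^sup>2)"
  by (simp add: L2_inner_def L2_norm_power2 complex_norm_square[symmetric] flip: of_real_power)

lemma L2_norm_cong_AE:
  assumes "f \<in> borel_measurable M" "f' \<in> borel_measurable M" "AE x in M. f x = f' x"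
  shows "L2_norm M f = L2_norm M f'"
proof -
  note [measurable] = assms(1,2)
  have "(LINT x|M. (cmod (f x))\<^sup>2) = (LINT x|M. (cmod (f' x))\<^sup>2)"
    using assms(3) by (intro integral_cong_AE) auto
  then show ?thesis by (simp add: L2_norm_def)
qed

lemma L2_norm_eq_0:
  assumes "f \<in> L2 M" "L2_norm M f = 0"
  shows "AE x in M. f x = 0"
proof -
  have "(LINT x|M. (cmod (f x))\<^sup>2) = 0"
    using assms(2) by (metis L2_norm_power2 zero_power2)
  then show ?thesis
    using integral_nonneg_eq_0_iff_AE[OF L2_integrable[OF assms(1)]] by simp
qed

lemma L2_norm_scale: "L2_norm M (\<lambda>x. c * f x) = cmod c * L2_norm M f"
  by (simp add: L2_norm_def norm_mult power_mult_distrib real_sqrt_mult)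

lemma L2_norm_minus_commute: "L2_norm M (\<lambda>x. f x - g x) = L2_norm M (\<lambda>x. g x - f x)"
  by (simp add: L2_norm_def norm_minus_commute)

lemma L2_norm_mono:
  assumes "f \<in> L2 M" "g \<in> L2 M" "AE x in M. cmod (f x) \<le> cmod (g x)"
  shows "L2_norm M f \<le> L2_norm M g"
proof -
  have "(LINT x|M. (cmod (f x))\<^sup>2) \<le> (LINT x|M. (cmod (g x))\<^sup>2)"
    using assms(3) by (intro integral_mono_AE L2_integrable assms) (auto intro: power_mono)
  then show ?thesis by (simp add: L2_norm_def)
qed

lemma L2_Cauchy_Schwarz:
  assumes "f \<in> L2 M" "g \<in> L2 M"
  shows "(LINT x|M. cmod (f x) * cmod (g x)) \<le> L2_norm M f * L2_norm M g"
proof -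
  note [measurable] = assms[THEN L2_measurable]
  have i: "integrable M (\<lambda>x. cmod (f x) * cmod (g x))"
    using integrable_norm[OF L2_integrable_mult[OF assms]] by (simp add: norm_mult)
  have "(\<integral>\<^sup>+x. ennreal (cmod (f x)) * ennreal (cmod (g x)) \<partial>M)\<^sup>2
      \<le> (\<integral>\<^sup>+x. (ennreal (cmod (f x)))\<^sup>2 \<partial>M) * (\<integral>\<^sup>+x. (ennreal (cmod (g x)))\<^sup>2 \<partial>M)"
    by (rule Cauchy_Schwarz_nn_integral) auto
  also have "\<dots> = ennreal ((L2_norm M f)\<^sup>2) * ennreal ((L2_norm M g)\<^sup>2)"
    by (simp add: L2_norm_nn_integral assms ennreal_power)
  also have "(\<integral>\<^sup>+x. ennreal (cmod (f x)) * ennreal (cmod (g x)) \<partial>M)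
      = ennreal (LINT x|M. cmod (f x) * cmod (g x))"
    using i by (simp add: nn_integral_eq_integral flip: ennreal_mult)
  finally have "(LINT x|M. cmod (f x) * cmod (g x))\<^sup>2 \<le> (L2_norm M f * L2_norm M g)\<^sup>2"
    by (simp add: ennreal_power integral_nonneg_AE power_mult_distrib flip: ennreal_mult)
  then show ?thesis
    by (rule power2_le_imp_le) (simp add: L2_norm_nonneg)
qed

lemma L2_inner_bound:
  assumes "f \<in> L2 M" "g \<in> L2 M"
  shows "cmod (L2_inner M f g) \<le> L2_norm M f * L2_norm M g"
proof -
  have "cmod (L2_inner M f g) \<le> (LINT x|M. cmod (f x * cnj (g x)))"
    unfolding L2_inner_def by (rule integral_norm_bound)
  then show ?thesis
    using L2_Cauchy_Schwarz[OF assms] by (simp add: norm_mult)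
qed

lemma L2_norm_add_power2:
  assumes "f \<in> L2 M" "g \<in> L2 M"
  shows "(L2_norm M (\<lambda>x. f x + g x))\<^sup>2 = (L2_norm M f)\<^sup>2 + 2 * Re (L2_inner M f g) + (L2_norm M g)\<^sup>2"
proof -
  have "L2_inner M (\<lambda>x. f x + g x) (\<lambda>x. f x + g x)
      = L2_inner M f f + (L2_inner M f g + cnj (L2_inner M f g)) + L2_inner M g g"
    using assms
    by (simp add: L2_inner_add_left L2_inner_add_right L2_add L2_inner_commute[of M g f])
  then have "Re (L2_inner M (\<lambda>x. f x + g x) (\<lambda>x. f x + g x))
      = Re (L2_inner M f f) + 2 * Re (L2_inner M f g) + Re (L2_inner M g g)"
    by simp
  then show ?thesis by (simp add: L2_inner_self flip: of_real_power)
qed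

lemma L2_norm_diff_power2:
  assumes "f \<in> L2 M" "g \<in> L2 M"
  shows "(L2_norm M (\<lambda>x. f x - g x))\<^sup>2 = (L2_norm M f)\<^sup>2 - 2 * Re (L2_inner M f g) + (L2_norm M g)\<^sup>2"
  using L2_norm_add_power2[OF assms(1) L2_scale[OF assms(2), of "-1"]]
  by (simp add: L2_norm_scale[of M "-1", simplified] L2_inner_scale_right[of M _ "-1", simplified])

lemma L2_orthogonal_imp_AE_0:
  assumes "f \<in> L2 M" "L2_inner M f f = 0"
  shows "AE x in M. f x = 0"
  using assms by (intro L2_norm_eq_0) (auto simp: L2_inner_self)

section \<open>Completeness and the Riesz representation\<close>

lemma fast_Cauchy_converges:
  fixes a :: "nat \<Rightarrow> complex"
  assumes "summable (\<lambda>n. 2 ^ n * (cmod (a (Suc n) - a n))\<^sup>2)"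
  shows "convergent a"
proof -
  \<comment> \<open>Only boundedness of the terms is used: it gives increments of order 2^(-n/2),
    which are again geometric and hence absolutely summable.\<close>
  obtain B where "\<forall>n. norm (2 ^ n * (cmod (a (Suc n) - a n))\<^sup>2) \<le> B"
    using summable_imp_Bseq[OF assms] unfolding Bseq_def by blast
  then have B: "2 ^ n * (cmod (a (Suc n) - a n))\<^sup>2 \<le> B" for n by (simp add: abs_mult)
  have bound: "cmod (a (Suc n) - a n) \<le> sqrt B * (1 / sqrt 2) ^ n" for n
  proof (rule power2_le_imp_le)
    have "0 \<le> B" using B[of 0] order_trans[OF zero_le_power2] by simp
    then show "(cmod (a (Suc n) - a n))\<^sup>2 \<le> (sqrt B * (1 / sqrt 2) ^ n)\<^sup>2"
    proof -
      have "(cmod (a (Suc n) - a n))\<^sup>2 \<le> B / 2 ^ n"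
        using B[of n] by (simp add: pos_le_divide_eq mult.commute)
      also have "\<dots> = B * ((1 / sqrt 2)\<^sup>2) ^ n"
        by (simp add: power_divide)
      also have "\<dots> = (sqrt B * (1 / sqrt 2) ^ n)\<^sup>2"
        using \<open>0 \<le> B\<close> by (simp only: power_mult_distrib power_mult[symmetric] mult.commute[of 2] real_sqrt_pow2)
      finally show ?thesis .
    qed
    show "0 \<le> sqrt B * (1 / sqrt 2) ^ n" using \<open>0 \<le> B\<close> by simp
  qed
  have "summable (\<lambda>n. sqrt B * (1 / sqrt 2) ^ n)"
    by (intro summable_mult summable_geometric) simp
  then have "summable (\<lambda>n. a (Suc n) - a n)"
    using bound by (auto intro: summable_comparison_test'[of "\<lambda>n. sqrt B * (1 / sqrt 2) ^ n" 0 "\<lambda>n. a (Suc n) - a n"])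
  then have "convergent (\<lambda>n. \<Sum>i<n. a (Suc i) - a i)"
    by (simp add: summable_iff_convergent)
  then have "convergent (\<lambda>n. a n - a 0)"
    by (simp add: sum_lessThan_telescope)
  then show ?thesis by (simp add: convergent_diff_const_right_iff)
qed

text \<open>The rate 4^(-n) of the squared distances survives the factor 2^n, so the weighted sum of
  squared increments has finite integral and is finite almost everywhere. The whole sequence, and
  not only a subsequence, then converges pointwise.\<close>

lemma L2_fast_Cauchy_converges:
  assumes f: "\<And>n. f n \<in> L2 M"
    and fast: "\<And>m n. n \<le> m \<Longrightarrow> (L2_norm M (\<lambda>x. f m x - f n x))\<^sup>2 \<le> 1 / 4 ^ n"
  obtains g where "g \<in> L2 M" "(\<lambda>n. L2_norm M (\<lambda>x. f n x - g x)) \<longlonglongrightarrow> 0"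
proof -
  note [measurable] = f[THEN L2_measurable]
  have nn: "(\<integral>\<^sup>+x. ennreal ((cmod (f m x - f n x))\<^sup>2) \<partial>M) \<le> ennreal (1 / 4 ^ n)" if "n \<le> m" for m n
    using fast[OF that] by (simp add: ennreal_leI flip: L2_norm_nn_integral[OF L2_diff[OF f f]])
  have "(\<integral>\<^sup>+x. (\<Sum>n. ennreal (2 ^ n * (cmod (f (Suc n) x - f n x))\<^sup>2)) \<partial>M)
      = (\<Sum>n. \<integral>\<^sup>+x. ennreal (2 ^ n * (cmod (f (Suc n) x - f n x))\<^sup>2) \<partial>M)"
    by (rule nn_integral_suminf) measurable
  also have "\<dots> \<le> (\<Sum>n. ennreal ((1 / 2) ^ n))"
  proof (rule suminf_le)
    fix n
    have "(\<integral>\<^sup>+x. ennreal (2 ^ n * (cmod (f (Suc n) x - f n x))\<^sup>2) \<partial>M)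
        = ennreal (2 ^ n) * (\<integral>\<^sup>+x. ennreal ((cmod (f (Suc n) x - f n x))\<^sup>2) \<partial>M)"
      by (subst nn_integral_cmult[symmetric]) (auto simp: ennreal_mult)
    also have "\<dots> \<le> ennreal (2 ^ n) * ennreal (1 / 4 ^ n)"
      by (intro mult_left_mono nn) auto
    also have "\<dots> = ennreal ((1 / 2) ^ n)"
      by (simp add: ennreal_mult[symmetric] power_divide field_simps flip: power_mult_distrib)
    finally show "(\<integral>\<^sup>+x. ennreal (2 ^ n * (cmod (f (Suc n) x - f n x))\<^sup>2) \<partial>M) \<le> ennreal ((1 / 2) ^ n)" .
  qed auto
  also have "\<dots> < \<infinity>"
    by (subst suminf_ennreal2) (auto simp: summable_geometric)
  finally have "AE x in M. (\<Sum>n. ennreal (2 ^ n * (cmod (f (Suc n) x - f n x))\<^sup>2)) \<noteq> \<infinity>"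
    by (intro nn_integral_PInf_AE) auto
  then have conv: "AE x in M. convergent (\<lambda>n. f n x)"
  proof eventually_elim
    case (elim x)
    then have "summable (\<lambda>n. 2 ^ n * (cmod (f (Suc n) x - f n x))\<^sup>2)"
      by (intro summable_suminf_not_top) auto
    then show ?case by (rule fast_Cauchy_converges)
  qed
  define g where "g x = lim (\<lambda>n. f n x)" for x
  have [measurable]: "g \<in> borel_measurable M"
    unfolding g_def by (rule borel_measurable_lim_metric) measurable
  have lim: "AE x in M. (\<lambda>n. f n x) \<longlonglongrightarrow> g x"
    using conv by eventually_elim (simp add: g_def convergent_LIMSEQ_iff)
  \<comment> \<open>Fatou in \<open>m\<close>: the pointwise limit inherits the bound on the
    distance between \<open>f m\<close> and \<open>f n\<close>.\<close>
  have fg: "(\<integral>\<^sup>+x. ennreal ((cmod (f n x - g x))\<^sup>2) \<partial>M) \<le> ennreal (1 / 4 ^ n)" for n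
  proof -
    have "(\<integral>\<^sup>+x. ennreal ((cmod (f n x - g x))\<^sup>2) \<partial>M)
        = (\<integral>\<^sup>+x. liminf (\<lambda>m. ennreal ((cmod (f m x - f n x))\<^sup>2)) \<partial>M)"
    proof (rule nn_integral_cong_AE, use lim in eventually_elim)
      case (elim x)
      then have "(\<lambda>m. ennreal ((cmod (f m x - f n x))\<^sup>2)) \<longlonglongrightarrow> ennreal ((cmod (g x - f n x))\<^sup>2)"
        by (intro tendsto_intros)
      from lim_imp_Liminf[OF _ this] show ?case
        by (simp add: norm_minus_commute)
    qed
    also have "\<dots> \<le> liminf (\<lambda>m. \<integral>\<^sup>+x. ennreal ((cmod (f m x - f n x))\<^sup>2) \<partial>M)"
      by (rule nn_integral_liminf) measurable
    also have "\<dots> \<le> ennreal (1 / 4 ^ n)"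
      by (intro Liminf_le eventually_mono[OF eventually_ge_at_top[of n]] nn) auto
    finally show ?thesis .
  qed
  have d: "(\<lambda>x. f n x - g x) \<in> L2 M" for n
    using fg[of n] by (auto simp: L2_iff_nn_integral intro: le_less_trans)
  have g: "g \<in> L2 M"
    using L2_diff[OF f[of 0] d[of 0]] by simp
  have le: "L2_norm M (\<lambda>x. f n x - g x) \<le> (1 / 2) ^ n" for n
  proof (rule power2_le_imp_le)
    show "(L2_norm M (\<lambda>x. f n x - g x))\<^sup>2 \<le> ((1 / 2) ^ n)\<^sup>2"
      using fg[of n] unfolding L2_norm_nn_integral[OF d, symmetric]
      by (simp add: power_divide power_mult_distrib[symmetric] power2_eq_square)
  qed simp
  have "(\<lambda>n. L2_norm M (\<lambda>x. f n x - g x)) \<longlonglongrightarrow> 0"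
    by (rule tendsto_sandwich[OF _ _ tendsto_const LIMSEQ_power_zero[of "1 / 2 :: real"]])
      (auto simp: L2_norm_nonneg le)
  with g show ?thesis by (rule that)
qed

text \<open>Minimising \<open>\<lVert>k\<rVert>\<^sup>2 - 2 Re (l k)\<close> over a subspace proves at once the Riesz
  representation of functionals defined on the subspace only, and the projection theorem.\<close>

lemma L2_riesz:
  assumes V: "V \<subseteq> L2 M" "(\<lambda>x. 0) \<in> V"
    and add: "\<And>f g. f \<in> V \<Longrightarrow> g \<in> V \<Longrightarrow> (\<lambda>x. f x + g x) \<in> V"
    and scale: "\<And>c f. f \<in> V \<Longrightarrow> (\<lambda>x. c * f x) \<in> V"
    and ladd: "\<And>f g. f \<in> V \<Longrightarrow> g \<in> V \<Longrightarrow> l (\<lambda>x. f x + g x) = l f + l g"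
    and lscale: "\<And>c f. f \<in> V \<Longrightarrow> l (\<lambda>x. c * f x) = c * l f"
    and bound: "\<And>f. f \<in> V \<Longrightarrow> cmod (l f) \<le> C * L2_norm M f"
  obtains h where "h \<in> L2 M" "\<And>k. k \<in> V \<Longrightarrow> l k = L2_inner M k h"
    "\<And>\<epsilon>. \<epsilon> > 0 \<Longrightarrow> \<exists>k\<in>V. L2_norm M (\<lambda>x. h x - k x) < \<epsilon>"
proof -
  define J where "J k = (L2_norm M k)\<^sup>2 - 2 * Re (l k)" for k
  define m where "m = Inf (J ` V)"
  have VL: "\<And>k. k \<in> V \<Longrightarrow> k \<in> L2 M" using V by auto
  have "- C\<^sup>2 \<le> J k" if "k \<in> V" for k
  proof -
    have "Re (l k) \<le> C * L2_norm M k"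
      using bound[OF that] complex_Re_le_cmod order_trans by blast
    moreover have "0 \<le> (L2_norm M k - C)\<^sup>2" by simp
    ultimately show ?thesis by (simp add: J_def power2_diff mult_ac)
  qed
  then have bdd: "bdd_below (J ` V)" by (auto intro!: bdd_belowI)
  have mle: "m \<le> J k" if "k \<in> V" for k
    unfolding m_def using that bdd by (intro cInf_lower) auto
  \<comment> \<open>The tolerance is tuned to the parallelogram law below: two contributions of 2/8
    leave at most half of the 4^(-n) required for convergence.\<close>
  have "\<exists>k\<in>V. J k < m + 1 / (8 * 4 ^ n)" for n :: nat
  proof -
    have "m < m + 1 / (8 * 4 ^ n)" by simp
    moreover have "J ` V \<noteq> {}" using V by auto
    ultimately show ?thesis
      unfolding m_def using cInf_lessD[of "J ` V"] by blast
  qed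
  then obtain k where k: "\<And>n. k n \<in> V" "\<And>n. J (k n) < m + 1 / (8 * 4 ^ n)" by metis
  have "(L2_norm M (\<lambda>x. k i x - k n x))\<^sup>2 \<le> 1 / 4 ^ n" if "n \<le> i" for i n
  proof -
    have mid: "(\<lambda>x. (1/2) * (k i x + k n x)) \<in> V" by (intro scale add k)
    have e1: "J (\<lambda>x. (1/2) * (k i x + k n x))
      = (1/4) * (L2_norm M (\<lambda>x. k i x + k n x))\<^sup>2 - Re (l (k i)) - Re (l (k n))"
      unfolding J_def lscale[OF add[OF k(1) k(1)]] L2_norm_scale ladd[OF k(1) k(1)]
      by (simp add: power2_eq_square field_simps)
    \<comment> \<open>Parallelogram law. The linear parts of \<open>J\<close> cancel in the
      combination with the midpoint, so almost minimality of both ends bounds their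
      distance.\<close>
    have e2: "(L2_norm M (\<lambda>x. k i x - k n x))\<^sup>2
        = 2 * (L2_norm M (k i))\<^sup>2 + 2 * (L2_norm M (k n))\<^sup>2 - (L2_norm M (\<lambda>x. k i x + k n x))\<^sup>2"
      by (simp add: L2_norm_diff_power2 L2_norm_add_power2 VL k)
    have "(L2_norm M (\<lambda>x. k i x - k n x))\<^sup>2
        = 2 * J (k i) + 2 * J (k n) - 4 * J (\<lambda>x. (1/2) * (k i x + k n x))"
      unfolding e1 unfolding J_def e2 by (simp add: algebra_simps)
    also have "\<dots> \<le> 2 * (m + 1 / (8 * 4 ^ i)) + 2 * (m + 1 / (8 * 4 ^ n)) - 4 * m"
    proof -
      have "2 * a + 2 * b - 4 * c \<le> 2 * u + 2 * v - 4 * m" if "a < u" "b < v" "m \<le> c" for a b c u v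
        using that by linarith
      then show ?thesis using k(2)[of i] k(2)[of n] mle[OF mid] by blast
    qed
    also have "\<dots> \<le> 1 / 4 ^ n"
    proof -
      have "1 / 4 ^ i \<le> 1 / (4::real) ^ n"
        using that by (intro divide_left_mono power_increasing) auto
      moreover have "2 * (m + x / 8) + 2 * (m + y / 8) - 4 * m \<le> y" if "x \<le> y" "0 \<le> y" for x y :: real
        using that by (simp add: field_simps)
      from this[of "1 / 4 ^ i" "1 / 4 ^ n"] calculation show ?thesis by simp
    qed
    finally show ?thesis .
  qed
  then obtain h where h: "h \<in> L2 M" "(\<lambda>n. L2_norm M (\<lambda>x. k n x - h x)) \<longlonglongrightarrow> 0"
    using L2_fast_Cauchy_converges[of k M] VL k by blast
  show ?thesis
  proof (rule that[OF h(1)])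
    fix \<epsilon> :: real assume "\<epsilon> > 0"
    then obtain n where "L2_norm M (\<lambda>x. k n x - h x) < \<epsilon>"
      using order_tendstoD(2)[OF h(2)] eventually_happens' sequentially_bot by blast
    then show "\<exists>k\<in>V. L2_norm M (\<lambda>x. h x - k x) < \<epsilon>"
      using k(1) by (metis L2_norm_minus_commute)
  next
    fix f assume f: "f \<in> V"
    have lim: "(\<lambda>n. L2_inner M f (k n)) \<longlonglongrightarrow> L2_inner M f h"
    proof (rule LIM_zero_cancel, rule Lim_null_comparison)
      show "(\<lambda>n. L2_norm M f * L2_norm M (\<lambda>x. k n x - h x)) \<longlonglongrightarrow> 0"
        using tendsto_mult_left[OF h(2), of "L2_norm M f"] by simp
      show "\<forall>\<^sub>F n in sequentially. norm (L2_inner M f (k n) - L2_inner M f h)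
          \<le> L2_norm M f * L2_norm M (\<lambda>x. k n x - h x)"
        using f k h(1) L2_inner_bound[of f M "\<lambda>x. k _ x - h x"]
        by (simp add: L2_inner_diff_right VL L2_diff)
    qed
    define d where "d = L2_inner M f h - l f"
    \<comment> \<open>First variation: \<open>k n\<close> is compared with
      \<open>c * f + k n\<close>, it is minimal up to a vanishing tolerance, and \<open>n\<close>
      tends to infinity.\<close>
    have "0 \<le> (cmod c)\<^sup>2 * (L2_norm M f)\<^sup>2 + 2 * Re (c * d)" for c
    proof -
      have "- (1 / 4 ^ n) \<le> (cmod c)\<^sup>2 * (L2_norm M f)\<^sup>2 + 2 * Re (c * (L2_inner M f (k n) - l f))" for n
      proof -
        have "m \<le> J (\<lambda>x. c * f x + k n x)" by (intro mle add scale f k)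
        also have "\<dots> = (cmod c)\<^sup>2 * (L2_norm M f)\<^sup>2
            + 2 * Re (c * (L2_inner M f (k n) - l f)) + J (k n)"
          by (simp add: J_def L2_norm_add_power2 L2_norm_scale power_mult_distrib L2_scale VL f k ladd
            lscale scale L2_inner_scale_left right_diff_distrib)
        finally have "m \<le> (cmod c)\<^sup>2 * (L2_norm M f)\<^sup>2
            + 2 * Re (c * (L2_inner M f (k n) - l f)) + J (k n)" .
        moreover have "1 / (8 * 4 ^ n) \<le> 1 / (4::real) ^ n" by (simp add: divide_simps)
        ultimately show ?thesis
          using k(2)[of n] by linarith
      qed
      moreover have "(\<lambda>n. - (1 / 4 ^ n :: real)) \<longlonglongrightarrow> - 0"
        by (intro tendsto_minus LIMSEQ_divide_realpow_zero) simp
      moreover have "(\<lambda>n. (cmod c)\<^sup>2 * (L2_norm M f)\<^sup>2 + 2 * Re (c * (L2_inner M f (k n) - l f)))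
          \<longlonglongrightarrow> (cmod c)\<^sup>2 * (L2_norm M f)\<^sup>2 + 2 * Re (c * d)"
        unfolding d_def by (intro tendsto_intros lim)
      ultimately show ?thesis
        by (intro LIMSEQ_le[of _ 0]) auto
    qed
    note quad = this
    have "d = 0"
    proof (rule ccontr)
      assume "d \<noteq> 0"
      define N where "N = (L2_norm M f)\<^sup>2"
      have N: "0 \<le> N" by (simp add: N_def)
      \<comment> \<open>Any positive step with \<open>\<delta> * N < 2\<close> contradicts the
        inequality; adding 1 to \<open>N\<close> covers \<open>N = 0\<close>.\<close>
      define \<delta> where "\<delta> = 1 / (N + 1)"
      have "0 \<le> \<delta>\<^sup>2 * (cmod d)\<^sup>2 * N - 2 * \<delta> * (cmod d)\<^sup>2"
      proof -
        have "Re (- of_real \<delta> * cnj d * d) = - \<delta> * (cmod d)\<^sup>2"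
          by (simp only: cmod_power2) (simp add: power2_eq_square algebra_simps)
        moreover have "(cmod (- of_real \<delta> * cnj d))\<^sup>2 = \<delta>\<^sup>2 * (cmod d)\<^sup>2"
          by (simp add: norm_mult power_mult_distrib)
        ultimately show ?thesis
          using quad[of "- of_real \<delta> * cnj d"] by (simp add: N_def)
      qed
      then have "0 \<le> \<delta> * (cmod d)\<^sup>2 * (\<delta> * N - 2)"
        by (simp add: algebra_simps power2_eq_square)
      moreover have "\<delta> > 0" "\<delta> * N < 2" using N by (auto simp: \<delta>_def field_simps)
      moreover have "(cmod d)\<^sup>2 > 0" using \<open>d \<noteq> 0\<close> by simp
      ultimately show False
        by (metis diff_less_0_iff_less linorder_not_le mult_pos_neg mult_pos_pos)
    qed
    then show "l f = L2_inner M f h" by (simp add: d_def)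
  qed
qed

section \<open>Symmetric operators and a criterion for self-adjointness\<close>

lemma
  assumes "linear_operator M T"
  shows linear_operator_L2: "(f, h) \<in> T \<Longrightarrow> f \<in> L2 M \<and> h \<in> L2 M"
    and linear_operator_cong: "(f, h) \<in> T \<Longrightarrow> f' \<in> L2 M \<Longrightarrow> h' \<in> L2 M \<Longrightarrow>
        AE x in M. f' x = f x \<Longrightarrow> AE x in M. h' x = h x \<Longrightarrow> (f', h') \<in> T"
    and linear_operator_add: "(f, h) \<in> T \<Longrightarrow> (g, k) \<in> T \<Longrightarrow> (\<lambda>x. f x + g x, \<lambda>x. h x + k x) \<in> T"
    and linear_operator_scale: "(f, h) \<in> T \<Longrightarrow> (\<lambda>x. c * f x, \<lambda>x. c * h x) \<in> T"
    and linear_operator_unique: "(f, h) \<in> T \<Longrightarrow> (f, h') \<in> T \<Longrightarrow> AE x in M. h x = h' x"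
  using assms unfolding linear_operator_def by blast+

definition symmetric_operator :: "'a measure \<Rightarrow> 'a operator \<Rightarrow> bool" where
  "symmetric_operator M T \<longleftrightarrow> (\<forall>(f, h) \<in> T. \<forall>(g, k) \<in> T. L2_inner M h g = L2_inner M f k)"

text \<open>The first clause of \<open>resolvent_set\<close>, split off because for a symmetric
  operator the bound in the second clause is automatic at nonreal \<open>z\<close>, see
  \<open>symmetric_operator_norm_nonreal\<close>.\<close>

definition onto_shift :: "'a measure \<Rightarrow> 'a operator \<Rightarrow> complex \<Rightarrow> bool" where
  "onto_shift M T z \<longleftrightarrow> (\<forall>h \<in> L2 M. \<exists>(f, k) \<in> T. AE x in M. k x - z * f x = h x)"

lemma symmetric_operatorD:
  "symmetric_operator M T \<Longrightarrow> (f, h) \<in> T \<Longrightarrow> (g, k) \<in> T \<Longrightarrow> L2_inner M h g = L2_inner M f k"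
  unfolding symmetric_operator_def by blast

lemma onto_shiftE:
  assumes "onto_shift M T z" "h \<in> L2 M"
  obtains f k where "(f, k) \<in> T" "AE x in M. k x - z * f x = h x"
  using assms unfolding onto_shift_def by blast

text \<open>\<open>(k, f)\<close> is real by symmetry, so the cross term with \<open>i y f\<close>
  has real part 0 and the squared norm splits as in Pythagoras. This is the source of the bound on
  the Yosida approximations in \<open>shear_domain_in_Domain\<close>.\<close>

lemma symmetric_operator_norm_shift:
  assumes T: "linear_operator M T" "symmetric_operator M T" and fk: "(f, k) \<in> T"
  shows "(L2_norm M (\<lambda>x. k x - (\<i> * of_real y) * f x))\<^sup>2 = (L2_norm M k)\<^sup>2 + y\<^sup>2 * (L2_norm M f)\<^sup>2"
proof -
  have L: "f \<in> L2 M" "k \<in> L2 M" using linear_operator_L2[OF T(1) fk] by auto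
  have "L2_inner M k f = cnj (L2_inner M k f)"
    using symmetric_operatorD[OF T(2) fk fk] L2_inner_commute[of M f k] by simp
  then have "Im (L2_inner M k f) = 0" by (simp add: complex_eq_iff)
  then show ?thesis
    using L by (simp add: L2_norm_diff_power2 L2_scale L2_inner_scale_right L2_norm_scale norm_mult
        power_mult_distrib)
qed

text \<open>Since \<open>(k, f)\<close> is real, the imaginary part of \<open>(k - z f, f)\<close>
  is \<open>- Im z\<close> times the squared norm of \<open>f\<close>; Cauchy-Schwarz does the rest.
  The constant depends on neither operator nor space, which makes it uniform over the
  fibres.\<close>

lemma symmetric_operator_norm_nonreal:
  assumes T: "linear_operator M T" "symmetric_operator M T" and fk: "(f, k) \<in> T"
  shows "\<bar>Im z\<bar> * L2_norm M f \<le> L2_norm M (\<lambda>x. k x - z * f x)"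
proof -
  have L: "f \<in> L2 M" "k \<in> L2 M" using linear_operator_L2[OF T(1) fk] by auto
  have e: "L2_inner M k f = L2_inner M f k" by (rule symmetric_operatorD[OF T(2) fk fk])
  have "L2_inner M k f = cnj (L2_inner M k f)"
    using e L2_inner_commute[of M f k] by simp
  then have "Im (L2_inner M k f) = 0" by (simp add: complex_eq_iff)
  moreover have "L2_inner M (\<lambda>x. k x - z * f x) f = L2_inner M k f - z * L2_inner M f f"
    using L by (simp add: L2_inner_diff_left L2_scale L2_inner_scale_left)
  ultimately have "\<bar>Im (L2_inner M (\<lambda>x. k x - z * f x) f)\<bar> = \<bar>Im z\<bar> * (L2_norm M f)\<^sup>2"
    by (simp add: L2_inner_self abs_mult flip: of_real_power)
  then have "\<bar>Im z\<bar> * (L2_norm M f)\<^sup>2 \<le> L2_norm M (\<lambda>x. k x - z * f x) * L2_norm M f"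
    using abs_Im_le_cmod[of "L2_inner M (\<lambda>x. k x - z * f x) f"] L2_inner_bound[of "\<lambda>x. k x - z * f x" M f] L
    by (simp add: L2_diff L2_scale)
  then show ?thesis
    using L2_norm_nonneg[of M f] L2_norm_nonneg[of M "\<lambda>x. k x - z * f x"]
    by (cases "L2_norm M f = 0") (auto simp: power2_eq_square)
qed

text \<open>The hypothesis says that \<open>u\<close> is orthogonal to the range of
  \<open>T - z\<close>; that range is everything, so \<open>u\<close> is orthogonal to
  itself.\<close>

lemma onto_shift_orthogonal:
  assumes T: "linear_operator M T" "onto_shift M T z" and u: "u \<in> L2 M"
    and orth: "\<And>g k. (g, k) \<in> T \<Longrightarrow> L2_inner M k u = z * L2_inner M g u"
  shows "AE x in M. u x = 0"
proof -
  obtain g k where gk: "(g, k) \<in> T" "AE x in M. k x - z * g x = u x"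
    using onto_shiftE[OF T(2) u] .
  have L: "g \<in> L2 M" "k \<in> L2 M" using linear_operator_L2[OF T(1) gk(1)] by auto
  have "L2_inner M u u = L2_inner M (\<lambda>x. k x - z * g x) u"
    using gk(2) u L by (intro L2_inner_cong_AE L2_measurable) (auto intro: L2_diff L2_scale)
  also have "\<dots> = 0"
    using L u orth[OF gk(1)] by (simp add: L2_inner_diff_left L2_scale L2_inner_scale_left)
  finally show ?thesis by (rule L2_orthogonal_imp_AE_0[OF u])
qed

text \<open>The standard range criterion, with density of the domain as a conclusion instead of a
  hypothesis: for the fibres and for the direct integral only the two range conditions remain
  besides linearity and symmetry.\<close>

lemma self_adjointI:
  assumes lin: "linear_operator M T" and sym: "symmetric_operator M T"
    and onto: "onto_shift M T \<i>" "onto_shift M T (- \<i>)"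
  shows "self_adjoint M T"
proof -
  note TL = linear_operator_L2[OF lin]
  have adj: "op_adjoint M T = T"
  proof (intro equalityI subrelI)
    fix f h assume "(f, h) \<in> T"
    then show "(f, h) \<in> op_adjoint M T"
      using TL symmetric_operatorD[OF sym] unfolding op_adjoint_def by blast
  next
    fix f h assume "(f, h) \<in> op_adjoint M T"
    then have L: "f \<in> L2 M" "h \<in> L2 M"
      and eq: "\<And>g k. (g, k) \<in> T \<Longrightarrow> L2_inner M k f = L2_inner M g h"
      unfolding op_adjoint_def by auto
    \<comment> \<open>An element of the graph with the same value of \<open>T - i\<close> as
      \<open>(f, h)\<close>; the difference \<open>f - f0\<close> is then orthogonal to the range of
      \<open>T + i\<close>.\<close>
    obtain f0 h0 where T0: "(f0, h0) \<in> T" "AE x in M. h0 x - \<i> * f0 x = h x - \<i> * f x"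
      using onto_shiftE[OF onto(1) L2_diff[OF L(2) L2_scale[OF L(1)]]] .
    have L0: "f0 \<in> L2 M" "h0 \<in> L2 M" using TL[OF T0(1)] by auto
    have AE1: "AE x in M. f x - f0 x = 0"
    proof (rule onto_shift_orthogonal[OF lin onto(2) L2_diff[OF L(1) L0(1)]])
      fix g k assume gk: "(g, k) \<in> T"
      then have LG: "g \<in> L2 M" "k \<in> L2 M" using TL by auto
      have "L2_inner M k (\<lambda>x. f x - f0 x) = L2_inner M g h - L2_inner M g h0"
        using LG L L0 eq[OF gk] symmetric_operatorD[OF sym gk T0(1)] by (simp add: L2_inner_diff_right)
      also have "\<dots> = L2_inner M g (\<lambda>x. h x - h0 x)"
        using LG L L0 by (simp add: L2_inner_diff_right)
      also have "\<dots> = L2_inner M g (\<lambda>x. \<i> * (f x - f0 x))"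
        using T0(2) LG L L0
        by (intro L2_inner_cong_AE L2_measurable) (auto intro: L2_diff L2_scale simp: algebra_simps)
      finally show "L2_inner M k (\<lambda>x. f x - f0 x) = - \<i> * L2_inner M g (\<lambda>x. f x - f0 x)"
        by (simp add: L2_inner_scale_right)
    qed
    show "(f, h) \<in> T"
    proof (rule linear_operator_cong[OF lin T0(1) L])
      show "AE x in M. f x = f0 x" using AE1 by eventually_elim simp
      show "AE x in M. h x = h0 x" using AE1 T0(2) by eventually_elim simp
    qed
  qed
  have dense: "densely_defined M T"
    unfolding densely_defined_def
  proof (intro ballI allI impI)
    fix f \<epsilon> assume f: "f \<in> L2 M" and \<epsilon>: "(0::real) < \<epsilon>"
    obtain u v where uv: "(u, v) \<in> T" using onto_shiftE[OF onto(1) f] .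
    \<comment> \<open>\<open>h\<close> represents the functional given by \<open>f\<close> on the
      domain and lies in the closure of the domain, so it is the projection of \<open>f\<close>. The
      rest shows \<open>f = h\<close> almost everywhere.\<close>
    obtain h where h: "h \<in> L2 M" "\<And>k. k \<in> Domain T \<Longrightarrow> L2_inner M k f = L2_inner M k h"
      "\<And>\<epsilon>. \<epsilon> > 0 \<Longrightarrow> \<exists>k\<in>Domain T. L2_norm M (\<lambda>x. h x - k x) < \<epsilon>"
    proof (rule L2_riesz[of "Domain T" M "\<lambda>k. L2_inner M k f" "L2_norm M f"])
      show "Domain T \<subseteq> L2 M" using TL by auto
      show "(\<lambda>x. 0) \<in> Domain T" using linear_operator_scale[OF lin uv, of 0] by auto
      show "cmod (L2_inner M k f) \<le> L2_norm M f * L2_norm M k" if "k \<in> Domain T" for k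
        using L2_inner_bound[of k M f] that TL f by (auto simp: mult.commute)
    qed (use TL f in \<open>auto intro: linear_operator_add[OF lin] linear_operator_scale[OF lin]
          simp: L2_inner_add_left L2_inner_scale_left\<close>)
    have d: "(\<lambda>x. f x - h x) \<in> L2 M" by (intro L2_diff f h)
    obtain g k where gk: "(g, k) \<in> T" "AE x in M. k x - \<i> * g x = f x - h x"
      using onto_shiftE[OF onto(1) d] .
    have LG: "g \<in> L2 M" "k \<in> L2 M" using TL[OF gk(1)] by auto
    \<comment> \<open>\<open>f - h\<close> is orthogonal to the domain. Pairing
      \<open>k - i g = f - h\<close> with the domain and moving \<open>T\<close> across by symmetry
      shows that \<open>g\<close> is orthogonal to the range of \<open>T + i\<close>.\<close>
    have g0: "AE x in M. g x = 0"
    proof (rule onto_shift_orthogonal[OF lin onto(2) LG(1)])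
      fix p q assume pq: "(p, q) \<in> T"
      then have LP: "p \<in> L2 M" "q \<in> L2 M" using TL by auto
      have "L2_inner M p (\<lambda>x. k x - \<i> * g x) = L2_inner M p (\<lambda>x. f x - h x)"
        using gk(2) LP d LG by (intro L2_inner_cong_AE L2_measurable) (auto intro: L2_diff L2_scale)
      also have "\<dots> = 0"
        using h(2)[of p] pq LP f h(1) by (auto simp: L2_inner_diff_right)
      finally have "L2_inner M p k = - \<i> * L2_inner M p g"
        using LP LG by (simp add: L2_inner_diff_right L2_scale L2_inner_scale_right add_eq_0_iff)
      then show "L2_inner M q g = - \<i> * L2_inner M p g"
        using symmetric_operatorD[OF sym pq gk(1)] by simp
    qed
    have "AE x in M. k x = 0"
    proof -
      have "(\<lambda>x. 0 * g x, \<lambda>x. 0 * k x) \<in> T" by (rule linear_operator_scale[OF lin gk(1)])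
      then have "(g, \<lambda>x. 0) \<in> T"
        using linear_operator_cong[OF lin _ LG(1) L2_zero, of "\<lambda>x. 0 * g x" "\<lambda>x. 0 * k x"] g0 by simp
      then show ?thesis using linear_operator_unique[OF lin gk(1)] by simp
    qed
    with g0 gk(2) have fh: "AE x in M. f x = h x" by eventually_elim simp
    obtain v where v: "v \<in> Domain T" "L2_norm M (\<lambda>x. h x - v x) < \<epsilon>" using h(3)[OF \<epsilon>] by blast
    have "v \<in> L2 M" using v(1) TL by auto
    then have "L2_norm M (\<lambda>x. f x - v x) = L2_norm M (\<lambda>x. h x - v x)"
      using fh f h(1) by (intro L2_norm_cong_AE L2_measurable L2_diff) auto
    then show "\<exists>g\<in>Domain T. L2_norm M (\<lambda>x. f x - g x) < \<epsilon>" using v by (intro bexI[of _ v]) auto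
  qed
  show ?thesis unfolding self_adjoint_def using lin dense adj by simp
qed

text \<open>An adjoint is closed, because its defining identity of inner products passes to limits
  in norm of both components, and a self-adjoint operator is an adjoint.\<close>

lemma op_closure_self_adjoint:
  assumes "self_adjoint M T"
  shows "op_closure M T = T"
proof (intro equalityI subrelI)
  have lin: "linear_operator M T" and adj: "op_adjoint M T = T"
    using assms unfolding self_adjoint_def by auto
  note TL = linear_operator_L2[OF lin]
  fix f h
  {
    assume fh: "(f, h) \<in> T"
    have "L2_norm M (\<lambda>x. u x - u x) = 0" for u by (simp add: L2_norm_def)
    then show "(f, h) \<in> op_closure M T"
      unfolding op_closure_def using TL[OF fh] by (auto intro!: bexI[OF _ fh])
  next
    assume "(f, h) \<in> op_closure M T"
    then have L: "f \<in> L2 M" "h \<in> L2 M"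
      and ex: "\<And>\<epsilon>. \<epsilon> > 0 \<Longrightarrow> \<exists>(g, k) \<in> T. L2_norm M (\<lambda>x. f x - g x) < \<epsilon> \<and> L2_norm M (\<lambda>x. h x - k x) < \<epsilon>"
      unfolding op_closure_def by auto
    have "L2_inner M k f = L2_inner M g h" if gk: "(g, k) \<in> T" for g k
    proof -
      have LG: "g \<in> L2 M" "k \<in> L2 M" using TL[OF gk] by auto
      have small: "cmod (L2_inner M k f - L2_inner M g h) \<le> (L2_norm M k + L2_norm M g) * \<epsilon>"
        if e0: "\<epsilon> > 0" for \<epsilon>
      proof -
        obtain p q where pq: "(p, q) \<in> T" "L2_norm M (\<lambda>x. f x - p x) < \<epsilon>" "L2_norm M (\<lambda>x. h x - q x) < \<epsilon>"
          using ex[OF e0] by auto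
        have LP: "p \<in> L2 M" "q \<in> L2 M" using TL[OF pq(1)] by auto
        have "(p, q) \<in> op_adjoint M T" using pq(1) adj by simp
        then have "L2_inner M k p = L2_inner M g q" using gk unfolding op_adjoint_def by auto
        then have "L2_inner M k f - L2_inner M g h
            = L2_inner M k (\<lambda>x. f x - p x) - L2_inner M g (\<lambda>x. h x - q x)"
          using L LG LP by (simp add: L2_inner_diff_right)
        also have "cmod \<dots> \<le> L2_norm M k * L2_norm M (\<lambda>x. f x - p x)
            + L2_norm M g * L2_norm M (\<lambda>x. h x - q x)"
          using L LG LP by (intro order_trans[OF norm_triangle_ineq4] add_mono L2_inner_bound L2_diff)
        also have "\<dots> \<le> L2_norm M k * \<epsilon> + L2_norm M g * \<epsilon>"
          using pq by (intro add_mono mult_left_mono) (auto simp: L2_norm_nonneg)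
        finally show ?thesis by (simp add: distrib_right)
      qed
      have "cmod (L2_inner M k f - L2_inner M g h) \<le> 0"
      proof (rule field_le_epsilon)
        fix e :: real assume e: "e > 0"
        define K where "K = L2_norm M k + L2_norm M g + 1"
        have K: "K > 0" "L2_norm M k + L2_norm M g \<le> K"
          using L2_norm_nonneg[of M k] L2_norm_nonneg[of M g] by (auto simp: K_def)
        have "(L2_norm M k + L2_norm M g) * (e / K) \<le> K * (e / K)"
          using K e by (intro mult_right_mono) auto
        also have "\<dots> = e" using K by simp
        finally show "cmod (L2_inner M k f - L2_inner M g h) \<le> 0 + e"
          using small[of "e / K"] K e by simp
      qed
      then show ?thesis by simp
    qed
    then have "(f, h) \<in> op_adjoint M T"
      unfolding op_adjoint_def using L by auto
    then show "(f, h) \<in> T" by (simp add: adj)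
  }
qed

section \<open>Locally absolutely continuous functions on the line\<close>

lemma compact_imp_sets_lebesgue: "compact K \<Longrightarrow> K \<in> sets lebesgue"
  using lmeasurable_compact fmeasurableD by blast

lemma locally_integrable_Icc:
  fixes v :: "real \<Rightarrow> complex"
  shows "locally_integrable v \<Longrightarrow> set_integrable lebesgue {a..b} v"
  by (simp add: locally_integrable_def)

lemma locally_integrableI:
  fixes v :: "real \<Rightarrow> complex"
  assumes "\<And>a b. set_integrable lebesgue {a..b} v"
  shows "locally_integrable v"
  unfolding locally_integrable_def
proof (intro allI impI)
  fix K :: "real set" assume K: "compact K"
  then obtain a b where "K \<subseteq> {a..b}"
    by (metis bounded_subset_cbox_symmetric cbox_interval compact_imp_bounded)
  then show "set_integrable lebesgue K v"
    using K by (intro set_integrable_subset[OF assms] compact_imp_sets_lebesgue)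
qed

lemma locally_integrable_measurable:
  fixes v :: "'a::euclidean_space \<Rightarrow> complex"
  assumes "locally_integrable v"
  shows "v \<in> borel_measurable lebesgue"
proof -
  have "(\<lambda>x. indicator (cball 0 (real n)) x *\<^sub>R v x) \<in> borel_measurable lebesgue" for n
    using assms unfolding locally_integrable_def set_integrable_def
    by (intro borel_measurable_integrable) simp
  moreover have "(\<lambda>n. indicator (cball 0 (real n)) x *\<^sub>R v x) \<longlonglongrightarrow> v x" for x
  proof (rule tendsto_eventually, rule eventually_sequentiallyI)
    fix n assume "nat \<lceil>norm x\<rceil> \<le> n"
    then have "norm x \<le> real n" by linarith
    then show "indicator (cball 0 (real n)) x *\<^sub>R v x = v x"
      by simp
  qed
  ultimately show ?thesis
    by (rule borel_measurable_LIMSEQ_metric)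
qed

lemma locally_integrable_add:
  "locally_integrable u \<Longrightarrow> locally_integrable v \<Longrightarrow> locally_integrable (\<lambda>x. u x + v x)"
  by (simp add: locally_integrable_def)

lemma locally_integrable_diff:
  "locally_integrable u \<Longrightarrow> locally_integrable v \<Longrightarrow> locally_integrable (\<lambda>x. u x - v x)"
  by (simp add: locally_integrable_def)

lemma locally_integrable_bound:
  fixes u v :: "'a::euclidean_space \<Rightarrow> complex"
  assumes "locally_integrable u" "v \<in> borel_measurable lebesgue"
    "\<And>K. compact K \<Longrightarrow> \<exists>C. AE x in lebesgue. x \<in> K \<longrightarrow> cmod (v x) \<le> C * cmod (u x)"
  shows "locally_integrable v"
  unfolding locally_integrable_def
proof (intro allI impI)
  fix K :: "'a set" assume K: "compact K"
  then obtain C where C: "AE x in lebesgue. x \<in> K \<longrightarrow> cmod (v x) \<le> C * cmod (u x)"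
    using assms(3) by blast
  show "set_integrable lebesgue K v"
  proof (rule set_integrable_bound)
    show "set_integrable lebesgue K (\<lambda>x. C *\<^sub>R u x)"
      using assms(1) K by (simp add: locally_integrable_def)
    show "set_borel_measurable lebesgue K v"
      unfolding set_borel_measurable_def using K assms(2)
      by (intro borel_measurable_scaleR borel_measurable_indicator compact_imp_sets_lebesgue)
    show "AE x in lebesgue. x \<in> K \<longrightarrow> norm (v x) \<le> norm (C *\<^sub>R u x)"
      using C
    proof eventually_elim
      case (elim x)
      have "C * cmod (u x) \<le> \<bar>C\<bar> * cmod (u x)" by (intro mult_right_mono) auto
      with elim show ?case by auto
    qed
  qed
qed

lemma continuous_imp_borel_lebesgue:
  fixes g :: "'a::euclidean_space \<Rightarrow> 'b::topological_space"
  assumes "continuous_on UNIV g"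
  shows "g \<in> borel_measurable lebesgue"
  using borel_measurable_continuous_onI[OF assms] by (simp add: measurable_completion)

lemma locally_integrable_mult_continuous:
  fixes g v :: "'a::euclidean_space \<Rightarrow> complex"
  assumes "continuous_on UNIV g" "locally_integrable v"
  shows "locally_integrable (\<lambda>x. g x * v x)"
proof (rule locally_integrable_bound[OF assms(2)])
  show "(\<lambda>x. g x * v x) \<in> borel_measurable lebesgue"
    by (intro borel_measurable_times continuous_imp_borel_lebesgue assms locally_integrable_measurable)
  fix K :: "'a set" assume "compact K"
  then have "compact (g ` K)"
    using assms(1) by (meson compact_continuous_image continuous_on_subset subset_UNIV)
  then obtain C where "\<And>x. x \<in> K \<Longrightarrow> cmod (g x) \<le> C"
    using compact_imp_bounded by (metis bounded_iff imageI)
  then show "\<exists>C. AE x in lebesgue. x \<in> K \<longrightarrow> cmod (g x * v x) \<le> C * cmod (v x)"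
    by (intro exI[of _ C] AE_I2) (auto simp: norm_mult intro!: mult_right_mono)
qed

lemma locally_integrable_continuous:
  fixes g :: "'a::euclidean_space \<Rightarrow> complex"
  assumes "continuous_on UNIV g"
  shows "locally_integrable g"
proof -
  have "locally_integrable (\<lambda>x::'a. 1)"
    unfolding locally_integrable_def set_integrable_def
    by (intro allI impI integrable_scaleR_left integrable_real_indicator compact_imp_sets_lebesgue)
      (simp_all add: emeasure_compact_finite[unfolded infinity_ennreal_def] borel_compact)
  from locally_integrable_mult_continuous[OF assms this] show ?thesis by simp
qed

lemma locally_integrable_integrable:
  fixes v :: "'a::euclidean_space \<Rightarrow> complex"
  assumes "integrable lebesgue v"
  shows "locally_integrable v"
  using assms unfolding locally_integrable_def set_integrable_def
  by (auto intro!: integrable_mult_indicator compact_imp_sets_lebesgue)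

lemma locally_integrable_scale:
  "locally_integrable v \<Longrightarrow> locally_integrable (\<lambda>x. c * v x)"
  by (rule locally_integrable_mult_continuous) auto

lemma locally_integrable_cong_AE:
  fixes u v :: "'a::euclidean_space \<Rightarrow> complex"
  assumes "locally_integrable u" "v \<in> borel_measurable lebesgue" "AE x in lebesgue. u x = v x"
  shows "locally_integrable v"
  using assms(3) by (intro locally_integrable_bound[OF assms(1,2)] exI[of _ 1]) auto

lemma set_integral_Icc_combine:
  fixes v :: "real \<Rightarrow> 'b::euclidean_space"
  assumes "set_integrable lebesgue {a..c} v" "a \<le> b" "b \<le> c"
  shows "(LINT s:{a..b}|lebesgue. v s) + (LINT s:{b..c}|lebesgue. v s) = (LINT s:{a..c}|lebesgue. v s)"
proof -
  have i: "set_integrable lebesgue {a..b} v" "set_integrable lebesgue {b..c} v"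
    using assms by (auto intro: set_integrable_subset)
  show ?thesis
    unfolding set_lebesgue_integral_eq_integral(2)[OF i(1)] set_lebesgue_integral_eq_integral(2)[OF i(2)]
      set_lebesgue_integral_eq_integral(2)[OF assms(1)]
    using assms by (intro Henstock_Kurzweil_Integration.integral_combine set_lebesgue_integral_eq_integral)
qed

text \<open>Local absolute continuity with derivative \<open>v\<close>, expressed by increments
  only. Almost everywhere differentiability never enters, and \<open>g\<close> is automatically the
  continuous representative.\<close>

definition antiderivative :: "(real \<Rightarrow> complex) \<Rightarrow> (real \<Rightarrow> complex) \<Rightarrow> bool" where
  "antiderivative g v \<longleftrightarrow> locally_integrable v \<and>
     (\<forall>a b. a \<le> b \<longrightarrow> g b - g a = (LINT s:{a..b}|lebesgue. v s))"

lemma antiderivative_locally_integrable: "antiderivative g v \<Longrightarrow> locally_integrable v"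
  by (simp add: antiderivative_def)

lemma antiderivative_eq:
  "antiderivative g v \<Longrightarrow> a \<le> b \<Longrightarrow> g b - g a = (LINT s:{a..b}|lebesgue. v s)"
  by (simp add: antiderivative_def)

lemma antiderivative_continuous:
  assumes "antiderivative g v"
  shows "continuous_on UNIV g"
proof -
  have "continuous_on {-r<..<r} g" for r :: real
  proof -
    have si: "set_integrable lebesgue {a..b} v" for a b
      using assms by (intro locally_integrable_Icc antiderivative_locally_integrable)
    have "continuous_on {-r..r} (\<lambda>x. g (-r) + integral {-r..x} v)"
      by (intro continuous_intros indefinite_integral_continuous_1 set_lebesgue_integral_eq_integral si)
    moreover have "g (-r) + integral {-r..x} v = g x" if "x \<in> {-r..r}" for x
      using antiderivative_eq[OF assms, of "-r" x] that set_lebesgue_integral_eq_integral(2)[OF si, of "-r" x]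
      by (simp add: algebra_simps)
    ultimately have "continuous_on {-r..r} g"
      by (rule continuous_on_eq)
    then show ?thesis by (rule continuous_on_subset) auto
  qed
  then have "continuous_on (\<Union>r. {-r<..<r::real}) g"
    by (intro continuous_on_open_UN) auto
  moreover have "x \<in> (\<Union>r. {-r<..<r})" for x :: real
    by (rule UN_I[of "\<bar>x\<bar> + 1"]) auto
  ultimately show ?thesis by (metis UNIV_eq_I)
qed

lemma antiderivative_add:
  "antiderivative f u \<Longrightarrow> antiderivative g v \<Longrightarrow> antiderivative (\<lambda>s. f s + g s) (\<lambda>s. u s + v s)"
  unfolding antiderivative_def
  by (auto simp: locally_integrable_add locally_integrable_Icc set_integral_add add_diff_add)

lemma antiderivative_scale:
  "antiderivative g v \<Longrightarrow> antiderivative (\<lambda>s. c * g s) (\<lambda>s. c * v s)"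
  unfolding antiderivative_def
  by (auto simp: locally_integrable_scale simp flip: right_diff_distrib)

lemma antiderivative_diff:
  assumes "antiderivative f u" "antiderivative g v"
  shows "antiderivative (\<lambda>s. f s - g s) (\<lambda>s. u s - v s)"
  using antiderivative_add[OF assms(1) antiderivative_scale[OF assms(2), of "-1"]] by simp

lemma antiderivative_const: "antiderivative (\<lambda>s. c) (\<lambda>s. 0)"
  unfolding antiderivative_def by (auto intro: locally_integrable_continuous)

lemma antiderivative_cnj:
  assumes "antiderivative g v"
  shows "antiderivative (\<lambda>s. cnj (g s)) (\<lambda>s. cnj (v s))"
proof -
  have v: "locally_integrable v" using assms by (rule antiderivative_locally_integrable)
  have "locally_integrable (\<lambda>s. cnj (v s))"
    using locally_integrable_measurable[OF v]
    by (intro locally_integrable_bound[OF v] exI[of _ 1])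
      (auto intro!: borel_measurable_continuous_on[OF continuous_on_cnj[OF continuous_on_id]])
  moreover have "(LINT s:A|lebesgue. cnj (v s)) = cnj (LINT s:A|lebesgue. v s)" for A
    unfolding set_lebesgue_integral_def
    by (simp flip: Bochner_Integration.integral_cnj)
  ultimately show ?thesis
    using assms unfolding antiderivative_def by (auto simp flip: complex_cnj_diff)
qed

lemma antiderivative_cong_AE:
  assumes "antiderivative g v" "v' \<in> borel_measurable lebesgue" "AE s in lebesgue. v s = v' s"
  shows "antiderivative g v'"
proof -
  have v: "locally_integrable v" using assms(1) by (rule antiderivative_locally_integrable)
  have "(LINT s:{a..b}|lebesgue. v s) = (LINT s:{a..b}|lebesgue. v' s)" for a b
    using assms(3) by (intro set_lebesgue_integral_cong_AE locally_integrable_measurable[OF v] assms(2)) auto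
  then show ?thesis
    using assms locally_integrable_cong_AE[OF v assms(2,3)] unfolding antiderivative_def by auto
qed

text \<open>The oriented integral from 0 to \<open>s\<close> as one integral over the line with a
  signed kernel. In this form measurability in \<open>s\<close> and in further parameters is a
  single instance of the theorem on integrals with a parameter.\<close>

definition primitive :: "(real \<Rightarrow> complex) \<Rightarrow> real \<Rightarrow> complex" where
  "primitive v s = (LINT u|lebesgue. (indicator {0..s} u - indicator {s..0} u) * v u)"

lemma primitive_eq:
  assumes "locally_integrable v"
  shows "primitive v s = (LINT u:{0..s}|lebesgue. v u) - (LINT u:{s..0}|lebesgue. v u)"
proof -
  have si: "set_integrable lebesgue {a..b} v" for a b
    using assms by (rule locally_integrable_Icc)
  have "primitive v s = (LINT u|lebesgue. indicator {0..s} u *\<^sub>R v u - indicator {s..0} u *\<^sub>R v u)"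
    unfolding primitive_def by (intro Bochner_Integration.integral_cong) (auto simp: indicator_def)
  also have "\<dots> = (LINT u:{0..s}|lebesgue. v u) - (LINT u:{s..0}|lebesgue. v u)"
    using si unfolding set_integrable_def set_lebesgue_integral_def by simp
  finally show ?thesis .
qed

lemma set_integral_singleton:
  fixes v :: "real \<Rightarrow> 'b::euclidean_space"
  shows "(LINT u:{a..a}|lebesgue. v u) = 0"
proof -
  have "AE u in lebesgue. indicator {a} u *\<^sub>R v u = 0"
    using AE_completion[OF AE_lborel_singleton[of a]] by eventually_elim simp
  then show ?thesis
    unfolding set_lebesgue_integral_def by (simp add: integral_eq_zero_AE)
qed

lemma antiderivative_primitive:
  assumes "locally_integrable v"
  shows "antiderivative (primitive v) v"
proof -
  have si: "set_integrable lebesgue {a..b} v" for a b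
    using assms by (rule locally_integrable_Icc)
  have e: "{a..b} = {} \<or> (a = b \<and> {a..b} = {a..a})" if "b \<le> a" for a b :: real using that by auto
  have z: "(LINT u:{a..b}|lebesgue. v u) = 0" if "b \<le> a" for a b :: real
    using e[OF that] by (auto simp: set_integral_singleton set_integral_singleton[simplified] set_lebesgue_integral_def[of _ "{}"])
  have "primitive v b - primitive v a = (LINT s:{a..b}|lebesgue. v s)" if ab: "a \<le> b" for a b
  proof -
    consider "0 \<le> a" | "a \<le> 0" "0 \<le> b" | "b \<le> 0" by linarith
    then show ?thesis
    proof cases
      case 1
      then show ?thesis using ab set_integral_Icc_combine[OF si, of 0 a b]
        by (simp add: primitive_eq[OF assms] z algebra_simps)
    next
      case 2
      then show ?thesis using ab set_integral_Icc_combine[OF si, of a 0 b]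
        by (simp add: primitive_eq[OF assms] z algebra_simps)
    next
      case 3
      then show ?thesis using ab set_integral_Icc_combine[OF si, of a b 0]
        by (simp add: primitive_eq[OF assms] z algebra_simps)
    qed
  qed
  then show ?thesis using assms by (simp add: antiderivative_def)
qed

section \<open>Product rule, exponential rule and limits at infinity\<close>

lemma antiderivative_0: "antiderivative g (\<lambda>s. 0) \<Longrightarrow> g b = g a"
  using antiderivative_eq[of g "\<lambda>s. 0" a b] antiderivative_eq[of g "\<lambda>s. 0" b a]
  by (cases "a \<le> b") auto

lemma antiderivative_C1:
  assumes "\<And>s. (g has_vector_derivative g' s) (at s)" "continuous_on UNIV g'"
  shows "antiderivative g g'"
proof -
  have g': "locally_integrable g'" by (rule locally_integrable_continuous[OF assms(2)])
  have "g b - g a = (LINT s:{a..b}|lebesgue. g' s)" if "a \<le> b" for a b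
  proof -
    have "(g' has_integral g b - g a) {a..b}"
      by (rule fundamental_theorem_of_calculus[OF that]) (auto intro: has_vector_derivative_at_within assms)
    then show ?thesis
      using set_lebesgue_integral_eq_integral(2)[OF locally_integrable_Icc[OF g']] by (metis integral_unique)
  qed
  with g' show ?thesis by (simp add: antiderivative_def)
qed

text \<open>Halving intervals with the intermediate value theorem gains a factor 2 in the bound.\<close>

lemma quadratic_increment_imp_eq:
  fixes E :: "real \<Rightarrow> complex" and m :: "real \<Rightarrow> real"
  assumes ab: "a \<le> b" and cont: "continuous_on {a..b} m"
    and mono: "\<And>s t. a \<le> s \<Longrightarrow> s \<le> t \<Longrightarrow> t \<le> b \<Longrightarrow> m s \<le> m t"
    and inc: "\<And>s t. a \<le> s \<Longrightarrow> s \<le> t \<Longrightarrow> t \<le> b \<Longrightarrow> cmod (E t - E s) \<le> K * (m t - m s)\<^sup>2"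
  shows "E b = E a"
proof -
  have halve: "cmod (E t - E s) \<le> K * (m t - m s)\<^sup>2 / 2 ^ n" if "a \<le> s" "s \<le> t" "t \<le> b" for n s t
    using that
  proof (induction n arbitrary: s t)
    case 0
    then show ?case using inc[of s t] by simp
  next
    case (Suc n)
    \<comment> \<open>\<open>c\<close> halves the growth of \<open>m\<close>, not the length of the
      interval, so each of the two parts carries a quarter of the squared increment.\<close>
    have "\<exists>c\<ge>s. c \<le> t \<and> m c = (m s + m t) / 2"
      using Suc.prems mono[of s t] by (intro IVT' continuous_on_subset[OF cont]) auto
    then obtain c where c: "s \<le> c" "c \<le> t" "m c = (m s + m t) / 2" by blast
    have d: "m t - m c = (m t - m s) / 2" "m c - m s = (m t - m s) / 2" using c(3) by (auto simp: field_simps)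
    have "cmod (E t - E s) \<le> cmod (E t - E c) + cmod (E c - E s)"
      using norm_triangle_ineq[of "E t - E c" "E c - E s"] by simp
    also have "\<dots> \<le> K * (m t - m c)\<^sup>2 / 2 ^ n + K * (m c - m s)\<^sup>2 / 2 ^ n"
      using Suc.prems c by (intro add_mono Suc.IH) auto
    also have "\<dots> = K * (m t - m s)\<^sup>2 / 2 ^ Suc n"
      unfolding d by (simp add: power_divide field_simps)
    finally show ?case .
  qed
  have "(\<lambda>n. K * (m b - m a)\<^sup>2 / 2 ^ n) \<longlonglongrightarrow> 0"
    by (rule LIMSEQ_divide_realpow_zero) simp
  then have "cmod (E b - E a) \<le> 0"
    using halve[of a b] ab by (intro LIMSEQ_le_const[of _ 0]) auto
  then show ?thesis by simp
qed

lemma set_integral_norm_le: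
  fixes f :: "real \<Rightarrow> complex" and h :: "real \<Rightarrow> real"
  assumes "set_integrable lebesgue A f" "set_integrable lebesgue A h" "\<And>u. u \<in> A \<Longrightarrow> cmod (f u) \<le> h u"
  shows "cmod (LINT u:A|lebesgue. f u) \<le> (LINT u:A|lebesgue. h u)"
  using order_trans[OF set_integral_norm_bound[OF assms(1)]
      set_integral_mono[OF set_integrable_norm[OF assms(1)] assms(2)]] assms(3) by blast

text \<open>The defect \<open>E\<close> of the product rule is of second order: on a short interval
  it contains only products of increments of \<open>F\<close> and \<open>G\<close>, or of increments
  with \<open>f\<close> and \<open>g\<close>, and all of these are controlled by one continuous
  increasing function \<open>m\<close>, the integral of \<open>|f| + |g|\<close>. Such a defect is
  constant by \<open>quadratic_increment_imp_eq\<close>.\<close>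

lemma antiderivative_mult:
  assumes F: "antiderivative F f" and G: "antiderivative G g"
  shows "antiderivative (\<lambda>s. F s * G s) (\<lambda>s. f s * G s + F s * g s)"
proof -
  have li: "locally_integrable f" "locally_integrable g" "locally_integrable (\<lambda>s. f s * G s + F s * g s)"
    using locally_integrable_mult_continuous[OF antiderivative_continuous[OF G] antiderivative_locally_integrable[OF F]]
      locally_integrable_mult_continuous[OF antiderivative_continuous[OF F] antiderivative_locally_integrable[OF G]]
      F G antiderivative_locally_integrable
    by (auto intro!: locally_integrable_add simp: mult.commute)
  note si = li[THEN locally_integrable_Icc]
  have "F b * G b - F a * G a = (LINT s:{a..b}|lebesgue. f s * G s + F s * g s)" if ab: "a \<le> b" for a b
  proof -
    define h where "h s = cmod (f s) + cmod (g s)" for s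
    define m where "m t = (LINT s:{a..t}|lebesgue. h s)" for t
    define E where "E t = F t * G t - (LINT s:{a..t}|lebesgue. f s * G s + F s * g s)" for t
    have sih: "set_integrable lebesgue {s..t} h" for s t
      unfolding h_def by (intro set_integral_add set_integrable_norm si)
    have h0: "0 \<le> h s" for s by (simp add: h_def)
    have mdiff: "m t - m s = (LINT u:{s..t}|lebesgue. h u)" if "a \<le> s" "s \<le> t" for s t
      using set_integral_Icc_combine[OF sih that] by (simp add: m_def)
    have m0: "0 \<le> m t - m s" if "a \<le> s" "s \<le> t" for s t
      unfolding mdiff[OF that] set_lebesgue_integral_def
      by (rule integral_nonneg_AE) (auto simp: h0)
    have Fd: "cmod (F t - F s) \<le> m t - m s" "cmod (G t - G s) \<le> m t - m s" if "a \<le> s" "s \<le> t" for s t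
      unfolding mdiff[OF that] antiderivative_eq[OF F that(2)] antiderivative_eq[OF G that(2)]
      by (intro set_integral_norm_le si sih; simp add: h_def)+
    have "E b = E a"
    proof (rule quadratic_increment_imp_eq[OF ab, of m E 2])
      show "continuous_on {a..b} m"
        unfolding m_def set_lebesgue_integral_eq_integral(2)[OF sih]
        by (intro indefinite_integral_continuous_1 set_lebesgue_integral_eq_integral sih)
      show "m s \<le> m t" if "a \<le> s" "s \<le> t" for s t using m0[OF that] by simp
      fix s t assume st: "a \<le> s" "s \<le> t" "t \<le> b"
      define r where "r u = f u * (G u - G s) + (F u - F s) * g u" for u
      have sir: "set_integrable lebesgue {s..t} r"
      proof -
        have "set_integrable lebesgue {s..t} (\<lambda>u. (f u * G u + F u * g u) - (G s * f u + F s * g u))"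
          by (intro set_integral_diff set_integral_add si set_integrable_mult_right)
        then show ?thesis by (simp add: r_def[abs_def] algebra_simps)
      qed
      have "(LINT u:{s..t}|lebesgue. f u * G u + F u * g u)
          = (LINT u:{s..t}|lebesgue. r u + (G s * f u + F s * g u))"
        by (simp add: r_def algebra_simps)
      also have "\<dots> = (LINT u:{s..t}|lebesgue. r u) + (G s * (F t - F s) + F s * (G t - G s))"
        using antiderivative_eq[OF F st(2)] antiderivative_eq[OF G st(2)] si sir
        by (simp add: set_integral_add)
      finally have I: "(LINT u:{s..t}|lebesgue. f u * G u + F u * g u)
        = (LINT u:{s..t}|lebesgue. r u) + (G s * (F t - F s) + F s * (G t - G s))" .
      have "E t - E s = (F t - F s) * (G t - G s) - (LINT u:{s..t}|lebesgue. r u)"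
        unfolding E_def set_integral_Icc_combine[OF si(3) st(1,2), symmetric] I by (simp add: algebra_simps)
      also have "cmod \<dots> \<le> (m t - m s) * (m t - m s) + (LINT u:{s..t}|lebesgue. (m t - m s) * h u)"
      proof (intro order_trans[OF norm_triangle_ineq4] add_mono)
        show "cmod ((F t - F s) * (G t - G s)) \<le> (m t - m s) * (m t - m s)"
          unfolding norm_mult using st by (intro mult_mono Fd m0) auto
        show "cmod (LINT u:{s..t}|lebesgue. r u) \<le> (LINT u:{s..t}|lebesgue. (m t - m s) * h u)"
        proof (rule set_integral_norm_le[OF sir])
          show "set_integrable lebesgue {s..t} (\<lambda>u. (m t - m s) * h u)" using sih by simp
          fix u assume u: "u \<in> {s..t}"
          have "m u - m s \<le> m t - m s" using m0[of u t] u st by auto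
          then have "cmod (G u - G s) \<le> m t - m s" "cmod (F u - F s) \<le> m t - m s"
            using Fd[of s u] u st by force+
          note d = this
          have "cmod (r u) \<le> cmod (f u) * cmod (G u - G s) + cmod (F u - F s) * cmod (g u)"
            unfolding r_def by (rule order_trans[OF norm_triangle_ineq]) (simp add: norm_mult)
          also have "\<dots> \<le> cmod (f u) * (m t - m s) + (m t - m s) * cmod (g u)"
            using m0[OF st(1,2)] d by (intro add_mono mult_mono) auto
          also have "\<dots> = (m t - m s) * h u" by (simp add: h_def algebra_simps)
          finally show "cmod (r u) \<le> (m t - m s) * h u" .
        qed
      qed
      also have "\<dots> = 2 * (m t - m s)\<^sup>2"
        using mdiff[OF st(1,2)] by (simp add: power2_eq_square)
      finally show "cmod (E t - E s) \<le> 2 * (m t - m s)\<^sup>2" .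
    qed
    then show ?thesis by (simp add: E_def set_integral_singleton[of a, simplified] diff_eq_eq add.commute)
  qed
  with li(3) show ?thesis by (simp add: antiderivative_def)
qed

text \<open>Same scheme as for products: the first-order Taylor polynomial of \<open>exp\<close> at
  \<open>F s\<close> accounts for the integral up to an error quadratic in the increase of the
  integral of \<open>|f|\<close>.\<close>

lemma antiderivative_exp:
  assumes F: "antiderivative F f"
  shows "antiderivative (\<lambda>s. exp (F s)) (\<lambda>s. f s * exp (F s))"
proof -
  have Fc: "continuous_on UNIV F" by (rule antiderivative_continuous[OF F])
  have eFc: "continuous_on UNIV (\<lambda>s. exp (F s))" by (intro continuous_intros Fc)
  have li: "locally_integrable f" "locally_integrable (\<lambda>s. f s * exp (F s))"
    using locally_integrable_mult_continuous[OF eFc antiderivative_locally_integrable[OF F]]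
      antiderivative_locally_integrable[OF F] by (simp_all add: mult.commute)
  note si = li[THEN locally_integrable_Icc]
  have "exp (F b) - exp (F a) = (LINT s:{a..b}|lebesgue. f s * exp (F s))" if ab: "a \<le> b" for a b
  proof -
    define h where "h s = cmod (f s)" for s
    define m where "m t = (LINT s:{a..t}|lebesgue. h s)" for t
    define E where "E t = exp (F t) - (LINT s:{a..t}|lebesgue. f s * exp (F s))" for t
    have sih: "set_integrable lebesgue {s..t} h" for s t
      unfolding h_def by (intro set_integrable_norm si)
    have mdiff: "m t - m s = (LINT u:{s..t}|lebesgue. h u)" if "a \<le> s" "s \<le> t" for s t
      using set_integral_Icc_combine[OF sih that] by (simp add: m_def)
    have m0: "0 \<le> m t - m s" if "a \<le> s" "s \<le> t" for s t
      unfolding mdiff[OF that] set_lebesgue_integral_def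
      by (rule integral_nonneg_AE) (auto simp: h_def)
    have Fd: "cmod (F t - F s) \<le> m t - m s" if "a \<le> s" "s \<le> t" for s t
      unfolding mdiff[OF that] antiderivative_eq[OF F that(2)]
      by (intro set_integral_norm_le si sih) (simp add: h_def)
    have "compact ((\<lambda>s. exp (F s)) ` {a..b})"
      by (intro compact_continuous_image continuous_on_subset[OF eFc]) auto
    then obtain B0 where B0: "\<And>s. s \<in> {a..b} \<Longrightarrow> cmod (exp (F s)) \<le> B0"
      by (metis bounded_iff compact_imp_bounded imageI)
    \<comment> \<open>\<open>B0\<close> bounds \<open>exp (F s)\<close> on the interval, and
      \<open>exp (m b)\<close> bounds the exponential factor of the Taylor remainders, since no
      increment of \<open>F\<close> exceeds \<open>m b\<close>.\<close>
    define B where "B = B0 * exp (m b)"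
    have ma: "m a = 0" using set_integral_singleton[of a h] by (simp add: m_def)
    have B00: "0 \<le> B0" using order_trans[OF norm_ge_zero B0[of a]] ab by simp
    have exp2: "cmod (exp (F t) - exp (F s) - exp (F s) * (F t - F s)) \<le> B * (m t - m s)\<^sup>2"
      and exp1: "cmod (exp (F t) - exp (F s)) \<le> B * (m t - m s)" if st: "a \<le> s" "s \<le> t" "t \<le> b" for s t
    proof -
      define z where "z = F t - F s"
      have z: "cmod z \<le> m t - m s" using Fd[OF st(1,2)] by (simp add: z_def)
      have zb: "cmod z \<le> m b" using z m0[of a s] m0[of t b] st ma by auto
      have eq: "exp (F t) = exp (F s) * exp z" by (simp add: z_def flip: exp_add)
      have "cmod (exp z - 1 - z) \<le> exp (cmod z) * (cmod z)\<^sup>2"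
        using Taylor_exp_field[of z 1] by (simp add: power2_eq_square diff_diff_eq)
      also have "\<dots> \<le> exp (m b) * (m t - m s)\<^sup>2"
        using zb z by (intro mult_mono power_mono) auto
      finally have 2: "cmod (exp z - 1 - z) \<le> exp (m b) * (m t - m s)\<^sup>2" .
      have "cmod (exp z - 1) \<le> exp (cmod z) * cmod z"
        using Taylor_exp_field[of z 0] by simp
      also have "\<dots> \<le> exp (m b) * (m t - m s)"
        using zb z by (intro mult_mono) auto
      finally have 1: "cmod (exp z - 1) \<le> exp (m b) * (m t - m s)" .
      have Fs: "cmod (exp (F s)) \<le> B0" using B0 st by simp
      have "exp (F t) - exp (F s) - exp (F s) * (F t - F s) = exp (F s) * (exp z - 1 - z)"
        unfolding eq by (simp add: z_def algebra_simps)
      then show "cmod (exp (F t) - exp (F s) - exp (F s) * (F t - F s)) \<le> B * (m t - m s)\<^sup>2"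
        using mult_mono[OF Fs 2 B00] by (simp add: norm_mult B_def mult.assoc)
      have "exp (F t) - exp (F s) = exp (F s) * (exp z - 1)"
        unfolding eq by (simp add: algebra_simps)
      then show "cmod (exp (F t) - exp (F s)) \<le> B * (m t - m s)"
        using mult_mono[OF Fs 1 B00] by (simp add: norm_mult B_def mult.assoc)
    qed
    have "E b = E a"
    proof (rule quadratic_increment_imp_eq[OF ab, of m E "2 * B"])
      show "continuous_on {a..b} m"
        unfolding m_def set_lebesgue_integral_eq_integral(2)[OF sih]
        by (intro indefinite_integral_continuous_1 set_lebesgue_integral_eq_integral sih)
      show "m s \<le> m t" if "a \<le> s" "s \<le> t" for s t using m0[OF that] by simp
      fix s t assume st: "a \<le> s" "s \<le> t" "t \<le> b"
      define r where "r u = f u * (exp (F u) - exp (F s))" for u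
      have sir: "set_integrable lebesgue {s..t} r"
      proof -
        have "set_integrable lebesgue {s..t} (\<lambda>u. f u * exp (F u) - exp (F s) * f u)"
          by (intro set_integral_diff si set_integrable_mult_right)
        then show ?thesis by (simp add: r_def[abs_def] algebra_simps)
      qed
      have "(LINT u:{s..t}|lebesgue. f u * exp (F u)) = (LINT u:{s..t}|lebesgue. r u + exp (F s) * f u)"
        by (simp add: r_def algebra_simps)
      also have "\<dots> = (LINT u:{s..t}|lebesgue. r u) + exp (F s) * (F t - F s)"
        using antiderivative_eq[OF F st(2)] si sir by (simp add: set_integral_add)
      finally have I: "(LINT u:{s..t}|lebesgue. f u * exp (F u))
        = (LINT u:{s..t}|lebesgue. r u) + exp (F s) * (F t - F s)" .
      have "E t - E s = (exp (F t) - exp (F s) - exp (F s) * (F t - F s)) - (LINT u:{s..t}|lebesgue. r u)"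
        unfolding E_def set_integral_Icc_combine[OF si(2) st(1,2), symmetric] I by (simp add: algebra_simps)
      also have "cmod \<dots> \<le> B * (m t - m s)\<^sup>2 + (LINT u:{s..t}|lebesgue. B * (m t - m s) * h u)"
      proof (rule order_trans[OF norm_triangle_ineq4], rule add_mono[OF exp2[OF st]])
        show "cmod (LINT u:{s..t}|lebesgue. r u) \<le> (LINT u:{s..t}|lebesgue. B * (m t - m s) * h u)"
        proof (rule set_integral_norm_le[OF sir])
          show "set_integrable lebesgue {s..t} (\<lambda>u. B * (m t - m s) * h u)" using sih by simp
          fix u assume u: "u \<in> {s..t}"
          have "B * (m u - m s) \<le> B * (m t - m s)"
            using m0[of u t] u st B00 by (intro mult_left_mono) (auto simp: B_def)
          then have "cmod (exp (F u) - exp (F s)) \<le> B * (m t - m s)"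
            using exp1[of s u] u st by force
          then show "cmod (r u) \<le> B * (m t - m s) * h u"
            unfolding r_def h_def norm_mult by (metis mult.commute mult_right_mono norm_ge_zero)
        qed
      qed
      also have "\<dots> = 2 * B * (m t - m s)\<^sup>2"
        using mdiff[OF st(1,2)] by (simp add: power2_eq_square)
      finally show "cmod (E t - E s) \<le> 2 * B * (m t - m s)\<^sup>2" .
    qed
    then show ?thesis by (simp add: E_def set_integral_singleton[of a, simplified] diff_eq_eq add.commute)
  qed
  with li(2) show ?thesis by (simp add: antiderivative_def)
qed

text \<open>Dominated convergence with majorant \<open>|v|\<close>; the limit at minus infinity is
  taken along the reflected parameter.\<close>

lemma antiderivative_tendsto:
  assumes g: "antiderivative g v" and v: "integrable lebesgue v"
  shows "(g \<longlongrightarrow> g 0 + (LINT s:{0..}|lebesgue. v s)) at_top"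
    and "(g \<longlongrightarrow> g 0 - (LINT s:{..0}|lebesgue. v s)) at_bot"
proof -
  have vm[measurable]: "v \<in> borel_measurable lebesgue" using v by simp
  have "((\<lambda>t. LINT s|lebesgue. indicator {0..t} s *\<^sub>R v s) \<longlongrightarrow> (LINT s|lebesgue. indicator {0..} s *\<^sub>R v s)) at_top"
  proof (rule integral_dominated_convergence_at_top[where w = "\<lambda>s. norm (v s)"])
    show "AE s in lebesgue. ((\<lambda>t. indicator {0..t} s *\<^sub>R v s) \<longlongrightarrow> indicator {0..} s *\<^sub>R v s) at_top"
    proof (rule AE_I2, rule tendsto_eventually, rule eventually_mono[OF eventually_ge_at_top])
      show "indicator {0..t} s *\<^sub>R v s = indicator {0..} s *\<^sub>R v s" if "s \<le> t" for s t :: real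
        using that by (auto simp: indicator_def)
    qed
  qed (use v in \<open>auto intro!: borel_measurable_scaleR borel_measurable_indicator split: split_indicator\<close>)
  then have "((\<lambda>t. g 0 + (LINT s:{0..t}|lebesgue. v s)) \<longlongrightarrow> g 0 + (LINT s:{0..}|lebesgue. v s)) at_top"
    unfolding set_lebesgue_integral_def by (intro tendsto_intros)
  moreover have "\<forall>\<^sub>F t in at_top. g 0 + (LINT s:{0..t}|lebesgue. v s) = g t"
    using eventually_ge_at_top[of 0]
    by eventually_elim (simp add: antiderivative_eq[OF g, symmetric])
  ultimately show "(g \<longlongrightarrow> g 0 + (LINT s:{0..}|lebesgue. v s)) at_top"
    by (rule Lim_transform_eventually)
  have "((\<lambda>t. LINT s|lebesgue. indicator {-t..0} s *\<^sub>R v s) \<longlongrightarrow> (LINT s|lebesgue. indicator {..0} s *\<^sub>R v s)) at_top"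
  proof (rule integral_dominated_convergence_at_top[where w = "\<lambda>s. norm (v s)"])
    show "AE s in lebesgue. ((\<lambda>t. indicator {-t..0} s *\<^sub>R v s) \<longlongrightarrow> indicator {..0} s *\<^sub>R v s) at_top"
    proof (rule AE_I2, rule tendsto_eventually, rule eventually_mono[OF eventually_ge_at_top])
      show "indicator {-t..0} s *\<^sub>R v s = indicator {..0} s *\<^sub>R v s" if "- s \<le> t" for s t :: real
        using that by (auto simp: indicator_def)
    qed
  qed (use v in \<open>auto intro!: borel_measurable_scaleR borel_measurable_indicator split: split_indicator\<close>)
  then have "((\<lambda>t. g 0 - (LINT s:{-t..0}|lebesgue. v s)) \<longlongrightarrow> g 0 - (LINT s:{..0}|lebesgue. v s)) at_top"
    unfolding set_lebesgue_integral_def by (intro tendsto_intros)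
  moreover have "\<forall>\<^sub>F t in at_top. g 0 - (LINT s:{-t..0}|lebesgue. v s) = g (- t)"
    using eventually_ge_at_top[of 0]
    by eventually_elim (simp add: antiderivative_eq[OF g, symmetric])
  ultimately have "((\<lambda>t. g (- t)) \<longlongrightarrow> g 0 - (LINT s:{..0}|lebesgue. v s)) at_top"
    by (rule Lim_transform_eventually)
  then show "(g \<longlongrightarrow> g 0 - (LINT s:{..0}|lebesgue. v s)) at_bot"
    by (simp add: filterlim_at_bot_mirror)
qed

lemma antiderivative_increment_bound:
  assumes g: "antiderivative g v" and v: "integrable lebesgue v"
  shows "cmod (g t - g s) \<le> (LINT u|lebesgue. cmod (v u))"
proof -
  have *: "cmod (g t - g s) \<le> (LINT u|lebesgue. cmod (v u))" if "s \<le> t" for s t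
  proof -
    have "cmod (LINT u:{s..t}|lebesgue. v u) \<le> (LINT u:{s..t}|lebesgue. cmod (v u))"
      by (rule set_integral_norm_bound[OF locally_integrable_Icc[OF antiderivative_locally_integrable[OF g]]])
    also have "\<dots> \<le> (LINT u|lebesgue. cmod (v u))"
      unfolding set_lebesgue_integral_def using v
      by (intro Bochner_Integration.integral_mono integrable_mult_indicator) (auto simp: indicator_def)
    finally show ?thesis by (simp add: antiderivative_eq[OF g that])
  qed
  show ?thesis using *[of s t] *[of t s] by (cases "s \<le> t") (auto simp: norm_minus_commute)
qed

section \<open>Test functions and weak derivatives\<close>

lemma C_k_Suc: "C_k (Suc k) f \<Longrightarrow> C_k k f"
proof (induction k arbitrary: f)
  case 0
  then show ?case
    by (auto intro!: continuous_at_imp_continuous_on differentiable_imp_continuous_within)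
next
  case (Suc k)
  then show ?case by (metis C_k.simps(2))
qed

lemma frechet_derivative_eqI:
  "(f has_derivative f') (at x) \<Longrightarrow> frechet_derivative f (at x) = f'"
  using frechet_derivative_at by metis

lemma frechet_works: "f differentiable (at x) \<Longrightarrow> (f has_derivative frechet_derivative f (at x)) (at x)"
  by (simp add: frechet_derivative_works)

lemma C_k_const: "C_k k (\<lambda>x. c)"
proof (induction k arbitrary: c)
  case (Suc k)
  have "frechet_derivative (\<lambda>x::'a. c) (at x) = (\<lambda>_. 0)" for x
    by (intro frechet_derivative_eqI derivative_intros)
  then show ?case using Suc by simp
qed simp

lemma C_k_add: "C_k k f \<Longrightarrow> C_k k g \<Longrightarrow> C_k k (\<lambda>x. f x + g x)"
proof (induction k arbitrary: f g)
  case 0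
  then show ?case by (auto intro: continuous_intros)
next
  case (Suc k)
  have d: "frechet_derivative (\<lambda>x. f x + g x) (at x) b
      = frechet_derivative f (at x) b + frechet_derivative g (at x) b" for x b
    using Suc.prems
    by (subst frechet_derivative_eqI[OF has_derivative_add[OF frechet_works frechet_works]]) auto
  show ?case using Suc by (simp add: d differentiable_add)
qed

lemma C_k_mult: "C_k k f \<Longrightarrow> C_k k g \<Longrightarrow> C_k k (\<lambda>x. f x * g x)"
proof (induction k arbitrary: f g)
  case 0
  then show ?case by (auto intro: continuous_intros)
next
  case (Suc k)
  have d: "frechet_derivative (\<lambda>x. f x * g x) (at x) b
      = f x * frechet_derivative g (at x) b + frechet_derivative f (at x) b * g x" for x b
    using Suc.prems
    by (subst frechet_derivative_eqI[OF has_derivative_mult[OF frechet_works frechet_works]]) auto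
  show ?case
    using Suc.prems C_k_Suc[OF Suc.prems(1)] C_k_Suc[OF Suc.prems(2)]
    by (simp add: d C_k_add Suc.IH differentiable_mult)
qed

lemma C_k_sum: "finite A \<Longrightarrow> (\<And>i. i \<in> A \<Longrightarrow> C_k k (f i)) \<Longrightarrow> C_k k (\<lambda>x. \<Sum>i\<in>A. f i x)"
  by (induction A rule: finite_induct) (auto intro: C_k_add C_k_const)

lemma C_k_prod: "finite A \<Longrightarrow> (\<And>i. i \<in> A \<Longrightarrow> C_k k (f i)) \<Longrightarrow> C_k k (\<lambda>x. \<Prod>i\<in>A. f i x)"
  by (induction A rule: finite_induct) (auto intro: C_k_mult C_k_const)

lemma frechet_derivative_compose_affine:
  fixes f :: "'b::euclidean_space \<Rightarrow> real" and L :: "'a::euclidean_space \<Rightarrow> 'b"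
  assumes L: "bounded_linear L" and f: "f differentiable (at (L x + c))"
  shows "((\<lambda>x. f (L x + c)) has_derivative (\<lambda>b. frechet_derivative f (at (L x + c)) (L b))) (at x)"
proof -
  have "((\<lambda>x. L x + c) has_derivative L) (at x)"
    using bounded_linear_imp_has_derivative[OF L] by (auto intro!: derivative_eq_intros)
  from has_derivative_compose[OF this frechet_works[OF f]] show ?thesis by simp
qed

lemma C_k_compose_affine:
  fixes f :: "'b::euclidean_space \<Rightarrow> real" and L :: "'a::euclidean_space \<Rightarrow> 'b"
  assumes L: "bounded_linear L"
  shows "C_k k f \<Longrightarrow> C_k k (\<lambda>x. f (L x + c))"
proof (induction k arbitrary: f)
  case 0
  have "continuous_on UNIV (\<lambda>x. L x + c)"
    by (intro continuous_intros linear_continuous_on L)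
  then show ?case using 0 continuous_on_compose2[of UNIV f UNIV "\<lambda>x. L x + c"] by simp
next
  case (Suc k)
  have fd: "f differentiable (at y)" for y using Suc.prems by simp
  \<comment> \<open>\<open>L b\<close> need not be a basis vector, while \<open>C_k\<close> speaks
    of basis directions only. Linearity expands the derivative into partial derivatives, to which
    the induction hypothesis applies.\<close>
  have "frechet_derivative (\<lambda>x. f (L x + c)) (at x) b
      = (\<Sum>j\<in>Basis. (L b \<bullet> j) * frechet_derivative f (at (L x + c)) j)" for x b
  proof -
    have lin: "linear (frechet_derivative f (at (L x + c)))"
      by (rule linear_frechet_derivative[OF fd])
    have "frechet_derivative (\<lambda>x. f (L x + c)) (at x) b = frechet_derivative f (at (L x + c)) (L b)"
      using frechet_derivative_eqI[OF frechet_derivative_compose_affine[OF L fd]] by simp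
    also have "\<dots> = frechet_derivative f (at (L x + c)) (\<Sum>j\<in>Basis. (L b \<bullet> j) *\<^sub>R j)"
      by (simp add: euclidean_representation)
    finally show ?thesis
      using lin by (simp add: linear_sum linear_cmul)
  qed
  moreover have "(\<lambda>x. f (L x + c)) differentiable (at x)" for x
    using frechet_derivative_compose_affine[OF L fd] differentiableI by blast
  moreover have "C_k k (\<lambda>x. \<Sum>j\<in>Basis. (L b \<bullet> j) * frechet_derivative f (at (L x + c)) j)" for b
    using Suc.prems by (intro C_k_sum C_k_mult C_k_const Suc.IH) auto
  ultimately show ?case by simp
qed

lemma test_function_C_k: "test_function \<phi> \<Longrightarrow> C_k k \<phi>"
  by (simp add: test_function_def)

lemma test_function_differentiable: "test_function \<phi> \<Longrightarrow> \<phi> differentiable (at x)"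
  using test_function_C_k[of \<phi> "Suc 0"] by simp

lemma test_function_continuous: "test_function \<phi> \<Longrightarrow> continuous_on UNIV \<phi>"
  using test_function_C_k[of \<phi> 0] by simp

lemma test_function_derivative_C_k:
  "test_function \<phi> \<Longrightarrow> b \<in> Basis \<Longrightarrow> C_k k (\<lambda>x. frechet_derivative \<phi> (at x) b)"
  using test_function_C_k[of \<phi> "Suc k"] by simp

lemma test_function_derivative:
  assumes "test_function \<phi>" "b \<in> Basis"
  shows "test_function (\<lambda>x. frechet_derivative \<phi> (at x) b)"
proof -
  obtain K where K: "compact K" "\<And>x. x \<notin> K \<Longrightarrow> \<phi> x = 0"
    using assms(1) unfolding test_function_def by blast
  have "frechet_derivative \<phi> (at x) b = 0" if "x \<notin> K" for x
  proof -
    have "(\<phi> has_derivative (\<lambda>_. 0)) (at x)"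
    proof (rule has_derivative_transform_within_open)
      show "open (- K)" using K(1) by (simp add: compact_imp_closed open_Compl)
      show "x \<in> - K" using that by simp
      show "((\<lambda>_. 0) has_derivative (\<lambda>_. 0)) (at x)" by (rule has_derivative_const)
    qed (use K(2) in auto)
    then show ?thesis by (simp add: frechet_derivative_eqI)
  qed
  then show ?thesis
    unfolding test_function_def using K(1) test_function_derivative_C_k[OF assms] by blast
qed

lemma test_function_diff:
  assumes "test_function \<phi>" "test_function \<eta>"
  shows "test_function (\<lambda>x. \<phi> x - c * \<eta> x)"
proof -
  obtain K L where "compact K" "\<And>x. x \<notin> K \<Longrightarrow> \<phi> x = 0" "compact L" "\<And>x. x \<notin> L \<Longrightarrow> \<eta> x = 0"
    using assms unfolding test_function_def by metis
  then have "compact (K \<union> L) \<and> (\<forall>x. x \<notin> K \<union> L \<longrightarrow> \<phi> x - c * \<eta> x = 0)" by auto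
  moreover have "C_k k (\<lambda>x. \<phi> x - c * \<eta> x)" for k
    using C_k_add[OF test_function_C_k[OF assms(1)] C_k_mult[OF C_k_const[of k "-c"] test_function_C_k[OF assms(2)]]]
    by simp
  ultimately show ?thesis unfolding test_function_def by blast
qed

lemma test_function_integrable_mult:
  fixes v :: "'a::euclidean_space \<Rightarrow> complex"
  assumes "test_function \<phi>" "locally_integrable v"
  shows "integrable lebesgue (\<lambda>x. \<phi> x *\<^sub>R v x)"
proof -
  obtain K where K: "compact K" "\<And>x. x \<notin> K \<Longrightarrow> \<phi> x = 0"
    using assms(1) unfolding test_function_def by blast
  have "continuous_on UNIV (\<lambda>x. complex_of_real (\<phi> x))"
    by (intro continuous_intros test_function_continuous assms)
  then have "set_integrable lebesgue K (\<lambda>x. complex_of_real (\<phi> x) * v x)"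
    using locally_integrable_mult_continuous[OF _ assms(2)] K(1) by (simp add: locally_integrable_def)
  moreover have "indicator K x *\<^sub>R (complex_of_real (\<phi> x) * v x) = \<phi> x *\<^sub>R v x" for x
    using K(2)[of x] by (auto simp: indicator_def scaleR_conv_of_real)
  ultimately show ?thesis by (simp add: set_integrable_def)
qed

lemma test_function_integrable:
  assumes "test_function \<phi>"
  shows "integrable lebesgue \<phi>"
proof -
  have "integrable lebesgue (\<lambda>x. \<phi> x *\<^sub>R (1::complex))"
    by (intro test_function_integrable_mult assms locally_integrable_continuous) simp
  then have "integrable lebesgue (\<lambda>x. Re (\<phi> x *\<^sub>R 1))" by (rule integrable_Re)
  then show ?thesis by simp
qed

lemma test_function_slice:
  fixes \<phi> :: "real \<times> 'b::euclidean_space \<Rightarrow> real"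
  assumes "test_function \<phi>"
  shows "test_function (\<lambda>s. \<phi> (s, y))"
    and "frechet_derivative (\<lambda>s. \<phi> (s, y)) (at s) 1 = frechet_derivative \<phi> (at (s, y)) (1, 0)"
proof -
  have L: "bounded_linear (\<lambda>s::real. (s, 0::'b))"
    by (intro bounded_linear_Pair bounded_linear_ident bounded_linear_zero)
  obtain K where K: "compact K" "\<And>x. x \<notin> K \<Longrightarrow> \<phi> x = 0"
    using assms unfolding test_function_def by blast
  have "compact (fst ` K)" by (intro compact_continuous_image K continuous_intros)
  moreover have "\<phi> (s, y) = 0" if "s \<notin> fst ` K" for s
    using K(2)[of "(s, y)"] that by force
  moreover have "C_k k (\<lambda>s. \<phi> (s, y))" for k
    using C_k_compose_affine[OF L test_function_C_k[OF assms], of k "(0, y)"] by simp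
  ultimately show "test_function (\<lambda>s. \<phi> (s, y))"
    unfolding test_function_def by blast
  show "frechet_derivative (\<lambda>s. \<phi> (s, y)) (at s) 1 = frechet_derivative \<phi> (at (s, y)) (1, 0)"
    using frechet_derivative_eqI[OF frechet_derivative_compose_affine
        [where x = s and c = "(0, y)", OF L test_function_differentiable[OF assms]]]
    by simp
qed

lemma test_function_product:
  fixes \<phi> :: "real \<Rightarrow> real" and \<eta> :: "'b::euclidean_space \<Rightarrow> real"
  assumes "test_function \<phi>" "test_function \<eta>"
  shows "test_function (\<lambda>z. \<phi> (fst z) * \<eta> (snd z))"
    and "frechet_derivative (\<lambda>z. \<phi> (fst z) * \<eta> (snd z)) (at z) (1, 0)
      = frechet_derivative \<phi> (at (fst z)) 1 * \<eta> (snd z)"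
proof -
  obtain K L where K: "compact K" "\<And>x. x \<notin> K \<Longrightarrow> \<phi> x = 0" "compact L" "\<And>x. x \<notin> L \<Longrightarrow> \<eta> x = 0"
    using assms unfolding test_function_def by metis
  have "compact (K \<times> L)" by (intro compact_Times K)
  moreover have "\<phi> (fst z) * \<eta> (snd z) = 0" if "z \<notin> K \<times> L" for z
    using K(2)[of "fst z"] K(4)[of "snd z"] that by (cases z) auto
  moreover have "C_k k (\<lambda>z. \<phi> (fst z) * \<eta> (snd z))" for k
    using C_k_mult[OF C_k_compose_affine[OF bounded_linear_fst test_function_C_k[OF assms(1)], of k 0]
        C_k_compose_affine[OF bounded_linear_snd test_function_C_k[OF assms(2)], of k 0]] by simp
  ultimately show "test_function (\<lambda>z. \<phi> (fst z) * \<eta> (snd z))"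
    unfolding test_function_def by blast
  have lin: "linear (frechet_derivative \<eta> (at (snd z)))"
    by (rule linear_frechet_derivative[OF test_function_differentiable[OF assms(2)]])
  show "frechet_derivative (\<lambda>z. \<phi> (fst z) * \<eta> (snd z)) (at z) (1, 0)
      = frechet_derivative \<phi> (at (fst z)) 1 * \<eta> (snd z)"
    using frechet_derivative_eqI[OF has_derivative_mult[OF
        frechet_derivative_compose_affine[where x = z and c = 0,
          OF bounded_linear_fst test_function_differentiable[OF assms(1)]]
        frechet_derivative_compose_affine[where x = z and c = 0,
          OF bounded_linear_snd test_function_differentiable[OF assms(2)]]]]
    using linear_0[OF lin] by simp
qed

section \<open>Smooth bumps and the fundamental lemma of the calculus of variations\<close>

definition inverse_power_exp :: "nat \<Rightarrow> real \<Rightarrow> real" where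
  "inverse_power_exp k x = (if x > 0 then exp (- (1 / x)) / x ^ k else 0)"

text \<open>The powers of \<open>1/x\<close> are carried along so that the family is closed under
  differentiation up to linear combinations; smoothness of \<open>exp (-1/x)\<close>, extended by 0,
  is then one induction. The two formulas meet only at 0, where exponential decay beats every
  power.\<close>

lemma inverse_power_exp_deriv:
  "(inverse_power_exp k has_real_derivative
     (inverse_power_exp (k + 2) x - real k * inverse_power_exp (k + 1) x)) (at x)"
proof -
  consider "x > 0" | "x < 0" | "x = 0" by linarith
  then show ?thesis
  proof cases
    case 1
    have "((\<lambda>x. exp (- (1 / x)) / x ^ k) has_real_derivative
        (exp (- (1 / x)) / x ^ (k + 2) - real k * (exp (- (1 / x)) / x ^ (k + 1)))) (at x)"
    proof (cases k)
      case 0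
      then show ?thesis using 1
        by (auto intro!: derivative_eq_intros simp: power2_eq_square divide_simps)
    next
      case (Suc j)
      then show ?thesis using 1
        by (auto intro!: derivative_eq_intros simp: divide_simps) (cases j; simp add: algebra_simps)
    qed
    then have "(inverse_power_exp k has_real_derivative
        (exp (- (1 / x)) / x ^ (k + 2) - real k * (exp (- (1 / x)) / x ^ (k + 1)))) (at x)"
      by (rule has_field_derivative_transform_within_open[of _ _ _ "{0<..}"])
        (use 1 in \<open>auto simp: inverse_power_exp_def\<close>)
    then show ?thesis using 1 by (simp add: inverse_power_exp_def)
  next
    case 2
    have "((\<lambda>x. 0) has_real_derivative 0) (at x)" by simp
    then have "(inverse_power_exp k has_real_derivative 0) (at x)"
      by (rule has_field_derivative_transform_within_open[of _ _ _ "{..<0}"])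
        (use 2 in \<open>auto simp: inverse_power_exp_def\<close>)
    then show ?thesis using 2 by (simp add: inverse_power_exp_def)
  next
    case 3
    \<comment> \<open>With \<open>y = 1/h\<close> the right difference quotient at 0 becomes
      \<open>y ^ (k + 1) / exp y\<close>.\<close>
    have "((\<lambda>y::real. y ^ (k + 1) / exp y) \<longlongrightarrow> 0) at_top"
      by (rule tendsto_power_div_exp_0)
    then have "((\<lambda>h::real. (1 / h) ^ (k + 1) / exp (1 / h)) \<longlongrightarrow> 0) (at_right 0)"
      by (rule filterlim_compose) (simp add: filterlim_inverse_at_top_right flip: inverse_eq_divide)
    moreover have "\<forall>\<^sub>F h in at_right 0. (1 / h) ^ (k + 1) / exp (1 / h) = inverse_power_exp k h / h"
      using eventually_at_right_less[of 0]
      by eventually_elim (simp add: inverse_power_exp_def exp_minus field_simps)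
    ultimately have "((\<lambda>h. inverse_power_exp k h / h) \<longlongrightarrow> 0) (at_right 0)"
      by (rule Lim_transform_eventually)
    moreover have "((\<lambda>h. inverse_power_exp k h / h) \<longlongrightarrow> 0) (at_left 0)"
    proof (rule tendsto_eventually)
      show "\<forall>\<^sub>F h in at_left 0. inverse_power_exp k h / h = 0"
        by (auto simp: eventually_at_left_field inverse_power_exp_def intro!: exI[of _ "-1"])
    qed
    ultimately have "((\<lambda>h. inverse_power_exp k h / h) \<longlongrightarrow> 0) (at 0)"
      by (simp add: filterlim_split_at)
    then show ?thesis using 3
      by (simp add: DERIV_def inverse_power_exp_def)
  qed
qed

lemma C_k_inverse_power_exp: "C_k n (inverse_power_exp k)"
proof (induction n arbitrary: k)
  case 0
  then show ?case
    by (auto intro!: continuous_at_imp_continuous_on DERIV_isCont inverse_power_exp_deriv)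
next
  case (Suc n)
  have d: "frechet_derivative (inverse_power_exp k) (at x) b
      = (inverse_power_exp (k + 2) x - real k * inverse_power_exp (k + 1) x) * b" for x b
    using frechet_derivative_eqI[OF inverse_power_exp_deriv[of k x, unfolded has_field_derivative_def]]
    by simp
  have "C_k n (\<lambda>x. (inverse_power_exp (k + 2) x + (- real k) * inverse_power_exp (k + 1) x) * 1)"
    by (intro C_k_mult C_k_add C_k_const Suc.IH)
  moreover have "inverse_power_exp k differentiable (at x)" for x
    using inverse_power_exp_deriv real_differentiable_def by blast
  ultimately show ?case by (simp add: d)
qed

text \<open>\<open>n\<close> is a steepness and not a scale: the support stays in the fixed box
  while every factor tends to 1 in the interior, so the bumps converge to the indicator of the open
  box.\<close>

definition bump :: "'a::euclidean_space \<Rightarrow> 'a \<Rightarrow> nat \<Rightarrow> 'a \<Rightarrow> real" where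
  "bump a b n x = (\<Prod>i\<in>Basis. inverse_power_exp 0 (real n * (x \<bullet> i - a \<bullet> i)) *
     inverse_power_exp 0 (real n * (b \<bullet> i - x \<bullet> i)))"

lemma inverse_power_exp_0_range: "0 \<le> inverse_power_exp 0 x" "inverse_power_exp 0 x \<le> 1"
  by (auto simp: inverse_power_exp_def)

lemma bump_range: "0 \<le> bump a b n x" "bump a b n x \<le> 1"
  unfolding bump_def
  by (auto intro!: prod_nonneg prod_le_1 mult_nonneg_nonneg mult_le_one simp: inverse_power_exp_0_range)

lemma bump_outside: "x \<notin> box a b \<Longrightarrow> bump a b n x = 0"
proof -
  assume "x \<notin> box a b"
  then obtain i where i: "i \<in> Basis" "x \<bullet> i \<le> a \<bullet> i \<or> b \<bullet> i \<le> x \<bullet> i"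
    by (auto simp: mem_box not_less)
  then have "real n * (x \<bullet> i - a \<bullet> i) \<le> 0 \<or> real n * (b \<bullet> i - x \<bullet> i) \<le> 0"
    by (auto simp: mult_le_0_iff)
  then show ?thesis
    unfolding bump_def using i(1)
    by (intro prod_zero bexI[of _ i]) (auto simp: inverse_power_exp_def)
qed

lemma test_function_bump: "test_function (bump a b n)"
proof -
  have "C_k k (bump a b n)" for k
  proof -
    have 1: "C_k k (\<lambda>x::'a. inverse_power_exp 0 ((real n * (x \<bullet> i)) + c))" for i c
      by (intro C_k_compose_affine C_k_inverse_power_exp bounded_linear_const_mult bounded_linear_inner_left)
    have "C_k k (\<lambda>x::'a. inverse_power_exp 0 (real n * (x \<bullet> i - a \<bullet> i)) *
        inverse_power_exp 0 (real n * (b \<bullet> i - x \<bullet> i)))" for i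
      using C_k_mult[OF 1[of i "- real n * (a \<bullet> i)"] 1[of "- i" "real n * (b \<bullet> i)"]]
      by (simp add: algebra_simps)
    then show ?thesis
      unfolding bump_def[abs_def] by (intro C_k_prod) auto
  qed
  moreover have "bump a b n x = 0" if "x \<notin> cbox a b" for x
    using bump_outside that box_subset_cbox by blast
  ultimately show ?thesis
    unfolding test_function_def using compact_cbox by blast
qed

lemma bump_tendsto: "(\<lambda>n. bump a b n x) \<longlonglongrightarrow> indicator (box a b) x"
proof (cases "x \<in> box a b")
  case True
  have lim: "(\<lambda>n. inverse_power_exp 0 (real n * c)) \<longlonglongrightarrow> 1" if "c > 0" for c
  proof -
    have "(\<lambda>n. exp (- (1 / (real n * c)))) \<longlonglongrightarrow> exp (- 0)"
      using that by (intro tendsto_intros) real_asymp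
    moreover have "\<forall>\<^sub>F n in sequentially. exp (- (1 / (real n * c))) = inverse_power_exp 0 (real n * c)"
      using eventually_gt_at_top[of 0] by eventually_elim (use that in \<open>simp add: inverse_power_exp_def\<close>)
    ultimately show ?thesis by (simp add: Lim_transform_eventually)
  qed
  have "(\<lambda>n. bump a b n x) \<longlonglongrightarrow> (\<Prod>i\<in>(Basis::'a set). 1 * 1)"
    unfolding bump_def using True by (intro tendsto_intros lim) (auto simp: mem_box)
  then show ?thesis using True by simp
qed (simp add: bump_outside)

lemma box_integral_eq_0:
  fixes u :: "'a::euclidean_space \<Rightarrow> complex"
  assumes u: "locally_integrable u" and z: "\<And>n. (LINT x|lebesgue. bump a b n x *\<^sub>R u x) = 0"
  shows "(LINT x:box a b|lebesgue. u x) = 0"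
proof -
  have "(\<lambda>n. LINT x|lebesgue. bump a b n x *\<^sub>R u x) \<longlonglongrightarrow> (LINT x|lebesgue. indicator (box a b) x *\<^sub>R u x)"
  proof (rule integral_dominated_convergence[where w = "\<lambda>x. indicator (cbox a b) x * cmod (u x)"])
    have "set_integrable lebesgue (cbox a b) u"
      using u by (simp add: locally_integrable_def)
    then show "integrable lebesgue (\<lambda>x. indicator (cbox a b) x * cmod (u x))"
      using set_integrable_norm by (force simp: set_integrable_def)
    show "AE x in lebesgue. (\<lambda>n. bump a b n x *\<^sub>R u x) \<longlonglongrightarrow> indicator (box a b) x *\<^sub>R u x"
      by (intro AE_I2 tendsto_intros bump_tendsto)
    show "AE x in lebesgue. norm (bump a b n x *\<^sub>R u x) \<le> indicator (cbox a b) x * cmod (u x)" for n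
    proof (rule AE_I2)
      fix x show "norm (bump a b n x *\<^sub>R u x) \<le> indicator (cbox a b) x * cmod (u x)"
      proof (cases "x \<in> box a b")
        case True
        then have "x \<in> cbox a b" using box_subset_cbox by blast
        then show ?thesis using bump_range[of a b n x] by (simp add: mult_left_le_one_le)
      qed (simp add: bump_outside)
    qed
    show "(\<lambda>x. indicator (box a b) x *\<^sub>R u x) \<in> borel_measurable lebesgue"
      by (intro borel_measurable_scaleR borel_measurable_indicator locally_integrable_measurable u) auto
    show "(\<lambda>x. bump a b n x *\<^sub>R u x) \<in> borel_measurable lebesgue" for n
      using test_function_integrable_mult[OF test_function_bump u] by (rule borel_measurable_integrable)
  qed
  then show ?thesis by (simp add: z set_lebesgue_integral_def LIMSEQ_const_iff)
qed

lemma complex_borel_representative: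
  fixes f :: "'a::euclidean_space \<Rightarrow> complex"
  assumes "f \<in> borel_measurable lebesgue"
  obtains f' where "f' \<in> borel_measurable borel" "AE x in lebesgue. f x = f' x"
proof -
  have "(\<lambda>x. Re (f x)) \<in> borel_measurable (completion lborel)" "(\<lambda>x. Im (f x)) \<in> borel_measurable (completion lborel)"
    using assms by measurable
  then obtain r i where ri: "r \<in> borel_measurable lborel" "AE x in lborel. Re (f x) = r x"
    "i \<in> borel_measurable lborel" "AE x in lborel. Im (f x) = i x"
    using completion_ex_borel_measurable_real by metis
  show ?thesis
  proof (rule that[of "\<lambda>x. Complex (r x) (i x)"])
    have "(\<lambda>x. complex_of_real (r x) + \<i> * complex_of_real (i x)) \<in> borel_measurable borel"
      using ri(1,3) by measurable
    then show "(\<lambda>x. Complex (r x) (i x)) \<in> borel_measurable borel" by (simp add: Complex_eq)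
    have "AE x in lborel. f x = Complex (r x) (i x)"
      using ri(2,4) by eventually_elim (simp add: complex_eq_iff)
    then show "AE x in lebesgue. f x = Complex (r x) (i x)" by (rule AE_completion)
  qed
qed

text \<open>For a fixed box, the Borel sets \<open>A\<close> over which the restricted function has
  integral 0 form a Dynkin system containing all boxes, a generator stable under intersections.
  Boundedness of the fixed box provides integrability; a Borel representative is used because boxes
  generate the Borel sets and not their completion.\<close>

lemma box_integrals_0_imp_AE_0:
  fixes u :: "'a::euclidean_space \<Rightarrow> complex"
  assumes u: "locally_integrable u" and z: "\<And>a b. (LINT x:box a b|lebesgue. u x) = 0"
  shows "AE x in lebesgue. u x = 0"
proof -
  obtain v where v: "v \<in> borel_measurable borel" "AE x in lebesgue. u x = v x"
    using complex_borel_representative[OF locally_integrable_measurable[OF u]] .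
  have [measurable]: "v \<in> borel_measurable lborel" using v(1) by simp
  have lv: "locally_integrable v"
    using v(1) by (intro locally_integrable_cong_AE[OF u _ v(2)] measurable_completion) simp
  have int: "integrable lborel (\<lambda>x. indicator A x *\<^sub>R (indicator (box a b) x *\<^sub>R v x))"
    if "A \<in> sets borel" for A a b
  proof -
    have "set_integrable lebesgue (cbox a b) v" using lv by (simp add: locally_integrable_def)
    then have "set_integrable lebesgue (box a b) v"
      by (rule set_integrable_subset) (auto simp: box_subset_cbox)
    then have "integrable lborel (\<lambda>x. indicator (box a b) x *\<^sub>R v x)"
      unfolding set_integrable_def by (subst (asm) integrable_completion) measurable
    with that show ?thesis by (intro integrable_mult_indicator[of A]) simp_all
  qed
  have zv: "(LINT x|lborel. indicator (box a b) x *\<^sub>R v x) = 0" for a b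
  proof -
    have "(LINT x:box a b|lebesgue. v x) = (LINT x:box a b|lebesgue. u x)"
      using v(2) by (intro set_lebesgue_integral_cong_AE locally_integrable_measurable u lv) auto
    then have "(LINT x:box a b|lebesgue. v x) = 0" by (simp only: z)
    then show ?thesis
      unfolding set_lebesgue_integral_def by (subst (asm) integral_completion) auto
  qed
  have int_box: "integrable lborel (\<lambda>x. indicator (box a b) x *\<^sub>R v x)" for a b
    using int[of UNIV a b] by simp
  have ex_box: "\<exists>e f. box a b \<inter> box c d = box e f" for a b c d :: 'a
    unfolding box_Int_box by blast
  have "AE x in lborel. indicator (box a b) x *\<^sub>R v x = 0" for a b
  proof (rule sigma_finite_measure.density_unique_banach[OF sigma_finite_lborel])
    show "integrable lborel (\<lambda>x. indicator (box a b) x *\<^sub>R v x)" by (rule int_box)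
    show "integrable lborel (\<lambda>x::'a. 0::complex)" by simp
    fix A :: "'a set" assume "A \<in> sets lborel"
    then have A: "A \<in> sigma_sets UNIV (range (\<lambda>(c, d). box c d))"
      by (simp add: borel_eq_box)
    have "Int_stable (range (\<lambda>(c::'a, d). box c d))"
      unfolding Int_stable_def
    proof (intro ballI)
      fix A B :: "'a set" assume "A \<in> range (\<lambda>(c, d). box c d)" "B \<in> range (\<lambda>(c, d). box c d)"
      then obtain c d c' d' where "A = box c d" "B = box c' d'" by auto
      then obtain e f where "A \<inter> B = box e f" using ex_box by blast
      then show "A \<inter> B \<in> range (\<lambda>(c, d). box c d)" by (auto intro: range_eqI[of _ _ "(e, f)"])
    qed
    moreover have "range (\<lambda>(c::'a, d). box c d) \<subseteq> Pow UNIV" by simp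
    moreover note A
    ultimately have "(LINT x|lborel. indicator A x *\<^sub>R (indicator (box a b) x *\<^sub>R v x)) = 0"
    proof (induction rule: sigma_sets_induct_disjoint)
      case (basic A)
      then obtain c d where "A = box c d" by auto
      then obtain e f where "A \<inter> box a b = box e f" using ex_box by blast
      then have "indicator A x *\<^sub>R (indicator (box a b) x *\<^sub>R v x) = indicator (box e f) x *\<^sub>R v x" for x
        by (metis indicator_inter_arith scaleR_scaleR)
      then show ?case by (simp only: zv)
    next
      case empty
      then show ?case by simp
    next
      case (compl A)
      then have A: "A \<in> sets borel" by (simp add: borel_eq_box)
      have "(LINT x|lborel. indicator (UNIV - A) x *\<^sub>R (indicator (box a b) x *\<^sub>R v x))
          = (LINT x|lborel. indicator (box a b) x *\<^sub>R v x - indicator A x *\<^sub>R (indicator (box a b) x *\<^sub>R v x))"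
        by (intro Bochner_Integration.integral_cong) (auto simp: indicator_def)
      also have "\<dots> = 0"
        unfolding Bochner_Integration.integral_diff[OF int_box int[OF A]] zv
        using compl(2) by simp
      finally show ?case .
    next
      case (union A)
      have A: "A i \<in> sets borel" for i using union by (auto simp: borel_eq_box)
      have "(LINT x:(\<Union>i. A i)|lborel. indicator (box a b) x *\<^sub>R v x)
          = (\<Sum>i. LINT x:A i|lborel. indicator (box a b) x *\<^sub>R v x)"
        using union A int[of "\<Union>i. A i" a b]
        by (intro lebesgue_integral_countable_add) (auto simp: disjoint_family_on_def set_integrable_def)
      then show ?case using union by (simp add: set_lebesgue_integral_def)
    qed
    then show "(LINT x:A|lborel. indicator (box a b) x *\<^sub>R v x) = (LINT x:A|lborel. 0)"
      by (simp add: set_lebesgue_integral_def)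
  qed
  then have "AE x in lborel. \<forall>n::nat. indicator (box (- real n *\<^sub>R One) (real n *\<^sub>R One)) x *\<^sub>R v x = 0"
    unfolding AE_all_countable by (rule allI)
  then have "AE x in lborel. v x = 0"
  proof eventually_elim
    case (elim x)
    have "x \<in> (\<Union>n::nat. box (- (real n *\<^sub>R One)) (real n *\<^sub>R One))"
      unfolding UN_box_eq_UNIV by simp
    then obtain n :: nat where "x \<in> box (- real n *\<^sub>R One) (real n *\<^sub>R One)" by auto
    with elim[rule_format, of n] show ?case by simp
  qed
  then have "AE x in lebesgue. v x = 0" by (rule AE_completion)
  with v(2) show ?thesis by eventually_elim simp
qed

lemma fundamental_lemma:
  fixes u :: "'a::euclidean_space \<Rightarrow> complex"
  assumes "locally_integrable u" "\<And>\<phi>. test_function \<phi> \<Longrightarrow> (LINT x|lebesgue. \<phi> x *\<^sub>R u x) = 0"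
  shows "AE x in lebesgue. u x = 0"
  by (intro box_integrals_0_imp_AE_0 box_integral_eq_0 assms(1) assms(2)[OF test_function_bump])

section \<open>Weak derivatives on the line\<close>

lemma test_function_support_real:
  fixes \<phi> :: "real \<Rightarrow> real"
  assumes "test_function \<phi>"
  obtains R where "R > 0" "\<And>x. \<bar>x\<bar> \<ge> R \<Longrightarrow> \<phi> x = 0"
proof -
  obtain K where K: "compact K" "\<And>x. x \<notin> K \<Longrightarrow> \<phi> x = 0"
    using assms unfolding test_function_def by blast
  obtain B where B: "\<And>x. x \<in> K \<Longrightarrow> \<bar>x\<bar> \<le> B"
    using compact_imp_bounded[OF K(1)] by (auto simp: bounded_iff)
  show ?thesis
  proof (rule that[of "\<bar>B\<bar> + 1"])
    fix x :: real assume "\<bar>B\<bar> + 1 \<le> \<bar>x\<bar>"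
    then have "x \<notin> K" using B[of x] by auto
    then show "\<phi> x = 0" by (rule K(2))
  qed simp
qed

lemma test_function_real_derivative:
  fixes \<phi> :: "real \<Rightarrow> real"
  assumes "test_function \<phi>"
  shows "(\<phi> has_vector_derivative frechet_derivative \<phi> (at x) 1) (at x)"
proof -
  have works: "(\<phi> has_derivative frechet_derivative \<phi> (at x)) (at x)"
    by (rule frechet_works[OF test_function_differentiable[OF assms]])
  have lin: "frechet_derivative \<phi> (at x) (h *\<^sub>R 1) = h *\<^sub>R frechet_derivative \<phi> (at x) 1" for h
    by (intro linear_cmul linear_frechet_derivative test_function_differentiable assms)
  have "frechet_derivative \<phi> (at x) = (\<lambda>h. h *\<^sub>R frechet_derivative \<phi> (at x) 1)"
  proof (rule ext)
    fix h show "frechet_derivative \<phi> (at x) h = h *\<^sub>R frechet_derivative \<phi> (at x) 1"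
      using lin[of h] by simp
  qed
  with works show ?thesis unfolding has_vector_derivative_def by metis
qed

text \<open>The primitive that vanishes to the left of the support is constant to its right, with
  the integral of \<open>\<eta>\<close> as value. Integral 0 is thus what gives the primitive
  compact support.\<close>

lemma test_function_primitive:
  fixes \<eta> :: "real \<Rightarrow> real"
  assumes \<eta>: "test_function \<eta>" and z: "(LINT x|lebesgue. \<eta> x) = 0"
  obtains \<phi> where "test_function \<phi>" "\<And>x. frechet_derivative \<phi> (at x) 1 = \<eta> x"
proof -
  obtain R where R: "R > 0" "\<And>x. \<bar>x\<bar> \<ge> R \<Longrightarrow> \<eta> x = 0"
    using test_function_support_real[OF \<eta>] by blast
  have "\<exists>F. \<forall>x::real. - \<infinity> < ereal x \<longrightarrow> ereal x < \<infinity> \<longrightarrow> (F has_vector_derivative \<eta> x) (at x)"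
    using test_function_continuous[OF \<eta>]
    by (intro einterval_antiderivative) (auto simp: continuous_on_eq_continuous_at)
  then obtain F where F: "\<And>x. (F has_vector_derivative \<eta> x) (at x)" by auto
  have ftc: "(\<eta> has_integral (F b - F a)) {a..b}" if "a \<le> b" for a b
    using that by (rule fundamental_theorem_of_calculus) (rule has_vector_derivative_at_within[OF F])
  have zero: "F b = F a" if "a \<le> b" "\<And>x. a \<le> x \<Longrightarrow> x \<le> b \<Longrightarrow> \<eta> x = 0" for a b
  proof -
    have "(\<eta> has_integral 0) {a..b}" using that by (intro has_integral_is_0) auto
    from has_integral_unique[OF ftc[OF that(1)] this] show ?thesis by simp
  qed
  have "F R = F (- R)"
  proof -
    have "(\<eta> has_integral (F R - F (- R))) UNIV"
      using R by (intro has_integral_on_superset[OF ftc[of "-R" R]]) auto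
    moreover have "(\<eta> has_integral 0) UNIV"
      using has_integral_integral_lebesgue[OF test_function_integrable[OF \<eta>]] z by simp
    ultimately have "F R - F (- R) = 0" by (rule has_integral_unique)
    then show ?thesis by simp
  qed
  define \<phi> where "\<phi> x = F x - F (- R)" for x
  have d: "(\<phi> has_derivative (\<lambda>h. h * \<eta> x)) (at x)" for x
    using F[of x] unfolding \<phi>_def has_vector_derivative_def by (auto intro!: derivative_eq_intros)
  have fd: "frechet_derivative \<phi> (at x) 1 = \<eta> x" for x
    using frechet_derivative_eqI[OF d] by simp
  have Ck: "C_k (Suc k) \<phi>" for k
    using test_function_C_k[OF \<eta>, of k] d by (auto simp: fd intro: differentiableI)
  have "test_function \<phi>"
    unfolding test_function_def
  proof (intro conjI allI exI impI)
    show "C_k k \<phi>" for k by (rule C_k_Suc[OF Ck])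
    show "compact {-R..R}" by simp
    fix x assume "x \<notin> {-R..R}"
    then consider "x < - R" | "x > R" by fastforce
    then show "\<phi> x = 0"
    proof cases
      case 1
      then show ?thesis using zero[of x "-R"] R by (auto simp: \<phi>_def)
    next
      case 2
      then show ?thesis using zero[of R x] R \<open>F R = F (- R)\<close> by (auto simp: \<phi>_def)
    qed
  qed
  then show ?thesis using fd by (rule that)
qed

lemma lebesgue_not_AE_False: "\<not> (AE x::'a::euclidean_space in lebesgue. False)"
proof
  assume "AE x::'a in lebesgue. False"
  then have "AE x::'a in lborel. False" by (simp add: AE_completion_iff)
  from AE_E[OF this] obtain N :: "'a set" where "UNIV \<subseteq> N" "emeasure lborel N = 0" by auto
  then show False using emeasure_lborel_UNIV[where 'a='a] by (metis ennreal_zero_neq_top infinity_ennreal_def top.extremum_uniqueI)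
qed

text \<open>Otherwise the fundamental lemma would make the constant function 1 vanish almost
  everywhere.\<close>

lemma ex_test_function_integral_nonzero:
  obtains \<eta> :: "'a::euclidean_space \<Rightarrow> real" where "test_function \<eta>" "(LINT x|lebesgue. \<eta> x) \<noteq> 0"
proof (rule ccontr)
  note obt = that
  assume "\<not> thesis"
  then have z: "(LINT x|lebesgue. \<eta> x) = 0" if t: "test_function \<eta>" for \<eta> :: "'a \<Rightarrow> real"
    using obt[OF t] by blast
  have "AE x::'a in lebesgue. (1::complex) = 0"
  proof (rule fundamental_lemma)
    fix \<phi> :: "'a \<Rightarrow> real" assume "test_function \<phi>"
    then have "(LINT x|lebesgue. complex_of_real (\<phi> x)) = 0" using z by simp
    then show "(LINT x|lebesgue. \<phi> x *\<^sub>R (1::complex)) = 0" by (simp add: scaleR_conv_of_real)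
  qed (rule locally_integrable_continuous, simp)
  then show False using lebesgue_not_AE_False[where 'a='a] by simp
qed

text \<open>Du Bois-Reymond: subtracting a multiple of a fixed \<open>\<eta>\<close> with nonzero
  integral turns any test function into a derivative, against which \<open>u\<close> integrates to
  0. The constant is the value of \<open>u\<close> on the normalised \<open>\<eta>\<close>.\<close>

lemma weak_derivative_0_imp_const:
  fixes u :: "real \<Rightarrow> complex"
  assumes u: "locally_integrable u"
    and z: "\<And>\<phi>. test_function \<phi> \<Longrightarrow> (LINT x|lebesgue. frechet_derivative \<phi> (at x) 1 *\<^sub>R u x) = 0"
  obtains c where "AE x in lebesgue. u x = c"
proof -
  obtain \<eta> :: "real \<Rightarrow> real" where \<eta>: "test_function \<eta>" "(LINT x|lebesgue. \<eta> x) \<noteq> 0"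
    using ex_test_function_integral_nonzero .
  define c where "c = (LINT x|lebesgue. \<eta> x *\<^sub>R u x) / of_real (LINT x|lebesgue. \<eta> x)"
  have "AE x in lebesgue. u x - c = 0"
  proof (rule fundamental_lemma)
    show lc: "locally_integrable (\<lambda>x. u x - c)"
      by (intro locally_integrable_diff u locally_integrable_continuous) simp
    fix \<phi> :: "real \<Rightarrow> real" assume \<phi>: "test_function \<phi>"
    define t where "t = (LINT x|lebesgue. \<phi> x) / (LINT x|lebesgue. \<eta> x)"
    have ti: "test_function (\<lambda>x. \<phi> x - t * \<eta> x)" by (rule test_function_diff[OF \<phi> \<eta>(1)])
    have "(LINT x|lebesgue. \<phi> x - t * \<eta> x) = 0"
      using \<eta>(2) by (simp add: test_function_integrable \<phi> \<eta>(1) t_def)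
    then obtain \<theta> where \<theta>: "test_function \<theta>" "\<And>x. frechet_derivative \<theta> (at x) 1 = \<phi> x - t * \<eta> x"
      using test_function_primitive[OF ti] by blast
    have i: "integrable lebesgue (\<lambda>x. \<phi> x *\<^sub>R u x)" "integrable lebesgue (\<lambda>x. \<eta> x *\<^sub>R u x)"
      by (intro test_function_integrable_mult \<phi> \<eta>(1) u)+
    have "0 = (LINT x|lebesgue. \<phi> x *\<^sub>R u x - t *\<^sub>R (\<eta> x *\<^sub>R u x))"
      using z[OF \<theta>(1)] by (simp add: \<theta>(2) scaleR_diff_left)
    also have "\<dots> = (LINT x|lebesgue. \<phi> x *\<^sub>R u x) - t *\<^sub>R (LINT x|lebesgue. \<eta> x *\<^sub>R u x)"
      using i by (simp del: scaleR_scaleR)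
    also have "t *\<^sub>R (LINT x|lebesgue. \<eta> x *\<^sub>R u x) = (LINT x|lebesgue. \<phi> x) *\<^sub>R c"
      using \<eta>(2) by (simp add: t_def c_def scaleR_conv_of_real)
    also have "(LINT x|lebesgue. \<phi> x) *\<^sub>R c = (LINT x|lebesgue. \<phi> x *\<^sub>R c)"
      by (simp add: test_function_integrable[OF \<phi>])
    also have "(LINT x|lebesgue. \<phi> x *\<^sub>R u x) - \<dots> = (LINT x|lebesgue. \<phi> x *\<^sub>R u x - \<phi> x *\<^sub>R c)"
      using i(1) test_function_integrable[OF \<phi>] by (intro Bochner_Integration.integral_diff[symmetric]) auto
    finally show "(LINT x|lebesgue. \<phi> x *\<^sub>R (u x - c)) = 0" by (simp add: scaleR_diff_right)
  qed
  then have "AE x in lebesgue. u x = c" by eventually_elim simp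
  then show ?thesis by (rule that)
qed

text \<open>Integration by parts, that is, the product rule for \<open>\<phi> g\<close> over an
  interval at whose ends \<open>\<phi>\<close> vanishes and outside which the integrands are
  0.\<close>

lemma antiderivative_imp_has_weak_derivative:
  assumes g: "antiderivative g v"
  shows "has_weak_derivative 1 g v"
  unfolding has_weak_derivative_def
proof (intro conjI allI impI)
  show lg: "locally_integrable g" by (rule locally_integrable_continuous[OF antiderivative_continuous[OF g]])
  show lv: "locally_integrable v" by (rule antiderivative_locally_integrable[OF g])
  fix \<phi> :: "real \<Rightarrow> real" assume \<phi>: "test_function \<phi>"
  define \<phi>' where "\<phi>' x = frechet_derivative \<phi> (at x) 1" for x
  have \<phi>': "test_function \<phi>'" unfolding \<phi>'_def by (rule test_function_derivative[OF \<phi>]) simp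
  obtain R1 R2 where R12: "\<And>x. \<bar>x\<bar> \<ge> R1 \<Longrightarrow> \<phi> x = 0" "\<And>x. \<bar>x\<bar> \<ge> R2 \<Longrightarrow> \<phi>' x = 0"
    using test_function_support_real[OF \<phi>] test_function_support_real[OF \<phi>'] by metis
  define R where "R = \<bar>R1\<bar> + \<bar>R2\<bar>"
  have R: "\<And>x. \<bar>x\<bar> \<ge> R \<Longrightarrow> \<phi> x = 0" "\<And>x. \<bar>x\<bar> \<ge> R \<Longrightarrow> \<phi>' x = 0" "R \<ge> 0"
    using R12 by (auto simp: R_def)
  have "antiderivative (\<lambda>s. complex_of_real (\<phi> s)) (\<lambda>s. complex_of_real (\<phi>' s))"
    using test_function_real_derivative[OF \<phi>] test_function_continuous[OF \<phi>']
    by (intro antiderivative_C1 has_vector_derivative_of_real continuous_intros)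
      (auto simp: \<phi>'_def has_real_derivative_iff_has_vector_derivative)
  from antiderivative_eq[OF antiderivative_mult[OF this g], of "-R" R]
  have "(LINT s:{-R..R}|lebesgue. \<phi>' s *\<^sub>R g s + \<phi> s *\<^sub>R v s) = 0"
    using R by (simp add: scaleR_conv_of_real)
  moreover have "(LINT s:{-R..R}|lebesgue. \<phi>' s *\<^sub>R g s + \<phi> s *\<^sub>R v s)
      = (LINT s|lebesgue. \<phi>' s *\<^sub>R g s + \<phi> s *\<^sub>R v s)"
    unfolding set_lebesgue_integral_def
  proof (rule Bochner_Integration.integral_cong[OF refl])
    fix s :: real
    show "indicator {-R..R} s *\<^sub>R (\<phi>' s *\<^sub>R g s + \<phi> s *\<^sub>R v s) = \<phi>' s *\<^sub>R g s + \<phi> s *\<^sub>R v s"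
      using R(1,2)[of s] by (cases "s \<in> {-R..R}") auto
  qed
  moreover have "integrable lebesgue (\<lambda>s. \<phi>' s *\<^sub>R g s)" "integrable lebesgue (\<lambda>s. \<phi> s *\<^sub>R v s)"
    by (intro test_function_integrable_mult \<phi> \<phi>' lg lv)+
  ultimately show "(LINT x|lebesgue. frechet_derivative \<phi> (at x) 1 *\<^sub>R g x) = - (LINT x|lebesgue. \<phi> x *\<^sub>R v x)"
    by (simp add: \<phi>'_def eq_neg_iff_add_eq_0)
qed

lemma has_weak_derivative_cong_AE:
  assumes "has_weak_derivative b f v" "f' \<in> borel_measurable lebesgue" "AE x in lebesgue. f x = f' x"
    "v' \<in> borel_measurable lebesgue" "AE x in lebesgue. v x = v' x" "b \<in> Basis"
  shows "has_weak_derivative b f' v'"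
proof -
  have l: "locally_integrable f" "locally_integrable v"
    using assms(1) by (auto simp: has_weak_derivative_def)
  have l': "locally_integrable f'" "locally_integrable v'"
    using locally_integrable_cong_AE[OF l(1) assms(2,3)] locally_integrable_cong_AE[OF l(2) assms(4,5)] by auto
  have eq: "(LINT x|lebesgue. \<phi> x *\<^sub>R u' x) = (LINT x|lebesgue. \<phi> x *\<^sub>R u x)"
    if "test_function \<phi>" "locally_integrable u" "locally_integrable u'" "AE x in lebesgue. u x = u' x"
    for \<phi> and u u' :: "'a \<Rightarrow> complex"
    using that(4) test_function_integrable_mult[OF that(1,2)] test_function_integrable_mult[OF that(1,3)]
    by (intro integral_cong_AE) auto
  show ?thesis
    unfolding has_weak_derivative_def
  proof (intro conjI allI impI l')
    fix \<phi> :: "'a \<Rightarrow> real" assume \<phi>: "test_function \<phi>"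
    show "(LINT x|lebesgue. frechet_derivative \<phi> (at x) b *\<^sub>R f' x) = - (LINT x|lebesgue. \<phi> x *\<^sub>R v' x)"
      unfolding eq[OF test_function_derivative[OF \<phi> assms(6)] l(1) l'(1) assms(3)]
        eq[OF \<phi> l(2) l'(2) assms(5)]
      using assms(1) \<phi> by (simp add: has_weak_derivative_def)
  qed
qed

lemma has_weak_derivative_unique:
  assumes "has_weak_derivative b f v" "has_weak_derivative b f v'"
  shows "AE x in lebesgue. v x = v' x"
proof -
  have l: "locally_integrable v" "locally_integrable v'"
    using assms by (auto simp: has_weak_derivative_def)
  have "AE x in lebesgue. v x - v' x = 0"
  proof (rule fundamental_lemma)
    fix \<phi> :: "'a \<Rightarrow> real" assume \<phi>: "test_function \<phi>"
    have "(LINT x|lebesgue. \<phi> x *\<^sub>R v x) = (LINT x|lebesgue. \<phi> x *\<^sub>R v' x)"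
      using assms \<phi> unfolding has_weak_derivative_def by (metis add.inverse_inverse)
    then show "(LINT x|lebesgue. \<phi> x *\<^sub>R (v x - v' x)) = 0"
      using test_function_integrable_mult[OF \<phi> l(1)] test_function_integrable_mult[OF \<phi> l(2)]
      by (simp add: scaleR_diff_right)
  qed (intro locally_integrable_diff l)
  then show ?thesis by eventually_elim simp
qed

text \<open>The bridge between the distributional definition and calculus. \<open>g\<close> minus a
  primitive of \<open>v\<close> has weak derivative 0 and is therefore constant almost everywhere;
  the converse is integration by parts.\<close>

lemma has_weak_derivative_iff_antiderivative:
  "has_weak_derivative 1 g v \<longleftrightarrow>
    g \<in> borel_measurable lebesgue \<and> (\<exists>g0. antiderivative g0 v \<and> (AE s in lebesgue. g s = g0 s))"
proof
  assume w: "has_weak_derivative 1 g v"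
  then have l: "locally_integrable g" "locally_integrable v" by (auto simp: has_weak_derivative_def)
  define G where "G = primitive v"
  have G: "antiderivative G v" unfolding G_def by (rule antiderivative_primitive[OF l(2)])
  have wG: "has_weak_derivative 1 G v" by (rule antiderivative_imp_has_weak_derivative[OF G])
  have lG: "locally_integrable G" using wG by (auto simp: has_weak_derivative_def)
  obtain c where c: "AE x in lebesgue. g x - G x = c"
  proof (rule weak_derivative_0_imp_const[of "\<lambda>x. g x - G x"])
    fix \<phi> :: "real \<Rightarrow> real" assume \<phi>: "test_function \<phi>"
    have \<phi>': "test_function (\<lambda>x. frechet_derivative \<phi> (at x) 1)"
      by (rule test_function_derivative[OF \<phi>]) simp
    show "(LINT x|lebesgue. frechet_derivative \<phi> (at x) 1 *\<^sub>R (g x - G x)) = 0"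
      using w wG \<phi> test_function_integrable_mult[OF \<phi>' l(1)] test_function_integrable_mult[OF \<phi>' lG]
      by (simp add: has_weak_derivative_def scaleR_diff_right)
  qed (intro locally_integrable_diff l lG)
  have "antiderivative (\<lambda>s. G s + c) v"
    using antiderivative_add[OF G antiderivative_const[of c]] by simp
  moreover have "AE s in lebesgue. g s = G s + c" using c by eventually_elim (auto simp: algebra_simps)
  ultimately show "g \<in> borel_measurable lebesgue \<and> (\<exists>g0. antiderivative g0 v \<and> (AE s in lebesgue. g s = g0 s))"
    using locally_integrable_measurable[OF l(1)] by blast
next
  assume "g \<in> borel_measurable lebesgue \<and> (\<exists>g0. antiderivative g0 v \<and> (AE s in lebesgue. g s = g0 s))"
  then obtain g0 where g0: "g \<in> borel_measurable lebesgue" "antiderivative g0 v" "AE s in lebesgue. g0 s = g s"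
    by (auto simp: eq_commute)
  show "has_weak_derivative 1 g v"
    using g0 antiderivative_locally_integrable locally_integrable_measurable
    by (intro has_weak_derivative_cong_AE[OF antiderivative_imp_has_weak_derivative[OF g0(2)]]) auto
qed

lemma has_weak_derivative_weak_deriv:
  "has_weak_derivative 1 g v \<Longrightarrow> has_weak_derivative 1 g (weak_deriv g)"
  unfolding weak_deriv_def by (rule someI[of "has_weak_derivative 1 g"])

lemma continuous_AE_eq_imp_eq:
  fixes f g :: "'a::euclidean_space \<Rightarrow> complex"
  assumes "continuous_on UNIV f" "continuous_on UNIV g" "AE x in lebesgue. f x = g x"
  shows "f = g"
proof (rule ccontr)
  assume "f \<noteq> g"
  then have ne: "{x. f x \<noteq> g x} \<noteq> {}" by auto
  have op: "open {x. f x \<noteq> g x}"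
    using assms(1,2) by (intro open_Collect_neq) auto
  have "{x. f x \<noteq> g x} \<in> null_sets lebesgue"
    using assms(3) op by (subst AE_iff_null_sets) auto
  then have "negligible {x. f x \<noteq> g x}" by (simp add: negligible_iff_null_sets)
  with open_not_negligible[OF op ne] show False by simp
qed

text \<open>A nonzero limit \<open>l\<close> would keep the modulus above \<open>|l|/2\<close> on
  intervals of every length, which makes the integral infinite.\<close>

lemma integrable_tendsto_imp_0:
  fixes f :: "real \<Rightarrow> complex"
  assumes f: "integrable lebesgue f"
  shows "(f \<longlongrightarrow> l) at_top \<Longrightarrow> l = 0" and "(f \<longlongrightarrow> l) at_bot \<Longrightarrow> l = 0"
proof -
  have *: False if l: "l \<noteq> 0" and big: "\<And>n::nat. \<exists>a. \<forall>x\<in>{a..a + real n}. cmod (f x) \<ge> cmod l / 2"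
  proof -
    have fin: "(\<integral>\<^sup>+x. ennreal (cmod (f x)) \<partial>lebesgue) < \<infinity>"
      using f by (auto simp: integrable_iff_bounded)
    have "ennreal (cmod l / 2) * ennreal (real n) \<le> (\<integral>\<^sup>+x. ennreal (cmod (f x)) \<partial>lebesgue)" for n :: nat
    proof -
      obtain a where a: "\<And>x. x \<in> {a..a + real n} \<Longrightarrow> cmod (f x) \<ge> cmod l / 2" using big by blast
      have "ennreal (cmod l / 2) * ennreal (real n)
          = (\<integral>\<^sup>+x. ennreal (cmod l / 2) * indicator {a..a + real n} x \<partial>lebesgue)"
        by (subst nn_integral_cmult_indicator) auto
      also have "\<dots> \<le> (\<integral>\<^sup>+x. ennreal (cmod (f x)) \<partial>lebesgue)"
        using a by (intro nn_integral_mono) (auto simp: indicator_def intro!: ennreal_leI)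
      finally show ?thesis .
    qed
    note le = this
    obtain I where I: "0 \<le> I" "(\<integral>\<^sup>+x. ennreal (cmod (f x)) \<partial>lebesgue) = ennreal I"
      using fin by (cases "\<integral>\<^sup>+x. ennreal (cmod (f x)) \<partial>lebesgue") auto
    have "real n * (cmod l / 2) \<le> I" for n
      using le[of n] I(1) unfolding I(2) by (simp add: ennreal_mult[symmetric] mult.commute)
    moreover obtain n :: nat where "I < real n * (cmod l / 2)"
      using reals_Archimedean3[of "cmod l / 2"] l by auto
    ultimately show False by (meson not_le)
  qed
  have half: "cmod l / 2 \<le> cmod y" if "dist y l < cmod l / 2" for y l
    using that norm_triangle_ineq2[of l y] by (simp add: dist_norm norm_minus_commute)
  show "l = 0" if "(f \<longlongrightarrow> l) at_top"
  proof (rule ccontr)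
    assume l: "l \<noteq> 0"
    then have "\<forall>\<^sub>F x in at_top. dist (f x) l < cmod l / 2" by (intro tendstoD[OF that]) simp
    then obtain N where N: "\<And>x. x \<ge> N \<Longrightarrow> dist (f x) l < cmod l / 2" by (auto simp: eventually_at_top_linorder)
    show False
    proof (rule *[OF l])
      show "\<exists>a. \<forall>x\<in>{a..a + real n}. cmod l / 2 \<le> cmod (f x)" for n
        by (intro exI[of _ N] ballI half N) simp
    qed
  qed
  show "l = 0" if "(f \<longlongrightarrow> l) at_bot"
  proof (rule ccontr)
    assume l: "l \<noteq> 0"
    then have "\<forall>\<^sub>F x in at_bot. dist (f x) l < cmod l / 2" by (intro tendstoD[OF that]) simp
    then obtain N where N: "\<And>x. x \<le> N \<Longrightarrow> dist (f x) l < cmod l / 2" by (auto simp: eventually_at_bot_linorder)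
    show False
    proof (rule *[OF l])
      show "\<exists>a. \<forall>x\<in>{a..a + real n}. cmod l / 2 \<le> cmod (f x)" for n
        by (intro exI[of _ "N - real n"] ballI half N) simp
    qed
  qed
qed

lemma antiderivative_total:
  assumes g: "antiderivative g v" and v: "integrable lebesgue v"
    and lim: "(g \<longlongrightarrow> A) at_bot" "(g \<longlongrightarrow> B) at_top"
  shows "B - A = (LINT s|lebesgue. v s)"
proof -
  have A: "A = g 0 - (LINT s:{..0}|lebesgue. v s)"
    using tendsto_unique[OF _ lim(1) antiderivative_tendsto(2)[OF g v]] by simp
  have B: "B = g 0 + (LINT s:{0..}|lebesgue. v s)"
    using tendsto_unique[OF _ lim(2) antiderivative_tendsto(1)[OF g v]] by simp
  have ne: "AE s in lebesgue. s \<noteq> (0::real)" by (rule AE_completion[OF AE_lborel_singleton])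
  have "(LINT s|lebesgue. v s) = (LINT s|lebesgue. indicator {0..} s *\<^sub>R v s + indicator {..0} s *\<^sub>R v s)"
    using v ne by (intro integral_cong_AE) (auto elim!: eventually_mono split: split_indicator
      intro!: borel_measurable_add borel_measurable_scaleR borel_measurable_indicator)
  also have "\<dots> = (LINT s:{0..}|lebesgue. v s) + (LINT s:{..0}|lebesgue. v s)"
    using v unfolding set_lebesgue_integral_def
    by (intro Bochner_Integration.integral_add integrable_mult_indicator) auto
  finally show ?thesis by (simp add: A B)
qed

section \<open>The operator on a fibre\<close>

text \<open>Positivity at every point gives the weighted measure exactly the null sets of Lebesgue
  measure, so almost everywhere statements pass freely between the two.\<close>

locale positive_weight =
  fixes u :: "'a::euclidean_space \<Rightarrow> real"
  assumes weight_measurable [measurable]: "u \<in> borel_measurable lebesgue"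
    and weight_pos: "\<And>x. 0 < u x"
begin

lemma sets_weighted [measurable_cong]: "sets (weighted u) = sets lebesgue"
  by (simp add: weighted_def)

lemma measurable_weighted: "f \<in> borel_measurable (weighted u) \<longleftrightarrow> f \<in> borel_measurable lebesgue"
  by (simp add: weighted_def)

lemma AE_weighted: "(AE x in weighted u. P x) \<longleftrightarrow> (AE x in lebesgue. P x)"
  unfolding weighted_def by (subst AE_density) (simp_all add: weight_pos)

lemma nn_integral_weighted:
  "f \<in> borel_measurable lebesgue \<Longrightarrow>
    (\<integral>\<^sup>+x. f x \<partial>weighted u) = (\<integral>\<^sup>+x. ennreal (u x) * f x \<partial>lebesgue)"
  unfolding weighted_def by (intro nn_integral_density) simp_all

lemma integrable_weighted:
  fixes f :: "'a \<Rightarrow> 'b::{banach, second_countable_topology}"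
  shows "f \<in> borel_measurable lebesgue \<Longrightarrow>
    integrable (weighted u) f \<longleftrightarrow> integrable lebesgue (\<lambda>x. u x *\<^sub>R f x)"
  unfolding weighted_def by (intro integrable_density) (simp_all add: weight_pos less_imp_le)

lemma integral_weighted:
  fixes f :: "'a \<Rightarrow> 'b::{banach, second_countable_topology}"
  shows "f \<in> borel_measurable lebesgue \<Longrightarrow>
    (LINT x|weighted u. f x) = (LINT x|lebesgue. u x *\<^sub>R f x)"
  unfolding weighted_def by (intro integral_density) (simp_all add: weight_pos less_imp_le)

lemma L2_weighted:
  "f \<in> L2 (weighted u) \<longleftrightarrow> f \<in> borel_measurable lebesgue \<and> integrable lebesgue (\<lambda>x. u x * (cmod (f x))\<^sup>2)"
proof -
  have "f \<in> borel_measurable lebesgue \<Longrightarrow> (\<lambda>x. (cmod (f x))\<^sup>2) \<in> borel_measurable lebesgue" by measurable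
  then show ?thesis by (auto simp: L2_def measurable_weighted integrable_weighted)
qed

lemma L2_weighted_measurable: "f \<in> L2 (weighted u) \<Longrightarrow> f \<in> borel_measurable lebesgue"
  by (simp add: L2_weighted)

lemma L2_weighted_nn_integral:
  "f \<in> L2 (weighted u) \<longleftrightarrow> f \<in> borel_measurable lebesgue \<and>
    (\<integral>\<^sup>+x. ennreal (u x * (cmod (f x))\<^sup>2) \<partial>lebesgue) < \<infinity>"
proof -
  have "f \<in> borel_measurable lebesgue \<Longrightarrow> (\<lambda>x. u x * (cmod (f x))\<^sup>2) \<in> borel_measurable lebesgue" by measurable
  then show ?thesis
    by (auto simp: L2_weighted integrable_iff_bounded weight_pos less_imp_le abs_mult)
qed

lemma L2_norm_weighted_nn_integral:
  "f \<in> L2 (weighted u) \<Longrightarrow>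
    ennreal ((L2_norm (weighted u) f)\<^sup>2) = (\<integral>\<^sup>+x. ennreal (u x * (cmod (f x))\<^sup>2) \<partial>lebesgue)"
proof -
  assume f: "f \<in> L2 (weighted u)"
  then have [measurable]: "f \<in> borel_measurable lebesgue" by (rule L2_weighted_measurable)
  show ?thesis
    by (subst L2_norm_nn_integral[OF f], subst nn_integral_weighted)
      (simp_all add: ennreal_mult weight_pos less_imp_le)
qed

lemma L2_inner_weighted:
  assumes "f \<in> L2 (weighted u)" "g \<in> L2 (weighted u)"
  shows "integrable lebesgue (\<lambda>x. u x *\<^sub>R (f x * cnj (g x)))"
    and "L2_inner (weighted u) f g = (LINT x|lebesgue. u x *\<^sub>R (f x * cnj (g x)))"
proof -
  have m: "(\<lambda>x. f x * cnj (g x)) \<in> borel_measurable lebesgue"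
    using borel_measurable_integrable[OF L2_inner_integrable[OF assms]] by (simp add: measurable_weighted)
  show "integrable lebesgue (\<lambda>x. u x *\<^sub>R (f x * cnj (g x)))"
    using L2_inner_integrable[OF assms] integrable_weighted[OF m] by blast
  show "L2_inner (weighted u) f g = (LINT x|lebesgue. u x *\<^sub>R (f x * cnj (g x)))"
    unfolding L2_inner_def by (rule integral_weighted[OF m])
qed

end

text \<open>The equation \<open>h = - i (c/p) g'\<close> is solved for the derivative and
  integrated, so the graph mentions no chosen derivative. If \<open>p = 1\<close> almost everywhere,
  square integrability forces both limits to be 0, and the boundary condition holds for every
  \<open>a\<close>.\<close>

definition transport_operator :: "(real \<Rightarrow> real) \<Rightarrow> real \<Rightarrow> complex \<Rightarrow> real operator" where
  "transport_operator p c a = {(g, h). g \<in> L2 (weighted p) \<and> h \<in> L2 (weighted p) \<and>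
     (\<exists>g0 A. (AE s in lebesgue. g s = g0 s) \<and> antiderivative g0 (\<lambda>s. \<i> * of_real (p s / c) * h s) \<and>
        (g0 \<longlongrightarrow> A) at_bot \<and> (g0 \<longlongrightarrow> a * A) at_top)}"

lemma transport_operatorI:
  assumes "g \<in> L2 (weighted p)" "h \<in> L2 (weighted p)" "AE s in lebesgue. g s = g0 s"
    "antiderivative g0 (\<lambda>s. \<i> * of_real (p s / c) * h s)" "(g0 \<longlongrightarrow> A) at_bot" "(g0 \<longlongrightarrow> a * A) at_top"
  shows "(g, h) \<in> transport_operator p c a"
  using assms unfolding transport_operator_def by blast

lemma transport_operatorE:
  assumes "(g, h) \<in> transport_operator p c a"
  obtains g0 A where "g \<in> L2 (weighted p)" "h \<in> L2 (weighted p)" "AE s in lebesgue. g s = g0 s"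
    "antiderivative g0 (\<lambda>s. \<i> * of_real (p s / c) * h s)" "(g0 \<longlongrightarrow> A) at_bot" "(g0 \<longlongrightarrow> a * A) at_top"
  using assms unfolding transport_operator_def by blast

definition phase :: "(real \<Rightarrow> real) \<Rightarrow> real \<Rightarrow> real \<Rightarrow> complex" where
  "phase p c = primitive (\<lambda>u. of_real (p u / c))"

text \<open>Variation of constants: in \<open>g' = i (p/c) (h + z g)\<close> the substitution
  \<open>g = exp (i z phase) y\<close> leaves \<open>y' = source\<close>.\<close>

definition source :: "(real \<Rightarrow> real) \<Rightarrow> real \<Rightarrow> complex \<Rightarrow> (real \<Rightarrow> complex) \<Rightarrow> real \<Rightarrow> complex" where
  "source p c z h u = exp (- (\<i> * z * phase p c u)) * (\<i> * of_real (p u / c) * h u)"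

text \<open>The free constant of the solution formula. For integrable \<open>p\<close> it solves the
  linear equation that the boundary condition imposes on the limits at both ends. Otherwise it is
  the choice that avoids exponential growth: added to the primitive from 0, it yields the integral
  from minus infinity if \<open>Im z > 0\<close>, and minus the integral to plus infinity if
  \<open>Im z < 0\<close>.\<close>

definition boundary_constant :: "(real \<Rightarrow> real) \<Rightarrow> real \<Rightarrow> complex \<Rightarrow> complex \<Rightarrow> (real \<Rightarrow> complex) \<Rightarrow> complex" where
  "boundary_constant p c a z h =
    (if integrable lebesgue p then
       (- a * exp (- (\<i> * z * (LINT u:{..0}|lebesgue. of_real (p u / c)))) * (LINT u:{..0}|lebesgue. source p c z h u)
        - exp (\<i> * z * (LINT u:{0..}|lebesgue. of_real (p u / c))) * (LINT u:{0..}|lebesgue. source p c z h u)) /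
       (exp (\<i> * z * (LINT u:{0..}|lebesgue. of_real (p u / c)))
        - a * exp (- (\<i> * z * (LINT u:{..0}|lebesgue. of_real (p u / c)))))
     else if Im z > 0 then (LINT u:{..0}|lebesgue. source p c z h u)
     else - (LINT u:{0..}|lebesgue. source p c z h u))"

definition resolvent :: "(real \<Rightarrow> real) \<Rightarrow> real \<Rightarrow> complex \<Rightarrow> complex \<Rightarrow> (real \<Rightarrow> complex) \<Rightarrow> real \<Rightarrow> complex" where
  "resolvent p c a z h s =
     exp (\<i> * z * phase p c s) * (boundary_constant p c a z h + primitive (source p c z h) s)"

lemma primitive_0: "primitive v 0 = 0"
  by (simp add: primitive_def)

lemma set_integral_Iic_split:
  fixes v :: "real \<Rightarrow> complex"
  assumes "set_integrable lebesgue {..b} v" "a \<le> b"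
  shows "(LINT u:{..b}|lebesgue. v u) = (LINT u:{..a}|lebesgue. v u) + (LINT u:{a..b}|lebesgue. v u)"
proof -
  have i: "set_integrable lebesgue {..a} v" "set_integrable lebesgue {a..b} v"
    using assms by (auto intro: set_integrable_subset)
  have ne: "AE u in lebesgue. u \<noteq> a" by (rule AE_completion[OF AE_lborel_singleton])
  have "(LINT u:{..b}|lebesgue. v u)
      = (LINT u|lebesgue. indicator {..a} u *\<^sub>R v u + indicator {a..b} u *\<^sub>R v u)"
    unfolding set_lebesgue_integral_def
  proof (rule integral_cong_AE)
    show "AE u in lebesgue. indicator {..b} u *\<^sub>R v u = indicator {..a} u *\<^sub>R v u + indicator {a..b} u *\<^sub>R v u"
      using ne by eventually_elim (use assms(2) in \<open>auto split: split_indicator\<close>)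
  qed (use assms(1) i in \<open>auto simp: set_integrable_def intro!: borel_measurable_add\<close>)
  then show ?thesis using i by (simp add: set_lebesgue_integral_def set_integrable_def)
qed

lemma set_integral_Ici_split:
  fixes v :: "real \<Rightarrow> complex"
  assumes "set_integrable lebesgue {a..} v" "a \<le> b"
  shows "(LINT u:{a..}|lebesgue. v u) = (LINT u:{a..b}|lebesgue. v u) + (LINT u:{b..}|lebesgue. v u)"
proof -
  have i: "set_integrable lebesgue {b..} v" "set_integrable lebesgue {a..b} v"
    using assms by (auto intro: set_integrable_subset)
  have ne: "AE u in lebesgue. u \<noteq> b" by (rule AE_completion[OF AE_lborel_singleton])
  have "(LINT u:{a..}|lebesgue. v u)
      = (LINT u|lebesgue. indicator {a..b} u *\<^sub>R v u + indicator {b..} u *\<^sub>R v u)"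
    unfolding set_lebesgue_integral_def
  proof (rule integral_cong_AE)
    show "AE u in lebesgue. indicator {a..} u *\<^sub>R v u = indicator {a..b} u *\<^sub>R v u + indicator {b..} u *\<^sub>R v u"
      using ne by eventually_elim (use assms(2) in \<open>auto split: split_indicator\<close>)
  qed (use assms(1) i in \<open>auto simp: set_integrable_def intro!: borel_measurable_add\<close>)
  then show ?thesis using i by (simp add: set_lebesgue_integral_def set_integrable_def)
qed

text \<open>The squared modulus has an integrable derivative, so it has limits at both ends; being
  integrable itself, it can only tend to 0.\<close>

lemma antiderivative_L2_tendsto_0:
  assumes g: "antiderivative g v" and L: "g \<in> L2 lebesgue" "v \<in> L2 lebesgue"
  shows "(g \<longlongrightarrow> 0) at_top" "(g \<longlongrightarrow> 0) at_bot"
proof -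
  have gg: "antiderivative (\<lambda>s. g s * cnj (g s)) (\<lambda>s. v s * cnj (g s) + g s * cnj (v s))"
    by (rule antiderivative_mult[OF g antiderivative_cnj[OF g]])
  have i: "integrable lebesgue (\<lambda>s. v s * cnj (g s) + g s * cnj (v s))"
    using L by (intro Bochner_Integration.integrable_add L2_inner_integrable)
  have i2: "integrable lebesgue (\<lambda>s. g s * cnj (g s))"
    using L by (intro L2_inner_integrable)
  have sq: "(g \<longlongrightarrow> 0) F" if "((\<lambda>s. g s * cnj (g s)) \<longlongrightarrow> 0) F" for F
  proof -
    have "((\<lambda>s. sqrt (cmod (g s * cnj (g s)))) \<longlongrightarrow> sqrt (cmod 0)) F"
      by (intro tendsto_intros that)
    then show ?thesis by (simp add: norm_mult tendsto_norm_zero_iff)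
  qed
  note lim = antiderivative_tendsto[OF gg i]
  show "(g \<longlongrightarrow> 0) at_top"
    by (rule sq) (rule lim(1)[unfolded integrable_tendsto_imp_0(1)[OF i2 lim(1)]])
  show "(g \<longlongrightarrow> 0) at_bot"
    by (rule sq) (rule lim(2)[unfolded integrable_tendsto_imp_0(2)[OF i2 lim(2)]])
qed

lemma nn_integral_exp_minus_abs:
  assumes "0 < (k::real)"
  shows "(\<integral>\<^sup>+x. ennreal (exp (- (k * \<bar>x\<bar>))) \<partial>lborel) < \<infinity>"
proof -
  have half: "(\<integral>\<^sup>+x. ennreal (exp (- (k * x))) * indicator {0..} x \<partial>lborel) = ennreal (0 - (- (exp (- (k * 0)) / k)))"
  proof (rule nn_integral_FTC_atLeast)
    show "((\<lambda>x. - (exp (- (k * x)) / k)) has_real_derivative exp (- (k * x))) (at x)" for x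
      using assms by (auto intro!: derivative_eq_intros)
    show "((\<lambda>x. - (exp (- (k * x)) / k)) \<longlongrightarrow> 0) at_top"
      using assms by real_asymp
  qed auto
  have "(\<integral>\<^sup>+x. ennreal (exp (- (k * \<bar>x\<bar>))) \<partial>lborel)
      \<le> (\<integral>\<^sup>+x. ennreal (exp (- (k * x))) * indicator {0..} x
          + ennreal (exp (- (k * - x))) * indicator {0..} (- x) \<partial>lborel)"
    by (intro nn_integral_mono) (auto simp: indicator_def)
  also have "\<dots> = (\<integral>\<^sup>+x. ennreal (exp (- (k * x))) * indicator {0..} x \<partial>lborel)
      + (\<integral>\<^sup>+x. ennreal (exp (- (k * - x))) * indicator {0..} (- x) \<partial>lborel)"
    by (intro nn_integral_add) auto
  also have "(\<integral>\<^sup>+x. ennreal (exp (- (k * - x))) * indicator {0..} (- x) \<partial>lborel)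
      = (\<integral>\<^sup>+x. ennreal (exp (- (k * x))) * indicator {0..} x \<partial>lborel)"
    by (subst (2) nn_integral_real_affine[where c = "-1" and t = 0]) auto
  also have "(\<integral>\<^sup>+x. ennreal (exp (- (k * x))) * indicator {0..} x \<partial>lborel) + \<dots> < \<infinity>"
    by (simp add: half)
  finally show ?thesis .
qed

text \<open>Young's inequality \<open>\<lVert>K * h\<rVert>\<^sub>2 \<le> \<lVert>K\<rVert>\<^sub>1 \<lVert>h\<rVert>\<^sub>2\<close>, and finiteness of the convolution everywhere.\<close>

lemma exponential_convolution:
  fixes h :: "real \<Rightarrow> complex"
  assumes k: "0 < k" and h: "h \<in> L2 lebesgue"
  defines "m \<equiv> \<lambda>s. \<integral>\<^sup>+u. ennreal (exp (- (k * \<bar>s - u\<bar>)) * cmod (h u)) \<partial>lebesgue"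
  shows "m s < \<infinity>" and "(\<integral>\<^sup>+s. (m s)\<^sup>2 \<partial>lebesgue) < \<infinity>" and "m \<in> borel_measurable lebesgue"
proof -
  obtain h' where h': "h' \<in> borel_measurable borel" "AE u in lebesgue. h u = h' u"
    using complex_borel_representative[OF L2_measurable[OF h]] .
  note [measurable] = h'(1)
  define K where "K k x = ennreal (exp (- (k * \<bar>x\<bar>)))" for k x :: real
  have [measurable]: "K k \<in> borel_measurable borel" for k unfolding K_def by measurable
  define H where "H u = ennreal (cmod (h' u))" for u
  have [measurable]: "H \<in> borel_measurable borel" unfolding H_def by measurable
  have fin: "(\<integral>\<^sup>+u. (H u)\<^sup>2 \<partial>lborel) < \<infinity>"
  proof -
    have "(\<integral>\<^sup>+u. (H u)\<^sup>2 \<partial>lborel) = (\<integral>\<^sup>+u. (H u)\<^sup>2 \<partial>lebesgue)"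
      by (rule nn_integral_completion[symmetric])
    also have "\<dots> = (\<integral>\<^sup>+u. ennreal ((cmod (h u))\<^sup>2) \<partial>lebesgue)"
      using h'(2) by (intro nn_integral_cong_AE) (auto simp: H_def ennreal_power)
    finally show ?thesis using h by (simp add: L2_iff_nn_integral)
  qed
  have m: "m s = (\<integral>\<^sup>+u. K k (s - u) * H u \<partial>lborel)" for s
  proof -
    have "m s = (\<integral>\<^sup>+u. K k (s - u) * H u \<partial>lebesgue)"
      unfolding m_def using h'(2)
      by (intro nn_integral_cong_AE) (auto simp: K_def H_def ennreal_mult)
    then show ?thesis by (simp add: nn_integral_completion)
  qed
  have "(\<lambda>s. \<integral>\<^sup>+u. K k (s - u) * H u \<partial>lborel) \<in> borel_measurable borel" by measurable
  then show "m \<in> borel_measurable lebesgue"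
    unfolding m[abs_def, symmetric] by (intro measurable_completion) simp
  have Ks: "(\<integral>\<^sup>+u. K k (s - u) \<partial>lborel) = (\<integral>\<^sup>+u. K k u \<partial>lborel)" for k s
    by (subst (2) nn_integral_real_affine[where c = "-1" and t = s]) auto
  have Ku: "(\<integral>\<^sup>+s. K k (s - u) \<partial>lborel) = (\<integral>\<^sup>+u. K k u \<partial>lborel)" for k u
    by (subst (2) nn_integral_real_affine[where c = 1 and t = "-u"]) auto
  have Kfin: "(\<integral>\<^sup>+u. K k u \<partial>lborel) < \<infinity>" if "0 < k" for k
    unfolding K_def by (rule nn_integral_exp_minus_abs[OF that])
  have K2: "(K k x)\<^sup>2 = K (2 * k) x" for k x
    by (simp add: K_def power2_eq_square ennreal_mult[symmetric] exp_add[symmetric])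
  have "(m s)\<^sup>2 \<le> (\<integral>\<^sup>+u. (K k (s - u))\<^sup>2 \<partial>lborel) * (\<integral>\<^sup>+u. (H u)\<^sup>2 \<partial>lborel)"
    unfolding m by (rule Cauchy_Schwarz_nn_integral) measurable
  also have "\<dots> < \<infinity>"
    using fin Kfin[of "2 * k"] k by (simp add: K2 Ks ennreal_mult_less_top)
  finally show "m s < \<infinity>" by (auto simp: power2_eq_square ennreal_mult_less_top less_top)
  define I where "I = (\<integral>\<^sup>+u. K k u \<partial>lborel)"
  have le: "(m s)\<^sup>2 \<le> I * (\<integral>\<^sup>+u. K k (s - u) * (H u)\<^sup>2 \<partial>lborel)" for s
  proof -
    \<comment> \<open>The kernel is the square of the kernel of half the rate. Giving one factor to
      each side of Cauchy-Schwarz produces the integral of the kernel instead of that of its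
      square.\<close>
    have half: "K k x = K (k / 2) x * K (k / 2) x" for x
      using K2[of "k / 2" x] by (simp add: power2_eq_square)
    have "m s = (\<integral>\<^sup>+u. K (k / 2) (s - u) * (K (k / 2) (s - u) * H u) \<partial>lborel)"
      unfolding m half by (simp add: mult.assoc)
    then have "(m s)\<^sup>2 \<le> (\<integral>\<^sup>+u. (K (k / 2) (s - u))\<^sup>2 \<partial>lborel)
        * (\<integral>\<^sup>+u. (K (k / 2) (s - u) * H u)\<^sup>2 \<partial>lborel)"
      by (simp only:) (rule Cauchy_Schwarz_nn_integral; measurable)
    then show ?thesis by (simp add: K2 Ks power_mult_distrib I_def)
  qed
  have "(\<integral>\<^sup>+s. (m s)\<^sup>2 \<partial>lebesgue) = (\<integral>\<^sup>+s. (m s)\<^sup>2 \<partial>lborel)"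
    by (rule nn_integral_completion)
  also have "\<dots> \<le> (\<integral>\<^sup>+s. I * (\<integral>\<^sup>+u. K k (s - u) * (H u)\<^sup>2 \<partial>lborel) \<partial>lborel)"
    by (intro nn_integral_mono le)
  also have "\<dots> = I * (\<integral>\<^sup>+s. (\<integral>\<^sup>+u. K k (s - u) * (H u)\<^sup>2 \<partial>lborel) \<partial>lborel)"
    by (rule nn_integral_cmult) measurable
  also have "(\<integral>\<^sup>+s. (\<integral>\<^sup>+u. K k (s - u) * (H u)\<^sup>2 \<partial>lborel) \<partial>lborel)
      = (\<integral>\<^sup>+u. (\<integral>\<^sup>+s. K k (s - u) * (H u)\<^sup>2 \<partial>lborel) \<partial>lborel)"
    by (rule lborel_pair.Fubini') measurable
  also have "\<dots> = (\<integral>\<^sup>+u. I * (H u)\<^sup>2 \<partial>lborel)"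
    by (intro nn_integral_cong) (simp add: nn_integral_multc Ku I_def)
  also have "\<dots> = I * (\<integral>\<^sup>+u. (H u)\<^sup>2 \<partial>lborel)"
    by (rule nn_integral_cmult) measurable
  finally have "(\<integral>\<^sup>+s. (m s)\<^sup>2 \<partial>lebesgue) \<le> I * (I * (\<integral>\<^sup>+u. (H u)\<^sup>2 \<partial>lborel))" .
  also have "\<dots> < \<infinity>"
    using fin Kfin[OF k] by (simp add: I_def ennreal_mult_less_top)
  finally show "(\<integral>\<^sup>+s. (m s)\<^sup>2 \<partial>lebesgue) < \<infinity>" .
qed

text \<open>The data at a single \<open>x'\<close>: \<open>c\<close> stands for
  \<open>\<psi> x'\<close> and \<open>a\<close> for \<open>\<alpha> x'\<close>, and the alternative
  in the last assumption is confinement read on one line.\<close>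

locale fibre = positive_weight p for p :: "real \<Rightarrow> real" +
  fixes c :: real and a :: complex
  assumes c_pos: "0 < c" and norm_a: "cmod a = 1"
    and constant_or_integrable: "(AE s in lebesgue. p s = 1) \<or> integrable lebesgue p"
begin

lemma locally_integrable_p: "locally_integrable (\<lambda>s. complex_of_real (p s))"
  using constant_or_integrable
proof
  assume "AE s in lebesgue. p s = 1"
  then have "AE s in lebesgue. 1 = complex_of_real (p s)" by eventually_elim simp
  then show ?thesis
    by (intro locally_integrable_cong_AE[OF locally_integrable_continuous[of "\<lambda>s. 1"]]) auto
qed (auto intro: locally_integrable_integrable)

lemma locally_integrable_pc: "locally_integrable (\<lambda>s. complex_of_real (p s / c))"
  using locally_integrable_scale[OF locally_integrable_p, of "1 / of_real c"] by simp

lemma cmod_le_1_plus_square: "cmod x \<le> 1 + (cmod x)\<^sup>2"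
proof -
  have "2 * cmod x \<le> 1 + (cmod x)\<^sup>2"
    using zero_le_power2[of "cmod x - 1"] by (simp add: power2_eq_square algebra_simps)
  then show ?thesis using norm_ge_zero[of x] by linarith
qed

text \<open>\<open>|x| \<le> 1 + |x|^2\<close> controls the derivative by \<open>p\<close> and
  \<open>p |h|^2\<close>, of which the second is integrable for \<open>h\<close> in the weighted
  space and the first is at least locally integrable.\<close>

lemma drift_bound: "cmod (\<i> * of_real (p s / c) * x) \<le> (p s + p s * (cmod x)\<^sup>2) / c"
proof -
  have "p s * cmod x \<le> p s * (1 + (cmod x)\<^sup>2)"
    using weight_pos[of s] by (intro mult_left_mono cmod_le_1_plus_square) simp
  then show ?thesis
    using c_pos weight_pos[of s] by (simp add: norm_mult norm_divide divide_right_mono algebra_simps)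
qed

lemma drift_measurable:
  "h \<in> borel_measurable lebesgue \<Longrightarrow> (\<lambda>s. \<i> * of_real (p s / c) * h s) \<in> borel_measurable lebesgue"
  by measurable

lemma locally_integrable_drift:
  assumes h: "h \<in> L2 (weighted p)"
  shows "locally_integrable (\<lambda>s. \<i> * of_real (p s / c) * h s)"
proof (rule locally_integrable_bound)
  show "locally_integrable (\<lambda>s. complex_of_real (p s) + complex_of_real (p s * (cmod (h s))\<^sup>2))"
    using h by (intro locally_integrable_add locally_integrable_p locally_integrable_integrable integrable_of_real)
      (simp add: L2_weighted)
  show "(\<lambda>s. \<i> * of_real (p s / c) * h s) \<in> borel_measurable lebesgue"
    using h by (intro drift_measurable) (simp add: L2_weighted)
  have "cmod (\<i> * of_real (p s / c) * h s) \<le> (1 / c) * cmod (complex_of_real (p s) + complex_of_real (p s * (cmod (h s))\<^sup>2))" for s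
    using drift_bound[of s "h s"] weight_pos[of s] unfolding of_real_add[symmetric] norm_of_real by simp
  then show "\<exists>C. AE s in lebesgue. s \<in> K \<longrightarrow> cmod (\<i> * of_real (p s / c) * h s)
      \<le> C * cmod (complex_of_real (p s) + complex_of_real (p s * (cmod (h s))\<^sup>2))" for K
    by (intro exI[of _ "1 / c"] AE_I2) simp
qed

lemma integrable_drift:
  assumes p: "integrable lebesgue p" and h: "h \<in> L2 (weighted p)"
  shows "integrable lebesgue (\<lambda>s. \<i> * of_real (p s / c) * h s)"
proof (rule Bochner_Integration.integrable_bound)
  show "integrable lebesgue (\<lambda>s. (p s + p s * (cmod (h s))\<^sup>2) / c)"
    using p h by (simp add: L2_weighted)
  show "(\<lambda>s. \<i> * of_real (p s / c) * h s) \<in> borel_measurable lebesgue"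
    using h by (intro drift_measurable) (simp add: L2_weighted)
  show "AE s in lebesgue. norm (\<i> * of_real (p s / c) * h s) \<le> norm ((p s + p s * (cmod (h s))\<^sup>2) / c)"
    by (intro AE_I2) (simp only: real_norm_def order_trans[OF drift_bound abs_ge_self])
qed

lemma linear_transport: "linear_operator (weighted p) (transport_operator p c a)"
  unfolding linear_operator_def
proof (intro conjI allI impI)
  show "transport_operator p c a \<subseteq> L2 (weighted p) \<times> L2 (weighted p)"
    by (auto simp: transport_operator_def)
next
  fix f h f' h'
  assume fh: "(f, h) \<in> transport_operator p c a" and L: "f' \<in> L2 (weighted p)" "h' \<in> L2 (weighted p)"
    and ae: "AE x in weighted p. f' x = f x" "AE x in weighted p. h' x = h x"
  then obtain g0 A where g0: "AE s in lebesgue. f s = g0 s" "antiderivative g0 (\<lambda>s. \<i> * of_real (p s / c) * h s)"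
    "(g0 \<longlongrightarrow> A) at_bot" "(g0 \<longlongrightarrow> a * A) at_top"
    by (auto simp: transport_operator_def)
  have "AE s in lebesgue. \<i> * of_real (p s / c) * h s = \<i> * of_real (p s / c) * h' s"
    using ae(2) unfolding AE_weighted by eventually_elim simp
  then have "antiderivative g0 (\<lambda>s. \<i> * of_real (p s / c) * h' s)"
    using L by (intro antiderivative_cong_AE[OF g0(2)] drift_measurable L2_weighted_measurable)
  moreover have "AE s in lebesgue. f' s = g0 s"
    using ae(1) g0(1) unfolding AE_weighted by eventually_elim simp
  ultimately show "(f', h') \<in> transport_operator p c a"
    using L g0 by (auto simp: transport_operator_def)
next
  fix f h g k
  assume "(f, h) \<in> transport_operator p c a" "(g, k) \<in> transport_operator p c a"
  then obtain f0 A g0 B where L: "f \<in> L2 (weighted p)" "h \<in> L2 (weighted p)" "g \<in> L2 (weighted p)" "k \<in> L2 (weighted p)"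
    and f0: "AE s in lebesgue. f s = f0 s" "antiderivative f0 (\<lambda>s. \<i> * of_real (p s / c) * h s)"
      "(f0 \<longlongrightarrow> A) at_bot" "(f0 \<longlongrightarrow> a * A) at_top"
    and g0: "AE s in lebesgue. g s = g0 s" "antiderivative g0 (\<lambda>s. \<i> * of_real (p s / c) * k s)"
      "(g0 \<longlongrightarrow> B) at_bot" "(g0 \<longlongrightarrow> a * B) at_top"
    by (auto simp: transport_operator_def)
  have "antiderivative (\<lambda>s. f0 s + g0 s) (\<lambda>s. \<i> * of_real (p s / c) * (h s + k s))"
    using antiderivative_add[OF f0(2) g0(2)] by (simp add: distrib_left)
  moreover have "AE s in lebesgue. f s + g s = f0 s + g0 s"
    using f0(1) g0(1) by eventually_elim simp
  moreover have "((\<lambda>s. f0 s + g0 s) \<longlongrightarrow> a * (A + B)) at_top"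
    using tendsto_add[OF f0(4) g0(4)] by (simp add: distrib_left)
  ultimately show "(\<lambda>x. f x + g x, \<lambda>x. h x + k x) \<in> transport_operator p c a"
    using L tendsto_add[OF f0(3) g0(3)] by (intro transport_operatorI L2_add)
next
  fix d f h
  assume "(f, h) \<in> transport_operator p c a"
  then obtain f0 A where L: "f \<in> L2 (weighted p)" "h \<in> L2 (weighted p)"
    and f0: "AE s in lebesgue. f s = f0 s" "antiderivative f0 (\<lambda>s. \<i> * of_real (p s / c) * h s)"
      "(f0 \<longlongrightarrow> A) at_bot" "(f0 \<longlongrightarrow> a * A) at_top"
    by (auto simp: transport_operator_def)
  have "antiderivative (\<lambda>s. d * f0 s) (\<lambda>s. \<i> * of_real (p s / c) * (d * h s))"
    using antiderivative_scale[OF f0(2), of d] by (simp add: mult_ac)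
  moreover have "AE s in lebesgue. d * f s = d * f0 s"
    using f0(1) by eventually_elim simp
  moreover have "((\<lambda>s. d * f0 s) \<longlongrightarrow> a * (d * A)) at_top"
    using tendsto_mult_left[OF f0(4), of d] by (simp add: mult_ac)
  ultimately show "(\<lambda>x. d * f x, \<lambda>x. d * h x) \<in> transport_operator p c a"
    using L tendsto_mult_left[OF f0(3), of d] by (intro transport_operatorI L2_scale)
next
  fix f h h'
  assume T: "(f, h) \<in> transport_operator p c a" "(f, h') \<in> transport_operator p c a"
  \<comment> \<open>Single-valuedness is uniqueness of the weak derivative together with
    \<open>p s / c \<noteq> 0\<close>.\<close>
  have "has_weak_derivative 1 f (\<lambda>s. \<i> * of_real (p s / c) * h s)"
    "has_weak_derivative 1 f (\<lambda>s. \<i> * of_real (p s / c) * h' s)"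
    unfolding has_weak_derivative_iff_antiderivative
    using T by (auto simp: transport_operator_def L2_weighted)
  from has_weak_derivative_unique[OF this] show "AE x in weighted p. h x = h' x"
    unfolding AE_weighted
  proof eventually_elim
    case (elim s)
    then show ?case using c_pos weight_pos[of s] by simp
  qed
qed

text \<open>The derivative of \<open>f0 * cnj g0\<close> integrates to the difference of the limits
  at the two ends. The boundary condition multiplies the limit at minus infinity by
  \<open>a * cnj a = 1\<close>, so the difference is 0, while the integral is a multiple of the
  defect of symmetry.\<close>

lemma symmetric_transport: "symmetric_operator (weighted p) (transport_operator p c a)"
  unfolding symmetric_operator_def
proof (intro ballI, clarify)
  fix f h g k
  assume "(f, h) \<in> transport_operator p c a" "(g, k) \<in> transport_operator p c a"
  then obtain f0 A g0 B where L: "f \<in> L2 (weighted p)" "h \<in> L2 (weighted p)" "g \<in> L2 (weighted p)" "k \<in> L2 (weighted p)"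
    and f0: "AE s in lebesgue. f s = f0 s" "antiderivative f0 (\<lambda>s. \<i> * of_real (p s / c) * h s)"
      "(f0 \<longlongrightarrow> A) at_bot" "(f0 \<longlongrightarrow> a * A) at_top"
    and g0: "AE s in lebesgue. g s = g0 s" "antiderivative g0 (\<lambda>s. \<i> * of_real (p s / c) * k s)"
      "(g0 \<longlongrightarrow> B) at_bot" "(g0 \<longlongrightarrow> a * B) at_top"
    by (auto simp: transport_operator_def)
  define v where "v s = (\<i> * of_real (p s / c) * h s) * cnj (g0 s) + f0 s * cnj (\<i> * of_real (p s / c) * k s)" for s
  have fg: "antiderivative (\<lambda>s. f0 s * cnj (g0 s)) v"
    unfolding v_def by (rule antiderivative_mult[OF f0(2) antiderivative_cnj[OF g0(2)]])
  \<comment> \<open>The function \<open>v\<close> with \<open>f\<close> and \<open>g\<close> in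
    place of their representatives: its integrability comes from the products of square integrable
    functions and transfers to \<open>v\<close>.\<close>
  define r where "r s = (\<i> / of_real c) * (p s *\<^sub>R (h s * cnj (g s)) - p s *\<^sub>R (f s * cnj (k s)))" for s
  have r: "integrable lebesgue r" "(LINT s|lebesgue. r s) = (\<i> / of_real c) * (L2_inner (weighted p) h g - L2_inner (weighted p) f k)"
    unfolding r_def using L by (simp_all add: L2_inner_weighted)
  have rv: "AE s in lebesgue. r s = v s"
    using f0(1) g0(1) by eventually_elim (simp add: r_def v_def scaleR_conv_of_real algebra_simps diff_divide_distrib)
  have vm: "v \<in> borel_measurable lebesgue"
    by (rule locally_integrable_measurable[OF antiderivative_locally_integrable[OF fg]])
  have v: "integrable lebesgue v" "(LINT s|lebesgue. v s) = (LINT s|lebesgue. r s)"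
    using r(1) vm rv integrable_cong_AE[of r lebesgue v] integral_cong_AE[of r lebesgue v] by auto
  have "a * cnj a = 1"
    using norm_a by (simp add: complex_norm_square[symmetric])
  then have eq: "(a * A) * cnj (a * B) = A * cnj B"
    by (simp add: mult_ac)
  have "((\<lambda>s. f0 s * cnj (g0 s)) \<longlongrightarrow> A * cnj B) at_top"
    using tendsto_mult[OF f0(4) tendsto_cnj[OF g0(4)]] unfolding eq .
  moreover have "((\<lambda>s. f0 s * cnj (g0 s)) \<longlongrightarrow> A * cnj B) at_bot"
    by (intro tendsto_intros f0 g0)
  ultimately have "(LINT s|lebesgue. v s) = 0"
    using antiderivative_total[OF fg v(1)] by fastforce
  then show "L2_inner (weighted p) h g = L2_inner (weighted p) f k"
    using v(2) r(2) c_pos by simp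
qed

text \<open>The definition of \<open>boundary_constant\<close> tests integrability of
  \<open>p\<close>; this selects its other branch when \<open>p = 1\<close> almost
  everywhere.\<close>

lemma not_both: "AE s in lebesgue. p s = 1 \<Longrightarrow> \<not> integrable lebesgue p"
proof
  assume p: "AE s in lebesgue. p s = 1" "integrable lebesgue p"
  then have "integrable lebesgue (\<lambda>s::real. 1::real)"
    using integrable_cong_AE[of p lebesgue "\<lambda>s. 1"] by auto
  then show False by (simp add: integrable_iff_bounded)
qed

definition total :: real where
  "total = (LINT s|lebesgue. p s / c)"

lemma total_pos:
  assumes "integrable lebesgue p"
  shows "0 < total"
proof (rule ccontr)
  assume n: "\<not> 0 < total"
  have nn: "AE s in lebesgue. 0 \<le> p s / c" using c_pos weight_pos by (intro AE_I2) (simp add: less_imp_le)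
  have "0 \<le> total" unfolding total_def by (rule integral_nonneg_AE[OF nn])
  with n have "total = 0" by linarith
  then have "AE s in lebesgue. p s / c = 0"
    using integral_nonneg_eq_0_iff_AE[OF _ nn] assms by (simp add: total_def)
  then have "AE s::real in lebesgue. False"
  proof eventually_elim
    case (elim s)
    then show ?case using c_pos weight_pos[of s] by simp
  qed
  then show False using lebesgue_not_AE_False by blast
qed

text \<open>The modulus of the exponential is \<open>exp (- Im z * total)\<close>, which differs
  from 1 because \<open>total\<close> is positive.\<close>

lemma exp_total_nonreal:
  assumes "integrable lebesgue p" "Im z \<noteq> 0"
  shows "exp (\<i> * z * of_real total) \<noteq> a"
proof
  assume "exp (\<i> * z * of_real total) = a"
  then have "exp (- (Im z * total)) = 1"
    using norm_a norm_exp_eq_Re[of "\<i> * z * of_real total"] by simp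
  then show False using total_pos[OF assms(1)] assms(2) by simp
qed

lemma antiderivative_phase: "antiderivative (phase p c) (\<lambda>s. of_real (p s / c))"
  unfolding phase_def by (rule antiderivative_primitive[OF locally_integrable_pc])

lemma phase_0: "phase p c 0 = 0"
  by (simp add: phase_def primitive_0)

lemma phase_real: "Im (phase p c s) = 0"
proof -
  have "phase p c s = of_real (LINT u|lebesgue. (indicator {0..s} u - indicator {s..0} u) * (p u / c))"
    unfolding phase_def primitive_def
    by (subst integral_complex_of_real[symmetric]) (intro Bochner_Integration.integral_cong, auto simp: indicator_def)
  then show ?thesis by simp
qed

lemma phase_constant:
  assumes "AE s in lebesgue. p s = 1"
  shows "phase p c s = of_real (s / c)"
proof -
  have 1: "antiderivative (\<lambda>s. complex_of_real (s / c)) (\<lambda>s. of_real (1 / c))"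
    by (intro antiderivative_C1 has_vector_derivative_of_real)
      (use c_pos in \<open>auto intro!: derivative_eq_intros
        simp: has_real_derivative_iff_has_vector_derivative[symmetric]\<close>)
  have "antiderivative (\<lambda>s. phase p c s - of_real (s / c)) (\<lambda>s. 0)"
    using assms by (intro antiderivative_cong_AE[OF antiderivative_diff[OF antiderivative_phase 1]])
      (auto elim!: eventually_mono)
  from antiderivative_0[OF this, of 0 s] show ?thesis by (simp add: phase_0)
qed

lemma integrable_pc: "integrable lebesgue p \<Longrightarrow> integrable lebesgue (\<lambda>s. complex_of_real (p s / c))"
  by (intro integrable_of_real) simp

lemma antiderivative_exp_phase:
  "antiderivative (\<lambda>s. exp (\<i> * z * phase p c s)) (\<lambda>s. \<i> * z * of_real (p s / c) * exp (\<i> * z * phase p c s))"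
  by (rule antiderivative_exp[OF antiderivative_scale[OF antiderivative_phase]])

lemma locally_integrable_source:
  assumes "h \<in> L2 (weighted p)"
  shows "locally_integrable (source p c z h)"
proof -
  have "continuous_on UNIV (\<lambda>s. exp (- (\<i> * z * phase p c s)))"
    by (intro continuous_intros antiderivative_continuous[OF antiderivative_phase])
  from locally_integrable_mult_continuous[OF this locally_integrable_drift[OF assms]]
  show ?thesis by (simp add: source_def[abs_def])
qed

text \<open>Valid for every constant \<open>k\<close>: the formula is the general solution of the
  first-order equation, and only the choice of \<open>k\<close> brings in the behaviour at
  infinity.\<close>

lemma antiderivative_resolvent_form:
  fixes k z :: complex
  assumes h: "h \<in> L2 (weighted p)"
  defines "g \<equiv> \<lambda>s. exp (\<i> * z * phase p c s) * (k + primitive (source p c z h) s)"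
  shows "antiderivative g (\<lambda>s. \<i> * of_real (p s / c) * (h s + z * g s))"
proof -
  have y: "antiderivative (\<lambda>s. k + primitive (source p c z h) s) (source p c z h)"
    using antiderivative_add[OF antiderivative_const[of k] antiderivative_primitive[OF locally_integrable_source[OF h]]]
    by simp
  have "exp (\<i> * z * phase p c s) * source p c z h s = \<i> * of_real (p s / c) * h s" for s
    by (simp add: source_def mult.assoc[symmetric] flip: exp_add)
  then have "(\<lambda>s. \<i> * z * of_real (p s / c) * exp (\<i> * z * phase p c s) * (k + primitive (source p c z h) s)
      + exp (\<i> * z * phase p c s) * source p c z h s) = (\<lambda>s. \<i> * of_real (p s / c) * (h s + z * g s))"
    by (simp add: g_def fun_eq_iff distrib_left mult_ac)
  with antiderivative_mult[OF antiderivative_exp_phase[of z] y] show ?thesis unfolding g_def by (simp only:)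
qed

end

text \<open>Approximate eigenvectors contradict any resolvent bound \<open>C\<close>: the precision
  \<open>1 / (|C| + 1)\<close> suffices, and the added 1 keeps it defined for
  \<open>C = 0\<close>.\<close>

lemma approximate_eigenvectors_imp_spectrum:
  assumes "\<And>\<epsilon>. \<epsilon> > 0 \<Longrightarrow> \<exists>(f, k) \<in> T. 0 < L2_norm M f \<and> L2_norm M (\<lambda>x. k x - z * f x) \<le> \<epsilon> * L2_norm M f"
  shows "z \<in> spectrum M T"
proof (rule ccontr)
  assume "z \<notin> spectrum M T"
  then obtain C where C: "\<And>f k. (f, k) \<in> T \<Longrightarrow> L2_norm M f \<le> C * L2_norm M (\<lambda>x. k x - z * f x)"
    unfolding spectrum_def resolvent_set_def by blast
  define D where "D = \<bar>C\<bar> + 1"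
  have D: "0 < D" "C \<le> D" "\<bar>C\<bar> < D" by (auto simp: D_def)
  obtain f k where fk: "(f, k) \<in> T" "0 < L2_norm M f" "L2_norm M (\<lambda>x. k x - z * f x) \<le> (1 / D) * L2_norm M f"
    using assms[of "1 / D"] D by auto
  have "L2_norm M f \<le> \<bar>C\<bar> * L2_norm M (\<lambda>x. k x - z * f x)"
    using C[OF fk(1)] by (rule order_trans) (intro mult_right_mono, simp_all add: L2_norm_nonneg)
  also have "\<dots> \<le> \<bar>C\<bar> * ((1 / D) * L2_norm M f)"
    using fk(3) by (intro mult_left_mono) auto
  also have "\<dots> = (\<bar>C\<bar> / D) * L2_norm M f" by simp
  also have "\<dots> < 1 * L2_norm M f"
    using D fk(2) by (intro mult_strict_right_mono) auto
  finally show False by simp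
qed

section \<open>The explicit resolvent and the spectrum of one fibre\<close>

context fibre
begin

lemma phase_bound:
  assumes "integrable lebesgue p"
  shows "cmod (phase p c s) \<le> total"
proof -
  have "(LINT u|lebesgue. cmod (complex_of_real (p u / c))) = total"
    unfolding total_def norm_of_real using weight_pos c_pos
    by (intro Bochner_Integration.integral_cong) (auto simp: less_imp_le)
  then show ?thesis
    using antiderivative_increment_bound[OF antiderivative_phase integrable_pc[OF assms], of s 0]
    by (simp add: phase_0 del: of_real_divide)
qed

lemma exp_phase_bound:
  assumes "integrable lebesgue p"
  shows "cmod (exp (\<i> * z * phase p c s)) \<le> exp (cmod z * total)"
    "cmod (exp (- (\<i> * z * phase p c s))) \<le> exp (cmod z * total)"
proof -
  have b: "cmod (\<i> * z * phase p c s) \<le> cmod z * total"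
    using phase_bound[OF assms, of s] by (simp add: norm_mult mult_left_mono)
  show "cmod (exp (\<i> * z * phase p c s)) \<le> exp (cmod z * total)"
    using b by (intro order_trans[OF norm_exp]) (simp only: exp_le_cancel_iff)
  show "cmod (exp (- (\<i> * z * phase p c s))) \<le> exp (cmod z * total)"
    using b by (intro order_trans[OF norm_exp]) (simp only: exp_le_cancel_iff norm_minus_cancel)
qed

lemma source_measurable: "h \<in> L2 (weighted p) \<Longrightarrow> source p c z h \<in> borel_measurable lebesgue"
  by (rule locally_integrable_measurable[OF locally_integrable_source])

lemma integrable_source:
  assumes p: "integrable lebesgue p" and h: "h \<in> L2 (weighted p)"
  shows "integrable lebesgue (source p c z h)"
proof (rule Bochner_Integration.integrable_bound)
  show "integrable lebesgue (\<lambda>s. exp (cmod z * total) *\<^sub>R (\<i> * of_real (p s / c) * h s))"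
    by (intro integrable_scaleR_right integrable_drift assms)
  show "AE s in lebesgue. norm (source p c z h s) \<le> norm (exp (cmod z * total) *\<^sub>R (\<i> * of_real (p s / c) * h s))"
    unfolding source_def norm_mult[of "exp _"] norm_scaleR
    using exp_phase_bound(2)[OF p] by (intro AE_I2 mult_right_mono) auto
qed (rule source_measurable[OF h])

lemma one_L2: "integrable lebesgue p \<Longrightarrow> (\<lambda>s. 1) \<in> L2 (weighted p)"
  by (simp add: L2_weighted)

lemma one_norm: "integrable lebesgue p \<Longrightarrow> (L2_norm (weighted p) (\<lambda>s. 1))\<^sup>2 = c * total"
proof -
  have "(L2_norm (weighted p) (\<lambda>s. 1))\<^sup>2 = (LINT s|weighted p. (1::real))"
    by (simp only: L2_norm_power2 norm_one one_power2)
  also have "\<dots> = (LINT s|lebesgue. p s *\<^sub>R (1::real))" by (rule integral_weighted) simp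
  finally show ?thesis using c_pos by (simp add: total_def)
qed

lemma bounded_L2:
  assumes "integrable lebesgue p" "g \<in> borel_measurable lebesgue" "\<And>s. cmod (g s) \<le> C"
  shows "g \<in> L2 (weighted p)"
  using assms(2,3) by (intro L2_bound[OF one_L2[OF assms(1)], of _ C]) (auto simp: measurable_weighted)

lemma phase_limits:
  assumes "integrable lebesgue p"
  shows "(phase p c \<longlongrightarrow> (LINT u:{0..}|lebesgue. of_real (p u / c))) at_top"
    and "(phase p c \<longlongrightarrow> - (LINT u:{..0}|lebesgue. of_real (p u / c))) at_bot"
    and "(LINT u:{0..}|lebesgue. complex_of_real (p u / c)) + (LINT u:{..0}|lebesgue. of_real (p u / c)) = of_real total"
proof -
  show lim: "(phase p c \<longlongrightarrow> (LINT u:{0..}|lebesgue. of_real (p u / c))) at_top"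
     "(phase p c \<longlongrightarrow> - (LINT u:{..0}|lebesgue. of_real (p u / c))) at_bot"
    using antiderivative_tendsto[OF antiderivative_phase integrable_pc[OF assms]] by (simp_all add: phase_0 del: of_real_divide)
  show "(LINT u:{0..}|lebesgue. complex_of_real (p u / c)) + (LINT u:{..0}|lebesgue. of_real (p u / c)) = of_real total"
    using antiderivative_total[OF antiderivative_phase integrable_pc[OF assms] lim(2,1)]
    by (simp add: total_def del: of_real_divide)
qed

text \<open>All factors are bounded and the weighted measure is finite, so square integrability is
  immediate and the boundary condition is the only issue. It is a linear equation for the constant,
  solvable because \<open>exp (i z total)\<close> differs from \<open>a\<close>.\<close>

lemma resolvent_integrable_case:
  assumes h: "h \<in> L2 (weighted p)" and p: "integrable lebesgue p" and z: "exp (\<i> * z * of_real total) \<noteq> a"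
  shows "(resolvent p c a z h, \<lambda>s. h s + z * resolvent p c a z h s) \<in> transport_operator p c a"
proof -
  define g where "g = resolvent p c a z h"
  define k where "k = boundary_constant p c a z h"
  define y where "y = primitive (source p c z h)"
  define P1 where "P1 = (LINT u:{0..}|lebesgue. complex_of_real (p u / c))"
  define P0 where "P0 = (LINT u:{..0}|lebesgue. complex_of_real (p u / c))"
  define Y1 where "Y1 = (LINT u:{0..}|lebesgue. source p c z h u)"
  define Y0 where "Y0 = (LINT u:{..0}|lebesgue. source p c z h u)"
  have geq: "g = (\<lambda>s. exp (\<i> * z * phase p c s) * (k + y s))"
    by (simp add: g_def k_def y_def resolvent_def[abs_def])
  have ga: "antiderivative g (\<lambda>s. \<i> * of_real (p s / c) * (h s + z * g s))"
    unfolding geq y_def by (rule antiderivative_resolvent_form[OF h])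
  have si: "integrable lebesgue (source p c z h)" by (rule integrable_source[OF p h])
  have ya: "antiderivative y (source p c z h)"
    unfolding y_def by (rule antiderivative_primitive[OF locally_integrable_source[OF h]])
  have y0: "y 0 = 0" by (simp add: y_def primitive_0)
  have ylim: "(y \<longlongrightarrow> Y1) at_top" "(y \<longlongrightarrow> - Y0) at_bot"
    using antiderivative_tendsto[OF ya si] by (simp_all add: y0 Y1_def Y0_def)
  note plim = phase_limits[OF p, folded P1_def P0_def]
  have bot: "(g \<longlongrightarrow> exp (\<i> * z * - P0) * (k + - Y0)) at_bot"
    unfolding geq by (intro tendsto_mult tendsto_exp tendsto_add tendsto_const ylim plim)
  have top: "(g \<longlongrightarrow> exp (\<i> * z * P1) * (k + Y1)) at_top"
    unfolding geq by (intro tendsto_mult tendsto_exp tendsto_add tendsto_const ylim plim)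
  have glim: "(g \<longlongrightarrow> exp (\<i> * z * P1) * (k + Y1)) at_top" "(g \<longlongrightarrow> exp (- (\<i> * z * P0)) * (k - Y0)) at_bot"
    using top bot by simp_all
  \<comment> \<open>\<open>E1\<close> and \<open>E0\<close> are the limits of the exponential at
    plus and minus infinity. Their quotient is \<open>exp (i z total)\<close>, so the denominator
    \<open>E1 - a * E0\<close> is nonzero by hypothesis.\<close>
  define E1 where "E1 = exp (\<i> * z * P1)"
  define E0 where "E0 = exp (- (\<i> * z * P0))"
  have "E1 = exp (\<i> * z * of_real total) * E0"
    unfolding E1_def E0_def plim(3)[symmetric] by (simp add: distrib_left flip: exp_add)
  moreover have "E0 \<noteq> 0" by (simp add: E0_def)
  ultimately have D: "E1 - a * E0 \<noteq> 0" using z by auto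
  have "k = (- a * E0 * Y0 - E1 * Y1) / (E1 - a * E0)"
    using p by (simp add: k_def boundary_constant_def E1_def E0_def P1_def P0_def Y1_def Y0_def del: of_real_divide)
  then have "k * (E1 - a * E0) = - a * E0 * Y0 - E1 * Y1" using D by simp
  then have bc: "E1 * (k + Y1) = a * (E0 * (k - Y0))" by (simp add: algebra_simps)
  have gm: "g \<in> borel_measurable lebesgue"
    by (intro continuous_imp_borel_lebesgue antiderivative_continuous[OF ga])
  have gb: "cmod (g s) \<le> exp (cmod z * total) * (cmod k + (LINT u|lebesgue. cmod (source p c z h u)))" for s
  proof -
    have "cmod (k + y s) \<le> cmod k + (LINT u|lebesgue. cmod (source p c z h u))"
      using antiderivative_increment_bound[OF ya si, of s 0]
      by (intro order_trans[OF norm_triangle_ineq] add_left_mono) (simp add: y0)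
    then show ?thesis
      unfolding geq norm_mult by (intro mult_mono exp_phase_bound p) auto
  qed
  have gL: "g \<in> L2 (weighted p)" by (rule bounded_L2[OF p gm gb])
  show ?thesis
    unfolding g_def[symmetric]
    by (rule transport_operatorI[OF gL L2_add[OF h L2_scale[OF gL]] _ ga glim(2)])
      (use glim(1) bc in \<open>simp_all add: E1_def E0_def\<close>)
qed

text \<open>The formula is a one-sided convolution of \<open>h\<close> with a decaying exponential,
  dominated by the two-sided one, so Young's inequality makes it square integrable. Its derivative
  is then square integrable as well, both limits are 0, and the boundary condition holds whatever
  \<open>a\<close> is.\<close>

lemma resolvent_constant_case:
  assumes h: "h \<in> L2 (weighted p)" and p: "AE s in lebesgue. p s = 1" and z: "Im z \<noteq> 0"
  shows "(resolvent p c a z h, \<lambda>s. h s + z * resolvent p c a z h s) \<in> transport_operator p c a"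
proof -
  define g where "g = resolvent p c a z h"
  define k where "k = boundary_constant p c a z h"
  define y where "y = primitive (source p c z h)"
  define w where "w = source p c z h"
  define \<kappa> where "\<kappa> = \<bar>Im z\<bar> / c"
  have \<kappa>: "0 < \<kappa>" using z c_pos by (simp add: \<kappa>_def)
  have L2eq: "f \<in> L2 (weighted p) \<longleftrightarrow> f \<in> L2 lebesgue" for f
  proof -
    have "integrable lebesgue (\<lambda>x. p x * (cmod (f x))\<^sup>2) \<longleftrightarrow> integrable lebesgue (\<lambda>x. (cmod (f x))\<^sup>2)"
      if [measurable]: "f \<in> borel_measurable lebesgue"
      using p by (intro integrable_cong_AE) auto
    then show ?thesis unfolding L2_weighted by (auto simp: L2_def)
  qed
  have hL: "h \<in> L2 lebesgue" using h by (simp add: L2eq)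
  have geq: "g = (\<lambda>s. exp (\<i> * z * phase p c s) * (k + y s))"
    by (simp add: g_def k_def y_def resolvent_def[abs_def])
  have ga: "antiderivative g (\<lambda>s. \<i> * of_real (p s / c) * (h s + z * g s))"
    unfolding geq y_def by (rule antiderivative_resolvent_form[OF h])
  have ya: "antiderivative y w"
    unfolding y_def w_def by (rule antiderivative_primitive[OF locally_integrable_source[OF h]])
  have y0: "y 0 = 0" by (simp add: y_def primitive_0)
  have wm[measurable]: "w \<in> borel_measurable lebesgue" unfolding w_def by (rule source_measurable[OF h])
  define m where "m s = (\<integral>\<^sup>+u. ennreal (exp (- (\<kappa> * \<bar>s - u\<bar>)) * cmod (h u)) \<partial>lebesgue)" for s
  have m: "m s < \<infinity>" "(\<integral>\<^sup>+s. (m s)\<^sup>2 \<partial>lebesgue) < \<infinity>" "m \<in> borel_measurable lebesgue" for s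
    unfolding m_def[abs_def] by (rule exponential_convolution[OF \<kappa> hL])+
  \<comment> \<open>The half-line on which the exponential kernel decays away from \<open>s\<close>;
    its direction depends on the sign of \<open>Im z\<close>.\<close>
  define I where "I s = (if Im z > 0 then {..s} else {s..})" for s :: real
  have Im: "I s \<in> sets lebesgue" for s by (simp add: I_def)
  have e: "cmod (exp (\<i> * z * phase p c s)) = exp (- (Im z * s / c))" for s
    by (simp add: phase_constant[OF p] del: of_real_divide)
  have wn: "AE u in lebesgue. cmod (w u) = exp (Im z * u / c) * cmod (h u) / c"
    using p
  proof eventually_elim
    case (elim u)
    then show ?case
      using c_pos by (simp add: w_def source_def phase_constant[OF p] norm_mult norm_divide del: of_real_divide)
  qed
  have bound: "(\<integral>\<^sup>+u. ennreal (norm (indicator (I s) u *\<^sub>R w u)) \<partial>lebesgue)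
      \<le> ennreal (exp (Im z * s / c) / c) * m s" for s
  proof -
    have "(\<integral>\<^sup>+u. ennreal (norm (indicator (I s) u *\<^sub>R w u)) \<partial>lebesgue)
        \<le> (\<integral>\<^sup>+u. ennreal (exp (Im z * s / c) / c) * ennreal (exp (- (\<kappa> * \<bar>s - u\<bar>)) * cmod (h u)) \<partial>lebesgue)"
    proof (rule nn_integral_mono_AE, use wn in eventually_elim)
      case (elim u)
      show ?case
      proof (cases "u \<in> I s")
        case True
        then have "\<bar>Im z\<bar> * \<bar>s - u\<bar> = Im z * (s - u)"
          by (auto simp: I_def algebra_simps split: if_splits)
        then have E: "Im z * u / c = Im z * s / c - \<kappa> * \<bar>s - u\<bar>"
          using c_pos by (simp add: \<kappa>_def field_simps)
        have "cmod (w u) = exp (Im z * s / c) / c * (exp (- (\<kappa> * \<bar>s - u\<bar>)) * cmod (h u))"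
          unfolding elim E diff_conv_add_uminus exp_add by simp
        then show ?thesis using True c_pos by (simp add: ennreal_mult[symmetric])
      qed simp
    qed
    also have "\<dots> = ennreal (exp (Im z * s / c) / c) * m s"
    proof -
      have [measurable]: "(\<lambda>u. exp (- (\<kappa> * \<bar>s - u\<bar>))) \<in> borel_measurable lebesgue"
        by (intro continuous_imp_borel_lebesgue continuous_intros)
      have [measurable]: "h \<in> borel_measurable lebesgue" by (rule L2_measurable[OF hL])
      show ?thesis unfolding m_def by (rule nn_integral_cmult) measurable
    qed
    finally show ?thesis .
  qed
  have wi: "set_integrable lebesgue (I s) w" for s
    unfolding set_integrable_def integrable_iff_bounded
  proof
    show "(\<lambda>x. indicator (I s) x *\<^sub>R w x) \<in> borel_measurable lebesgue"
      using Im by (intro borel_measurable_scaleR borel_measurable_indicator wm)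
    show "(\<integral>\<^sup>+u. ennreal (norm (indicator (I s) u *\<^sub>R w u)) \<partial>lebesgue) < \<infinity>"
      using bound[of s] m(1)[of s] by (auto intro: le_less_trans simp: ennreal_mult_less_top)
  qed
  \<comment> \<open>Here the choice made in \<open>boundary_constant\<close> pays off: constant and
    primitive merge, up to sign, into one integral over \<open>I s\<close>.\<close>
  have ky: "cmod (k + y s) = cmod (LINT u:I s|lebesgue. w u)" for s
  proof (cases "Im z > 0")
    case True
    have wi': "set_integrable lebesgue {..s} w" for s using wi[of s] True by (simp add: I_def)
    have "k = (LINT u:{..0}|lebesgue. w u)"
      using not_both[OF p] True by (simp add: k_def boundary_constant_def w_def)
    moreover have "(LINT u:{..s}|lebesgue. w u) = (LINT u:{..0}|lebesgue. w u) + y s"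
    proof (cases "0 \<le> s")
      case True
      then show ?thesis
        using set_integral_Iic_split[OF wi' True] antiderivative_eq[OF ya True] y0 by simp
    next
      case False
      then have s: "s \<le> 0" by simp
      then show ?thesis
        using set_integral_Iic_split[OF wi' s] unfolding antiderivative_eq[OF ya s, symmetric] y0 by simp
    qed
    ultimately show ?thesis using True by (simp add: I_def)
  next
    case False
    have wi': "set_integrable lebesgue {s..} w" for s using wi[of s] False by (simp add: I_def)
    have "k = - (LINT u:{0..}|lebesgue. w u)"
      using not_both[OF p] False by (simp add: k_def boundary_constant_def w_def)
    moreover have "(LINT u:{s..}|lebesgue. w u) = (LINT u:{0..}|lebesgue. w u) - y s"
    proof (cases "0 \<le> s")
      case True
      then show ?thesis
        using set_integral_Ici_split[OF wi' True] antiderivative_eq[OF ya True] y0 by simp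
    next
      case False
      then have s: "s \<le> 0" by simp
      then show ?thesis
        using set_integral_Ici_split[OF wi' s] unfolding antiderivative_eq[OF ya s, symmetric] y0 by simp
    qed
    ultimately have "k + y s = - (LINT u:{s..}|lebesgue. w u)" by simp
    then show ?thesis using False by (simp add: I_def)
  qed
  have gb: "ennreal (cmod (g s)) \<le> ennreal (1 / c) * m s" for s
  proof -
    have "ennreal (cmod (g s)) = ennreal (exp (- (Im z * s / c))) * ennreal (cmod (LINT u:I s|lebesgue. w u))"
      unfolding geq norm_mult e ky by (simp add: ennreal_mult)
    also have "\<dots> \<le> ennreal (exp (- (Im z * s / c))) * (ennreal (exp (Im z * s / c) / c) * m s)"
    proof (rule mult_left_mono)
      have "ennreal (cmod (LINT u:I s|lebesgue. w u)) \<le> (\<integral>\<^sup>+u. ennreal (norm (indicator (I s) u *\<^sub>R w u)) \<partial>lebesgue)"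
        unfolding set_lebesgue_integral_def
        by (rule integral_norm_bound_ennreal) (use wi[of s] in \<open>simp add: set_integrable_def\<close>)
      then show "ennreal (cmod (LINT u:I s|lebesgue. w u)) \<le> ennreal (exp (Im z * s / c) / c) * m s"
        using bound[of s] by (rule order_trans)
    qed simp
    also have "\<dots> = (ennreal (exp (- (Im z * s / c))) * ennreal (exp (Im z * s / c) / c)) * m s"
      by (simp add: mult.assoc)
    also have "ennreal (exp (- (Im z * s / c))) * ennreal (exp (Im z * s / c) / c) = ennreal (1 / c)"
      using c_pos by (simp add: ennreal_mult[symmetric] exp_minus)
    finally show ?thesis .
  qed
  have gm: "g \<in> borel_measurable lebesgue"
    by (intro continuous_imp_borel_lebesgue antiderivative_continuous[OF ga])
  have gL: "g \<in> L2 lebesgue"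
    unfolding L2_iff_nn_integral
  proof
    have "(\<integral>\<^sup>+s. ennreal ((cmod (g s))\<^sup>2) \<partial>lebesgue) \<le> (\<integral>\<^sup>+s. (ennreal (1 / c))\<^sup>2 * (m s)\<^sup>2 \<partial>lebesgue)"
    proof (rule nn_integral_mono)
      fix s
      have "(ennreal (cmod (g s)))\<^sup>2 \<le> (ennreal (1 / c) * m s)\<^sup>2"
        using gb[of s] by (intro power_mono) auto
      then show "ennreal ((cmod (g s))\<^sup>2) \<le> (ennreal (1 / c))\<^sup>2 * (m s)\<^sup>2"
        by (simp add: ennreal_power power_mult_distrib)
    qed
    also have "\<dots> = (ennreal (1 / c))\<^sup>2 * (\<integral>\<^sup>+s. (m s)\<^sup>2 \<partial>lebesgue)"
      using m(3) by (intro nn_integral_cmult) measurable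
    also have "\<dots> < \<infinity>" using m(2) c_pos by (simp add: ennreal_mult_less_top ennreal_power)
    finally show "(\<integral>\<^sup>+s. ennreal ((cmod (g s))\<^sup>2) \<partial>lebesgue) < \<infinity>" .
  qed (rule gm)
  have "(\<lambda>s. \<i> * of_real (p s / c) * (h s + z * g s)) \<in> L2 lebesgue"
  proof (rule L2_bound)
    show "(\<lambda>s. h s + z * g s) \<in> L2 lebesgue" by (intro L2_add L2_scale hL gL)
    show "AE s in lebesgue. cmod (\<i> * of_real (p s / c) * (h s + z * g s)) \<le> (1 / c) * cmod (h s + z * g s)"
      using p by eventually_elim (use c_pos in \<open>simp add: norm_mult norm_divide\<close>)
    show "(\<lambda>s. \<i> * of_real (p s / c) * (h s + z * g s)) \<in> borel_measurable lebesgue"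
      using L2_measurable[OF L2_add[OF hL L2_scale[OF gL, of z]]] by (rule drift_measurable)
  qed
  note lim = antiderivative_L2_tendsto_0[OF ga gL this]
  show ?thesis
    unfolding g_def[symmetric]
  proof (rule transport_operatorI[OF _ L2_add[OF h L2_scale] _ ga lim(2)])
    show "(g \<longlongrightarrow> a * 0) at_top" using lim(1) by simp
  qed (use gL in \<open>simp_all add: L2eq\<close>)
qed

text \<open>The points at which the explicit formula is a resolvent: the denominator of the constant
  is nonzero, or, without integrability, the exponentials decay. Real points can qualify in the
  first case.\<close>

definition regular :: "complex \<Rightarrow> bool" where
  "regular z \<longleftrightarrow> (if integrable lebesgue p then exp (\<i> * z * of_real total) \<noteq> a else Im z \<noteq> 0)"

lemma resolvent_in_transport:
  assumes "h \<in> L2 (weighted p)" "regular z"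
  shows "(resolvent p c a z h, \<lambda>s. h s + z * resolvent p c a z h s) \<in> transport_operator p c a"
  using assms constant_or_integrable resolvent_integrable_case resolvent_constant_case
  by (auto simp: regular_def split: if_splits)

lemma onto_shift_transport:
  assumes "regular z"
  shows "onto_shift (weighted p) (transport_operator p c a) z"
  unfolding onto_shift_def
proof
  fix h assume "h \<in> L2 (weighted p)"
  then show "\<exists>(f, k)\<in>transport_operator p c a. AE s in weighted p. k s - z * f s = h s"
    by (intro bexI[OF _ resolvent_in_transport[OF _ assms]]) auto
qed

lemma regular_nonreal: "Im z \<noteq> 0 \<Longrightarrow> regular z"
  by (simp add: regular_def exp_total_nonreal)

lemma self_adjoint_transport: "self_adjoint (weighted p) (transport_operator p c a)"
  by (intro self_adjointI linear_transport symmetric_transport onto_shift_transport regular_nonreal) auto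

lemma exp_phase_norm: "cmod (exp (\<i> * of_real t * phase p c s)) = 1"
  by (simp add: phase_real)

text \<open>Multiplication by \<open>exp (- i t phase)\<close>, of modulus 1, removes
  \<open>t\<close>: the increments of \<open>b\<close> are bounded by the integral \<open>V\<close>
  of the modulus of its derivative, and Cauchy-Schwarz bounds \<open>V\<close> by the norm of
  \<open>k - t g\<close>. The boundary condition bounds the limit \<open>B\<close> by
  \<open>V / d\<close>, so \<open>|b|\<close> is at most \<open>V (1 + 1/d)\<close>. The resulting
  constant involves the fibre only through \<open>total\<close> and \<open>d\<close>, which is what
  allows uniformity over the fibres.\<close>

lemma transport_lower_bound:
  fixes t :: real
  assumes p: "integrable lebesgue p" and t: "exp (\<i> * of_real t * of_real total) \<noteq> a"
    and gk: "(g, k) \<in> transport_operator p c a"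
  shows "L2_norm (weighted p) g \<le> total * (1 + 1 / cmod (a - exp (\<i> * of_real t * of_real total)))
    * L2_norm (weighted p) (\<lambda>s. k s - of_real t * g s)"
proof -
  obtain g0 A where L: "g \<in> L2 (weighted p)" "k \<in> L2 (weighted p)"
    and g0: "AE s in lebesgue. g s = g0 s" "antiderivative g0 (\<lambda>s. \<i> * of_real (p s / c) * k s)"
      "(g0 \<longlongrightarrow> A) at_bot" "(g0 \<longlongrightarrow> a * A) at_top"
    using gk by (elim transport_operatorE)
  define h where "h s = k s - of_real t * g s" for s
  have h: "h \<in> L2 (weighted p)" unfolding h_def by (intro L2_diff L2_scale L)
  define e where "e s = exp (\<i> * of_real (- t) * phase p c s)" for s
  have en: "cmod (e s) = 1" for s unfolding e_def by (rule exp_phase_norm)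
  define b where "b s = e s * g0 s" for s
  define v where "v s = \<i> * of_real (- t) * of_real (p s / c) * e s * g0 s + e s * (\<i> * of_real (p s / c) * k s)" for s
  have ba: "antiderivative b v"
    unfolding b_def v_def e_def by (rule antiderivative_mult[OF antiderivative_exp_phase g0(2)])
  define r where "r s = e s * (\<i> * of_real (p s / c) * h s)" for s
  have rs: "r = source p c (of_real t) h" by (simp add: r_def e_def source_def fun_eq_iff)
  have ri: "integrable lebesgue r" unfolding rs by (rule integrable_source[OF p h])
  have rv: "AE s in lebesgue. r s = v s"
    using g0(1) by eventually_elim (simp add: r_def v_def h_def algebra_simps diff_divide_distrib)
  have vm: "v \<in> borel_measurable lebesgue"
    by (rule locally_integrable_measurable[OF antiderivative_locally_integrable[OF ba]])
  have vi: "integrable lebesgue v"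
    using integrable_cong_AE[of r lebesgue v] ri vm rv by auto
  define V where "V = (LINT s|lebesgue. cmod (v s))"
  define N where "N = L2_norm (weighted p) (\<lambda>s. 1)"
  have N0: "0 \<le> N" by (simp add: N_def L2_norm_nonneg)
  have V: "V \<le> N * L2_norm (weighted p) h / c"
  proof -
    have hm[measurable]: "h \<in> borel_measurable lebesgue" using h by (rule L2_weighted_measurable)
    have "V = (LINT s|lebesgue. cmod (r s))"
      unfolding V_def using rv ri vm by (intro integral_cong_AE) auto
    also have "\<dots> = (LINT s|lebesgue. (p s * cmod (h s)) / c)"
      using c_pos weight_pos by (intro Bochner_Integration.integral_cong)
        (simp_all add: r_def norm_mult en norm_divide less_imp_le)
    also have "\<dots> = (LINT s|weighted p. cmod 1 * cmod (h s)) / c"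
      by (simp add: integral_weighted)
    also have "\<dots> \<le> N * L2_norm (weighted p) h / c"
      unfolding N_def using c_pos by (intro divide_right_mono L2_Cauchy_Schwarz one_L2 p h) simp
    finally show ?thesis .
  qed
  define P1 where "P1 = (LINT u:{0..}|lebesgue. complex_of_real (p u / c))"
  define P0 where "P0 = (LINT u:{..0}|lebesgue. complex_of_real (p u / c))"
  note plim = phase_limits[OF p, folded P1_def P0_def]
  define B where "B = exp (\<i> * of_real t * P0) * A"
  define d where "d = cmod (a - exp (\<i> * of_real t * of_real total))"
  have d: "0 < d" using t by (simp add: d_def)
  have limbot: "(b \<longlongrightarrow> B) at_bot"
    unfolding b_def B_def e_def using g0(3) plim(2) by (auto intro!: tendsto_eq_intros)
  have limtop: "(b \<longlongrightarrow> a * exp (- (\<i> * of_real t * of_real total)) * B) at_top"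
  proof -
    have "(b \<longlongrightarrow> exp (- (\<i> * of_real t * P1)) * (a * A)) at_top"
      unfolding b_def e_def using g0(4) plim(1) by (auto intro!: tendsto_eq_intros)
    moreover have "exp (- (\<i> * of_real t * P1)) = exp (- (\<i> * of_real t * of_real total)) * exp (\<i> * of_real t * P0)"
      unfolding plim(3)[symmetric] by (simp add: distrib_left flip: exp_add)
    ultimately show ?thesis by (simp add: B_def mult_ac)
  qed
  \<comment> \<open>The integral of the derivative is the difference of the limits, and by the
    boundary condition that is \<open>B\<close> times a factor of modulus \<open>d\<close>.\<close>
  have "a * exp (- (\<i> * of_real t * of_real total)) * B - B = (LINT s|lebesgue. v s)"
    by (rule antiderivative_total[OF ba vi limbot limtop])
  then have "cmod (a * exp (- (\<i> * of_real t * of_real total)) * B - B) \<le> V"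
    unfolding V_def using integral_norm_bound by metis
  moreover have "a * exp (- (\<i> * of_real t * of_real total)) * B - B
      = (a - exp (\<i> * of_real t * of_real total)) * exp (- (\<i> * of_real t * of_real total)) * B"
    by (simp add: left_diff_distrib flip: exp_add)
  ultimately have "d * cmod B \<le> V"
    by (simp add: norm_mult d_def)
  then have BV: "cmod B \<le> V / d" using d by (simp add: field_simps)
  have bs: "cmod (b s) \<le> V * (1 + 1 / d)" for s
  proof -
    have "cmod (b s - B) \<le> V"
    proof (rule tendsto_upperbound)
      show "((\<lambda>r. cmod (b s - b r)) \<longlongrightarrow> cmod (b s - B)) at_bot" by (intro tendsto_intros limbot)
      show "\<forall>\<^sub>F r in at_bot. cmod (b s - b r) \<le> V"
        unfolding V_def by (intro always_eventually allI antiderivative_increment_bound[OF ba vi])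
    qed simp
    then show ?thesis
      using BV norm_triangle_ineq[of "b s - B" B] by (simp add: algebra_simps)
  qed
  have "AE s in weighted p. cmod (g s) \<le> cmod (of_real (V * (1 + 1 / d)) * 1)"
    unfolding AE_weighted using g0(1)
  proof eventually_elim
    case (elim s)
    have "cmod (g s) = cmod (b s)" by (simp add: b_def norm_mult en elim)
    also have "\<dots> \<le> \<bar>V * (1 + 1 / d)\<bar>" using bs[of s] by simp
    finally show ?case by (simp del: of_real_mult of_real_add)
  qed
  then have "L2_norm (weighted p) g \<le> L2_norm (weighted p) (\<lambda>s. of_real (V * (1 + 1 / d)) * 1)"
    by (intro L2_norm_mono L L2_scale one_L2 p)
  also have "\<dots> = V * (1 + 1 / d) * N"
  proof -
    have "0 \<le> V" unfolding V_def by (rule integral_nonneg_AE) simp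
    then show ?thesis
      unfolding L2_norm_scale N_def[symmetric] norm_of_real using d by simp
  qed
  also have "\<dots> \<le> (N * L2_norm (weighted p) h / c) * (1 + 1 / d) * N"
    using V d N0 by (intro mult_right_mono) auto
  also have "\<dots> = (N\<^sup>2 / c) * (1 + 1 / d) * L2_norm (weighted p) h"
    by (simp add: power2_eq_square mult_ac)
  also have "N\<^sup>2 / c = total"
    using one_norm[OF p] c_pos by (simp add: N_def)
  finally show ?thesis by (simp add: h_def[abs_def] d_def)
qed

text \<open>From minus to plus infinity the exponential gains the factor
  \<open>exp (i t total)\<close>, and the hypothesis identifies this factor with the boundary
  condition.\<close>

lemma eigenfunction:
  fixes t :: real
  assumes p: "integrable lebesgue p" and t: "exp (\<i> * of_real t * of_real total) = a"
  shows "(\<lambda>s. exp (\<i> * of_real t * phase p c s), \<lambda>s. of_real t * exp (\<i> * of_real t * phase p c s))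
    \<in> transport_operator p c a"
proof -
  define e where "e s = exp (\<i> * of_real t * phase p c s)" for s
  have ea: "antiderivative e (\<lambda>s. \<i> * of_real (p s / c) * (of_real t * e s))"
    using antiderivative_exp_phase[of "of_real t"] by (simp add: e_def[abs_def] mult_ac)
  have em: "e \<in> borel_measurable lebesgue"
    by (intro continuous_imp_borel_lebesgue antiderivative_continuous[OF ea])
  have eL: "e \<in> L2 (weighted p)"
    by (rule bounded_L2[OF p em, of 1]) (simp only: e_def exp_phase_norm order_refl)
  define P1 where "P1 = (LINT u:{0..}|lebesgue. complex_of_real (p u / c))"
  define P0 where "P0 = (LINT u:{..0}|lebesgue. complex_of_real (p u / c))"
  note plim = phase_limits[OF p, folded P1_def P0_def]
  have bot: "(e \<longlongrightarrow> exp (- (\<i> * of_real t * P0))) at_bot"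
    unfolding e_def using plim(2) by (auto intro!: tendsto_eq_intros)
  have "(e \<longlongrightarrow> exp (\<i> * of_real t * P1)) at_top"
    unfolding e_def using plim(1) by (auto intro!: tendsto_eq_intros)
  also have "exp (\<i> * of_real t * P1) = a * exp (- (\<i> * of_real t * P0))"
    unfolding t[symmetric] plim(3)[symmetric] by (simp add: distrib_left flip: exp_add)
  finally have top: "(e \<longlongrightarrow> a * exp (- (\<i> * of_real t * P0))) at_top" .
  have "(e, \<lambda>s. of_real t * e s) \<in> transport_operator p c a"
    by (rule transport_operatorI[OF eL L2_scale[OF eL] _ ea bot top]) simp
  then show ?thesis by (simp add: e_def[abs_def])
qed

end

text \<open>A smooth form of \<open>exp (- \<delta> |s|)\<close>. Its derivative is at every point
  bounded by \<open>\<delta>\<close> times the function itself, which no nonzero cutoff of compact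
  support satisfies. The error of the approximate eigenfunction is thus a pointwise multiple of that
  function, which moreover vanishes nowhere.\<close>

definition cutoff :: "real \<Rightarrow> real \<Rightarrow> real" where
  "cutoff \<delta> s = exp (- (\<delta> * sqrt (1 + s\<^sup>2)))"

definition cutoff' :: "real \<Rightarrow> real \<Rightarrow> real" where
  "cutoff' \<delta> s = - (\<delta> * (s / sqrt (1 + s\<^sup>2))) * cutoff \<delta> s"

lemma cutoff_pos: "0 < cutoff \<delta> s"
  by (simp add: cutoff_def)

lemma cutoff'_bound:
  assumes "0 < \<delta>"
  shows "\<bar>cutoff' \<delta> s\<bar> \<le> \<delta> * cutoff \<delta> s"
proof -
  have "\<bar>s\<bar> \<le> sqrt (1 + s\<^sup>2)" by (rule real_le_rsqrt) simp
  moreover have "0 < sqrt (1 + s\<^sup>2)" by (simp add: add_pos_nonneg)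
  ultimately have "\<bar>s / sqrt (1 + s\<^sup>2)\<bar> \<le> 1" by (simp add: abs_divide)
  then have "\<delta> * \<bar>s / sqrt (1 + s\<^sup>2)\<bar> * cutoff \<delta> s \<le> \<delta> * 1 * cutoff \<delta> s"
    using assms cutoff_pos[of \<delta> s] by (intro mult_right_mono mult_left_mono) auto
  then show ?thesis
    using assms cutoff_pos[of \<delta> s] by (simp add: cutoff'_def abs_mult)
qed

lemma cutoff_derivative: "(cutoff \<delta> has_real_derivative cutoff' \<delta> s) (at s)"
proof -
  have "0 < 1 + s\<^sup>2" by (simp add: add_pos_nonneg)
  then show ?thesis
    unfolding cutoff_def[abs_def] cutoff'_def
    by (auto intro!: derivative_eq_intros simp: divide_simps)
qed

lemma cutoff_continuous: "continuous_on UNIV (cutoff \<delta>)" "continuous_on UNIV (cutoff' \<delta>)"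
proof -
  show c: "continuous_on UNIV (cutoff \<delta>)"
    unfolding cutoff_def[abs_def] by (intro continuous_intros)
  have "sqrt (1 + s\<^sup>2) \<noteq> 0" for s :: real
    by (metis add_pos_nonneg less_irrefl real_sqrt_eq_zero_cancel_iff zero_le_power2 zero_less_one)
  then show "continuous_on UNIV (cutoff' \<delta>)"
    unfolding cutoff'_def[abs_def] using c by (intro continuous_intros) auto
qed

lemma cutoff_le: "0 < \<delta> \<Longrightarrow> cutoff \<delta> s \<le> exp (- (\<delta> * \<bar>s\<bar>))"
  unfolding cutoff_def by (auto intro!: mult_left_mono real_le_rsqrt)

lemma cutoff_tendsto:
  assumes "0 < \<delta>"
  shows "(cutoff \<delta> \<longlongrightarrow> 0) at_top" "(cutoff \<delta> \<longlongrightarrow> 0) at_bot"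
proof -
  have "((\<lambda>s. exp (- (\<delta> * s))) \<longlongrightarrow> 0) at_top" "((\<lambda>s. exp (- (\<delta> * - s))) \<longlongrightarrow> 0) at_bot"
    using assms by real_asymp+
  then have lim: "((\<lambda>s. exp (- (\<delta> * \<bar>s\<bar>))) \<longlongrightarrow> 0) at_top" "((\<lambda>s. exp (- (\<delta> * \<bar>s\<bar>))) \<longlongrightarrow> 0) at_bot"
    by (auto elim!: Lim_transform_eventually
        intro: eventually_mono[OF eventually_ge_at_top[of 0]] eventually_mono[OF eventually_le_at_bot[of 0]])
  show "(cutoff \<delta> \<longlongrightarrow> 0) at_top" "(cutoff \<delta> \<longlongrightarrow> 0) at_bot"
    using cutoff_pos cutoff_le[OF assms]
    by (auto intro!: tendsto_sandwich[OF _ _ tendsto_const lim(1)] tendsto_sandwich[OF _ _ tendsto_const lim(2)]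
        simp: less_imp_le)
qed

lemma cutoff_square_integrable:
  assumes "0 < \<delta>"
  shows "integrable lebesgue (\<lambda>s. (cutoff \<delta> s)\<^sup>2)"
  unfolding integrable_iff_bounded
proof
  show "(\<lambda>s. (cutoff \<delta> s)\<^sup>2) \<in> borel_measurable lebesgue"
    by (intro continuous_imp_borel_lebesgue continuous_intros cutoff_continuous)
  have "(cutoff \<delta> s)\<^sup>2 \<le> exp (- (2 * \<delta> * \<bar>s\<bar>))" for s
  proof -
    have "(cutoff \<delta> s)\<^sup>2 \<le> (exp (- (\<delta> * \<bar>s\<bar>)))\<^sup>2"
      using cutoff_le[OF assms, of s] cutoff_pos[of \<delta> s] by (intro power_mono) auto
    then show ?thesis by (simp add: power2_eq_square mult.assoc flip: exp_add)
  qed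
  then have "(\<integral>\<^sup>+s. ennreal (norm ((cutoff \<delta> s)\<^sup>2)) \<partial>lebesgue) \<le> (\<integral>\<^sup>+s. ennreal (exp (- (2 * \<delta> * \<bar>s\<bar>))) \<partial>lebesgue)"
    by (intro nn_integral_mono ennreal_leI) simp
  also have "\<dots> < \<infinity>"
    using nn_integral_exp_minus_abs[of "2 * \<delta>"] assms by (simp add: nn_integral_completion)
  finally show "(\<integral>\<^sup>+s. ennreal (norm ((cutoff \<delta> s)\<^sup>2)) \<partial>lebesgue) < \<infinity>" .
qed

context fibre
begin

text \<open>With \<open>p = 1\<close> the exponential solves the eigenvalue equation exactly and
  fails only to be square integrable. The cutoff repairs this at the cost of the term with
  \<open>cutoff'\<close>, of relative size \<open>c * \<delta>\<close>. The estimate is pointwise,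
  so it survives gluing over \<open>x'\<close>.\<close>

lemma approximate_eigenfunction:
  fixes t :: real
  assumes p: "AE s in lebesgue. p s = 1" and \<delta>: "0 < \<delta>"
  defines "f \<equiv> \<lambda>s. exp (\<i> * of_real (t * (s / c))) * of_real (cutoff \<delta> s)"
    and "k \<equiv> \<lambda>s. of_real t * (exp (\<i> * of_real (t * (s / c))) * of_real (cutoff \<delta> s))
       - \<i> * of_real c * (exp (\<i> * of_real (t * (s / c))) * of_real (cutoff' \<delta> s))"
  shows "(f, k) \<in> transport_operator p c a"
    and "cmod (k s - of_real t * f s) \<le> c * \<delta> * cmod (f s)"
    and "cmod (f s) = cutoff \<delta> s"
proof -
  define e where "e s = exp (\<i> * complex_of_real (t * (s / c)))" for s
  have en: "cmod (e s) = 1" for s unfolding e_def by (rule norm_exp_i_times)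
  have fe: "f = (\<lambda>s. e s * of_real (cutoff \<delta> s))"
    and ke: "k = (\<lambda>s. of_real t * (e s * of_real (cutoff \<delta> s)) - \<i> * of_real c * (e s * of_real (cutoff' \<delta> s)))"
    by (simp_all add: f_def k_def e_def)
  show fn: "cmod (f s) = cutoff \<delta> s" for s
    using cutoff_pos[of \<delta> s] by (simp add: fe norm_mult en)
  have kf: "cmod (k s - of_real t * f s) \<le> c * \<delta> * cmod (f s)" for s
  proof -
    have "k s - of_real t * f s = - (\<i> * of_real c * (e s * of_real (cutoff' \<delta> s)))" by (simp add: fe ke)
    then have "cmod (k s - of_real t * f s) = c * \<bar>cutoff' \<delta> s\<bar>"
      using c_pos by (simp add: norm_mult en)
    also have "\<dots> \<le> c * (\<delta> * cutoff \<delta> s)" using c_pos by (intro mult_left_mono cutoff'_bound \<delta>) simp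
    finally show ?thesis by (simp add: fn)
  qed
  show "cmod (k s - of_real t * f s) \<le> c * \<delta> * cmod (f s)" by (rule kf)
  have ea: "antiderivative e (\<lambda>s. \<i> * of_real (t / c) * e s)"
  proof -
    have "antiderivative (\<lambda>s. complex_of_real (t * (s / c))) (\<lambda>s. of_real (t / c))"
      by (intro antiderivative_C1 has_vector_derivative_of_real)
        (use c_pos in \<open>auto intro!: derivative_eq_intros
          simp: has_real_derivative_iff_has_vector_derivative[symmetric]\<close>)
    from antiderivative_exp[OF antiderivative_scale[OF this, of \<i>]] show ?thesis by (simp add: e_def[abs_def])
  qed
  have ca: "antiderivative (\<lambda>s. complex_of_real (cutoff \<delta> s)) (\<lambda>s. of_real (cutoff' \<delta> s))"
    using cutoff_derivative
    by (intro antiderivative_C1 has_vector_derivative_of_real continuous_intros cutoff_continuous)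
      (simp add: has_real_derivative_iff_has_vector_derivative)
  have ec: "continuous_on UNIV e" by (rule antiderivative_continuous[OF ea])
  have fm: "f \<in> borel_measurable lebesgue" and km: "k \<in> borel_measurable lebesgue"
    unfolding fe ke by (intro continuous_imp_borel_lebesgue continuous_intros ec cutoff_continuous)+
  have fa: "antiderivative f (\<lambda>s. \<i> * of_real (p s / c) * k s)"
  proof (rule antiderivative_cong_AE[OF antiderivative_mult[OF ea ca, folded fe]])
    show "(\<lambda>s. \<i> * of_real (p s / c) * k s) \<in> borel_measurable lebesgue" by (rule drift_measurable[OF km])
    show "AE s in lebesgue. \<i> * of_real (t / c) * e s * of_real (cutoff \<delta> s) + e s * of_real (cutoff' \<delta> s)
        = \<i> * of_real (p s / c) * k s"
      using p
    proof eventually_elim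
      case (elim s)
      then show ?case using c_pos by (simp add: ke field_simps)
    qed
  qed
  have fL: "f \<in> L2 (weighted p)"
    unfolding L2_weighted
  proof
    have "AE s in lebesgue. (cutoff \<delta> s)\<^sup>2 = p s * (cmod (f s))\<^sup>2"
      using p by eventually_elim (simp add: fn)
    moreover have "(\<lambda>s. p s * (cmod (f s))\<^sup>2) \<in> borel_measurable lebesgue" using fm by measurable
    ultimately show "integrable lebesgue (\<lambda>s. p s * (cmod (f s))\<^sup>2)"
      by (intro integrable_cong_AE_imp[OF cutoff_square_integrable[OF \<delta>]])
  qed (rule fm)
  have kL: "k \<in> L2 (weighted p)"
  proof -
    have "(\<lambda>s. k s - of_real t * f s) \<in> L2 (weighted p)"
    proof (rule L2_bound[OF fL])
      show "(\<lambda>s. k s - of_real t * f s) \<in> borel_measurable (weighted p)"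
        using fm km unfolding measurable_weighted by measurable
    qed (use kf in \<open>auto intro!: AE_I2\<close>)
    from L2_add[OF this L2_scale[OF fL, of "of_real t"]] show ?thesis by simp
  qed
  have "(f \<longlongrightarrow> 0) F" if "(cutoff \<delta> \<longlongrightarrow> 0) F" for F
    by (rule tendsto_norm_zero_cancel) (simp add: fn that)
  then have "(f \<longlongrightarrow> 0) at_bot" "(f \<longlongrightarrow> a * 0) at_top" using cutoff_tendsto[OF \<delta>] by auto
  then show "(f, k) \<in> transport_operator p c a"
    by (intro transport_operatorI[OF fL kL _ fa]) auto
qed

lemma L2_norm_pos:
  assumes f: "f \<in> L2 (weighted p)" and nz: "\<And>s. f s \<noteq> 0"
  shows "0 < L2_norm (weighted p) f"
proof (rule ccontr)
  assume "\<not> 0 < L2_norm (weighted p) f"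
  then have "L2_norm (weighted p) f = 0" using L2_norm_nonneg[of "weighted p" f] by simp
  from L2_norm_eq_0[OF f this] have "AE s::real in lebesgue. False" by (simp add: AE_weighted nz)
  then show False using lebesgue_not_AE_False by blast
qed

text \<open>Eigenfunctions or their cut-off versions place \<open>t\<close> in the spectrum;
  conversely the resolvent formula and the explicit lower bound exclude a \<open>t\<close> that
  violates the boundary condition.\<close>

theorem spectrum_transport:
  fixes t :: real
  shows "of_real t \<in> spectrum (weighted p) (transport_operator p c a) \<longleftrightarrow>
    (integrable lebesgue p \<longrightarrow> exp (\<i> * of_real t * of_real total) = a)"
proof (cases "integrable lebesgue p")
  case True
  have "of_real t \<in> spectrum (weighted p) (transport_operator p c a)"
    if t: "exp (\<i> * of_real t * of_real total) = a"
  proof (rule approximate_eigenvectors_imp_spectrum)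
    fix \<epsilon> :: real assume "\<epsilon> > 0"
    define e where "e s = exp (\<i> * of_real t * phase p c s)" for s
    have ee: "(e, \<lambda>s. of_real t * e s) \<in> transport_operator p c a"
      unfolding e_def by (rule eigenfunction[OF True t])
    then have "0 < L2_norm (weighted p) e"
      using linear_operator_L2[OF linear_transport ee] by (intro L2_norm_pos) (auto simp: e_def)
    moreover have "L2_norm (weighted p) (\<lambda>s. of_real t * e s - of_real t * e s) = 0"
      by (simp add: L2_norm_def)
    ultimately show "\<exists>(f, k)\<in>transport_operator p c a. 0 < L2_norm (weighted p) f \<and>
        L2_norm (weighted p) (\<lambda>s. k s - of_real t * f s) \<le> \<epsilon> * L2_norm (weighted p) f"
      using \<open>\<epsilon> > 0\<close> by (intro bexI[OF _ ee]) auto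
  qed
  moreover have "of_real t \<notin> spectrum (weighted p) (transport_operator p c a)"
    if t: "exp (\<i> * of_real t * of_real total) \<noteq> a"
  proof -
    have "onto_shift (weighted p) (transport_operator p c a) (of_real t)"
      using True t by (intro onto_shift_transport) (simp add: regular_def)
    then show ?thesis
      unfolding spectrum_def resolvent_set_def onto_shift_def
      using transport_lower_bound[OF True t] by fastforce
  qed
  ultimately show ?thesis using True by blast
next
  case False
  then have p: "AE s in lebesgue. p s = 1" using constant_or_integrable by blast
  have "of_real t \<in> spectrum (weighted p) (transport_operator p c a)"
  proof (rule approximate_eigenvectors_imp_spectrum)
    fix \<epsilon> :: real assume \<epsilon>: "\<epsilon> > 0"
    define \<delta> where "\<delta> = \<epsilon> / c"
    have \<delta>: "0 < \<delta>" "c * \<delta> = \<epsilon>" using \<epsilon> c_pos by (auto simp: \<delta>_def)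
    obtain f k where fk: "(f, k) \<in> transport_operator p c a"
      "\<And>s. cmod (k s - of_real t * f s) \<le> \<epsilon> * cmod (f s)" "\<And>s. cmod (f s) = cutoff \<delta> s"
      using approximate_eigenfunction[OF p \<delta>(1), of t] unfolding \<delta>(2) by blast
    have L: "f \<in> L2 (weighted p)" "k \<in> L2 (weighted p)"
      using linear_operator_L2[OF linear_transport fk(1)] by auto
    have "f s \<noteq> 0" for s using fk(3)[of s] cutoff_pos[of \<delta> s] by auto
    then have "0 < L2_norm (weighted p) f" by (intro L2_norm_pos L)
    moreover have "L2_norm (weighted p) (\<lambda>s. k s - of_real t * f s) \<le> L2_norm (weighted p) (\<lambda>s. of_real \<epsilon> * f s)"
      using fk(2) \<epsilon> by (intro L2_norm_mono L2_diff L2_scale L AE_I2) (simp add: norm_mult)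
    ultimately show "\<exists>(f, k)\<in>transport_operator p c a. 0 < L2_norm (weighted p) f \<and>
        L2_norm (weighted p) (\<lambda>s. k s - of_real t * f s) \<le> \<epsilon> * L2_norm (weighted p) f"
      using \<epsilon> by (intro bexI[OF _ fk(1)]) (auto simp: L2_norm_scale)
  qed
  then show ?thesis using False by blast
qed

end

section \<open>Fubini for Lebesgue measure and slices\<close>

text \<open>Completeness of Lebesgue measure: the preimages under the two functions differ only
  inside a null set.\<close>

lemma lebesgue_measurable_cong_AE:
  assumes f: "f \<in> measurable lebesgue N" and ae: "AE x::'a::euclidean_space in lebesgue. f x = g x"
    and g: "\<And>x. g x \<in> space N"
  shows "g \<in> measurable lebesgue N"
proof (rule measurableI)
  fix A assume A: "A \<in> sets N"
  obtain Z where Z: "{x. f x \<noteq> g x} \<subseteq> Z" "Z \<in> null_sets lebesgue"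
    using ae by (auto simp: eventually_ae_filter)
  have "f -` A - Z \<in> sets lebesgue"
    using measurable_sets[OF f A] Z(2) by (intro sets.Diff) auto
  moreover have "g -` A \<inter> Z \<in> sets lebesgue"
    using null_sets_completion_subset[OF _ Z(2), of "g -` A \<inter> Z"] by auto
  moreover have fg: "f x = g x" if "x \<notin> Z" for x using Z(1) that by auto
  then have eq: "g -` A \<inter> space lebesgue = (f -` A - Z) \<union> (g -` A \<inter> Z)" by auto
  ultimately show "g -` A \<inter> space lebesgue \<in> sets lebesgue" unfolding eq by (intro sets.Un)
qed (simp add: g)

text \<open>Lebesgue measure on the product is the completion of a product measure, so the
  exceptional set is first enlarged to a Borel null set, for which Fubini is available.\<close>

lemma AE_lebesgue_slices:
  assumes "AE z::real \<times> 'b::euclidean_space in lebesgue. P z"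
  shows "AE y in lebesgue. AE s in lebesgue. P (s, y)"
proof -
  have "AE z in lborel. P z" using assms by (simp add: AE_completion_iff)
  from AE_E[OF this] obtain N where N: "{z. \<not> P z} \<subseteq> N" "emeasure lborel N = 0" "N \<in> sets lborel"
    by auto
  have "AE z in lborel. z \<notin> N"
    using N by (intro AE_not_in) (auto simp: null_sets_def)
  then have ae: "AE z in (lborel :: real measure) \<Otimes>\<^sub>M (lborel :: 'b measure). z \<notin> N"
    unfolding lborel_prod .
  have Nm: "N \<in> sets ((lborel :: real measure) \<Otimes>\<^sub>M (lborel :: 'b measure))"
    using N(3) unfolding lborel_prod .
  have "AE s in lborel. AE y in lborel. (s, y) \<notin> N"
    by (rule lborel_pair.AE_pair[OF ae])
  moreover have "{z \<in> space ((lborel :: real measure) \<Otimes>\<^sub>M (lborel :: 'b measure)). case z of (s, y) \<Rightarrow> (s, y) \<notin> N}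
      \<in> sets ((lborel :: real measure) \<Otimes>\<^sub>M (lborel :: 'b measure))"
  proof -
    have "{z \<in> space ((lborel :: real measure) \<Otimes>\<^sub>M (lborel :: 'b measure)). case z of (s, y) \<Rightarrow> (s, y) \<notin> N}
        = space ((lborel :: real measure) \<Otimes>\<^sub>M (lborel :: 'b measure)) - N"
      by auto
    then show ?thesis using sets.compl_sets[OF Nm] by simp
  qed
  ultimately have "AE y in lborel. AE s in lborel. (s, y) \<notin> N"
    by (subst (asm) lborel_pair.AE_commute) auto
  then have "AE y in lborel. AE s in lborel. P (s, y)"
    by eventually_elim (use N(1) in \<open>auto elim!: eventually_mono\<close>)
  then show ?thesis by (simp add: AE_completion_iff)
qed

text \<open>A Lebesgue measurable function on the product may have nonmeasurable slices. Those of a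
  Borel representative are measurable, and almost all slices of \<open>f\<close> agree with them
  almost everywhere.\<close>

lemma lebesgue_slice_measurable:
  fixes f :: "real \<times> 'b::euclidean_space \<Rightarrow> complex"
  assumes "f \<in> borel_measurable lebesgue"
  shows "AE y in lebesgue. (\<lambda>s. f (s, y)) \<in> borel_measurable lebesgue"
proof -
  obtain f' where f': "f' \<in> borel_measurable borel" "AE z in lebesgue. f z = f' z"
    using complex_borel_representative[OF assms] .
  from AE_lebesgue_slices[OF f'(2)] show ?thesis
  proof eventually_elim
    case (elim y)
    have "(\<lambda>s. f' (s, y)) \<in> borel_measurable borel"
      by (rule measurable_compose[OF _ f'(1)]) (simp add: borel_prod[symmetric])
    then have "(\<lambda>s. f' (s, y)) \<in> borel_measurable lebesgue" by (intro measurable_completion) simp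
    then show ?case by (rule lebesgue_measurable_cong_AE) (use elim in auto)
  qed
qed

lemma nn_integral_lebesgue_slices:
  fixes f :: "real \<times> 'b::euclidean_space \<Rightarrow> ennreal"
  assumes "f \<in> borel_measurable lebesgue"
  shows "(\<integral>\<^sup>+z. f z \<partial>lebesgue) = (\<integral>\<^sup>+y. (\<integral>\<^sup>+s. f (s, y) \<partial>lebesgue) \<partial>lebesgue)"
    and "(\<lambda>y. \<integral>\<^sup>+s. f (s, y) \<partial>lebesgue) \<in> borel_measurable lebesgue"
proof -
  obtain f' where f': "f' \<in> borel_measurable lborel" "AE z in lborel. f z = f' z"
    using completion_ex_borel_measurable[OF assms] by blast
  have m: "(\<lambda>(s, y). f' (s, y)) \<in> borel_measurable (lborel \<Otimes>\<^sub>M lborel)"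
    using f'(1) by (simp add: lborel_prod)
  have "AE y in lebesgue. AE s in lebesgue. f (s, y) = f' (s, y)"
    using f'(2) by (intro AE_lebesgue_slices AE_completion)
  then have eq: "AE y in lebesgue. (\<integral>\<^sup>+s. f' (s, y) \<partial>lborel) = (\<integral>\<^sup>+s. f (s, y) \<partial>lebesgue)"
  proof eventually_elim
    case (elim y)
    have "(\<integral>\<^sup>+s. f' (s, y) \<partial>lborel) = (\<integral>\<^sup>+s. f' (s, y) \<partial>lebesgue)"
      by (rule nn_integral_completion[symmetric])
    also have "\<dots> = (\<integral>\<^sup>+s. f (s, y) \<partial>lebesgue)"
      using elim by (intro nn_integral_cong_AE) (auto elim!: eventually_mono)
    finally show ?case .
  qed
  have m': "(\<lambda>y. \<integral>\<^sup>+s. f' (s, y) \<partial>lborel) \<in> borel_measurable lborel"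
    using m by (intro lborel.borel_measurable_nn_integral) (simp add: measurable_split_conv measurable_pair_swap)
  show "(\<lambda>y. \<integral>\<^sup>+s. f (s, y) \<partial>lebesgue) \<in> borel_measurable lebesgue"
    by (rule lebesgue_measurable_cong_AE[OF measurable_completion[OF m'] eq]) simp
  have "(\<integral>\<^sup>+z. f z \<partial>lebesgue) = (\<integral>\<^sup>+z. f' z \<partial>lborel)"
    using f'(2) by (subst nn_integral_completion) (rule nn_integral_cong_AE)
  also have "\<dots> = (\<integral>\<^sup>+y. (\<integral>\<^sup>+s. f' (s, y) \<partial>lborel) \<partial>lborel)"
    using lborel_pair.nn_integral_snd[OF m] by (simp add: lborel_prod split_def)
  also have "\<dots> = (\<integral>\<^sup>+y. (\<integral>\<^sup>+s. f' (s, y) \<partial>lborel) \<partial>lebesgue)"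
    by (rule nn_integral_completion[symmetric])
  also have "\<dots> = (\<integral>\<^sup>+y. (\<integral>\<^sup>+s. f (s, y) \<partial>lebesgue) \<partial>lebesgue)"
    by (rule nn_integral_cong_AE[OF eq])
  finally show "(\<integral>\<^sup>+z. f z \<partial>lebesgue) = (\<integral>\<^sup>+y. (\<integral>\<^sup>+s. f (s, y) \<partial>lebesgue) \<partial>lebesgue)" .
qed

lemma integral_lebesgue_slices:
  fixes f :: "real \<times> 'b::euclidean_space \<Rightarrow> complex"
  assumes f: "integrable lebesgue f"
  shows "AE y in lebesgue. integrable lebesgue (\<lambda>s. f (s, y))"
    and "integrable lebesgue (\<lambda>y. LINT s|lebesgue. f (s, y))"
    and "(LINT z|lebesgue. f z) = (LINT y|lebesgue. LINT s|lebesgue. f (s, y))"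
proof -
  obtain f' where f': "f' \<in> borel_measurable borel" "AE z in lebesgue. f z = f' z"
    using complex_borel_representative borel_measurable_integrable[OF f] by blast
  have f'm: "f' \<in> borel_measurable lborel" using f'(1) by simp
  have f'l: "f' \<in> borel_measurable lebesgue" using f'm by (rule measurable_completion)
  have "integrable lebesgue f'" by (rule integrable_cong_AE_imp[OF f f'l f'(2)])
  then have i: "integrable lborel f'" by (subst (asm) integrable_completion[OF f'm])
  then have i': "integrable (lborel \<Otimes>\<^sub>M lborel) (\<lambda>(s, y). f' (s, y))" by (simp add: lborel_prod)
  have sm: "(\<lambda>s. f' (s, y)) \<in> borel_measurable lborel" for y
    using measurable_compose[OF _ f'(1), of "\<lambda>s. (s, y)" lborel] by (simp add: borel_prod[symmetric])
  have sl: "(\<lambda>s. f' (s, y)) \<in> borel_measurable lebesgue" for y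
    using sm by (rule measurable_completion)
  note sae = AE_lebesgue_slices[OF f'(2)]
  note smeas = lebesgue_slice_measurable[OF borel_measurable_integrable[OF f]]
  have "AE y in lborel. integrable lborel (\<lambda>s. f' (s, y))"
    using lborel_pair.AE_integrable_snd[OF i'] by simp
  then have "AE y in lebesgue. integrable lborel (\<lambda>s. f' (s, y))" by (rule AE_completion)
  with sae smeas show "AE y in lebesgue. integrable lebesgue (\<lambda>s. f (s, y))"
  proof eventually_elim
    case (elim y)
    have "integrable lebesgue (\<lambda>s. f' (s, y))" using elim(3) by (subst integrable_completion[OF sm])
    then show ?case by (rule integrable_cong_AE_imp) (use elim in \<open>auto elim!: eventually_mono\<close>)
  qed
  from sae smeas have eq: "AE y in lebesgue. (LINT s|lborel. f' (s, y)) = (LINT s|lebesgue. f (s, y))"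
  proof eventually_elim
    case (elim y)
    have "(LINT s|lborel. f' (s, y)) = (LINT s|lebesgue. f' (s, y))" by (rule integral_completion[OF sm, symmetric])
    also have "\<dots> = (LINT s|lebesgue. f (s, y))"
      using elim by (intro integral_cong_AE sl) (auto elim!: eventually_mono)
    finally show ?case .
  qed
  have i2: "integrable lborel (\<lambda>y. LINT s|lborel. f' (s, y))"
    using lborel_pair.integrable_snd[OF i'] by simp
  have i3: "integrable lebesgue (\<lambda>y. LINT s|lborel. f' (s, y))"
    using i2 by (subst integrable_completion) auto
  have m3: "(\<lambda>y. LINT s|lebesgue. f (s, y)) \<in> borel_measurable lebesgue"
    by (rule lebesgue_measurable_cong_AE[OF borel_measurable_integrable[OF i3] eq]) simp
  show "integrable lebesgue (\<lambda>y. LINT s|lebesgue. f (s, y))"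
    by (rule integrable_cong_AE_imp[OF i3 m3 eq])
  have "(LINT z|lebesgue. f z) = (LINT z|lebesgue. f' z)"
    by (rule integral_cong_AE[OF borel_measurable_integrable[OF f] f'l f'(2)])
  also have "\<dots> = (LINT z|lborel. f' z)" by (rule integral_completion[OF f'm])
  also have "\<dots> = (LINT y|lborel. LINT s|lborel. f' (s, y))"
    using lborel_pair.integral_snd[OF i'] by (simp add: lborel_prod split_def)
  also have "\<dots> = (LINT y|lebesgue. LINT s|lborel. f' (s, y))"
    by (rule integral_completion[symmetric]) (rule borel_measurable_integrable[OF i2])
  also have "\<dots> = (LINT y|lebesgue. LINT s|lebesgue. f (s, y))"
    by (rule integral_cong_AE[OF borel_measurable_integrable[OF i3] m3 eq])
  finally show "(LINT z|lebesgue. f z) = (LINT y|lebesgue. LINT s|lebesgue. f (s, y))" .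
qed

lemma AE_snd:
  assumes "AE y in lebesgue. R y"
  shows "AE z::real \<times> 'b::euclidean_space in lebesgue. R (snd z)"
proof -
  have "AE y in lborel. R y" using assms by (simp add: AE_completion_iff)
  from AE_E[OF this] obtain N where N: "{y. \<not> R y} \<subseteq> N" "emeasure lborel N = 0" "N \<in> sets lborel" by auto
  have "emeasure (lborel \<Otimes>\<^sub>M lborel) (UNIV \<times> N) = 0"
    using N by (subst lborel.emeasure_pair_measure_Times) auto
  then have "UNIV \<times> N \<in> null_sets (lborel :: (real \<times> 'b) measure)"
    using N(3) by (auto simp: null_sets_def lborel_prod intro!: borel_Times)
  then have "AE z::real \<times> 'b in lborel. z \<notin> UNIV \<times> N" by (rule AE_not_in)
  then have "AE z::real \<times> 'b in lborel. R (snd z)"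
    by eventually_elim (use N(1) in auto)
  then show ?thesis by (rule AE_completion)
qed

lemma snd_lebesgue_measurable:
  fixes g :: "'b::euclidean_space \<Rightarrow> complex"
  assumes "g \<in> borel_measurable lebesgue"
  shows "(\<lambda>z::real \<times> 'b. g (snd z)) \<in> borel_measurable lebesgue"
proof -
  obtain g' where g': "g' \<in> borel_measurable borel" "AE y in lebesgue. g y = g' y"
    using complex_borel_representative[OF assms] .
  have m: "(\<lambda>z::real \<times> 'b. g' (snd z)) \<in> borel_measurable lebesgue"
    using g'(1) by (intro measurable_completion) (simp add: borel_prod[symmetric])
  have "AE z::real \<times> 'b in lebesgue. g' (snd z) = g (snd z)"
    using AE_snd[OF g'(2)] by eventually_elim simp
  then show ?thesis by (intro lebesgue_measurable_cong_AE[OF m]) auto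
qed

section \<open>Measurable dependence of the resolvent on the fibre\<close>

lemma measurable_set_integral_parameter:
  fixes v :: "'c \<Rightarrow> real \<Rightarrow> complex"
  assumes v: "(\<lambda>(y, u). v y u) \<in> borel_measurable (N \<Otimes>\<^sub>M borel)" and A: "A \<in> sets borel"
  shows "(\<lambda>y. LINT u:A|lebesgue. v y u) \<in> borel_measurable N"
proof -
  have vy: "(\<lambda>u. v y u) \<in> borel_measurable borel" if "y \<in> space N" for y
    using measurable_compose[OF measurable_Pair1'[OF that] v] by simp
  have "(\<lambda>y. LINT u|lborel. indicator A u *\<^sub>R v y u) \<in> borel_measurable N"
  proof (rule lborel.borel_measurable_lebesgue_integral)
    have "(\<lambda>(y, u). indicator A u *\<^sub>R v y u) \<in> borel_measurable (N \<Otimes>\<^sub>M borel)"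
      using v A by (auto simp: split_def intro!: borel_measurable_scaleR borel_measurable_indicator')
    then show "(\<lambda>(y, u). indicator A u *\<^sub>R v y u) \<in> borel_measurable (N \<Otimes>\<^sub>M lborel)"
      unfolding measurable_cong_sets[OF sets_pair_measure_cong[OF refl sets_lborel] refl] .
  qed
  moreover have "(LINT u:A|lebesgue. v y u) = (LINT u|lborel. indicator A u *\<^sub>R v y u)" if "y \<in> space N" for y
    unfolding set_lebesgue_integral_def using vy[OF that] A by (intro integral_completion) auto
  ultimately show ?thesis by (simp cong: measurable_cong)
qed

lemma measurable_primitive_parameter:
  fixes v :: "'c \<Rightarrow> real \<Rightarrow> complex"
  assumes v: "(\<lambda>(y, u). v y u) \<in> borel_measurable (N \<Otimes>\<^sub>M borel)"
  shows "(\<lambda>(y, s). primitive (v y) s) \<in> borel_measurable (N \<Otimes>\<^sub>M borel)"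
proof -
  define V where "V x u = ((if 0 \<le> u \<and> u \<le> snd x then 1 else 0) - (if snd x \<le> u \<and> u \<le> 0 then 1 else 0)) * v (fst x) u"
    for x and u :: real
  have V: "(\<lambda>(x, u). V x u) \<in> borel_measurable ((N \<Otimes>\<^sub>M borel) \<Otimes>\<^sub>M borel)"
  proof -
    have "(\<lambda>x. v (fst (fst x)) (snd x)) \<in> borel_measurable ((N \<Otimes>\<^sub>M (borel::real measure)) \<Otimes>\<^sub>M borel)"
    proof -
      have "(\<lambda>x. case (fst (fst x), snd x) of (y, u) \<Rightarrow> v y u) \<in> borel_measurable ((N \<Otimes>\<^sub>M (borel::real measure)) \<Otimes>\<^sub>M borel)"
        by (rule measurable_compose[OF _ v]) measurable
      then show ?thesis by simp
    qed
    then show ?thesis unfolding V_def split_def by measurable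
  qed
  from measurable_set_integral_parameter[OF this, of UNIV]
  have "(\<lambda>x. LINT u:UNIV|lebesgue. V x u) \<in> borel_measurable (N \<Otimes>\<^sub>M borel)" by simp
  moreover have "(LINT u:UNIV|lebesgue. V x u) = (case x of (y, s) \<Rightarrow> primitive (v y) s)" for x
    unfolding set_lebesgue_integral_def primitive_def V_def split_def
    by (intro Bochner_Integration.integral_cong) (auto simp: indicator_def)
  ultimately show ?thesis by simp
qed

text \<open>Every ingredient of the formula is an integral with parameter \<open>y\<close>, apart
  from the case distinction in \<open>boundary_constant\<close>; that condition is measurable as
  finiteness of an integral with parameter. The data have no exceptional sets here;
  \<open>resolvent_cong_AE\<close> allows the passage to such data.\<close>

lemma measurable_resolvent:
  fixes p :: "'c \<Rightarrow> real \<Rightarrow> real" and c :: "'c \<Rightarrow> real" and a :: "'c \<Rightarrow> complex" and h :: "'c \<Rightarrow> real \<Rightarrow> complex"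
  assumes p: "(\<lambda>(y, u). p y u) \<in> borel_measurable (N \<Otimes>\<^sub>M borel)"
    and c[measurable]: "c \<in> borel_measurable N" and a[measurable]: "a \<in> borel_measurable N"
    and h: "(\<lambda>(y, u). h y u) \<in> borel_measurable (N \<Otimes>\<^sub>M borel)"
  shows "(\<lambda>(y, s). resolvent (p y) (c y) (a y) z (h y) s) \<in> borel_measurable (N \<Otimes>\<^sub>M borel)"
proof -
  note ph[measurable] = p[unfolded split_def] h[unfolded split_def]
  have pc: "(\<lambda>(y, u). complex_of_real (p y u / c y)) \<in> borel_measurable (N \<Otimes>\<^sub>M borel)"
    unfolding split_def by measurable
  have ph': "(\<lambda>(y, s). phase (p y) (c y) s) \<in> borel_measurable (N \<Otimes>\<^sub>M borel)"
    unfolding phase_def by (rule measurable_primitive_parameter[OF pc])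
  note [measurable] = ph'[unfolded split_def]
  have so: "(\<lambda>(y, u). source (p y) (c y) z (h y) u) \<in> borel_measurable (N \<Otimes>\<^sub>M borel)"
    unfolding source_def split_def by measurable
  note pr = measurable_primitive_parameter[OF so]
  note [measurable] = pr[unfolded split_def]
  have [measurable]: "(\<lambda>y. LINT u:{0..}|lebesgue. complex_of_real (p y u / c y)) \<in> borel_measurable N"
     "(\<lambda>y. LINT u:{..0}|lebesgue. complex_of_real (p y u / c y)) \<in> borel_measurable N"
     "(\<lambda>y. LINT u:{0..}|lebesgue. source (p y) (c y) z (h y) u) \<in> borel_measurable N"
     "(\<lambda>y. LINT u:{..0}|lebesgue. source (p y) (c y) z (h y) u) \<in> borel_measurable N"
    by (intro measurable_set_integral_parameter pc so; simp)+
  have py: "p y \<in> borel_measurable borel" if "y \<in> space N" for y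
    using measurable_compose[OF measurable_Pair1'[OF that] p] by simp
  have "{y \<in> space N. (\<integral>\<^sup>+u. ennreal (norm (p y u)) \<partial>lborel) < \<infinity>} \<in> sets N"
  proof -
    have [measurable]: "(\<lambda>x. p (fst x) (snd x)) \<in> borel_measurable (N \<Otimes>\<^sub>M lborel)"
      using ph(1) unfolding measurable_cong_sets[OF sets_pair_measure_cong[OF refl sets_lborel] refl] .
    have "(\<lambda>y. \<integral>\<^sup>+u. ennreal (norm (p y u)) \<partial>lborel) \<in> borel_measurable N"
      by (rule lborel.borel_measurable_nn_integral) (simp add: split_def)
    then show ?thesis by measurable
  qed
  moreover have "integrable lebesgue (p y) \<longleftrightarrow> (\<integral>\<^sup>+u. ennreal (norm (p y u)) \<partial>lborel) < \<infinity>" if "y \<in> space N" for y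
  proof -
    have "p y \<in> borel_measurable lebesgue" using py[OF that] by (intro measurable_completion) simp
    then show ?thesis by (simp add: integrable_iff_bounded nn_integral_completion)
  qed
  ultimately have [measurable]: "{y \<in> space N. integrable lebesgue (p y)} \<in> sets N"
    by (simp cong: conj_cong)
  have "(\<lambda>y. boundary_constant (p y) (c y) (a y) z (h y)) \<in> borel_measurable N"
    unfolding boundary_constant_def by measurable
  then show ?thesis
    unfolding resolvent_def split_def by measurable
qed

lemma primitive_cong_AE:
  assumes "v \<in> borel_measurable lebesgue" "v' \<in> borel_measurable lebesgue" "AE u in lebesgue. v u = v' u"
  shows "primitive v = primitive v'"
proof -
  have i: "(\<lambda>u. indicator {0..s} u - indicator {s..0} u :: complex) \<in> borel_measurable lebesgue" for s :: real
    by (intro borel_measurable_diff borel_measurable_indicator) auto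
  show ?thesis
    unfolding primitive_def fun_eq_iff using assms
    by (intro allI integral_cong_AE borel_measurable_times i) (auto elim!: eventually_mono)
qed

text \<open>The formula sees \<open>p\<close> and \<open>h\<close> through integrals only, so
  equality holds at every point and not merely almost everywhere. This permits Borel representatives
  of weight and right-hand side in each slice.\<close>

lemma resolvent_cong_AE:
  assumes p: "p \<in> borel_measurable lebesgue" "p' \<in> borel_measurable lebesgue" "AE s in lebesgue. p s = p' s"
    and h: "h \<in> borel_measurable lebesgue" "h' \<in> borel_measurable lebesgue" "AE s in lebesgue. h s = h' s"
    and ph: "phase p c \<in> borel_measurable lebesgue"
  shows "resolvent p c a z h = resolvent p' c a z h'"
proof -
  have cong: "(LINT u:A|lebesgue. v u) = (LINT u:A|lebesgue. v' u)" and cong': "primitive v = primitive v'"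
    if "v \<in> borel_measurable lebesgue" "v' \<in> borel_measurable lebesgue" "AE u in lebesgue. v u = v' u"
      "A \<in> sets lebesgue" for v v' :: "real \<Rightarrow> complex" and A
  proof -
    show "(LINT u:A|lebesgue. v u) = (LINT u:A|lebesgue. v' u)"
      using that by (intro set_lebesgue_integral_cong_AE) auto
    show "primitive v = primitive v'" using that(1-3) by (rule primitive_cong_AE)
  qed
  note [measurable] = p(1,2) h(1,2) ph
  have phase: "phase p c = phase p' c"
    unfolding phase_def using p(3) by (intro cong'[where A = UNIV]) (auto elim!: eventually_mono)
  have [measurable]: "source p c z h \<in> borel_measurable lebesgue" "source p' c z h' \<in> borel_measurable lebesgue"
    unfolding source_def[abs_def] phase[symmetric] by measurable
  have src: "AE u in lebesgue. source p c z h u = source p' c z h' u"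
    using p(3) h(3) by eventually_elim (simp add: source_def phase)
  have pc: "AE u in lebesgue. complex_of_real (p u / c) = complex_of_real (p' u / c)"
    using p(3) by eventually_elim simp
  have "integrable lebesgue p \<longleftrightarrow> integrable lebesgue p'" by (rule integrable_cong_AE[OF p])
  then have "boundary_constant p c a z h = boundary_constant p' c a z h'"
    unfolding boundary_constant_def
    using cong[OF _ _ src, of "{..0}"] cong[OF _ _ src, of "{0..}"] cong[OF _ _ pc, of "{..0}"] cong[OF _ _ pc, of "{0..}"]
    by (simp del: of_real_divide)
  moreover have "primitive (source p c z h) = primitive (source p' c z h')"
    by (rule cong'[where A = UNIV]) (use src in auto)
  ultimately show ?thesis unfolding resolvent_def phase by simp
qed

section \<open>Direct integrals\<close>

text \<open>In terms of the resolvent \<open>(F, K)\<close> of \<open>f\<close> at \<open>i n\<close>, a bound on the Yosida approximations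
  \<open>n K\<close> makes \<open>k \<mapsto> (T k, f)\<close> a bounded functional, so that \<open>f\<close> is in the domain of the adjoint.\<close>

lemma self_adjoint_domainI:
  assumes sa: "self_adjoint M T" and f: "f \<in> L2 M"
    and ex: "\<And>n::nat. n > 0 \<Longrightarrow> \<exists>(F, K) \<in> T. (AE x in M. K x - (\<i> * of_nat n) * F x = f x) \<and> real n * L2_norm M K \<le> C"
  obtains h where "(f, h) \<in> T"
proof -
  have lin: "linear_operator M T" and adj: "op_adjoint M T = T"
    using sa unfolding self_adjoint_def by auto
  note TL = linear_operator_L2[OF lin]
  have sym: "L2_inner M l g = L2_inner M k m" if "(k, l) \<in> T" "(g, m) \<in> T" for k l g m
  proof -
    have "(g, m) \<in> op_adjoint M T" using that(2) adj by simp
    then show ?thesis using that(1) unfolding op_adjoint_def by auto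
  qed
  have bound: "cmod (L2_inner M l f) \<le> C * L2_norm M k" if kl: "(k, l) \<in> T" for k l
  proof -
    have L: "k \<in> L2 M" "l \<in> L2 M" using TL[OF kl] by auto
    have "cmod (L2_inner M l f) \<le> L2_norm M l * C / real n + C * L2_norm M k" if n: "n > 0" for n :: nat
    proof -
      obtain F K where FK: "(F, K) \<in> T" "AE x in M. K x - (\<i> * of_nat n) * F x = f x" "real n * L2_norm M K \<le> C"
        using ex[OF n] by auto
      have LF: "F \<in> L2 M" "K \<in> L2 M" using TL[OF FK(1)] by auto
      have K: "L2_norm M K \<le> C / real n" using FK(3) n by (simp add: field_simps)
      \<comment> \<open>Substituting \<open>f = K - i n F\<close> and using
        \<open>(l, F) = (k, K)\<close> leaves one term of order \<open>1/n\<close> and one bounded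
        by \<open>L2_norm M k\<close> times \<open>n * L2_norm M K\<close>.\<close>
      have "L2_inner M l f = L2_inner M l (\<lambda>x. K x - (\<i> * of_nat n) * F x)"
        using FK(2) L LF f
        by (intro L2_inner_cong_AE L2_measurable L2_diff L2_scale) (auto elim!: eventually_mono)
      also have "\<dots> = L2_inner M l K + \<i> * of_nat n * L2_inner M k K"
        using L LF by (simp add: L2_inner_diff_right L2_scale L2_inner_scale_right sym[OF kl FK(1)])
      also have "cmod \<dots> \<le> L2_norm M l * L2_norm M K + real n * (L2_norm M k * L2_norm M K)"
        using L LF by (intro order_trans[OF norm_triangle_ineq] add_mono)
          (auto simp: norm_mult intro!: L2_inner_bound mult_left_mono)
      also have "\<dots> \<le> L2_norm M l * (C / real n) + real n * (L2_norm M k * (C / real n))"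
        using K by (intro add_mono mult_left_mono) (auto simp: L2_norm_nonneg)
      finally show ?thesis using n by (simp add: mult.commute)
    qed
    note le = this
    have "(\<lambda>n. L2_norm M l * C / real n + C * L2_norm M k) \<longlonglongrightarrow> 0 + C * L2_norm M k"
      by (intro tendsto_add tendsto_const lim_const_over_n)
    then have "cmod (L2_inner M l f) \<le> 0 + C * L2_norm M k"
    proof (rule tendsto_lowerbound)
      show "\<forall>\<^sub>F n in sequentially. cmod (L2_inner M l f) \<le> L2_norm M l * C / real n + C * L2_norm M k"
        using eventually_gt_at_top[of "0::nat"] by eventually_elim (rule le)
    qed simp
    then show ?thesis by simp
  qed
  \<comment> \<open>The functional has to depend on \<open>k\<close> alone, so an image of
    \<open>k\<close> is chosen; any two images agree almost everywhere.\<close>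
  define lf where "lf k = L2_inner M (SOME l. (k, l) \<in> T) f" for k
  have lf: "lf k = L2_inner M l f" if "(k, l) \<in> T" for k l
  proof -
    have s: "(k, SOME l. (k, l) \<in> T) \<in> T" using that by (rule someI[of "\<lambda>l. (k, l) \<in> T"])
    show ?thesis
      unfolding lf_def using linear_operator_unique[OF lin s that] TL[OF s] TL[OF that] f
      by (intro L2_inner_cong_AE L2_measurable) auto
  qed
  obtain u v where uv: "(u, v) \<in> T" using ex[of 1] by auto
  obtain h where h: "h \<in> L2 M" "\<And>k. k \<in> Domain T \<Longrightarrow> lf k = L2_inner M k h"
  proof (rule L2_riesz[of "Domain T" M lf C])
    show "Domain T \<subseteq> L2 M" using TL by auto
    show "(\<lambda>x. 0) \<in> Domain T" using linear_operator_scale[OF lin uv, of 0] by auto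
    fix g g' c assume g: "g \<in> Domain T"
    then obtain k where k: "(g, k) \<in> T" by auto
    show "(\<lambda>x. c * g x) \<in> Domain T" using linear_operator_scale[OF lin k] by auto
    show "lf (\<lambda>x. c * g x) = c * lf g"
      using lf[OF linear_operator_scale[OF lin k]] lf[OF k] by (simp add: L2_inner_scale_left)
    show "cmod (lf g) \<le> C * L2_norm M g" using bound[OF k] lf[OF k] by simp
    assume "g' \<in> Domain T"
    then obtain k' where k': "(g', k') \<in> T" by auto
    show "(\<lambda>x. g x + g' x) \<in> Domain T" using linear_operator_add[OF lin k k'] by auto
    show "lf (\<lambda>x. g x + g' x) = lf g + lf g'"
      using lf[OF linear_operator_add[OF lin k k']] lf[OF k] lf[OF k'] TL[OF k] TL[OF k'] f
      by (simp add: L2_inner_add_left)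
  qed auto
  have "L2_inner M l f = L2_inner M k h" if "(k, l) \<in> T" for k l
    using h(2)[OF DomainI[OF that]] lf[OF that] by simp
  then have "(f, h) \<in> op_adjoint M T"
    unfolding op_adjoint_def using f h(1) by auto
  then show ?thesis using adj that by simp
qed

lemma L2_cong_AE:
  assumes "f \<in> L2 M" "f' \<in> borel_measurable M" "AE x in M. f' x = f x"
  shows "f' \<in> L2 M"
  using assms(3) by (intro L2_bound[OF assms(1,2), of 1]) (auto elim!: eventually_mono)

section \<open>Self-adjointness of the direct integral\<close>

locale shear = positive_weight w for w :: "real \<times> (real ^ 'n) \<Rightarrow> real" +
  fixes \<psi> :: "real ^ 'n \<Rightarrow> real" and \<alpha> :: "real ^ 'n \<Rightarrow> complex"
  assumes psi_measurable [measurable]: "\<psi> \<in> borel_measurable lebesgue" and psi_pos: "\<And>y. 0 < \<psi> y"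
    and alpha_measurable [measurable]: "\<alpha> \<in> borel_measurable lebesgue" and alpha_norm: "\<And>y. cmod (\<alpha> y) = 1"
    and slice_cases: "\<And>y. (\<forall>s. w (s, y) = 1) \<or> integrable lebesgue (\<lambda>s. w (s, y))"
begin

abbreviation P :: "real ^ 'n \<Rightarrow> real \<Rightarrow> real" where
  "P y \<equiv> \<lambda>s. w (s, y)"

abbreviation T :: "real ^ 'n \<Rightarrow> real operator" where
  "T y \<equiv> transport_operator (P y) (\<psi> y) (\<alpha> y)"

lemma fibre_slice: "fibre (P y) (\<psi> y) (\<alpha> y)"
proof
  show "P y \<in> borel_measurable lebesgue" using slice_cases[of y] by (auto intro: borel_measurable_integrable)
  show "(AE s in lebesgue. P y s = 1) \<or> integrable lebesgue (P y)" using slice_cases[of y] by auto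
qed (simp_all add: weight_pos psi_pos alpha_norm)

lemma slice_weight: "positive_weight (P y)"
  using fibre_slice[of y] by (simp add: fibre_def)

lemmas slice_linear = fibre.linear_transport[OF fibre_slice]
  and slice_symmetric = fibre.symmetric_transport[OF fibre_slice]
  and slice_self_adjoint = fibre.self_adjoint_transport[OF fibre_slice]
  and AE_slice_weighted = positive_weight.AE_weighted[OF slice_weight]

text \<open>Multiplications by \<open>i P/\<psi>\<close> and by \<open>- i \<psi>/P\<close> are
  mutually inverse, so the differential and the integrated form of the equation agree. The
  continuous representative in \<open>fiber_domain\<close> coincides everywhere with the
  antiderivative, since continuous functions equal almost everywhere are equal; hence both have the
  same limits.\<close>

lemma fiber_operator_eq: "fiber_operator \<psi> w \<alpha> y = T y"
proof (intro equalityI subrelI)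
  interpret fibre "P y" "\<psi> y" "\<alpha> y" by (rule fibre_slice)
  fix g h
  have pc: "\<i> * of_real (P y s / \<psi> y) * (- \<i> * of_real (\<psi> y / P y s) * x) = x" for s x
    using psi_pos[of y] weight_pos[of s] by simp
  have cp: "- \<i> * of_real (\<psi> y / P y s) * (\<i> * of_real (P y s / \<psi> y) * x) = x" for s x
    using psi_pos[of y] weight_pos[of s] by simp
  {
    assume "(g, h) \<in> fiber_operator \<psi> w \<alpha> y"
    then obtain v g0 a b where L: "g \<in> L2 (weighted (P y))" "h \<in> L2 (weighted (P y))"
      and v: "has_weak_derivative 1 g v"
      and g0: "continuous_on UNIV g0" "AE s in lebesgue. g s = g0 s"
        "(g0 \<longlongrightarrow> a) at_bot" "(g0 \<longlongrightarrow> b) at_top" "b = \<alpha> y * a"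
      and h: "AE s in lebesgue. h s = fiber_action \<psi> w y g s"
      unfolding fiber_operator_def fiber_domain_def fiber_measure_def by auto
    have "has_weak_derivative 1 g (weak_deriv g)" by (rule has_weak_derivative_weak_deriv[OF v])
    then obtain g1 where g1: "antiderivative g1 (weak_deriv g)" "AE s in lebesgue. g s = g1 s"
      unfolding has_weak_derivative_iff_antiderivative by auto
    have "AE s in lebesgue. g1 s = g0 s" using g0(2) g1(2) by eventually_elim simp
    then have "g1 = g0" by (intro continuous_AE_eq_imp_eq antiderivative_continuous[OF g1(1)] g0(1))
    have "AE s in lebesgue. weak_deriv g s = \<i> * of_real (P y s / \<psi> y) * h s"
      using h by eventually_elim (simp only: fiber_action_def pc)
    from antiderivative_cong_AE[OF g1(1)[unfolded \<open>g1 = g0\<close>] drift_measurable[OF L2_weighted_measurable[OF L(2)]] this]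
    have "antiderivative g0 (\<lambda>s. \<i> * of_real (P y s / \<psi> y) * h s)" .
    then show "(g, h) \<in> T y" using L g0 by (intro transport_operatorI) auto
  next
    assume gh: "(g, h) \<in> T y"
    then obtain g0 A where L: "g \<in> L2 (weighted (P y))" "h \<in> L2 (weighted (P y))"
      and g0: "AE s in lebesgue. g s = g0 s" "antiderivative g0 (\<lambda>s. \<i> * of_real (P y s / \<psi> y) * h s)"
        "(g0 \<longlongrightarrow> A) at_bot" "(g0 \<longlongrightarrow> \<alpha> y * A) at_top"
      by (elim transport_operatorE)
    have v: "has_weak_derivative 1 g (\<lambda>s. \<i> * of_real (P y s / \<psi> y) * h s)"
      unfolding has_weak_derivative_iff_antiderivative using L2_weighted_measurable[OF L(1)] g0 by blast
    have wd: "has_weak_derivative 1 g (weak_deriv g)" by (rule has_weak_derivative_weak_deriv[OF v])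
    have h: "AE s in lebesgue. fiber_action \<psi> w y g s = h s"
      using has_weak_derivative_unique[OF wd v] by eventually_elim (simp only: fiber_action_def cp)
    have [measurable]: "weak_deriv g \<in> borel_measurable lebesgue"
      using wd by (auto simp: has_weak_derivative_def intro: locally_integrable_measurable)
    have "fiber_action \<psi> w y g \<in> borel_measurable lebesgue"
      unfolding fiber_action_def by measurable
    then have "fiber_action \<psi> w y g \<in> L2 (weighted (P y))"
      using h by (intro L2_cong_AE[OF L(2)]) (simp_all add: measurable_weighted AE_weighted)
    moreover have "continuous_on UNIV g0" by (rule antiderivative_continuous[OF g0(2)])
    moreover have "AE s in lebesgue. h s = fiber_action \<psi> w y g s" using h by eventually_elim simp
    ultimately show "(g, h) \<in> fiber_operator \<psi> w \<alpha> y"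
      unfolding fiber_operator_def fiber_domain_def fiber_measure_def using L v g0 by blast
  }
qed

text \<open>The fibre operators are self-adjoint already on the domain given in the statement, so
  taking the closure changes nothing.\<close>

lemma fiber_extension_eq: "fiber_extension \<psi> w \<alpha> y = T y"
  unfolding fiber_extension_def fiber_operator_eq fiber_measure_def
  by (rule op_closure_self_adjoint[OF slice_self_adjoint])

lemma essentially_self_adjoint_fiber: "essentially_self_adjoint (fiber_measure w y) (fiber_operator \<psi> w \<alpha> y)"
  using slice_self_adjoint[of y] op_closure_self_adjoint[OF slice_self_adjoint[of y]]
  by (simp add: essentially_self_adjoint_def fiber_operator_eq fiber_measure_def self_adjoint_def)

lemma L2_slices:
  assumes f: "f \<in> L2 (weighted w)"
  shows "AE y in lebesgue. (\<lambda>s. f (s, y)) \<in> L2 (weighted (P y))"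
    and "(\<integral>\<^sup>+y. ennreal ((L2_norm (weighted (P y)) (\<lambda>s. f (s, y)))\<^sup>2) \<partial>lebesgue)
      = ennreal ((L2_norm (weighted w) f)\<^sup>2)"
proof -
  have fm[measurable]: "f \<in> borel_measurable lebesgue" by (rule L2_weighted_measurable[OF f])
  define Q where "Q y = (\<integral>\<^sup>+s. ennreal (w (s, y) * (cmod (f (s, y)))\<^sup>2) \<partial>lebesgue)" for y
  have m: "(\<lambda>z. ennreal (w z * (cmod (f z))\<^sup>2)) \<in> borel_measurable lebesgue" by measurable
  have Q: "(\<integral>\<^sup>+y. Q y \<partial>lebesgue) = ennreal ((L2_norm (weighted w) f)\<^sup>2)" "Q \<in> borel_measurable lebesgue"
    unfolding Q_def[abs_def] L2_norm_weighted_nn_integral[OF f] using nn_integral_lebesgue_slices[OF m] by simp_all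
  have "AE y in lebesgue. Q y \<noteq> \<infinity>"
    by (rule nn_integral_PInf_AE[OF Q(2)]) (simp add: Q(1))
  with lebesgue_slice_measurable[OF fm]
  show sl: "AE y in lebesgue. (\<lambda>s. f (s, y)) \<in> L2 (weighted (P y))"
  proof eventually_elim
    case (elim y)
    then show ?case
      by (simp add: positive_weight.L2_weighted_nn_integral[OF slice_weight] Q_def less_top)
  qed
  have "AE y in lebesgue. ennreal ((L2_norm (weighted (P y)) (\<lambda>s. f (s, y)))\<^sup>2) = Q y"
    using sl by eventually_elim (simp add: positive_weight.L2_norm_weighted_nn_integral[OF slice_weight] Q_def)
  then show "(\<integral>\<^sup>+y. ennreal ((L2_norm (weighted (P y)) (\<lambda>s. f (s, y)))\<^sup>2) \<partial>lebesgue)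
      = ennreal ((L2_norm (weighted w) f)\<^sup>2)"
    unfolding Q(1)[symmetric] by (rule nn_integral_cong_AE)
qed

lemma L2_from_slices:
  assumes F: "F \<in> borel_measurable lebesgue"
    and sl: "AE y in lebesgue. (\<lambda>s. F (s, y)) \<in> L2 (weighted (P y))"
    and C: "(\<integral>\<^sup>+y. ennreal ((L2_norm (weighted (P y)) (\<lambda>s. F (s, y)))\<^sup>2) \<partial>lebesgue) < \<infinity>"
  shows "F \<in> L2 (weighted w)"
proof -
  note [measurable] = F
  have m: "(\<lambda>z. ennreal (w z * (cmod (F z))\<^sup>2)) \<in> borel_measurable lebesgue" by measurable
  have "(\<integral>\<^sup>+z. ennreal (w z * (cmod (F z))\<^sup>2) \<partial>lebesgue)
      = (\<integral>\<^sup>+y. (\<integral>\<^sup>+s. ennreal (w (s, y) * (cmod (F (s, y)))\<^sup>2) \<partial>lebesgue) \<partial>lebesgue)"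
    by (rule nn_integral_lebesgue_slices[OF m])
  also have "\<dots> = (\<integral>\<^sup>+y. ennreal ((L2_norm (weighted (P y)) (\<lambda>s. F (s, y)))\<^sup>2) \<partial>lebesgue)"
    by (rule nn_integral_cong_AE, use sl in eventually_elim)
      (simp add: positive_weight.L2_norm_weighted_nn_integral[OF slice_weight])
  finally show ?thesis using F C by (simp add: L2_weighted_nn_integral)
qed

text \<open>One constant \<open>B\<close> for almost all fibres gives the same constant on the
  product, by Tonelli. Resolvents and lower bounds are both carried over in this way.\<close>

lemma L2_from_slices_bound:
  assumes F: "F \<in> borel_measurable lebesgue" and h: "h \<in> L2 (weighted w)" and B: "0 \<le> B"
    and sl: "AE y in lebesgue. (\<lambda>s. F (s, y)) \<in> L2 (weighted (P y)) \<and>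
      L2_norm (weighted (P y)) (\<lambda>s. F (s, y)) \<le> B * L2_norm (weighted (P y)) (\<lambda>s. h (s, y))"
  shows "F \<in> L2 (weighted w)" and "L2_norm (weighted w) F \<le> B * L2_norm (weighted w) h"
proof -
  define H where "H y = ennreal ((L2_norm (weighted (P y)) (\<lambda>s. h (s, y)))\<^sup>2)" for y
  have Hm: "H \<in> borel_measurable lebesgue"
  proof -
    have hm[measurable]: "h \<in> borel_measurable lebesgue" by (rule L2_weighted_measurable[OF h])
    have m: "(\<lambda>z. ennreal (w z * (cmod (h z))\<^sup>2)) \<in> borel_measurable lebesgue" by measurable
    have "AE y in lebesgue. (\<integral>\<^sup>+s. ennreal (w (s, y) * (cmod (h (s, y)))\<^sup>2) \<partial>lebesgue) = H y"
      using L2_slices(1)[OF h]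
      by eventually_elim (simp add: positive_weight.L2_norm_weighted_nn_integral[OF slice_weight] H_def)
    from lebesgue_measurable_cong_AE[OF nn_integral_lebesgue_slices(2)[OF m] this] show ?thesis by simp
  qed
  have "(\<integral>\<^sup>+y. ennreal ((L2_norm (weighted (P y)) (\<lambda>s. F (s, y)))\<^sup>2) \<partial>lebesgue)
      \<le> (\<integral>\<^sup>+y. ennreal (B\<^sup>2) * H y \<partial>lebesgue)"
  proof (rule nn_integral_mono_AE, use sl in eventually_elim)
    case (elim y)
    then have "(L2_norm (weighted (P y)) (\<lambda>s. F (s, y)))\<^sup>2 \<le> (B * L2_norm (weighted (P y)) (\<lambda>s. h (s, y)))\<^sup>2"
      by (intro power_mono) (auto simp: L2_norm_nonneg)
    then show ?case by (simp add: H_def ennreal_mult[symmetric] power_mult_distrib ennreal_leI)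
  qed
  also have "\<dots> = ennreal (B\<^sup>2) * (\<integral>\<^sup>+y. H y \<partial>lebesgue)" by (rule nn_integral_cmult[OF Hm])
  also have "\<dots> = ennreal (B\<^sup>2) * ennreal ((L2_norm (weighted w) h)\<^sup>2)"
    unfolding H_def L2_slices(2)[OF h] ..
  also have "\<dots> = ennreal ((B * L2_norm (weighted w) h)\<^sup>2)"
    by (simp add: ennreal_mult[symmetric] power_mult_distrib)
  finally have le: "(\<integral>\<^sup>+y. ennreal ((L2_norm (weighted (P y)) (\<lambda>s. F (s, y)))\<^sup>2) \<partial>lebesgue)
      \<le> ennreal ((B * L2_norm (weighted w) h)\<^sup>2)" .
  show FL: "F \<in> L2 (weighted w)"
  proof (rule L2_from_slices[OF F])
    show "AE y in lebesgue. (\<lambda>s. F (s, y)) \<in> L2 (weighted (P y))" using sl by eventually_elim simp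
    show "(\<integral>\<^sup>+y. ennreal ((L2_norm (weighted (P y)) (\<lambda>s. F (s, y)))\<^sup>2) \<partial>lebesgue) < \<infinity>"
      using le by (rule le_less_trans) simp
  qed
  show "L2_norm (weighted w) F \<le> B * L2_norm (weighted w) h"
  proof (rule power2_le_imp_le)
    show "(L2_norm (weighted w) F)\<^sup>2 \<le> (B * L2_norm (weighted w) h)\<^sup>2"
      using le unfolding L2_slices(2)[OF FL] by simp
    show "0 \<le> B * L2_norm (weighted w) h" using B by (simp add: L2_norm_nonneg)
  qed
qed

text \<open>Measurability on the product is the essential hypothesis: it allows Tonelli for the
  modulus, whose integral then vanishes.\<close>

lemma AE_0_from_slices:
  fixes f :: "real \<times> (real ^ 'n) \<Rightarrow> complex"
  assumes [measurable]: "f \<in> borel_measurable lebesgue" and ae: "AE y in lebesgue. AE s in lebesgue. f (s, y) = 0"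
  shows "AE z in lebesgue. f z = 0"
proof -
  have m: "(\<lambda>z. ennreal (cmod (f z))) \<in> borel_measurable lebesgue" by measurable
  have "(\<integral>\<^sup>+z. ennreal (cmod (f z)) \<partial>lebesgue) = (\<integral>\<^sup>+y. (\<integral>\<^sup>+s. ennreal (cmod (f (s, y))) \<partial>lebesgue) \<partial>lebesgue)"
    by (rule nn_integral_lebesgue_slices[OF m])
  also have "\<dots> = (\<integral>\<^sup>+y. 0 \<partial>(lebesgue :: (real ^ 'n) measure))"
  proof (rule nn_integral_cong_AE, use ae in eventually_elim)
    case (elim y)
    then have "(\<integral>\<^sup>+s. ennreal (cmod (f (s, y))) \<partial>lebesgue) = (\<integral>\<^sup>+s. 0 \<partial>(lebesgue :: real measure))"
      by (intro nn_integral_cong_AE) (auto elim!: eventually_mono)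
    then show ?case by simp
  qed
  finally have "(\<integral>\<^sup>+z. ennreal (cmod (f z)) \<partial>lebesgue) = 0" by simp
  then show ?thesis using nn_integral_0_iff_AE[OF m] by simp
qed

abbreviation D :: "(real \<times> (real ^ 'n)) operator" where
  "D \<equiv> direct_integral w T"

lemma direct_integral_iff:
  "(f, h) \<in> D \<longleftrightarrow> f \<in> L2 (weighted w) \<and> h \<in> L2 (weighted w) \<and>
    (AE y in lebesgue. (\<lambda>s. f (s, y), \<lambda>s. h (s, y)) \<in> T y)"
  by (simp add: direct_integral_def)

lemma linear_direct_integral: "linear_operator (weighted w) D"
  unfolding linear_operator_def
proof (intro conjI allI impI)
  show "D \<subseteq> L2 (weighted w) \<times> L2 (weighted w)" by (auto simp: direct_integral_iff)
next
  fix f h f' h'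
  assume fh: "(f, h) \<in> D" and L: "f' \<in> L2 (weighted w)" "h' \<in> L2 (weighted w)"
    and ae: "AE x in weighted w. f' x = f x" "AE x in weighted w. h' x = h x"
  have "AE y in lebesgue. (\<lambda>s. f (s, y), \<lambda>s. h (s, y)) \<in> T y" using fh by (simp add: direct_integral_iff)
  with L2_slices(1)[OF L(1)] L2_slices(1)[OF L(2)]
    AE_lebesgue_slices[OF ae(1)[unfolded AE_weighted]] AE_lebesgue_slices[OF ae(2)[unfolded AE_weighted]]
  have "AE y in lebesgue. (\<lambda>s. f' (s, y), \<lambda>s. h' (s, y)) \<in> T y"
  proof eventually_elim
    case (elim y)
    then show ?case by (intro linear_operator_cong[OF slice_linear elim(5)]) (simp_all add: AE_slice_weighted)
  qed
  with L show "(f', h') \<in> D" by (simp add: direct_integral_iff)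
next
  fix f h g k assume "(f, h) \<in> D" "(g, k) \<in> D"
  then have L: "f \<in> L2 (weighted w)" "h \<in> L2 (weighted w)" "g \<in> L2 (weighted w)" "k \<in> L2 (weighted w)"
    and ae: "AE y in lebesgue. (\<lambda>s. f (s, y), \<lambda>s. h (s, y)) \<in> T y" "AE y in lebesgue. (\<lambda>s. g (s, y), \<lambda>s. k (s, y)) \<in> T y"
    by (auto simp: direct_integral_iff)
  have "AE y in lebesgue. (\<lambda>s. f (s, y) + g (s, y), \<lambda>s. h (s, y) + k (s, y)) \<in> T y"
    using ae by eventually_elim (rule linear_operator_add[OF slice_linear])
  then show "(\<lambda>x. f x + g x, \<lambda>x. h x + k x) \<in> D" using L by (simp add: direct_integral_iff L2_add)
next
  fix c f h assume "(f, h) \<in> D"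
  then have L: "f \<in> L2 (weighted w)" "h \<in> L2 (weighted w)"
    and ae: "AE y in lebesgue. (\<lambda>s. f (s, y), \<lambda>s. h (s, y)) \<in> T y"
    by (auto simp: direct_integral_iff)
  have "AE y in lebesgue. (\<lambda>s. c * f (s, y), \<lambda>s. c * h (s, y)) \<in> T y"
    using ae by eventually_elim (rule linear_operator_scale[OF slice_linear])
  then show "(\<lambda>x. c * f x, \<lambda>x. c * h x) \<in> D" using L by (simp add: direct_integral_iff L2_scale)
next
  fix f h h' assume "(f, h) \<in> D" "(f, h') \<in> D"
  then have L: "h \<in> L2 (weighted w)" "h' \<in> L2 (weighted w)"
    and ae: "AE y in lebesgue. (\<lambda>s. f (s, y), \<lambda>s. h (s, y)) \<in> T y" "AE y in lebesgue. (\<lambda>s. f (s, y), \<lambda>s. h' (s, y)) \<in> T y"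
    by (auto simp: direct_integral_iff)
  have "AE y in lebesgue. AE s in lebesgue. h (s, y) - h' (s, y) = 0"
    using ae
  proof eventually_elim
    case (elim y)
    from linear_operator_unique[OF slice_linear elim] show ?case by (simp add: AE_slice_weighted)
  qed
  then have "AE z in lebesgue. h z - h' z = 0"
    using L by (intro AE_0_from_slices L2_weighted_measurable L2_diff)
  then show "AE z in weighted w. h z = h' z" unfolding AE_weighted by eventually_elim simp
qed

lemma symmetric_direct_integral: "symmetric_operator (weighted w) D"
  unfolding symmetric_operator_def
proof (intro ballI, clarify)
  fix f h g k assume "(f, h) \<in> D" "(g, k) \<in> D"
  then have L: "f \<in> L2 (weighted w)" "h \<in> L2 (weighted w)" "g \<in> L2 (weighted w)" "k \<in> L2 (weighted w)"
    and ae: "AE y in lebesgue. (\<lambda>s. f (s, y), \<lambda>s. h (s, y)) \<in> T y" "AE y in lebesgue. (\<lambda>s. g (s, y), \<lambda>s. k (s, y)) \<in> T y"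
    by (auto simp: direct_integral_iff)
  note i1 = integral_lebesgue_slices[OF L2_inner_weighted(1)[OF L(2,3)]]
  note i2 = integral_lebesgue_slices[OF L2_inner_weighted(1)[OF L(1,4)]]
  have "AE y in lebesgue. (LINT s|lebesgue. w (s, y) *\<^sub>R (h (s, y) * cnj (g (s, y))))
      = (LINT s|lebesgue. w (s, y) *\<^sub>R (f (s, y) * cnj (k (s, y))))"
    using ae
  proof eventually_elim
    case (elim y)
    have SL: "(\<lambda>s. f (s, y)) \<in> L2 (weighted (P y))" "(\<lambda>s. h (s, y)) \<in> L2 (weighted (P y))"
      "(\<lambda>s. g (s, y)) \<in> L2 (weighted (P y))" "(\<lambda>s. k (s, y)) \<in> L2 (weighted (P y))"
      using linear_operator_L2[OF slice_linear elim(1)] linear_operator_L2[OF slice_linear elim(2)] by auto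
    show ?case
      using symmetric_operatorD[OF slice_symmetric elim]
      unfolding positive_weight.L2_inner_weighted(2)[OF slice_weight SL(2,3)]
        positive_weight.L2_inner_weighted(2)[OF slice_weight SL(1,4)] .
  qed
  then show "L2_inner (weighted w) h g = L2_inner (weighted w) f k"
    unfolding L2_inner_weighted(2)[OF L(2,3)] L2_inner_weighted(2)[OF L(1,4)] i1(3) i2(3)
    by (intro integral_cong_AE borel_measurable_integrable i1(2) i2(2))
qed

text \<open>The fibre resolvents of \<open>h\<close> are glued to one function \<open>F\<close>.
  Regularity places its slices in the fibre domains, and the uniform bound \<open>B\<close> makes it
  square integrable on the product.\<close>

lemma onto_shift_direct_integral:
  assumes B: "0 \<le> B"
    and reg: "AE y in lebesgue. fibre.regular (P y) (\<psi> y) (\<alpha> y) z"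
    and bd: "AE y in lebesgue. \<forall>(g, k) \<in> T y.
      L2_norm (weighted (P y)) g \<le> B * L2_norm (weighted (P y)) (\<lambda>s. k s - z * g s)"
  shows "onto_shift (weighted w) D z"
  unfolding onto_shift_def
proof
  fix h assume h: "h \<in> L2 (weighted w)"
  have hm: "h \<in> borel_measurable lebesgue" by (rule L2_weighted_measurable[OF h])
  obtain h' where h': "h' \<in> borel_measurable borel" "AE x in lebesgue. h x = h' x"
    using complex_borel_representative[OF hm] .
  obtain \<alpha>' where \<alpha>': "\<alpha>' \<in> borel_measurable borel" "AE y in lebesgue. \<alpha> y = \<alpha>' y"
    using complex_borel_representative[OF alpha_measurable] .
  obtain \<psi>' where \<psi>': "\<psi>' \<in> borel_measurable lborel" "AE y in lborel. \<psi> y = \<psi>' y"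
    using completion_ex_borel_measurable_real[OF psi_measurable] by blast
  obtain w' where w': "w' \<in> borel_measurable lborel" "AE z in lborel. w z = w' z"
    using completion_ex_borel_measurable_real[OF weight_measurable] by blast
  \<comment> \<open>The formula is applied to Borel representatives of all four data, which makes it
    measurable on the product; on almost every slice it equals the resolvent of the original data at
    every point.\<close>
  define F where "F x = resolvent (\<lambda>s. w' (s, snd x)) (\<psi>' (snd x)) (\<alpha>' (snd x)) z (\<lambda>s. h' (s, snd x)) (fst x)"
    for x :: "real \<times> (real ^ 'n)"
  have swap: "(\<lambda>(y, u). q (u, y)) \<in> borel_measurable (borel \<Otimes>\<^sub>M borel)"
    if "q \<in> borel_measurable (borel :: (real \<times> (real ^ 'n)) measure)" for q :: "real \<times> (real ^ 'n) \<Rightarrow> 'r::topological_space"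
  proof -
    have "(\<lambda>x. q (case x of (y, u) \<Rightarrow> (u, y))) \<in> borel_measurable (borel \<Otimes>\<^sub>M borel)"
      by (rule measurable_compose[OF _ that]) (simp add: borel_prod[symmetric])
    then show ?thesis by (simp add: split_def)
  qed
  have "(\<lambda>(y, s). resolvent (\<lambda>s. w' (s, y)) (\<psi>' y) (\<alpha>' y) z (\<lambda>s. h' (s, y)) s) \<in> borel_measurable (borel \<Otimes>\<^sub>M borel)"
    using w'(1) \<psi>'(1) \<alpha>'(1) h'(1) by (intro measurable_resolvent swap) simp_all
  from measurable_compose[OF measurable_pair_swap' this]
  have "F \<in> borel_measurable (borel \<Otimes>\<^sub>M borel)"
    unfolding F_def[abs_def] by (simp add: split_def)
  then have Fm: "F \<in> borel_measurable lebesgue"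
    by (intro measurable_completion) (simp add: borel_prod)
  have slm: "(\<lambda>s. q (s, y)) \<in> borel_measurable lebesgue"
    if "q \<in> borel_measurable (borel :: (real \<times> (real ^ 'n)) measure)" for q :: "real \<times> (real ^ 'n) \<Rightarrow> 'r::topological_space" and y
  proof -
    have "(\<lambda>s. q (s, y)) \<in> borel_measurable borel"
      by (rule measurable_compose[OF _ that]) (simp add: borel_prod[symmetric])
    then show ?thesis by (intro measurable_completion) simp
  qed
  from AE_lebesgue_slices[OF h'(2)] AE_lebesgue_slices[OF AE_completion[OF w'(2)]] \<alpha>'(2) AE_completion[OF \<psi>'(2)]
    L2_slices(1)[OF h] reg
  have FT: "AE y in lebesgue. (\<lambda>s. F (s, y), \<lambda>s. h (s, y) + z * F (s, y)) \<in> T y"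
  proof eventually_elim
    case (elim y)
    interpret fib: fibre "P y" "\<psi> y" "\<alpha> y" by (rule fibre_slice)
    have "resolvent (P y) (\<psi> y) (\<alpha> y) z (\<lambda>s. h (s, y)) = resolvent (\<lambda>s. w' (s, y)) (\<psi> y) (\<alpha> y) z (\<lambda>s. h' (s, y))"
      using elim w'(1) h'(1)
      by (intro resolvent_cong_AE fib.weight_measurable slm fib.L2_weighted_measurable
          continuous_imp_borel_lebesgue antiderivative_continuous[OF fib.antiderivative_phase]) simp_all
    then have "F (s, y) = resolvent (P y) (\<psi> y) (\<alpha> y) z (\<lambda>s. h (s, y)) s" for s
      using elim(3,4) by (simp add: F_def)
    then show ?case using fib.resolvent_in_transport[OF elim(5,6)] by simp
  qed
  have FL: "F \<in> L2 (weighted w)"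
  proof (rule L2_from_slices_bound(1)[OF Fm h B])
    show "AE y in lebesgue. (\<lambda>s. F (s, y)) \<in> L2 (weighted (P y)) \<and>
      L2_norm (weighted (P y)) (\<lambda>s. F (s, y)) \<le> B * L2_norm (weighted (P y)) (\<lambda>s. h (s, y))"
      using FT bd
    proof eventually_elim
      case (elim y)
      have "(\<lambda>s. F (s, y)) \<in> L2 (weighted (P y))" using linear_operator_L2[OF slice_linear elim(1)] by simp
      \<comment> \<open>The fibre bound is applied to \<open>F\<close> and its image
        \<open>h + z F\<close>, for which \<open>k - z g\<close> is \<open>h\<close>.\<close>
      moreover have "L2_norm (weighted (P y)) (\<lambda>s. F (s, y))
          \<le> B * L2_norm (weighted (P y)) (\<lambda>s. (h (s, y) + z * F (s, y)) - z * F (s, y))"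
        using bspec[OF elim(2) elim(1)] by (simp only: prod.case)
      ultimately show ?case by simp
    qed
  qed
  have "(F, \<lambda>x. h x + z * F x) \<in> D"
    using FT FL h by (simp add: direct_integral_iff L2_add L2_scale)
  then show "\<exists>(f, k)\<in>D. AE x in weighted w. k x - z * f x = h x"
    by (intro bexI[of _ "(F, \<lambda>x. h x + z * F x)"]) auto
qed

lemma onto_shift_nonreal:
  assumes "Im z \<noteq> 0"
  shows "onto_shift (weighted w) D z"
proof (rule onto_shift_direct_integral)
  show "0 \<le> 1 / \<bar>Im z\<bar>" by simp
  show "AE y in lebesgue. fibre.regular (P y) (\<psi> y) (\<alpha> y) z"
    by (rule AE_I2) (rule fibre.regular_nonreal[OF fibre_slice assms])
  show "AE y in lebesgue. \<forall>(g, k) \<in> T y.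
      L2_norm (weighted (P y)) g \<le> 1 / \<bar>Im z\<bar> * L2_norm (weighted (P y)) (\<lambda>s. k s - z * g s)"
  proof (rule AE_I2, clarify)
    fix y g k assume "(g, k) \<in> T y"
    from symmetric_operator_norm_nonreal[OF slice_linear slice_symmetric this, of z]
    show "L2_norm (weighted (P y)) g \<le> 1 / \<bar>Im z\<bar> * L2_norm (weighted (P y)) (\<lambda>s. k s - z * g s)"
      using assms by (simp add: field_simps)
  qed
qed

lemma self_adjoint_direct_integral: "self_adjoint (weighted w) D"
  by (intro self_adjointI linear_direct_integral symmetric_direct_integral onto_shift_nonreal) simp_all

text \<open>The fibrewise image \<open>K y\<close> comes from \<open>weak_deriv\<close>, chosen
  separately for every \<open>y\<close>, so joint measurability is not known and it cannot be taken
  as \<open>h\<close>. The Yosida approximations \<open>n G\<close>, formed with the resolvent of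
  the direct integral, are measurable and bounded by the fibre norms of \<open>K y\<close>;
  \<open>self_adjoint_domainI\<close> then produces an image of \<open>f\<close>.\<close>

lemma shear_domain_in_Domain:
  assumes f: "f \<in> shear_domain \<psi> w \<alpha>"
  obtains h where "(f, h) \<in> D"
proof -
  have fL: "f \<in> L2 (weighted w)"
    and fd: "AE y in lebesgue. (\<lambda>s. f (s, y)) \<in> fiber_domain \<psi> w \<alpha> y"
    and fin: "(\<integral>\<^sup>+y. (\<integral>\<^sup>+s. ennreal ((cmod (fiber_action \<psi> w y (\<lambda>s. f (s, y)) s))\<^sup>2) \<partial>fiber_measure w y) \<partial>lebesgue) < \<infinity>"
    using f by (auto simp: shear_domain_def)
  define K where "K y = fiber_action \<psi> w y (\<lambda>s. f (s, y))" for y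
  have KT: "AE y in lebesgue. (\<lambda>s. f (s, y), K y) \<in> T y"
    using fd by eventually_elim (auto simp: K_def fiber_operator_def fiber_domain_def simp flip: fiber_operator_eq)
  have "AE y in lebesgue. (\<integral>\<^sup>+s. ennreal ((cmod (K y s))\<^sup>2) \<partial>fiber_measure w y)
      = ennreal ((L2_norm (weighted (P y)) (K y))\<^sup>2)"
    using KT
  proof eventually_elim
    case (elim y)
    then show ?case
      using linear_operator_L2[OF slice_linear elim] by (simp add: L2_norm_nn_integral fiber_measure_def)
  qed
  from nn_integral_cong_AE[OF this]
  have fin': "(\<integral>\<^sup>+y. ennreal ((L2_norm (weighted (P y)) (K y))\<^sup>2) \<partial>lebesgue) < \<infinity>"
    using fin by (simp add: K_def)
  then obtain C where C: "0 \<le> C" "(\<integral>\<^sup>+y. ennreal ((L2_norm (weighted (P y)) (K y))\<^sup>2) \<partial>lebesgue) = ennreal C"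
    by (cases "\<integral>\<^sup>+y. ennreal ((L2_norm (weighted (P y)) (K y))\<^sup>2) \<partial>lebesgue") auto
  show ?thesis
  proof (rule self_adjoint_domainI[OF self_adjoint_direct_integral fL])
    fix n :: nat assume n: "n > 0"
    obtain F G where FG: "(F, G) \<in> D" "AE x in weighted w. G x - (\<i> * of_nat n) * F x = f x"
      using onto_shiftE[OF onto_shift_nonreal fL, of "\<i> * of_nat n"] n by auto
    have GL: "G \<in> L2 (weighted w)" using FG(1) by (simp add: direct_integral_iff)
    have ae: "AE y in lebesgue. AE s in lebesgue. G (s, y) - (\<i> * of_nat n) * F (s, y) = f (s, y)"
      using FG(2) unfolding AE_weighted by (rule AE_lebesgue_slices)
    have FGT: "AE y in lebesgue. (\<lambda>s. F (s, y), \<lambda>s. G (s, y)) \<in> T y" using FG(1) by (simp add: direct_integral_iff)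
    have le: "AE y in lebesgue. (real n)\<^sup>2 * (L2_norm (weighted (P y)) (\<lambda>s. G (s, y)))\<^sup>2 \<le> (L2_norm (weighted (P y)) (K y))\<^sup>2"
      using KT ae FGT
    proof eventually_elim
      case (elim y)
      define c where "c = \<i> * complex_of_real (real n)"
      have LG: "(\<lambda>s. G (s, y)) \<in> L2 (weighted (P y))" and LK: "K y \<in> L2 (weighted (P y))"
        using linear_operator_L2[OF slice_linear elim(3)] linear_operator_L2[OF slice_linear elim(1)] by auto
      have sum: "(\<lambda>s. f (s, y) + c * F (s, y), \<lambda>s. K y s + c * G (s, y)) \<in> T y"
        by (rule linear_operator_add[OF slice_linear elim(1) linear_operator_scale[OF slice_linear elim(3)]])
      \<comment> \<open>\<open>G = f + i n F\<close> lies in the fibre domain with image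
        \<open>K y + i n G\<close>. Removing \<open>i n G\<close> from this image leaves
        \<open>K y\<close>, whose squared norm therefore contains \<open>n^2\<close> times that of
        \<open>G\<close>.\<close>
      have "(\<lambda>s. G (s, y), \<lambda>s. K y s + c * G (s, y)) \<in> T y"
      proof (rule linear_operator_cong[OF slice_linear sum LG])
        show "(\<lambda>s. K y s + c * G (s, y)) \<in> L2 (weighted (P y))" by (intro L2_add L2_scale LG LK)
        show "AE s in weighted (P y). G (s, y) = f (s, y) + c * F (s, y)"
          unfolding AE_slice_weighted using elim(2) by eventually_elim (simp add: c_def algebra_simps)
      qed simp
      from symmetric_operator_norm_shift[OF slice_linear slice_symmetric this, of "real n"]
      show ?case by (simp add: c_def)
    qed
    have "ennreal ((real n)\<^sup>2) * ennreal ((L2_norm (weighted w) G)\<^sup>2)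
        = ennreal ((real n)\<^sup>2) * (\<integral>\<^sup>+y. ennreal ((L2_norm (weighted (P y)) (\<lambda>s. G (s, y)))\<^sup>2) \<partial>lebesgue)"
      by (simp only: L2_slices(2)[OF GL])
    also have "\<dots> = ennreal ((L2_norm (weighted w) (\<lambda>x. of_nat n * G x))\<^sup>2)"
      by (simp add: L2_slices(2)[OF GL] L2_norm_scale power_mult_distrib ennreal_mult)
    also have "\<dots> = (\<integral>\<^sup>+y. ennreal ((L2_norm (weighted (P y)) (\<lambda>s. of_nat n * G (s, y)))\<^sup>2) \<partial>lebesgue)"
      using L2_slices(2)[OF L2_scale[OF GL, of "of_nat n"]] by simp
    \<comment> \<open>Monotonicity holds also for functions not known to be measurable, such as the
      fibre norm of \<open>K y\<close> as a function of \<open>y\<close>.\<close>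
    also have "\<dots> \<le> ennreal C"
      unfolding C(2)[symmetric]
      by (rule nn_integral_mono_AE, use le in eventually_elim)
        (simp add: L2_norm_scale power_mult_distrib ennreal_leI)
    finally have "(real n * L2_norm (weighted w) G)\<^sup>2 \<le> C"
      using C(1) by (simp add: ennreal_mult[symmetric] power_mult_distrib)
    then have "real n * L2_norm (weighted w) G \<le> sqrt C" by (rule real_le_rsqrt)
    then show "\<exists>(F, K)\<in>D. (AE x in weighted w. K x - (\<i> * of_nat n) * F x = f x) \<and>
        real n * L2_norm (weighted w) K \<le> sqrt C"
      using FG by (intro bexI[OF _ FG(1)]) auto
  qed (rule that)
qed

end

section \<open>The distributional derivative on the product space\<close>

text \<open>A primitive of \<open>u\<close> is continuous and takes a single value on the rationals,
  so it is constant. Rational ends matter because countably many conditions can hold outside one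
  common null set.\<close>

lemma rational_boxes_0_imp_AE_0:
  fixes u :: "real \<Rightarrow> complex"
  assumes u: "locally_integrable u"
    and z: "\<And>a b. a \<in> \<rat> \<Longrightarrow> b \<in> \<rat> \<Longrightarrow> (LINT s:box a b|lebesgue. u s) = 0"
  shows "AE s in lebesgue. u s = 0"
proof -
  have box: "(LINT s:box a b|lebesgue. u s) = (LINT s:{a..b}|lebesgue. u s)" for a b :: real
  proof -
    have "AE s in lebesgue. (s \<in> {a..b}) = (s \<in> box a b)"
      using AE_completion[OF AE_lborel_singleton[of a]] AE_completion[OF AE_lborel_singleton[of b]]
      by eventually_elim (auto simp: box_real)
    moreover have "set_borel_measurable lebesgue A u" if "A \<in> sets lebesgue" for A
      unfolding set_borel_measurable_def using that
      by (intro borel_measurable_scaleR borel_measurable_indicator locally_integrable_measurable[OF u])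
    ultimately show ?thesis by (intro set_integral_cong_set) auto
  qed
  define g where "g = primitive u"
  have g: "antiderivative g u" unfolding g_def by (rule antiderivative_primitive[OF u])
  have gQ: "g s = g 0" if "s \<in> \<rat>" for s
  proof (cases "0 \<le> s")
    case True
    then show ?thesis using antiderivative_eq[OF g True] z[of 0 s] that box[of 0 s] by simp
  next
    case False
    then have s: "s \<le> 0" by simp
    then show ?thesis using antiderivative_eq[OF g s] z[of s 0] that box[of s 0] by simp
  qed
  have "continuous_on (closure \<rat>) g"
    using antiderivative_continuous[OF g] by (simp add: Rats_closure_real)
  from continuous_constant_on_closure[OF this gQ] have gc: "g s = g 0" for s
    by (simp add: Rats_closure_real)
  have "(LINT s:{a..b}|lebesgue. u s) = 0" for a b
  proof (cases "a \<le> b")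
    case True
    then show ?thesis using antiderivative_eq[OF g True] gc[of a] gc[of b] by simp
  qed (simp add: set_lebesgue_integral_def)
  then show ?thesis by (intro box_integrals_0_imp_AE_0 u) (simp only: box)
qed

text \<open>A fixed weight that is both bounded and square integrable as well as integrable: it
  makes fibre integrals finite for bounded, integrable and square integrable functions, the cases
  that occur for \<open>g\<close> and its derivative.\<close>

definition damping :: "real \<Rightarrow> real" where
  "damping s = exp (- (1 * \<bar>s\<bar>))"

lemma damping_measurable: "damping \<in> borel_measurable lebesgue"
  unfolding damping_def[abs_def] by (intro continuous_imp_borel_lebesgue continuous_intros)

lemma damping_range: "0 < damping s" "damping s \<le> 1"
  by (auto simp: damping_def)

lemma nn_integral_damping: "(\<integral>\<^sup>+s. ennreal (damping s) \<partial>lebesgue) < \<infinity>"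
  unfolding damping_def using nn_integral_exp_minus_abs[of 1] by (simp add: nn_integral_completion)

lemma damped_finite_L2:
  assumes "u \<in> L2 lebesgue"
  shows "(\<integral>\<^sup>+s. ennreal (cmod (u s) * damping s) \<partial>lebesgue) < \<infinity>"
proof -
  have [measurable]: "u \<in> borel_measurable lebesgue" by (rule L2_measurable[OF assms])
  note [measurable] = damping_measurable
  have "cmod (u s) * damping s \<le> (cmod (u s))\<^sup>2 + damping s" for s
  proof -
    have "cmod (u s) * damping s \<le> (1 + (cmod (u s))\<^sup>2) * damping s"
      using damping_range[of s] power2_sum[of "cmod (u s)" "-1"] zero_le_power2[of "cmod (u s) - 1"]
        norm_ge_zero[of "u s"]
      by (intro mult_right_mono) (auto simp: power2_diff simp del: norm_ge_zero)
    also have "\<dots> \<le> (cmod (u s))\<^sup>2 + damping s"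
      using damping_range[of s] mult_left_mono[of "damping s" 1 "(cmod (u s))\<^sup>2"] by (simp add: distrib_right)
    finally show ?thesis .
  qed
  then have "(\<integral>\<^sup>+s. ennreal (cmod (u s) * damping s) \<partial>lebesgue)
      \<le> (\<integral>\<^sup>+s. ennreal ((cmod (u s))\<^sup>2) + ennreal (damping s) \<partial>lebesgue)"
    using damping_range by (intro nn_integral_mono) (simp add: ennreal_plus[symmetric] less_imp_le ennreal_leI del: ennreal_plus)
  also have "\<dots> = (\<integral>\<^sup>+s. ennreal ((cmod (u s))\<^sup>2) \<partial>lebesgue) + (\<integral>\<^sup>+s. ennreal (damping s) \<partial>lebesgue)"
    by (intro nn_integral_add) measurable
  also have "\<dots> < \<infinity>"
    using assms nn_integral_damping by (simp add: L2_iff_nn_integral)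
  finally show ?thesis .
qed

lemma damped_finite_integrable:
  assumes "integrable lebesgue u"
  shows "(\<integral>\<^sup>+s. ennreal (cmod (u s) * damping s) \<partial>lebesgue) < \<infinity>"
proof -
  have "(\<integral>\<^sup>+s. ennreal (cmod (u s) * damping s) \<partial>lebesgue) \<le> (\<integral>\<^sup>+s. ennreal (cmod (u s)) \<partial>lebesgue)"
    using damping_range by (intro nn_integral_mono ennreal_leI) (simp add: mult_left_le less_imp_le)
  also have "\<dots> < \<infinity>" using assms by (simp add: integrable_iff_bounded)
  finally show ?thesis .
qed

lemma damped_finite_bounded:
  assumes "AE s in lebesgue. cmod (u s) \<le> C"
  shows "(\<integral>\<^sup>+s. ennreal (cmod (u s) * damping s) \<partial>lebesgue) < \<infinity>"
proof -
  have "(\<integral>\<^sup>+s. ennreal (cmod (u s) * damping s) \<partial>lebesgue) \<le> (\<integral>\<^sup>+s. ennreal \<bar>C\<bar> * ennreal (damping s) \<partial>lebesgue)"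
    by (rule nn_integral_mono_AE, use assms in eventually_elim)
      (use damping_range in \<open>auto simp: ennreal_mult[symmetric] less_imp_le intro!: ennreal_leI mult_right_mono\<close>)
  also have "\<dots> = ennreal \<bar>C\<bar> * (\<integral>\<^sup>+s. ennreal (damping s) \<partial>lebesgue)"
    using damping_measurable by (intro nn_integral_cmult) measurable
  also have "\<dots> < \<infinity>" using nn_integral_damping by (simp add: ennreal_mult_less_top)
  finally show ?thesis .
qed

context fibre
begin

text \<open>For integrable \<open>p\<close> the derivative is integrable and the representative of
  \<open>g\<close> bounded; if \<open>p = 1\<close> almost everywhere, both are square
  integrable.\<close>

lemma transport_damped_finite:
  assumes "(g, h) \<in> transport_operator p c a"
  shows "(\<integral>\<^sup>+s. ennreal (cmod (g s) * damping s) \<partial>lebesgue) < \<infinity>"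
    and "(\<integral>\<^sup>+s. ennreal (cmod (\<i> * of_real (p s / c) * h s) * damping s) \<partial>lebesgue) < \<infinity>"
proof -
  obtain g0 A where L: "g \<in> L2 (weighted p)" "h \<in> L2 (weighted p)"
    and g0: "AE s in lebesgue. g s = g0 s" "antiderivative g0 (\<lambda>s. \<i> * of_real (p s / c) * h s)"
    using assms by (elim transport_operatorE)
  have "(\<integral>\<^sup>+s. ennreal (cmod (g s) * damping s) \<partial>lebesgue) < \<infinity> \<and>
    (\<integral>\<^sup>+s. ennreal (cmod (\<i> * of_real (p s / c) * h s) * damping s) \<partial>lebesgue) < \<infinity>"
  proof (cases "integrable lebesgue p")
    case True
    have i: "integrable lebesgue (\<lambda>s. \<i> * of_real (p s / c) * h s)" by (rule integrable_drift[OF True L(2)])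
    define C where "C = cmod (g0 0) + (LINT s|lebesgue. cmod (\<i> * of_real (p s / c) * h s))"
    have "cmod (g0 s) \<le> C" for s
      using antiderivative_increment_bound[OF g0(2) i, of s 0] norm_triangle_ineq2[of "g0 s" "g0 0"]
      unfolding C_def by linarith
    then have "AE s in lebesgue. cmod (g s) \<le> C" using g0(1) by (auto elim!: eventually_mono)
    then show ?thesis using damped_finite_bounded damped_finite_integrable[OF i] by blast
  next
    case False
    then have p: "AE s in lebesgue. p s = 1" using constant_or_integrable by blast
    have L2: "f \<in> L2 lebesgue" if f: "f \<in> L2 (weighted p)" for f
    proof (rule L2_I)
      have [measurable]: "f \<in> borel_measurable lebesgue" by (rule L2_weighted_measurable[OF f])
      show "f \<in> borel_measurable lebesgue" by fact
      have "integrable lebesgue (\<lambda>s. p s * (cmod (f s))\<^sup>2)" using f by (simp add: L2_weighted)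
      then show "integrable lebesgue (\<lambda>s. (cmod (f s))\<^sup>2)"
      proof (rule integrable_cong_AE_imp)
        show "(\<lambda>s. (cmod (f s))\<^sup>2) \<in> borel_measurable lebesgue" by measurable
        show "AE s in lebesgue. p s * (cmod (f s))\<^sup>2 = (cmod (f s))\<^sup>2" using p by eventually_elim simp
      qed
    qed
    have "(\<lambda>s. \<i> * of_real (p s / c) * h s) \<in> L2 lebesgue"
    proof (rule L2_bound[OF L2[OF L(2)]])
      show "(\<lambda>s. \<i> * of_real (p s / c) * h s) \<in> borel_measurable lebesgue"
        by (rule drift_measurable[OF L2_weighted_measurable[OF L(2)]])
      show "AE s in lebesgue. cmod (\<i> * of_real (p s / c) * h s) \<le> (1 / c) * cmod (h s)"
        using p by eventually_elim (use c_pos in \<open>simp add: norm_mult norm_divide\<close>)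
    qed
    then show ?thesis using damped_finite_L2 L2[OF L(1)] by blast
  qed
  then show "(\<integral>\<^sup>+s. ennreal (cmod (g s) * damping s) \<partial>lebesgue) < \<infinity>"
    "(\<integral>\<^sup>+s. ennreal (cmod (\<i> * of_real (p s / c) * h s) * damping s) \<partial>lebesgue) < \<infinity>" by auto
qed

end

lemma compact_in_product:
  fixes K :: "(real \<times> 'b::euclidean_space) set"
  assumes "compact K"
  obtains R where "R > 0" "K \<subseteq> {-R..R} \<times> cball 0 R"
proof -
  obtain B where B: "\<And>z. z \<in> K \<Longrightarrow> norm z \<le> B"
    using compact_imp_bounded[OF assms] by (auto simp: bounded_iff)
  show ?thesis
  proof (rule that[of "\<bar>B\<bar> + 1"])
    show "K \<subseteq> {-(\<bar>B\<bar> + 1)..\<bar>B\<bar> + 1} \<times> cball 0 (\<bar>B\<bar> + 1)"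
    proof
      fix z assume "z \<in> K"
      then have "norm z \<le> B" by (rule B)
      then have "\<bar>fst z\<bar> \<le> B" "norm (snd z) \<le> B"
        using norm_fst_le[of "fst z" "snd z"] norm_snd_le[of "snd z" "fst z"] by simp_all
      then show "z \<in> {-(\<bar>B\<bar> + 1)..\<bar>B\<bar> + 1} \<times> cball 0 (\<bar>B\<bar> + 1)"
        by (cases z) (auto simp: abs_le_iff)
    qed
  qed simp
qed

text \<open>The factor \<open>1 / (1 + A)\<close> brings every damped fibre integral below 1. On a
  compact set \<open>|s| \<le> R\<close>, where \<open>exp R * damping s\<close> is at least 1, so
  the undamped integral is at most \<open>exp R\<close> times the volume of a ball. This supplies
  the factor \<open>\<rho>\<close> in \<open>has_weak_partial1\<close>.\<close>

lemma locally_integrable_renormalized: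
  fixes u :: "real \<times> 'b::euclidean_space \<Rightarrow> complex" and A :: "'b \<Rightarrow> ennreal"
  assumes u[measurable]: "u \<in> borel_measurable lebesgue" and A[measurable]: "A \<in> borel_measurable lebesgue"
    and le: "AE y in lebesgue. (\<integral>\<^sup>+s. ennreal (cmod (u (s, y)) * damping s) \<partial>lebesgue) \<le> A y \<and> A y < \<infinity>"
  defines "\<rho> \<equiv> \<lambda>y. 1 / (1 + enn2real (A y))"
  shows "locally_integrable (\<lambda>z. \<rho> (snd z) *\<^sub>R u z)"
  unfolding locally_integrable_def
proof (intro allI impI)
  fix K :: "(real \<times> 'b) set" assume K: "compact K"
  have \<rho>0: "0 < \<rho> y" for y by (simp add: \<rho>_def add_pos_nonneg)
  have "(\<lambda>y. complex_of_real (\<rho> y)) \<in> borel_measurable lebesgue" unfolding \<rho>_def by measurable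
  from snd_lebesgue_measurable[OF this]
  have [measurable]: "(\<lambda>z::real \<times> 'b. complex_of_real (\<rho> (snd z))) \<in> borel_measurable lebesgue" .
  have m[measurable]: "(\<lambda>z. \<rho> (snd z) *\<^sub>R u z) \<in> borel_measurable lebesgue"
    unfolding scaleR_conv_of_real by measurable
  obtain R where R: "R > 0" "K \<subseteq> {-R..R} \<times> cball 0 R" using compact_in_product[OF K] .
  define Q where "Q = {-R..R} \<times> cball (0::'b) R"
  have Q[measurable]: "Q \<in> sets lebesgue"
    unfolding Q_def by (intro compact_imp_sets_lebesgue compact_Times) auto
  have "set_integrable lebesgue Q (\<lambda>z. \<rho> (snd z) *\<^sub>R u z)"
    unfolding set_integrable_def integrable_iff_bounded
  proof
    show "(\<lambda>z. indicator Q z *\<^sub>R \<rho> (snd z) *\<^sub>R u z) \<in> borel_measurable lebesgue"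
      by (intro borel_measurable_scaleR borel_measurable_indicator Q m)
    then have m': "(\<lambda>z. ennreal (norm (indicator Q z *\<^sub>R \<rho> (snd z) *\<^sub>R u z))) \<in> borel_measurable lebesgue" by measurable
    have "(\<integral>\<^sup>+z. ennreal (norm (indicator Q z *\<^sub>R \<rho> (snd z) *\<^sub>R u z)) \<partial>lebesgue)
        = (\<integral>\<^sup>+y. (\<integral>\<^sup>+s. ennreal (norm (indicator Q (s, y) *\<^sub>R \<rho> y *\<^sub>R u (s, y))) \<partial>lebesgue) \<partial>lebesgue)"
      using nn_integral_lebesgue_slices(1)[OF m'] by simp
    also have "\<dots> \<le> (\<integral>\<^sup>+y. ennreal (exp R) * indicator (cball (0::'b) R) y \<partial>lebesgue)"
    proof (rule nn_integral_mono_AE)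
      show "AE y in lebesgue. (\<integral>\<^sup>+s. ennreal (norm (indicator Q (s, y) *\<^sub>R \<rho> y *\<^sub>R u (s, y))) \<partial>lebesgue)
          \<le> ennreal (exp R) * indicator (cball (0::'b) R) y"
        using le lebesgue_slice_measurable[OF u]
      proof eventually_elim
        case (elim y)
        show ?case
        proof (cases "y \<in> cball 0 R")
          case True
          have Ay: "A y = ennreal (enn2real (A y))" using elim(1) by (simp add: less_top)
          have \<rho>A: "\<rho> y * enn2real (A y) \<le> 1" by (simp add: \<rho>_def divide_le_eq add_pos_nonneg)
          have "(\<integral>\<^sup>+s. ennreal (norm (indicator Q (s, y) *\<^sub>R \<rho> y *\<^sub>R u (s, y))) \<partial>lebesgue)
              \<le> (\<integral>\<^sup>+s. ennreal (exp R * \<rho> y) * ennreal (cmod (u (s, y)) * damping s) \<partial>lebesgue)"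
          proof (rule nn_integral_mono)
            fix s
            show "ennreal (norm (indicator Q (s, y) *\<^sub>R \<rho> y *\<^sub>R u (s, y))) \<le> ennreal (exp R * \<rho> y) * ennreal (cmod (u (s, y)) * damping s)"
            proof (cases "s \<in> {-R..R}")
              case True
              then have "1 \<le> exp R * damping s" by (auto simp: damping_def abs_le_iff simp flip: exp_add)
              then have "\<rho> y * cmod (u (s, y)) * 1 \<le> \<rho> y * cmod (u (s, y)) * (exp R * damping s)"
                using \<rho>0[of y] by (intro mult_left_mono) (auto simp: less_imp_le)
              then show ?thesis
                using \<rho>0[of y] True \<open>y \<in> cball 0 R\<close> damping_range(1)[of s]
                by (simp add: Q_def ennreal_mult[symmetric] less_imp_le mult_ac ennreal_leI)
            qed (simp add: Q_def indicator_times)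
          qed
          also have "\<dots> = ennreal (exp R * \<rho> y) * (\<integral>\<^sup>+s. ennreal (cmod (u (s, y)) * damping s) \<partial>lebesgue)"
            by (rule nn_integral_cmult, rule measurable_compose[OF _ measurable_ennreal],
                rule borel_measurable_times[OF measurable_compose[OF elim(2) borel_measurable_norm] damping_measurable])
          also have "\<dots> \<le> ennreal (exp R * \<rho> y) * A y" using elim(1) by (intro mult_left_mono) auto
          also have "\<dots> = ennreal (exp R * (\<rho> y * enn2real (A y)))"
            by (subst Ay) (simp only: ennreal_mult''[OF enn2real_nonneg, symmetric] mult.assoc)
          also have "\<dots> \<le> ennreal (exp R * 1)"
            using \<rho>A by (intro ennreal_leI mult_left_mono) auto
          finally show ?thesis using True by simp
        qed (simp add: Q_def)
      qed
    qed
    also have "\<dots> = ennreal (exp R) * emeasure lebesgue (cball (0::'b) R)"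
      by (rule nn_integral_cmult_indicator) simp
    also have "\<dots> < \<infinity>"
      using emeasure_lborel_cball_finite[of "0::'b" R] by (simp add: ennreal_mult_less_top)
    finally show "(\<integral>\<^sup>+z. ennreal (norm (indicator Q z *\<^sub>R \<rho> (snd z) *\<^sub>R u z)) \<partial>lebesgue) < \<infinity>" .
  qed
  then show "set_integrable lebesgue K (\<lambda>z. \<rho> (snd z) *\<^sub>R u z)"
    by (rule set_integrable_subset) (use R(2) compact_imp_sets_lebesgue[OF K] in \<open>simp_all add: Q_def\<close>)
qed

section \<open>Weak derivatives and their slices\<close>

lemma locally_integrable_slices:
  fixes u :: "real \<times> 'b::euclidean_space \<Rightarrow> complex"
  assumes u: "locally_integrable u"
  shows "AE y in lebesgue. locally_integrable (\<lambda>s. u (s, y))"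
proof -
  have "AE y in lebesgue. y \<in> cball 0 (real n) \<longrightarrow> set_integrable lebesgue {- real n..real n} (\<lambda>s. u (s, y))" for n :: nat
  proof -
    have "set_integrable lebesgue ({- real n..real n} \<times> cball 0 (real n)) u"
      using u compact_Times[of "{- real n..real n}" "cball (0::'b) (real n)"] by (simp add: locally_integrable_def)
    from integral_lebesgue_slices(1)[OF this[unfolded set_integrable_def]] show ?thesis
      by eventually_elim (auto simp: set_integrable_def indicator_times)
  qed
  then have "AE y in lebesgue. \<forall>n::nat. y \<in> cball 0 (real n) \<longrightarrow> set_integrable lebesgue {- real n..real n} (\<lambda>s. u (s, y))"
    unfolding AE_all_countable by (rule allI)
  then show ?thesis
  proof eventually_elim
    case (elim y)
    show ?case
    proof (rule locally_integrableI)
      fix a b :: real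
      obtain n :: nat where n: "max (norm y) (max \<bar>a\<bar> \<bar>b\<bar>) < real n" using reals_Archimedean2 by blast
      then have "set_integrable lebesgue {- real n..real n} (\<lambda>s. u (s, y))" using elim by simp
      then show "set_integrable lebesgue {a..b} (\<lambda>s. u (s, y))"
        by (rule set_integrable_subset) (use n in auto)
    qed
  qed
qed

lemma slice_integral_locally_integrable:
  fixes u :: "real \<times> 'b::euclidean_space \<Rightarrow> complex"
  assumes u: "locally_integrable u" and R: "\<And>s y. \<bar>s\<bar> \<ge> R \<Longrightarrow> u (s, y) = 0"
  shows "locally_integrable (\<lambda>y. LINT s|lebesgue. u (s, y))"
  unfolding locally_integrable_def
proof (intro allI impI)
  fix K :: "'b set" assume K: "compact K"
  have "set_integrable lebesgue ({-R..R} \<times> K) u"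
    using u compact_Times[of "{-R..R}" K] K by (simp add: locally_integrable_def)
  note i = integral_lebesgue_slices(2)[OF this[unfolded set_integrable_def]]
  have "indicator ({-R..R} \<times> K) (s, y) *\<^sub>R u (s, y) = indicator K y *\<^sub>R u (s, y)" for s y
  proof (cases "R \<le> \<bar>s\<bar>")
    case False
    then have "s \<in> {-R..R}" by auto
    then show ?thesis by (simp add: indicator_times)
  qed (simp add: R)
  with i show "set_integrable lebesgue K (\<lambda>y. LINT s|lebesgue. u (s, y))"
    by (simp add: set_integrable_def)
qed

text \<open>Testing with products \<open>\<phi>(s) \<eta>(y)\<close> separates the variables.\<close>

lemma weak_derivative_slices:
  fixes f v :: "real \<times> 'b::euclidean_space \<Rightarrow> complex"
  assumes w: "has_weak_derivative (1, 0) f v" and \<phi>: "test_function \<phi>"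
  shows "AE y in lebesgue. (LINT s|lebesgue. frechet_derivative \<phi> (at s) 1 *\<^sub>R f (s, y)) = - (LINT s|lebesgue. \<phi> s *\<^sub>R v (s, y))"
proof -
  define \<phi>' where "\<phi>' x = frechet_derivative \<phi> (at x) 1" for x
  have \<phi>': "test_function \<phi>'" unfolding \<phi>'_def by (rule test_function_derivative[OF \<phi>]) simp
  have l: "locally_integrable f" "locally_integrable v" using w by (auto simp: has_weak_derivative_def)
  obtain R1 R2 where R12: "\<And>x. \<bar>x\<bar> \<ge> R1 \<Longrightarrow> \<phi> x = 0" "\<And>x. \<bar>x\<bar> \<ge> R2 \<Longrightarrow> \<phi>' x = 0"
    using test_function_support_real[OF \<phi>] test_function_support_real[OF \<phi>'] by metis
  \<comment> \<open>Both sides are put into one function, so the claim becomes the vanishing of its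
    slice integrals, to which the fundamental lemma in \<open>y\<close> applies.\<close>
  define G where "G z = complex_of_real (\<phi>' (fst z)) * f z + complex_of_real (\<phi> (fst z)) * v z" for z
  have lG: "locally_integrable G"
    unfolding G_def
    by (intro locally_integrable_add locally_integrable_mult_continuous l continuous_intros
        continuous_on_compose2[OF test_function_continuous[OF \<phi>]] continuous_on_compose2[OF test_function_continuous[OF \<phi>']]) auto
  have G0: "G (s, y) = 0" if "\<bar>s\<bar> \<ge> max R1 R2" for s y
    using R12 that by (simp add: G_def)
  define u where "u y = (LINT s|lebesgue. G (s, y))" for y
  have lu: "locally_integrable u"
    unfolding u_def by (rule slice_integral_locally_integrable[OF lG G0])
  have "AE y in lebesgue. u y = 0"
  proof (rule fundamental_lemma[OF lu])
    fix \<eta> :: "'b \<Rightarrow> real" assume \<eta>: "test_function \<eta>"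
    define \<Phi> where "\<Phi> z = \<phi> (fst z) * \<eta> (snd z)" for z
    have \<Phi>: "test_function \<Phi>" "frechet_derivative \<Phi> (at z) (1, 0) = \<phi>' (fst z) * \<eta> (snd z)" for z
      unfolding \<Phi>_def \<phi>'_def using test_function_product[OF \<phi> \<eta>] by auto
    have \<Phi>': "test_function (\<lambda>z. \<phi>' (fst z) * \<eta> (snd z))" by (rule test_function_product(1)[OF \<phi>' \<eta>])
    have i: "integrable lebesgue (\<lambda>z. (\<phi>' (fst z) * \<eta> (snd z)) *\<^sub>R f z)" "integrable lebesgue (\<lambda>z. \<Phi> z *\<^sub>R v z)"
      using test_function_integrable_mult[OF \<Phi>' l(1)] test_function_integrable_mult[OF \<Phi>(1) l(2)] by auto
    have eq: "(\<phi>' (fst z) * \<eta> (snd z)) *\<^sub>R f z + \<Phi> z *\<^sub>R v z = \<eta> (snd z) *\<^sub>R G z" for z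
      by (simp add: \<Phi>_def G_def scaleR_conv_of_real algebra_simps)
    have iG: "integrable lebesgue (\<lambda>z. \<eta> (snd z) *\<^sub>R G z)"
      using Bochner_Integration.integrable_add[OF i] unfolding eq .
    have "(LINT z|lebesgue. (\<phi>' (fst z) * \<eta> (snd z)) *\<^sub>R f z) = - (LINT z|lebesgue. \<Phi> z *\<^sub>R v z)"
    proof -
      have "(LINT z|lebesgue. frechet_derivative \<Phi> (at z) (1, 0) *\<^sub>R f z) = - (LINT z|lebesgue. \<Phi> z *\<^sub>R v z)"
        using w \<Phi>(1) unfolding has_weak_derivative_def by blast
      then show ?thesis by (simp only: \<Phi>(2))
    qed
    then have "(LINT z|lebesgue. (\<phi>' (fst z) * \<eta> (snd z)) *\<^sub>R f z + \<Phi> z *\<^sub>R v z) = 0"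
      using i by simp
    then have "(LINT z|lebesgue. \<eta> (snd z) *\<^sub>R G z) = 0" unfolding eq .
    then show "(LINT y|lebesgue. \<eta> y *\<^sub>R u y) = 0"
      unfolding integral_lebesgue_slices(3)[OF iG] by (simp add: u_def)
  qed
  with locally_integrable_slices[OF l(1)] locally_integrable_slices[OF l(2)] show ?thesis
  proof eventually_elim
    case (elim y)
    have "integrable lebesgue (\<lambda>s. \<phi>' s *\<^sub>R f (s, y))" "integrable lebesgue (\<lambda>s. \<phi> s *\<^sub>R v (s, y))"
      using elim by (intro test_function_integrable_mult \<phi> \<phi>'; simp)+
    moreover have "(LINT s|lebesgue. \<phi>' s *\<^sub>R f (s, y) + \<phi> s *\<^sub>R v (s, y)) = 0"
      using elim(3) by (simp add: u_def G_def scaleR_conv_of_real)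
    ultimately show ?case by (simp add: \<phi>'_def eq_neg_iff_add_eq_0)
  qed
qed

text \<open>The exceptional set of \<open>y\<close> depends on the test function, so only countably
  many can be used: bumps with rational ends and natural steepness. These already determine the
  integrals over rational intervals, hence the derivative.\<close>

lemma weak_derivative_slices_unique:
  fixes f v :: "real \<times> 'b::euclidean_space \<Rightarrow> complex"
  assumes w: "has_weak_derivative (1, 0) f v"
    and sl: "AE y in lebesgue. has_weak_derivative 1 (\<lambda>s. f (s, y)) (v' y)"
  shows "AE y in lebesgue. AE s in lebesgue. v (s, y) = v' y s"
proof -
  have lv: "locally_integrable v" using w by (auto simp: has_weak_derivative_def)
  define I where "I = (\<rat> \<times> \<rat> \<times> (UNIV :: nat set) :: (real \<times> real \<times> nat) set)"
  have "countable I" unfolding I_def by (intro countable_SIGMA countable_rat) auto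
  then have "AE y in lebesgue. \<forall>(a, b, n)\<in>I. (LINT s|lebesgue. frechet_derivative (bump a b n) (at s) 1 *\<^sub>R f (s, y))
      = - (LINT s|lebesgue. bump a b n s *\<^sub>R v (s, y))"
    by (intro AE_ball_countable') (auto intro: weak_derivative_slices[OF w test_function_bump])
  with sl locally_integrable_slices[OF lv] show ?thesis
  proof eventually_elim
    case (elim y)
    have lv': "locally_integrable (v' y)" using elim(1) by (simp add: has_weak_derivative_def)
    have "AE s in lebesgue. v (s, y) - v' y s = 0"
    proof (rule rational_boxes_0_imp_AE_0)
      show ld: "locally_integrable (\<lambda>s. v (s, y) - v' y s)" by (intro locally_integrable_diff elim(2) lv')
      fix a b :: real assume ab: "a \<in> \<rat>" "b \<in> \<rat>"
      show "(LINT s:box a b|lebesgue. v (s, y) - v' y s) = 0"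
      proof (rule box_integral_eq_0[OF ld])
        fix n
        have "(LINT s|lebesgue. bump a b n s *\<^sub>R v (s, y)) = (LINT s|lebesgue. bump a b n s *\<^sub>R v' y s)"
          using elim(1,3) ab test_function_bump[of a b n] by (force simp: I_def has_weak_derivative_def)
        then show "(LINT s|lebesgue. bump a b n s *\<^sub>R (v (s, y) - v' y s)) = 0"
          using test_function_integrable_mult[OF test_function_bump elim(2), of a b n]
            test_function_integrable_mult[OF test_function_bump lv', of a b n]
          by (simp add: scaleR_diff_right)
      qed
    qed
    then show ?case by eventually_elim simp
  qed
qed

text \<open>A slice of a test function is a test function on the line, so the identity holds on
  almost every line, and Fubini integrates it over \<open>y\<close>.\<close>

lemma weak_derivative_from_slices:
  fixes f v :: "real \<times> 'b::euclidean_space \<Rightarrow> complex"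
  assumes l: "locally_integrable f" "locally_integrable v"
    and sl: "AE y in lebesgue. has_weak_derivative 1 (\<lambda>s. f (s, y)) (\<lambda>s. v (s, y))"
  shows "has_weak_derivative (1, 0) f v"
  unfolding has_weak_derivative_def
proof (intro conjI allI impI l)
  fix \<phi> :: "real \<times> 'b \<Rightarrow> real" assume \<phi>: "test_function \<phi>"
  have \<phi>': "test_function (\<lambda>z. frechet_derivative \<phi> (at z) (1, 0))"
    by (rule test_function_derivative[OF \<phi>]) (simp add: Basis_prod_def)
  note i1 = integral_lebesgue_slices[OF test_function_integrable_mult[OF \<phi>' l(1)]]
  note i2 = integral_lebesgue_slices[OF test_function_integrable_mult[OF \<phi> l(2)]]
  have "AE y in lebesgue. (LINT s|lebesgue. frechet_derivative \<phi> (at (s, y)) (1, 0) *\<^sub>R f (s, y))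
      = - (LINT s|lebesgue. \<phi> (s, y) *\<^sub>R v (s, y))"
    using sl
  proof eventually_elim
    case (elim y)
    then have "(LINT s|lebesgue. frechet_derivative (\<lambda>s. \<phi> (s, y)) (at s) 1 *\<^sub>R f (s, y))
        = - (LINT s|lebesgue. \<phi> (s, y) *\<^sub>R v (s, y))"
      using test_function_slice(1)[OF \<phi>] unfolding has_weak_derivative_def by blast
    then show ?case by (simp only: test_function_slice(2)[OF \<phi>])
  qed
  then have "(LINT y|lebesgue. LINT s|lebesgue. frechet_derivative \<phi> (at (s, y)) (1, 0) *\<^sub>R f (s, y))
      = (LINT y|lebesgue. - (LINT s|lebesgue. \<phi> (s, y) *\<^sub>R v (s, y)))"
    by (intro integral_cong_AE borel_measurable_uminus borel_measurable_integrable i1(2) i2(2))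
  then show "(LINT z|lebesgue. frechet_derivative \<phi> (at z) (1, 0) *\<^sub>R f z) = - (LINT z|lebesgue. \<phi> z *\<^sub>R v z)"
    unfolding i1(3) i2(3) by simp
qed

lemma has_weak_derivative_scale:
  assumes "has_weak_derivative b f v"
  shows "has_weak_derivative b (\<lambda>x. r *\<^sub>R f x) (\<lambda>x. r *\<^sub>R v x)"
proof -
  have e: "a *\<^sub>R r *\<^sub>R z = of_real r * (a *\<^sub>R z)" for a and z :: complex
    by (simp add: scaleR_conv_of_real)
  show ?thesis
    using assms locally_integrable_scale[of f "of_real r"] locally_integrable_scale[of v "of_real r"]
    unfolding has_weak_derivative_def e by (simp add: scaleR_conv_of_real[of r] del: mult_scaleR_right)
qed

section \<open>The shear flow operator is the direct integral\<close>

context shear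
begin

lemma slice_has_weak_derivative:
  assumes "(g, h) \<in> T y"
  shows "has_weak_derivative 1 g (\<lambda>s. \<i> * of_real (P y s / \<psi> y) * h s)"
proof -
  obtain g0 A where "g \<in> L2 (weighted (P y))" "AE s in lebesgue. g s = g0 s"
    "antiderivative g0 (\<lambda>s. \<i> * of_real (P y s / \<psi> y) * h s)"
    using assms by (elim transport_operatorE)
  then show ?thesis
    unfolding has_weak_derivative_iff_antiderivative
    using positive_weight.L2_weighted_measurable[OF slice_weight] by blast
qed

text \<open>The derivative of \<open>f\<close> that the equation \<open>h = - i (\<psi>/w) v\<close>
  forces, as a function on the product.\<close>

definition lift :: "(real \<times> (real ^ 'n) \<Rightarrow> complex) \<Rightarrow> real \<times> (real ^ 'n) \<Rightarrow> complex" where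
  "lift h z = \<i> * of_real (w z / \<psi> (snd z)) * h z"

lemma lift_measurable:
  assumes [measurable]: "h \<in> borel_measurable lebesgue"
  shows "lift h \<in> borel_measurable lebesgue"
proof -
  have "(\<lambda>y. complex_of_real (\<psi> y)) \<in> borel_measurable lebesgue" by measurable
  from snd_lebesgue_measurable[OF this]
  have [measurable]: "(\<lambda>z::real \<times> (real ^ 'n). complex_of_real (\<psi> (snd z))) \<in> borel_measurable lebesgue" .
  show ?thesis unfolding lift_def[abs_def] of_real_divide by measurable
qed

lemma lift_inverse: "- \<i> * of_real (\<psi> y / w (s, y)) * lift h (s, y) = h (s, y)"
  using psi_pos[of y] weight_pos[of "(s, y)"] by (simp add: lift_def)

lemma direct_integral_imp_weak_partial1:
  assumes fh: "(f, h) \<in> D"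
  shows "has_weak_partial1 f (lift h)"
proof -
  have L: "f \<in> L2 (weighted w)" "h \<in> L2 (weighted w)"
    and ae: "AE y in lebesgue. (\<lambda>s. f (s, y), \<lambda>s. h (s, y)) \<in> T y"
    using fh by (auto simp: direct_integral_iff)
  have fm[measurable]: "f \<in> borel_measurable lebesgue" by (rule L2_weighted_measurable[OF L(1)])
  have lm[measurable]: "lift h \<in> borel_measurable lebesgue" by (rule lift_measurable[OF L2_weighted_measurable[OF L(2)]])
  define A1 where "A1 y = (\<integral>\<^sup>+s. ennreal (cmod (f (s, y)) * damping s) \<partial>lebesgue)" for y
  define A2 where "A2 y = (\<integral>\<^sup>+s. ennreal (cmod (lift h (s, y)) * damping s) \<partial>lebesgue)" for y
  have dm: "(\<lambda>z::real \<times> (real ^ 'n). damping (fst z)) \<in> borel_measurable lebesgue"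
    unfolding damping_def by (intro continuous_imp_borel_lebesgue continuous_intros)
  note [measurable] = dm
  have "(\<lambda>z. ennreal (cmod (f z) * damping (fst z))) \<in> borel_measurable lebesgue"
    "(\<lambda>z. ennreal (cmod (lift h z) * damping (fst z))) \<in> borel_measurable lebesgue" by measurable
  then have A[measurable]: "A1 \<in> borel_measurable lebesgue" "A2 \<in> borel_measurable lebesgue"
    unfolding A1_def A2_def using nn_integral_lebesgue_slices(2) by fastforce+
  \<comment> \<open>One renormalisation has to serve both \<open>f\<close> and its derivative, so
    their damped fibre integrals are added.\<close>
  define A where "A y = A1 y + A2 y" for y
  have Am: "A \<in> borel_measurable lebesgue" unfolding A_def[abs_def] by measurable
  have fin: "AE y in lebesgue. A y < \<infinity>"
    using ae
  proof eventually_elim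
    case (elim y)
    from fibre.transport_damped_finite[OF fibre_slice elim]
    have "A1 y < \<infinity>" "A2 y < \<infinity>" by (auto simp: A1_def A2_def lift_def)
    then show ?case by (simp add: A_def)
  qed
  define \<rho> where "\<rho> y = 1 / (1 + enn2real (A y))" for y
  have \<rho>0: "0 < \<rho> y" for y by (simp add: \<rho>_def add_pos_nonneg)
  have \<rho>m: "\<rho> \<in> borel_measurable lebesgue" unfolding \<rho>_def[abs_def] using Am by measurable
  have l: "locally_integrable (\<lambda>z. \<rho> (snd z) *\<^sub>R f z)" "locally_integrable (\<lambda>z. \<rho> (snd z) *\<^sub>R lift h z)"
    unfolding \<rho>_def
    by (rule locally_integrable_renormalized[OF _ Am]; use fin in \<open>auto elim!: eventually_mono simp: A_def A1_def A2_def\<close>)+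
  have "has_weak_derivative (1, 0) (\<lambda>z. \<rho> (snd z) *\<^sub>R f z) (\<lambda>z. \<rho> (snd z) *\<^sub>R lift h z)"
  proof (rule weak_derivative_from_slices[OF l])
    show "AE y in lebesgue. has_weak_derivative 1 (\<lambda>s. \<rho> (snd (s, y)) *\<^sub>R f (s, y)) (\<lambda>s. \<rho> (snd (s, y)) *\<^sub>R lift h (s, y))"
      using ae
    proof eventually_elim
      case (elim y)
      from has_weak_derivative_scale[OF slice_has_weak_derivative[OF elim], of "\<rho> y"]
      show ?case by (simp add: lift_def)
    qed
  qed
  then show ?thesis
    unfolding has_weak_partial1_def using \<rho>m \<rho>0 by (intro bexI[of _ \<rho>]) (auto simp: split_def)
qed

lemma direct_integral_imp_shear_domain:
  assumes fh: "(f, h) \<in> D"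
  shows "f \<in> shear_domain \<psi> w \<alpha>"
proof -
  have L: "f \<in> L2 (weighted w)" "h \<in> L2 (weighted w)"
    and ae: "AE y in lebesgue. (\<lambda>s. f (s, y), \<lambda>s. h (s, y)) \<in> T y"
    using fh by (auto simp: direct_integral_iff)
  have fo: "AE y in lebesgue. (\<lambda>s. f (s, y), \<lambda>s. h (s, y)) \<in> fiber_operator \<psi> w \<alpha> y"
    using ae by (simp add: fiber_operator_eq)
  then have "AE y in lebesgue. (\<lambda>s. f (s, y)) \<in> fiber_domain \<psi> w \<alpha> y"
    by eventually_elim (simp add: fiber_operator_def)
  moreover have "AE y in lebesgue. (\<integral>\<^sup>+s. ennreal ((cmod (fiber_action \<psi> w y (\<lambda>s. f (s, y)) s))\<^sup>2) \<partial>fiber_measure w y)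
      = ennreal ((L2_norm (weighted (P y)) (\<lambda>s. h (s, y)))\<^sup>2)"
    using fo
  proof eventually_elim
    case (elim y)
    then have hL: "(\<lambda>s. h (s, y)) \<in> L2 (weighted (P y))"
      and ha: "AE s in weighted (P y). h (s, y) = fiber_action \<psi> w y (\<lambda>s. f (s, y)) s"
      by (simp_all add: fiber_operator_def fiber_measure_def AE_slice_weighted)
    have "(\<integral>\<^sup>+s. ennreal ((cmod (fiber_action \<psi> w y (\<lambda>s. f (s, y)) s))\<^sup>2) \<partial>weighted (P y))
        = (\<integral>\<^sup>+s. ennreal ((cmod (h (s, y)))\<^sup>2) \<partial>weighted (P y))"
      by (rule nn_integral_cong_AE, use ha in eventually_elim) simp
    then show ?case by (simp add: L2_norm_nn_integral[OF hL] fiber_measure_def)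
  qed
  from nn_integral_cong_AE[OF this] L2_slices(2)[OF L(2)]
  have "(\<integral>\<^sup>+y. (\<integral>\<^sup>+s. ennreal ((cmod (fiber_action \<psi> w y (\<lambda>s. f (s, y)) s))\<^sup>2) \<partial>fiber_measure w y) \<partial>lebesgue) < \<infinity>"
    by simp
  ultimately show ?thesis using L(1) by (simp add: shear_domain_def)
qed

text \<open>Membership in \<open>shear_domain\<close> already provides an image \<open>h1\<close>
  under the direct integral. The distributional derivative agrees on almost every slice with the one
  coming from \<open>h1\<close>, where the positive factor \<open>\<rho>\<close> cancels, so
  \<open>h = h1\<close> almost everywhere.\<close>

theorem shear_operator_eq: "shear_operator \<psi> w \<alpha> = D"
proof (intro equalityI subrelI)
  fix f h assume fh: "(f, h) \<in> D"
  have "AE z in lebesgue. case z of (s, y) \<Rightarrow> h (s, y) = - \<i> * complex_of_real (\<psi> y / w (s, y)) * lift h (s, y)"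
    unfolding lift_inverse by (rule AE_I2) auto
  then show "(f, h) \<in> shear_operator \<psi> w \<alpha>"
    using direct_integral_imp_weak_partial1[OF fh] direct_integral_imp_shear_domain[OF fh] fh
    unfolding shear_operator_def by (auto simp: direct_integral_iff)
next
  fix f h assume "(f, h) \<in> shear_operator \<psi> w \<alpha>"
  then obtain v where f: "f \<in> shear_domain \<psi> w \<alpha>" and h: "h \<in> L2 (weighted w)"
    and v: "has_weak_partial1 f v"
    and hv: "AE z in lebesgue. case z of (s, y) \<Rightarrow> h (s, y) = - \<i> * complex_of_real (\<psi> y / w (s, y)) * v (s, y)"
    unfolding shear_operator_def by auto
  obtain h1 where fh1: "(f, h1) \<in> D" using shear_domain_in_Domain[OF f] .
  have L: "f \<in> L2 (weighted w)" "h1 \<in> L2 (weighted w)"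
    and ae: "AE y in lebesgue. (\<lambda>s. f (s, y), \<lambda>s. h1 (s, y)) \<in> T y"
    using fh1 by (auto simp: direct_integral_iff)
  obtain \<rho> where \<rho>: "\<And>y. 0 < \<rho> y"
    "has_weak_derivative (1, 0) (\<lambda>(s, y). \<rho> y *\<^sub>R f (s, y)) (\<lambda>(s, y). \<rho> y *\<^sub>R v (s, y))"
    using v by (auto simp: has_weak_partial1_def)
  have "AE y in lebesgue. AE s in lebesgue. (case (s, y) of (s, y) \<Rightarrow> \<rho> y *\<^sub>R v (s, y)) = \<rho> y *\<^sub>R lift h1 (s, y)"
  proof (rule weak_derivative_slices_unique[OF \<rho>(2)])
    show "AE y in lebesgue. has_weak_derivative 1 (\<lambda>s. case (s, y) of (s, y) \<Rightarrow> \<rho> y *\<^sub>R f (s, y)) (\<lambda>s. \<rho> y *\<^sub>R lift h1 (s, y))"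
      using ae
    proof eventually_elim
      case (elim y)
      from has_weak_derivative_scale[OF slice_has_weak_derivative[OF elim], of "\<rho> y"]
      show ?case by (simp add: lift_def)
    qed
  qed
  with AE_lebesgue_slices[OF hv] have "AE y in lebesgue. AE s in lebesgue. h (s, y) - h1 (s, y) = 0"
  proof eventually_elim
    case (elim y)
    from elim show ?case
    proof eventually_elim
      case (elim s)
      have "v (s, y) = lift h1 (s, y)" using elim(2) \<rho>(1)[of y] by simp
      then show ?case using elim(1) lift_inverse[of y s h1] by simp
    qed
  qed
  then have "AE z in lebesgue. h z - h1 z = 0"
    by (intro AE_0_from_slices L2_weighted_measurable L2_diff h L(2))
  then have "AE z in weighted w. h z = h1 z" unfolding AE_weighted by eventually_elim simp
  then show "(f, h) \<in> D" by (intro linear_operator_cong[OF linear_direct_integral fh1 L(1) h]) auto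
qed

lemma Domain_shear_operator: "Domain (shear_operator \<psi> w \<alpha>) = shear_domain \<psi> w \<alpha>"
  unfolding shear_operator_eq
proof (intro equalityI subsetI)
  fix f assume "f \<in> Domain D"
  then obtain h where "(f, h) \<in> D" by (rule DomainE)
  then show "f \<in> shear_domain \<psi> w \<alpha>" by (rule direct_integral_imp_shear_domain)
next
  fix f assume "f \<in> shear_domain \<psi> w \<alpha>"
  from shear_domain_in_Domain[OF this] obtain h where "(f, h) \<in> D" .
  then show "f \<in> Domain D" by (rule DomainI)
qed

end

section \<open>The spectrum\<close>

text \<open>The Taylor error \<open>|x|^3 / 6\<close> is at most \<open>4 |x| / 6\<close> on this
  range, which leaves a third of \<open>|x|\<close>. In \<open>spectral_gap\<close> it is applied to
  half of a number of modulus at most 4.\<close>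

lemma abs_sin_lower_bound:
  fixes x :: real
  assumes "\<bar>x\<bar> \<le> 2"
  shows "\<bar>x\<bar> / 3 \<le> \<bar>sin x\<bar>"
proof -
  have "\<bar>sin x - x\<bar> \<le> \<bar>x\<bar> ^ 3 / 6"
    using Maclaurin_sin_bound[of x 3]
    by (simp add: numeral_3_eq_3 sin_coeff_def fact_numeral field_simps)
  also have "\<bar>x\<bar> ^ 3 \<le> 4 * \<bar>x\<bar>"
    using mult_mono[of "\<bar>x\<bar>" 2 "\<bar>x\<bar>" 2] assms mult_right_mono[of "\<bar>x\<bar> * \<bar>x\<bar>" 4 "\<bar>x\<bar>"]
    by (simp add: power3_eq_cube)
  finally have "\<bar>sin x - x\<bar> \<le> 4 * \<bar>x\<bar> / 6" by simp
  moreover have "\<bar>x\<bar> \<le> \<bar>sin x\<bar> + \<bar>sin x - x\<bar>" by linarith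
  ultimately show ?thesis by simp
qed

context fibre
begin

lemma exp_total_eq_iff:
  assumes \<theta>: "exp (\<i> * of_real \<theta>) = a"
  shows "exp (\<i> * of_real s * of_real total) = a \<longleftrightarrow> (\<exists>k::int. s * total = \<theta> + 2 * pi * of_int k)"
proof -
  have "exp (\<i> * of_real s * of_real total) = a \<longleftrightarrow> exp (\<i> * complex_of_real (s * total)) = exp (\<i> * complex_of_real \<theta>)"
    by (simp add: \<theta> mult.assoc)
  also have "\<dots> \<longleftrightarrow> (\<exists>k::int. \<i> * complex_of_real (s * total) = \<i> * complex_of_real \<theta> + (of_int (2 * k) * pi) * \<i>)"
    by (rule exp_eq)
  also have "\<dots> \<longleftrightarrow> (\<exists>k::int. s * total = \<theta> + 2 * pi * of_int k)"
  proof (rule iff_exI)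
    fix k :: int
    have "\<i> * complex_of_real \<theta> + (of_int (2 * k) * pi) * \<i> = \<i> * complex_of_real (\<theta> + 2 * pi * of_int k)"
      by (simp add: algebra_simps)
    then show "\<i> * complex_of_real (s * total) = \<i> * complex_of_real \<theta> + (of_int (2 * k) * pi) * \<i>
        \<longleftrightarrow> s * total = \<theta> + 2 * pi * of_int k"
      by (simp only: mult_cancel_left of_real_eq_iff) simp
  qed
  finally show ?thesis .
qed

text \<open>Points of the spectrum on branch \<open>k\<close> satisfy
  \<open>s * total = \<theta> + 2 * pi * k\<close>. Multiplying the distance to \<open>t\<close> by
  \<open>total\<close> removes the division and leaves countably many conditions that are visibly
  measurable in the fibre.\<close>

lemma spectrum_near_iff:
  assumes \<theta>: "exp (\<i> * of_real \<theta>) = a" and \<epsilon>: "0 < \<epsilon>"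
  shows "spectrum (weighted p) (transport_operator p c a) \<inter> complex_of_real ` {t - \<epsilon><..<t + \<epsilon>} \<noteq> {} \<longleftrightarrow>
    \<not> integrable lebesgue p \<or> (\<exists>k::int. \<bar>\<theta> + 2 * pi * of_int k - t * total\<bar> < \<epsilon> * total)"
proof -
  have "spectrum (weighted p) (transport_operator p c a) \<inter> complex_of_real ` {t - \<epsilon><..<t + \<epsilon>} \<noteq> {} \<longleftrightarrow>
      (\<exists>s. \<bar>s - t\<bar> < \<epsilon> \<and> (integrable lebesgue p \<longrightarrow> (\<exists>k::int. s * total = \<theta> + 2 * pi * of_int k)))"
  proof -
    have "{t - \<epsilon><..<t + \<epsilon>} = {s. \<bar>s - t\<bar> < \<epsilon>}" by auto
    then have "spectrum (weighted p) (transport_operator p c a) \<inter> complex_of_real ` {t - \<epsilon><..<t + \<epsilon>} \<noteq> {} \<longleftrightarrow>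
      (\<exists>s. \<bar>s - t\<bar> < \<epsilon> \<and> of_real s \<in> spectrum (weighted p) (transport_operator p c a))" by auto
    then show ?thesis by (simp only: spectrum_transport exp_total_eq_iff[OF \<theta>])
  qed
  also have "\<dots> \<longleftrightarrow> \<not> integrable lebesgue p \<or> (\<exists>k::int. \<bar>\<theta> + 2 * pi * of_int k - t * total\<bar> < \<epsilon> * total)"
  proof (cases "integrable lebesgue p")
    case True
    note L = total_pos[OF True]
    have "(\<exists>s. \<bar>s - t\<bar> < \<epsilon> \<and> s * total = x) \<longleftrightarrow> \<bar>x - t * total\<bar> < \<epsilon> * total" for x
    proof -
      have "(\<exists>s. \<bar>s - t\<bar> < \<epsilon> \<and> s * total = x) \<longleftrightarrow> \<bar>x / total - t\<bar> < \<epsilon>"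
      proof -
        have "s * total = x \<longleftrightarrow> s = x / total" for s using L by (simp add: eq_divide_eq)
        then show ?thesis by simp
      qed
      also have "\<dots> \<longleftrightarrow> \<bar>x / total - t\<bar> * total < \<epsilon> * total" using L by simp
      also have "\<bar>x / total - t\<bar> * total = \<bar>(x / total - t) * total\<bar>" using L by (simp add: abs_mult)
      also have "(x / total - t) * total = x - t * total" using L by (simp add: field_simps)
      finally show ?thesis .
    qed
    then show ?thesis using True by blast
  next
    case False
    then show ?thesis using \<epsilon> by (auto intro: exI[of _ t])
  qed
  finally show ?thesis .
qed

text \<open>For the nearest branch \<open>k\<close> the remainder \<open>r\<close> has modulus at
  most \<open>pi < 4\<close>, while the gap gives \<open>\<epsilon> * total \<le> |r|\<close>. The
  distance in the denominator is \<open>2 |sin (r/2)|\<close>, at least \<open>|r|/3\<close>. Hence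
  \<open>total \<le> 4/\<epsilon>\<close> and the quotient is at most \<open>3/\<epsilon>\<close>;
  the sum is the 7, the same for all fibres.\<close>

lemma spectral_gap:
  assumes p: "integrable lebesgue p" and \<theta>: "exp (\<i> * of_real \<theta>) = a" and \<epsilon>: "0 < \<epsilon>"
    and gap: "\<And>k::int. \<epsilon> * total \<le> \<bar>\<theta> + 2 * pi * of_int k - t * total\<bar>"
  shows "exp (\<i> * of_real t * of_real total) \<noteq> a"
    and "total * (1 + 1 / cmod (a - exp (\<i> * of_real t * of_real total))) \<le> 7 / \<epsilon>"
proof -
  note L = total_pos[OF p]
  define k where "k = round ((t * total - \<theta>) / (2 * pi))"
  define r where "r = t * total - \<theta> - 2 * pi * of_int k"
  have "\<bar>of_int k - (t * total - \<theta>) / (2 * pi)\<bar> \<le> 1 / 2"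
    unfolding k_def by (rule of_int_round_abs_le)
  then have "(2 * pi) * \<bar>of_int k - (t * total - \<theta>) / (2 * pi)\<bar> \<le> (2 * pi) * (1 / 2)"
    by (rule mult_left_mono) simp
  moreover have "(2 * pi) * \<bar>of_int k - (t * total - \<theta>) / (2 * pi)\<bar> = \<bar>r\<bar>"
  proof -
    have "(2 * pi) * \<bar>of_int k - (t * total - \<theta>) / (2 * pi)\<bar> = \<bar>(2 * pi) * (of_int k - (t * total - \<theta>) / (2 * pi))\<bar>"
      by (simp add: abs_mult)
    also have "(2 * pi) * (of_int k - (t * total - \<theta>) / (2 * pi)) = - r"
      by (simp add: r_def field_simps)
    finally show ?thesis by simp
  qed
  ultimately have r4: "\<bar>r\<bar> \<le> 4" using pi_less_4 by simp
  have er: "\<epsilon> * total \<le> \<bar>r\<bar>"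
    using gap[of k] by (simp add: r_def abs_minus_commute algebra_simps)
  have r0: "0 < \<bar>r\<bar>" using er mult_pos_pos[OF \<epsilon> L] by linarith
  have "exp (\<i> * of_real t * of_real total) = exp (\<i> * of_real \<theta> + (\<i> * of_real r + 2 * of_int k * pi * \<i>))"
    by (rule arg_cong[where f = exp]) (simp add: r_def algebra_simps)
  also have "\<dots> = a * exp (\<i> * of_real r)"
    using exp_eq[of "\<i> * of_real r + 2 * of_int k * pi * \<i>" "\<i> * of_real r"] by (auto simp: exp_add \<theta>)
  finally have E: "exp (\<i> * of_real t * of_real total) = a * exp (\<i> * of_real r)" .
  have "a - exp (\<i> * of_real t * of_real total) = - (a * (exp (\<i> * of_real r) - 1))"
    unfolding E by (simp add: algebra_simps)
  then have "cmod (a - exp (\<i> * of_real t * of_real total)) = cmod (exp (\<i> * of_real r) - 1)"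
    by (simp only: norm_minus_cancel norm_mult norm_a)
  also have "\<dots> = 2 * \<bar>sin (r / 2)\<bar>" by (rule dist_exp_i_1)
  finally have "\<bar>r\<bar> / 3 \<le> cmod (a - exp (\<i> * of_real t * of_real total))"
    using abs_sin_lower_bound[of "r / 2"] r4 by simp
  note le = this
  show "exp (\<i> * of_real t * of_real total) \<noteq> a" using le r0 by auto
  have "total / cmod (a - exp (\<i> * of_real t * of_real total)) \<le> total / (\<bar>r\<bar> / 3)"
    using le r0 L by (intro divide_left_mono mult_pos_pos) auto
  also have "\<dots> \<le> 3 / \<epsilon>" using er r0 \<epsilon> by (simp add: field_simps)
  finally have "total / cmod (a - exp (\<i> * of_real t * of_real total)) \<le> 3 / \<epsilon>" .
  moreover have "total \<le> 4 / \<epsilon>" using er r4 \<epsilon> by (simp add: field_simps)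
  ultimately have "total + total / cmod (a - exp (\<i> * of_real t * of_real total)) \<le> 4 / \<epsilon> + 3 / \<epsilon>" by simp
  then show "total * (1 + 1 / cmod (a - exp (\<i> * of_real t * of_real total))) \<le> 7 / \<epsilon>"
    by (simp add: distrib_left flip: add_divide_distrib)
qed

end

text \<open>\<open>Arg\<close> is continuous off the nonpositive real axis, which meets the unit
  circle only in -1; the value \<open>pi\<close> there completes it to a Borel function.\<close>

lemma exists_angle:
  assumes f: "f \<in> borel_measurable M" and norm: "\<And>y. cmod (f y) = 1"
  obtains \<theta> :: "'a \<Rightarrow> real" where "\<theta> \<in> borel_measurable M" "\<And>y. exp (\<i> * of_real (\<theta> y)) = f y"
proof
  define q where "q z = (if z \<in> \<real>\<^sub>\<le>\<^sub>0 then pi else Arg z)" for z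
  have "q \<in> borel_measurable borel"
    unfolding q_def[abs_def]
    by (intro borel_measurable_continuous_on_if continuous_on_const continuous_on_Arg) simp
  from measurable_compose[OF f this] show "(\<lambda>y. q (f y)) \<in> borel_measurable M" .
  show "exp (\<i> * of_real (q (f y))) = f y" for y
  proof (cases "f y \<in> \<real>\<^sub>\<le>\<^sub>0")
    case True
    then obtain r where r: "f y = of_real r" "r \<le> 0" by (auto elim: nonpos_Reals_cases)
    then have "f y = -1" using norm[of y] by simp
    then show ?thesis by (simp add: q_def)
  next
    case False
    then have "f y \<noteq> 0" by auto
    from Arg_eq[OF this] show ?thesis using norm[of y] False by (simp add: q_def)
  qed
qed

section \<open>Measurable branches of eigenvalues and approximate eigenvectors\<close>

context shear
begin

text \<open>Needed to glue the fibre eigenfunctions to a measurable function on the product. As for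
  the resolvent, Borel representatives give the same primitive at every point of almost every
  slice.\<close>

lemma phase_measurable:
  "(\<lambda>z. phase (P (snd z)) (\<psi> (snd z)) (fst z)) \<in> borel_measurable lebesgue"
proof -
  obtain \<psi>' where \<psi>'[measurable]: "\<psi>' \<in> borel_measurable lborel" and \<psi>'_eq: "AE y in lborel. \<psi> y = \<psi>' y"
    using completion_ex_borel_measurable_real[OF psi_measurable] by blast
  obtain w' where w': "w' \<in> borel_measurable lborel" "AE z in lborel. w z = w' z"
    using completion_ex_borel_measurable_real[OF weight_measurable] by blast
  have wm: "w' \<in> borel_measurable (borel \<Otimes>\<^sub>M borel)" using w'(1) by (simp add: borel_prod)
  have [measurable]: "(\<lambda>x. w' (snd x, fst x)) \<in> borel_measurable (borel \<Otimes>\<^sub>M borel)"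
    by (rule measurable_compose[OF _ wm]) measurable
  define F where "F x = primitive (\<lambda>u. complex_of_real (w' (u, snd x) / \<psi>' (snd x))) (fst x)"
    for x :: "real \<times> (real ^ 'n)"
  have "(\<lambda>(y, u). complex_of_real (w' (u, y) / \<psi>' y)) \<in> borel_measurable (borel \<Otimes>\<^sub>M borel)"
    using \<psi>' by (simp add: split_def) measurable
  from measurable_compose[OF measurable_pair_swap' measurable_primitive_parameter[OF this]]
  have "F \<in> borel_measurable (borel \<Otimes>\<^sub>M borel)"
    unfolding F_def[abs_def] by (simp add: split_def)
  then have Fm: "F \<in> borel_measurable lebesgue"
    by (intro measurable_completion) (simp add: borel_prod)
  from AE_lebesgue_slices[OF AE_completion[OF w'(2)]] AE_completion[OF \<psi>'_eq]
  have "AE y in lebesgue. \<forall>s. F (s, y) = phase (P y) (\<psi> y) s"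
  proof eventually_elim
    case (elim y)
    have [measurable]: "P y \<in> borel_measurable lebesgue" by (rule positive_weight.weight_measurable[OF slice_weight])
    have "(\<lambda>u. w' (u, y)) \<in> borel_measurable borel"
      by (rule measurable_compose[OF _ wm]) measurable
    then have [measurable]: "(\<lambda>u. w' (u, y)) \<in> borel_measurable lebesgue" by (intro measurable_completion) simp
    have "primitive (\<lambda>u. complex_of_real (w' (u, y) / \<psi>' y)) = primitive (\<lambda>u. complex_of_real (P y u / \<psi> y))"
    proof (rule primitive_cong_AE)
      show "AE u in lebesgue. complex_of_real (w' (u, y) / \<psi>' y) = complex_of_real (P y u / \<psi> y)"
        using elim(1) by eventually_elim (simp add: elim(2))
    qed measurable
    then show ?case by (intro allI) (simp only: F_def phase_def fst_conv snd_conv)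
  qed
  from AE_snd[OF this] have "AE z in lebesgue. F z = phase (P (snd z)) (\<psi> (snd z)) (fst z)"
    by eventually_elim (metis prod.collapse)
  then show ?thesis by (intro lebesgue_measurable_cong_AE[OF Fm]) auto
qed

lemma slice_mass_measurable: "(\<lambda>y. \<integral>\<^sup>+s. ennreal (w (s, y)) \<partial>lebesgue) \<in> borel_measurable lebesgue"
  by (rule nn_integral_lebesgue_slices(2)) measurable

lemma integrable_slice_iff: "integrable lebesgue (P y) \<longleftrightarrow> (\<integral>\<^sup>+s. ennreal (w (s, y)) \<partial>lebesgue) < \<infinity>"
  using positive_weight.weight_measurable[OF slice_weight[of y]]
  by (simp add: integrable_iff_bounded abs_of_pos weight_pos)

lemma integrable_slices_measurable: "{y. integrable lebesgue (P y)} \<in> sets lebesgue"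
proof -
  have "{y \<in> space lebesgue. (\<integral>\<^sup>+s. ennreal (w (s, y)) \<partial>lebesgue) < \<infinity>} \<in> sets lebesgue"
    using slice_mass_measurable by measurable
  then show ?thesis by (simp add: integrable_slice_iff)
qed

definition total :: "real ^ 'n \<Rightarrow> real" where
  "total y = fibre.total (P y) (\<psi> y)"

lemma total_measurable [measurable]: "total \<in> borel_measurable lebesgue"
proof -
  have "total y = enn2real (\<integral>\<^sup>+s. ennreal (w (s, y)) \<partial>lebesgue) / \<psi> y" for y
  proof -
    have "(LINT s|lebesgue. w (s, y)) = enn2real (\<integral>\<^sup>+s. ennreal (w (s, y)) \<partial>lebesgue)"
      using positive_weight.weight_measurable[OF slice_weight[of y]]
      by (intro integral_eq_nn_integral) (simp_all add: weight_pos less_imp_le)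
    then show ?thesis by (simp add: total_def fibre.total_def[OF fibre_slice])
  qed
  then have "total = (\<lambda>y. enn2real (\<integral>\<^sup>+s. ennreal (w (s, y)) \<partial>lebesgue) / \<psi> y)" by (rule ext)
  moreover note [measurable] = slice_mass_measurable
  ultimately show ?thesis by simp
qed

lemma transport_zero: "(\<lambda>s. 0, \<lambda>s. 0) \<in> T y"
proof -
  obtain g k where "(g, k) \<in> T y"
    using fibre.resolvent_in_transport[OF fibre_slice L2_zero fibre.regular_nonreal[OF fibre_slice, of \<i>]] by auto
  from linear_operator_scale[OF slice_linear this, of 0] show ?thesis by simp
qed

text \<open>Fibrewise approximate eigenvectors are glued after cutting \<open>E\<close> down to a
  bounded part on which the fibre norms are bounded, which makes \<open>f\<close> square integrable.
  The error estimate is pointwise and unaffected by the cut; since \<open>F\<close> vanishes nowhere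
  over \<open>E\<close>, positive measure of the remaining set gives a nonzero
  \<open>f\<close>.\<close>

lemma approximate_eigenvector_from_slices:
  assumes Fm: "F \<in> borel_measurable lebesgue" and Km: "K \<in> borel_measurable lebesgue"
    and E: "E \<in> sets lebesgue" "0 < emeasure lebesgue E" and \<epsilon>: "0 < \<epsilon>"
    and FT: "\<And>y. y \<in> E \<Longrightarrow> (\<lambda>s. F (s, y), \<lambda>s. K (s, y)) \<in> T y"
    and nz: "\<And>s y. y \<in> E \<Longrightarrow> F (s, y) \<noteq> 0"
    and close: "\<And>s y. y \<in> E \<Longrightarrow> cmod (K (s, y) - z * F (s, y)) \<le> \<epsilon> * cmod (F (s, y))"
  shows "\<exists>(f, k)\<in>D. 0 < L2_norm (weighted w) f \<and>
    L2_norm (weighted w) (\<lambda>x. k x - z * f x) \<le> \<epsilon> * L2_norm (weighted w) f"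
proof -
  note [measurable] = Fm Km E(1)
  define N where "N y = (\<integral>\<^sup>+s. ennreal (w (s, y) * (cmod (F (s, y)))\<^sup>2) \<partial>lebesgue)" for y
  have "(\<lambda>z. ennreal (w z * (cmod (F z))\<^sup>2)) \<in> borel_measurable lebesgue" by measurable
  then have [measurable]: "N \<in> borel_measurable lebesgue"
    unfolding N_def[abs_def] by (rule nn_integral_lebesgue_slices(2))
  have FL: "(\<lambda>s. F (s, y)) \<in> L2 (weighted (P y))" if "y \<in> E" for y
    using linear_operator_L2[OF slice_linear FT[OF that]] by simp
  have NE: "N y = ennreal ((L2_norm (weighted (P y)) (\<lambda>s. F (s, y)))\<^sup>2)" if "y \<in> E" for y
    unfolding N_def by (simp add: positive_weight.L2_norm_weighted_nn_integral[OF slice_weight FL[OF that]])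
  \<comment> \<open>These sets exhaust \<open>E\<close>, because every fibre norm over
    \<open>E\<close> is finite; one of them therefore has positive measure.\<close>
  define E' where "E' n = (E \<inter> cball 0 (real n)) \<inter> {y \<in> space lebesgue. N y \<le> of_nat n}" for n
  have "{y \<in> space lebesgue. N y \<le> of_nat n} \<in> sets lebesgue" for n by measurable
  then have E'm: "E' n \<in> sets lebesgue" for n
    unfolding E'_def by (intro sets.Int E(1)) simp_all
  have "E = (\<Union>n. E' n)"
  proof (intro equalityI subsetI)
    fix y assume y: "y \<in> E"
    obtain n where n: "max (norm y) ((L2_norm (weighted (P y)) (\<lambda>s. F (s, y)))\<^sup>2) \<le> real n"
      using real_arch_simple by blast
    then have "N y \<le> of_nat n" unfolding NE[OF y] by (simp add: ennreal_of_nat_eq_real_of_nat ennreal_leI)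
    with n y show "y \<in> (\<Union>n. E' n)" by (auto simp: E'_def)
  qed (auto simp: E'_def)
  then obtain n where n: "emeasure lebesgue (E' n) \<noteq> 0"
    using E(2) E'm emeasure_UN_eq_0[of lebesgue E'] by (metis image_subset_iff less_irrefl)
  define I where "I z = complex_of_real (indicator (E' n) (snd z))" for z :: "real \<times> (real ^ 'n)"
  have [measurable]: "I \<in> borel_measurable lebesgue"
    unfolding I_def[abs_def] by (rule snd_lebesgue_measurable) (use E'm in measurable)
  define f where "f z = I z * F z" for z
  define k where "k z = I z * K z" for z
  have fm: "f \<in> borel_measurable lebesgue" and km: "k \<in> borel_measurable lebesgue"
    unfolding f_def[abs_def] k_def[abs_def] by measurable
  have sl: "(\<lambda>s. f (s, y), \<lambda>s. k (s, y)) \<in> T y" for y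
    using FT[of y] transport_zero[of y] by (cases "y \<in> E' n") (auto simp: f_def k_def I_def E'_def)
  have fL: "f \<in> L2 (weighted w)"
  proof (rule L2_from_slices[OF fm])
    show "AE y in lebesgue. (\<lambda>s. f (s, y)) \<in> L2 (weighted (P y))"
      using linear_operator_L2[OF slice_linear sl] by (intro AE_I2) auto
    have "(\<integral>\<^sup>+y. ennreal ((L2_norm (weighted (P y)) (\<lambda>s. f (s, y)))\<^sup>2) \<partial>lebesgue)
        \<le> (\<integral>\<^sup>+y. of_nat n * indicator (cball (0::real ^ 'n) (real n)) y \<partial>lebesgue)"
    proof (rule nn_integral_mono)
      fix y
      show "ennreal ((L2_norm (weighted (P y)) (\<lambda>s. f (s, y)))\<^sup>2) \<le> of_nat n * indicator (cball (0::real ^ 'n) (real n)) y"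
      proof (cases "y \<in> E' n")
        case True
        then have "y \<in> E" "N y \<le> of_nat n" "y \<in> cball 0 (real n)" by (auto simp: E'_def)
        then show ?thesis using True NE[of y] by (simp add: f_def I_def)
      next
        case False
        then show ?thesis by (simp add: f_def I_def L2_norm_def)
      qed
    qed
    also have "\<dots> = of_nat n * emeasure lebesgue (cball (0::real ^ 'n) (real n))"
      by (rule nn_integral_cmult_indicator) simp
    also have "\<dots> < \<infinity>"
      using emeasure_lborel_cball_finite[of "0::real ^ 'n" "real n"] by (simp add: ennreal_mult_less_top ennreal_of_nat_eq_real_of_nat)
    finally show "(\<integral>\<^sup>+y. ennreal ((L2_norm (weighted (P y)) (\<lambda>s. f (s, y)))\<^sup>2) \<partial>lebesgue) < \<infinity>" .
  qed
  have cl: "cmod (k x - z * f x) \<le> \<epsilon> * cmod (f x)" for x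
  proof (cases "snd x \<in> E' n")
    case True
    then have "snd x \<in> E" by (auto simp: E'_def)
    then show ?thesis using close[of "snd x" "fst x"] True by (simp add: f_def k_def I_def)
  next
    case False
    then show ?thesis by (simp add: f_def k_def I_def)
  qed
  have kL: "k \<in> L2 (weighted w)"
  proof (rule L2_bound[OF fL])
    show "k \<in> borel_measurable (weighted w)" using km by (simp add: measurable_weighted)
    have "cmod (k x) \<le> (cmod z + \<epsilon>) * cmod (f x)" for x
      using norm_triangle_sub[of "k x" "z * f x"] cl[of x] by (simp add: norm_mult distrib_right)
    then show "AE x in weighted w. cmod (k x) \<le> (cmod z + \<epsilon>) * cmod (f x)" by simp
  qed
  have "(f, k) \<in> D" using fL kL sl by (simp add: direct_integral_iff)
  moreover have "0 < L2_norm (weighted w) f"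
  proof (rule ccontr)
    assume "\<not> 0 < L2_norm (weighted w) f"
    then have "L2_norm (weighted w) f = 0" using L2_norm_nonneg[of "weighted w" f] by linarith
    from L2_norm_eq_0[OF fL this] have "AE y in lebesgue. AE s in lebesgue. f (s, y) = 0"
      unfolding AE_weighted by (rule AE_lebesgue_slices)
    then have "AE y in lebesgue. y \<notin> E' n"
    proof eventually_elim
      case (elim y)
      show ?case
      proof
        assume y: "y \<in> E' n"
        then have "f (s, y) \<noteq> 0" for s using nz[of y s] by (auto simp: f_def I_def E'_def)
        with elim have "AE s::real in lebesgue. False" by simp
        then show False using lebesgue_not_AE_False by blast
      qed
    qed
    then have "E' n \<in> null_sets lebesgue" using E'm[of n] by (simp add: AE_iff_null_sets)
    then show False using n by auto
  qed
  moreover have "L2_norm (weighted w) (\<lambda>x. k x - z * f x) \<le> L2_norm (weighted w) (\<lambda>x. of_real \<epsilon> * f x)"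
    using cl \<epsilon> by (intro L2_norm_mono L2_diff L2_scale fL kL) (simp add: norm_mult)
  ultimately show ?thesis using \<epsilon> by (intro bexI[of _ "(f, k)"]) (simp_all add: L2_norm_scale)
qed

text \<open>\<open>\<theta>\<close> may be any measurable branch of the angle, so branch
  \<open>k\<close> is reached by adding \<open>2 * pi * k\<close> to it. The glued function consists
  of exact eigenfunctions whose eigenvalues \<open>\<tau> y\<close> vary with the fibre but stay
  within \<open>\<epsilon>\<close> of \<open>t\<close>.\<close>

lemma spectrum_direct_integralI_eigenvalues:
  assumes \<theta>: "\<theta> \<in> borel_measurable lebesgue" "\<And>y. exp (\<i> * of_real (\<theta> y)) = \<alpha> y"
    and E: "E \<in> sets lebesgue" "0 < emeasure lebesgue E" and \<epsilon>: "0 < \<epsilon>"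
    and int: "\<And>y. y \<in> E \<Longrightarrow> integrable lebesgue (P y)"
    and near: "\<And>y. y \<in> E \<Longrightarrow> \<bar>\<theta> y - t * total y\<bar> < \<epsilon> * total y"
  shows "\<exists>(f, k)\<in>D. 0 < L2_norm (weighted w) f \<and>
    L2_norm (weighted w) (\<lambda>x. k x - of_real t * f x) \<le> \<epsilon> * L2_norm (weighted w) f"
proof -
  define \<tau> where "\<tau> y = \<theta> y / total y" for y
  note [measurable] = \<theta>(1) phase_measurable
  have "(\<lambda>y. complex_of_real (\<tau> y)) \<in> borel_measurable lebesgue" unfolding \<tau>_def by measurable
  from snd_lebesgue_measurable[OF this]
  have [measurable]: "(\<lambda>z::real \<times> (real ^ 'n). complex_of_real (\<tau> (snd z))) \<in> borel_measurable lebesgue" .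
  define F where "F z = exp (\<i> * of_real (\<tau> (snd z)) * phase (P (snd z)) (\<psi> (snd z)) (fst z))" for z :: "real \<times> (real ^ 'n)"
  have [measurable]: "F \<in> borel_measurable lebesgue"
    unfolding F_def[abs_def]
    by (rule measurable_compose[of _ _ borel, OF _ borel_measurable_continuous_onI[OF continuous_on_exp[OF continuous_on_id]]]) measurable
  show ?thesis
  proof (rule approximate_eigenvector_from_slices[of F "\<lambda>z. of_real (\<tau> (snd z)) * F z", OF _ _ E \<epsilon>])
    show "F \<in> borel_measurable lebesgue" "(\<lambda>z. of_real (\<tau> (snd z)) * F z) \<in> borel_measurable lebesgue" by measurable
    fix y assume y: "y \<in> E"
    interpret fib: fibre "P y" "\<psi> y" "\<alpha> y" by (rule fibre_slice)
    have L: "0 < total y" unfolding total_def by (rule fib.total_pos[OF int[OF y]])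
    have "exp (\<i> * of_real (\<tau> y) * of_real (total y)) = \<alpha> y"
      using L by (simp add: \<tau>_def flip: \<theta>(2))
    from fib.eigenfunction[OF int[OF y] this[unfolded total_def]]
    show "(\<lambda>s. F (s, y), \<lambda>s. of_real (\<tau> (snd (s, y))) * F (s, y)) \<in> T y" by (simp add: F_def)
    have "\<bar>\<tau> y - t\<bar> * total y = \<bar>\<theta> y - t * total y\<bar>"
      using L by (simp add: \<tau>_def abs_mult_pos field_simps)
    with near[OF y] L have \<tau>: "\<bar>\<tau> y - t\<bar> \<le> \<epsilon>"
      by (metis less_imp_le mult_less_cancel_right_pos)
    fix s
    show "F (s, y) \<noteq> 0" by (simp add: F_def)
    have "of_real (\<tau> y) * F (s, y) - of_real t * F (s, y) = of_real (\<tau> y - t) * F (s, y)"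
      by (simp add: algebra_simps)
    then show "cmod (of_real (\<tau> (snd (s, y))) * F (s, y) - of_real t * F (s, y)) \<le> \<epsilon> * cmod (F (s, y))"
      using mult_right_mono[OF \<tau>, of "cmod (F (s, y))"] by (simp add: norm_mult del: of_real_diff)
  qed
qed

lemma spectrum_direct_integralI_constant:
  assumes E: "E \<in> sets lebesgue" "0 < emeasure lebesgue E" and \<epsilon>: "0 < \<epsilon>"
    and const: "\<And>y. y \<in> E \<Longrightarrow> \<not> integrable lebesgue (P y)"
  shows "\<exists>(f, k)\<in>D. 0 < L2_norm (weighted w) f \<and>
    L2_norm (weighted w) (\<lambda>x. k x - of_real t * f x) \<le> \<epsilon> * L2_norm (weighted w) f"
proof -
  \<comment> \<open>The fibre error is \<open>\<psi> y * \<delta>\<close>, so one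
    \<open>\<delta>\<close> serves only where \<open>\<psi>\<close> is bounded; such sets exhaust
    \<open>E\<close>.\<close>
  define E' where "E' n = E \<inter> {y \<in> space lebesgue. \<psi> y \<le> real n}" for n
  have E'm: "E' n \<in> sets lebesgue" for n
    unfolding E'_def by (intro sets.Int E(1)) measurable
  have "E = (\<Union>n. E' n)" using real_arch_simple by (auto simp: E'_def)
  then obtain n where n: "0 < emeasure lebesgue (E' n)"
    using E(2) E'm emeasure_UN_eq_0[of lebesgue E'] by (metis image_subset_iff less_irrefl zero_less_iff_neq_zero)
  \<comment> \<open>The added 1 keeps the quotient defined without a discussion of
    \<open>n = 0\<close>.\<close>
  define \<delta> where "\<delta> = \<epsilon> / (real n + 1)"
  have \<delta>: "0 < \<delta>" using \<epsilon> by (simp add: \<delta>_def)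
  have "(\<lambda>y. complex_of_real (\<psi> y)) \<in> borel_measurable lebesgue" by measurable
  from snd_lebesgue_measurable[OF this]
  have [measurable]: "(\<lambda>z::real \<times> (real ^ 'n). complex_of_real (\<psi> (snd z))) \<in> borel_measurable lebesgue" .
  have [measurable]: "(\<lambda>z::real \<times> (real ^ 'n). complex_of_real (fst z)) \<in> borel_measurable lebesgue"
    "(\<lambda>z::real \<times> (real ^ 'n). complex_of_real (cutoff \<delta> (fst z))) \<in> borel_measurable lebesgue"
    "(\<lambda>z::real \<times> (real ^ 'n). complex_of_real (cutoff' \<delta> (fst z))) \<in> borel_measurable lebesgue"
    by (intro continuous_imp_borel_lebesgue continuous_intros continuous_on_compose2[OF cutoff_continuous(1)]
        continuous_on_compose2[OF cutoff_continuous(2)]; simp)+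
  define e where "e z = exp (\<i> * of_real (t * (fst z / \<psi> (snd z))))" for z :: "real \<times> (real ^ 'n)"
  have "(\<lambda>z::real \<times> (real ^ 'n). \<i> * (of_real t * (of_real (fst z) / of_real (\<psi> (snd z))))) \<in> borel_measurable lebesgue"
    by measurable
  from measurable_compose[OF this borel_measurable_continuous_onI[OF continuous_on_exp[OF continuous_on_id]]]
  have [measurable]: "e \<in> borel_measurable lebesgue"
    unfolding e_def[abs_def] by simp
  define F where "F z = e z * of_real (cutoff \<delta> (fst z))" for z
  define K where "K z = of_real t * (e z * of_real (cutoff \<delta> (fst z)))
    - \<i> * of_real (\<psi> (snd z)) * (e z * of_real (cutoff' \<delta> (fst z)))" for z
  show ?thesis
  proof (rule approximate_eigenvector_from_slices[of F K, OF _ _ E'm n \<epsilon>])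
    show "F \<in> borel_measurable lebesgue" "K \<in> borel_measurable lebesgue"
      unfolding F_def[abs_def] K_def[abs_def] by measurable
    fix y assume y: "y \<in> E' n"
    interpret fib: fibre "P y" "\<psi> y" "\<alpha> y" by (rule fibre_slice)
    have p: "AE s in lebesgue. P y s = 1"
      using slice_cases[of y] const[of y] y by (auto simp: E'_def)
    have ae: "(\<lambda>s. F (s, y), \<lambda>s. K (s, y)) \<in> T y" "cmod (K (s, y) - of_real t * F (s, y)) \<le> \<psi> y * \<delta> * cmod (F (s, y))"
      "cmod (F (s, y)) = cutoff \<delta> s" for s
      using fib.approximate_eigenfunction[OF p \<delta>, of t] by (simp_all add: F_def K_def e_def)
    show "(\<lambda>s. F (s, y), \<lambda>s. K (s, y)) \<in> T y" by (rule ae(1))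
    fix s
    show "F (s, y) \<noteq> 0" using ae(3)[of s] cutoff_pos[of \<delta> s] by auto
    have "\<psi> y \<le> real n + 1" using y by (simp add: E'_def)
    then have "\<psi> y * \<delta> \<le> (real n + 1) * \<delta>" using \<delta> by (intro mult_right_mono) auto
    then have "\<psi> y * \<delta> \<le> \<epsilon>" by (simp add: \<delta>_def)
    then show "cmod (K (s, y) - of_real t * F (s, y)) \<le> \<epsilon> * cmod (F (s, y))"
      using ae(2)[of s] mult_right_mono[of "\<psi> y * \<delta>" \<epsilon> "cmod (F (s, y))"] by simp
  qed
qed

lemma lower_bound_direct_integral:
  assumes B: "0 \<le> B" and fk: "(f, k) \<in> D"
    and bd: "AE y in lebesgue. \<forall>(g, k) \<in> T y.
      L2_norm (weighted (P y)) g \<le> B * L2_norm (weighted (P y)) (\<lambda>s. k s - z * g s)"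
  shows "L2_norm (weighted w) f \<le> B * L2_norm (weighted w) (\<lambda>x. k x - z * f x)"
proof (rule L2_from_slices_bound(2)[OF _ _ B])
  have L: "f \<in> L2 (weighted w)" "k \<in> L2 (weighted w)"
    and ae: "AE y in lebesgue. (\<lambda>s. f (s, y), \<lambda>s. k (s, y)) \<in> T y"
    using fk by (auto simp: direct_integral_iff)
  show "f \<in> borel_measurable lebesgue" by (rule L2_weighted_measurable[OF L(1)])
  show "(\<lambda>x. k x - z * f x) \<in> L2 (weighted w)" by (intro L2_diff L2_scale L)
  show "AE y in lebesgue. (\<lambda>s. f (s, y)) \<in> L2 (weighted (P y)) \<and>
      L2_norm (weighted (P y)) (\<lambda>s. f (s, y)) \<le> B * L2_norm (weighted (P y)) (\<lambda>s. k (s, y) - z * f (s, y))"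
    using ae bd
  proof eventually_elim
    case (elim y)
    show ?case using linear_operator_L2[OF slice_linear elim(1)] bspec[OF elim(2) elim(1)] by simp
  qed
qed

theorem spectrum_direct_integral:
  "of_real t \<in> spectrum (weighted w) D \<longleftrightarrow>
    (\<forall>\<epsilon>>0. 0 < emeasure lebesgue {y. spectrum (weighted (P y)) (T y) \<inter> complex_of_real ` {t - \<epsilon><..<t + \<epsilon>} \<noteq> {}})"
proof -
  obtain \<theta> where \<theta>[measurable]: "\<theta> \<in> borel_measurable lebesgue" and \<alpha>: "\<And>y. exp (\<i> * of_real (\<theta> y)) = \<alpha> y"
    using exists_angle[OF alpha_measurable alpha_norm] by blast
  define A where "A \<epsilon> = {y. spectrum (weighted (P y)) (T y) \<inter> complex_of_real ` {t - \<epsilon><..<t + \<epsilon>} \<noteq> {}}" for \<epsilon>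
  define N where "N = {y. \<not> integrable lebesgue (P y)}"
  define R where "R \<epsilon> k = - N \<inter> {y \<in> space lebesgue. \<bar>\<theta> y + 2 * pi * of_int k - t * total y\<bar> < \<epsilon> * total y}" for \<epsilon> and k :: int
  have N: "N \<in> sets lebesgue"
    using sets.compl_sets[OF integrable_slices_measurable] by (simp add: N_def Compl_eq_Diff_UNIV[symmetric] Collect_neg_eq)
  have R: "R \<epsilon> k \<in> sets lebesgue" for \<epsilon> k
    unfolding R_def by (intro sets.Int) (use sets.compl_sets[OF N] in \<open>simp add: Compl_eq_Diff_UNIV\<close>, measurable)
  \<comment> \<open>The condition splits into the fibres whose spectrum is the whole line and the
    countably many eigenvalue branches on the others.\<close>
  have A: "A \<epsilon> = N \<union> (\<Union>k. R \<epsilon> k)" if "0 < \<epsilon>" for \<epsilon>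
    unfolding A_def fibre.spectrum_near_iff[OF fibre_slice \<alpha> that]
    by (auto simp: N_def R_def total_def)
  \<comment> \<open>Needed to read vanishing \<open>emeasure\<close> as a null set, since
    nonmeasurable sets have \<open>emeasure\<close> 0 as well.\<close>
  have Am: "A \<epsilon> \<in> sets lebesgue" if "0 < \<epsilon>" for \<epsilon>
    unfolding A[OF that] by (intro sets.Un N sets.countable_UN') (auto simp: R)
  show ?thesis
    unfolding A_def[symmetric]
  proof (intro iffI allI impI)
    fix \<epsilon> :: real assume t: "of_real t \<in> spectrum (weighted w) D" and \<epsilon>: "0 < \<epsilon>"
    show "0 < emeasure lebesgue (A \<epsilon>)"
    proof (rule ccontr)
      assume "\<not> 0 < emeasure lebesgue (A \<epsilon>)"
      then have "A \<epsilon> \<in> null_sets lebesgue" using Am[OF \<epsilon>] by (simp add: null_sets_def)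
      then have nA: "AE y in lebesgue. y \<notin> A \<epsilon>" by (rule AE_not_in)
      \<comment> \<open>Off \<open>A \<epsilon>\<close> every branch keeps distance
        \<open>\<epsilon>\<close> from \<open>t\<close>, so the constant
        \<open>7 / \<epsilon>\<close> is common to almost all fibres; it serves both the range
        condition and the lower bound.\<close>
      have gap: "integrable lebesgue (P y)" "exp (\<i> * of_real t * of_real (total y)) \<noteq> \<alpha> y"
        "total y * (1 + 1 / cmod (\<alpha> y - exp (\<i> * of_real t * of_real (total y)))) \<le> 7 / \<epsilon>"
        if y: "y \<notin> A \<epsilon>" for y
      proof -
        interpret fib: fibre "P y" "\<psi> y" "\<alpha> y" by (rule fibre_slice)
        show i: "integrable lebesgue (P y)" using y by (auto simp: A[OF \<epsilon>] N_def)
        have "\<epsilon> * fib.total \<le> \<bar>\<theta> y + 2 * pi * of_int k - t * fib.total\<bar>" for k :: int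
        proof -
          have "y \<notin> R \<epsilon> k" using y by (simp add: A[OF \<epsilon>])
          then show ?thesis using i by (simp add: R_def N_def total_def not_less)
        qed
        from fib.spectral_gap[OF i \<alpha> \<epsilon> this]
        show "exp (\<i> * of_real t * of_real (total y)) \<noteq> \<alpha> y"
          "total y * (1 + 1 / cmod (\<alpha> y - exp (\<i> * of_real t * of_real (total y)))) \<le> 7 / \<epsilon>"
          unfolding total_def by auto
      qed
      have bd: "AE y in lebesgue. \<forall>(g, k) \<in> T y.
          L2_norm (weighted (P y)) g \<le> 7 / \<epsilon> * L2_norm (weighted (P y)) (\<lambda>s. k s - of_real t * g s)"
        using nA
      proof eventually_elim
        case (elim y)
        interpret fib: fibre "P y" "\<psi> y" "\<alpha> y" by (rule fibre_slice)
        show ?case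
        proof clarify
          fix g k assume "(g, k) \<in> T y"
          from fib.transport_lower_bound[OF gap(1)[OF elim] gap(2)[OF elim, unfolded total_def] this]
          show "L2_norm (weighted (P y)) g \<le> 7 / \<epsilon> * L2_norm (weighted (P y)) (\<lambda>s. k s - of_real t * g s)"
            by (rule order_trans) (intro mult_right_mono gap(3)[OF elim, unfolded total_def] L2_norm_nonneg)
        qed
      qed
      have "AE y in lebesgue. fibre.regular (P y) (\<psi> y) (\<alpha> y) (of_real t)"
        using nA by eventually_elim
          (simp add: fibre.regular_def[OF fibre_slice] gap(1) gap(2)[unfolded total_def])
      then have "onto_shift (weighted w) D (of_real t)"
        using \<epsilon> bd by (intro onto_shift_direct_integral[of "7 / \<epsilon>"]) auto
      moreover have "L2_norm (weighted w) f \<le> 7 / \<epsilon> * L2_norm (weighted w) (\<lambda>x. k x - of_real t * f x)"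
        if "(f, k) \<in> D" for f k
        using \<epsilon> by (intro lower_bound_direct_integral that bd) simp
      ultimately have "of_real t \<in> resolvent_set (weighted w) D"
        unfolding resolvent_set_def onto_shift_def by blast
      then show False using t by (simp add: spectrum_def)
    qed
  next
    assume pos: "\<forall>\<epsilon>>0. 0 < emeasure lebesgue (A \<epsilon>)"
    show "of_real t \<in> spectrum (weighted w) D"
    proof (rule approximate_eigenvectors_imp_spectrum)
      fix \<epsilon> :: real assume \<epsilon>: "0 < \<epsilon>"
      show "\<exists>(f, k)\<in>D. 0 < L2_norm (weighted w) f \<and>
          L2_norm (weighted w) (\<lambda>x. k x - of_real t * f x) \<le> \<epsilon> * L2_norm (weighted w) f"
      \<comment> \<open>Either the fibres with spectrum the whole line have positive measure, or
        they are negligible and countable subadditivity singles out one branch.\<close>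
      proof (cases "emeasure lebesgue N = 0")
        case False
        then show ?thesis
          by (intro spectrum_direct_integralI_constant[OF N _ \<epsilon>]) (auto simp: N_def zero_less_iff_neq_zero)
      next
        case True
        obtain k where k: "emeasure lebesgue (R \<epsilon> k) \<noteq> 0"
        proof (rule ccontr)
          assume "\<not> thesis"
          then have "R \<epsilon> k \<in> null_sets lebesgue" for k using that R by (auto simp: null_sets_def)
          then have "(\<Union>k. R \<epsilon> k) \<in> null_sets lebesgue" by (intro null_sets_UN') auto
          then have "A \<epsilon> \<in> null_sets lebesgue"
            unfolding A[OF \<epsilon>] using True N by (intro null_sets.Un) (auto simp: null_sets_def)
          then show False using pos \<epsilon> by (auto simp: null_sets_def)
        qed
        \<comment> \<open>The shifted angle represents the same \<open>\<alpha>\<close>, so branch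
          \<open>k\<close> is treated as branch 0.\<close>
        have "exp (\<i> * of_real (\<theta> y + 2 * pi * of_int k)) = \<alpha> y" for y
          unfolding \<alpha>[symmetric] exp_eq by (intro exI[of _ k]) (simp add: algebra_simps)
        then show ?thesis
          using k by (intro spectrum_direct_integralI_eigenvalues[of "\<lambda>y. \<theta> y + 2 * pi * of_int k", OF _ _ R _ \<epsilon>])
            (auto simp: R_def N_def zero_less_iff_neq_zero)
      qed
    qed
  qed
qed

end

text \<open>Real \<open>t\<close> are the only candidates for the spectrum: at nonreal
  \<open>z\<close> the shifted operator is onto by \<open>onto_shift_nonreal\<close> and bounded
  below by \<open>symmetric_operator_norm_nonreal\<close>, so \<open>z\<close> is in the resolvent
  set.\<close>

theorem theorem3p5:
  fixes \<psi> :: "real ^ 'n \<Rightarrow> real"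
    and w :: "real \<times> (real ^ 'n) \<Rightarrow> real"
    and \<alpha> :: "real ^ 'n \<Rightarrow> complex"
  assumes "\<psi> \<in> borel_measurable lebesgue"
    and "\<And>x'. 0 < \<psi> x'"
    and "\<And>K. compact K \<Longrightarrow> bounded (\<psi> ` K)"
    and "confined w"
    and "\<alpha> \<in> borel_measurable lebesgue"
    and "\<And>x'. cmod (\<alpha> x') = 1"
  shows "(\<forall>x'. essentially_self_adjoint (fiber_measure w x') (fiber_operator \<psi> w \<alpha> x')) \<and>
    Domain (shear_operator \<psi> w \<alpha>) = shear_domain \<psi> w \<alpha> \<and>
    shear_operator \<psi> w \<alpha> = direct_integral w (fiber_extension \<psi> w \<alpha>) \<and>
    self_adjoint (weighted w) (shear_operator \<psi> w \<alpha>) \<and>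
    (\<forall>t::real. complex_of_real t \<in> spectrum (weighted w) (shear_operator \<psi> w \<alpha>) \<longleftrightarrow>
       (\<forall>\<epsilon>>0. 0 < emeasure lebesgue
          {x'. spectrum (fiber_measure w x') (fiber_extension \<psi> w \<alpha> x')
                 \<inter> complex_of_real ` {t - \<epsilon> <..< t + \<epsilon>} \<noteq> {}}))"
proof -
  interpret shear w \<psi> \<alpha>
  proof
    show "w \<in> borel_measurable lebesgue" "\<And>x. 0 < w x" using assms(4) by (auto simp: confined_def)
    \<comment> \<open>Membership of \<open>y\<close> in the confinement region decides which
      alternative is available.\<close>
    show "(\<forall>s. w (s, y) = 1) \<or> integrable lebesgue (\<lambda>s. w (s, y))" for y
      using assms(4) unfolding confined_def by blast
  qed (use assms in auto)
  have ext: "fiber_extension \<psi> w \<alpha> = T" by (rule ext) (rule fiber_extension_eq)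
  show ?thesis
    unfolding ext shear_operator_eq[unfolded ext] fiber_measure_def
    using essentially_self_adjoint_fiber Domain_shear_operator self_adjoint_direct_integral spectrum_direct_integral
    by (simp add: shear_operator_eq fiber_measure_def)
qed

end
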